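(* Let the centered stationary Gaussian field $G$ and its covariance $\mathcal C$ satisfy the standing assumptions (stated in the context) with $0<\beta\le1$. Let $f,g\in C^1([0,1])$, let $u_\varepsilon$ be the solution of $$(a(\tfrac{x}{\varepsilon})u_\varepsilon'(x))'=f'(x)\ \text{ on }(0,1),\qquad u_\varepsilon(0)=u_\varepsilon(1)=0,$$ let $v_\varepsilon$ be the solution of the same problem with $f$ replaced by $g$, and set $I_\varepsilon(f,g):=\int_0^1u_\varepsilon'(x)g(x)dx=\int_0^1v_\varepsilon'(x)f(x)dx$ and $\sigma_\varepsilon(f,g):=\pi_\beta(\varepsilon)^{-1}\sqrt{\mathrm{Var}[I_\varepsilon(f,g)]}$, where $\pi_\beta(\varepsilon)=\varepsilon^{\beta/2}$ if $0<\beta<1$ and $\pi_1(\varepsilon)=\sqrt\varepsilon|\log\varepsilon|^{1/2}$. Then there exists a finite constant $M$, depending on $f$ and $g$ but not on $\varepsilon$, such that for all $\varepsilon\in(0,\frac12]$ with $\sigma_\varepsilon(f,g)\neq0$ $$d_{TV}\Big(\frac{I_\varepsilon(f,g)-\mathbb E[I_\varepsilon(f,g)]}{\pi_\beta(\varepsilon)\,\sigma_\varepsilon(f,g)},\mathcal N\Big)\le\frac{M}{\sigma_\varepsilon(f,g)^2}\,\pi_\beta(\varepsilon),$$ where $\mathcal N$ is a centered normal random variable of variance one.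
   Context: Standing assumptions. $G:\mathbb R\to\mathbb R$ is a stationary centered Gaussian random field with covariance function $\mathcal C:\mathbb R\to\mathbb R$, that is, $\mathbb E[G(x)G(y)]=\mathcal C(x-y)$, where $\mathcal C$ is Hölder continuous at zero. For the given $\beta$ and a finite constant $K$ one has $|\mathcal C(x)|\le K(1+|x|)^{-\beta}$ for all $x\in\mathbb R$. Moreover $\mathcal C=\mathcal C^\circ\star\mathcal C^\circ$ (convolution) for some $\mathcal C^\circ$ satisfying, for all $x\in\mathbb R$, $\sup_{B(x)}|\mathcal C^\circ|\le K(1+|x|)^{-\frac{1+\beta}{2}}\ell_\beta(x)$, with $\ell_\beta(x)=1$ if $\beta\neq1$ and $\ell_1(x)=\log(2+|x|)^{-1/2}$, where $B(x)$ is the unit ball centered at $x$. Realizations of $G$ are almost surely continuous (continuous version). The random coefficient field is $a(x)=\exp(G(x))$. The solution $u_\varepsilon\in C^1([0,1])$ is random, with $$u_\varepsilon'(x)=\frac{1}{a(x/\varepsilon)}\Big(f(x)-\Big(\int_0^1\frac{1}{a(y/\varepsilon)}dy\Big)^{-1}\int_0^1\frac{f(y)}{a(y/\varepsilon)}dy\Big).$$ The total variation distance between random variables $\mathcal M_1,\mathcal M_2$ with laws $\mu_1,\mu_2$ is $d_{TV}(\mathcal M_1,\mathcal M_2)=\sup_A|\mu_1(A)-\mu_2(A)|$, the supremum being over Borel sets $A\subset\mathbb R$. *)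

theory Defs
  imports "HOL-Probability.Probability"
begin

text \<open>Constants are admitted as (degenerate) Gaussian variables, so that linear combinations of the
  values of a Gaussian field are Gaussian without any nondegeneracy assumption.\<close>
definition gaussian_rv :: "'w measure \<Rightarrow> ('w \<Rightarrow> real) \<Rightarrow> bool" where
  "gaussian_rv P X \<longleftrightarrow> X \<in> borel_measurable P \<and>
     ((\<exists>m. AE \<omega> in P. X \<omega> = m) \<or>
      (\<exists>m s. 0 < s \<and> distributed P lborel X (normal_density m s)))"

definition gaussian_field :: "'w measure \<Rightarrow> (real \<Rightarrow> 'w \<Rightarrow> real) \<Rightarrow> bool" where
  "gaussian_field P G \<longleftrightarrow>
     (\<forall>S c. finite S \<longrightarrow> gaussian_rv P (\<lambda>\<omega>. \<Sum>x\<in>S. c x * G x \<omega>))"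

text \<open>For a centered Gaussian field, stationarity of the law is the statement that the covariance
  of the values at \<open>x\<close> and \<open>y\<close> depends on \<open>x - y\<close> only.\<close>
definition stationary_centered_gaussian_field ::
  "'w measure \<Rightarrow> (real \<Rightarrow> 'w \<Rightarrow> real) \<Rightarrow> (real \<Rightarrow> real) \<Rightarrow> bool" where
  "stationary_centered_gaussian_field P G C \<longleftrightarrow>
     gaussian_field P G \<and>
     (\<forall>x. (\<integral>\<omega>. G x \<omega> \<partial>P) = 0) \<and>
     (\<forall>x y. (\<integral>\<omega>. G x \<omega> * G y \<omega> \<partial>P) = C (x - y))"

definition holder_continuous_at_zero :: "(real \<Rightarrow> real) \<Rightarrow> bool" where
  "holder_continuous_at_zero C \<longleftrightarrow>
     (\<exists>\<alpha> L r. 0 < \<alpha> \<and> \<alpha> \<le> 1 \<and> 0 < r \<and> (\<forall>x. \<bar>x\<bar> \<le> r \<longrightarrow> \<bar>C x - C 0\<bar> \<le> L * \<bar>x\<bar> powr \<alpha>))"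

definition convolve :: "(real \<Rightarrow> real) \<Rightarrow> (real \<Rightarrow> real) \<Rightarrow> real \<Rightarrow> real" where
  "convolve h k x = (\<integral>y. h y * k (x - y) \<partial>lebesgue)"

definition ell :: "real \<Rightarrow> real \<Rightarrow> real" where
  "ell \<beta> x = (if \<beta> = 1 then ln (2 + \<bar>x\<bar>) powr (- 1 / 2) else 1)"

definition pi_scale :: "real \<Rightarrow> real \<Rightarrow> real" where
  "pi_scale \<beta> \<epsilon> = (if \<beta> = 1 then sqrt \<epsilon> * \<bar>ln \<epsilon>\<bar> powr (1 / 2) else \<epsilon> powr (\<beta> / 2))"

text \<open>\<open>h \<in> C\<^sup>1([0,1])\<close>, with one-sided derivatives at the end points; the values of \<open>h\<close> outside
  \<open>[0,1]\<close> are irrelevant.\<close>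
definition C1_unit :: "(real \<Rightarrow> real) \<Rightarrow> bool" where
  "C1_unit h \<longleftrightarrow>
     (\<exists>h'. (\<forall>x\<in>{0..1}. (h has_real_derivative h' x) (at x within {0..1})) \<and>
           continuous_on {0..1} h')"

text \<open>Classical solution in \<open>C\<^sup>1([0,1])\<close> of \<open>(A w')' = f'\<close> on \<open>(0,1)\<close>, \<open>w(0) = w(1) = 0\<close>.\<close>
definition bvp_solution :: "(real \<Rightarrow> real) \<Rightarrow> (real \<Rightarrow> real) \<Rightarrow> (real \<Rightarrow> real) \<Rightarrow> bool" where
  "bvp_solution A f w \<longleftrightarrow>
     C1_unit w \<and> w 0 = 0 \<and> w 1 = 0 \<and>
     (\<forall>x\<in>{0<..<1}. ((\<lambda>y. A y * deriv w y) has_real_derivative deriv f x) (at x))"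

text \<open>\<open>W\<close> is a random element of \<open>C\<^sup>1([0,1])\<close> solving the problem almost surely. On the null event
  where the coefficient fails to be continuous, \<open>W\<close> may be any function in \<open>C\<^sup>1([0,1])\<close>.\<close>
definition random_bvp_solution ::
  "'w measure \<Rightarrow> ('w \<Rightarrow> real \<Rightarrow> real) \<Rightarrow> (real \<Rightarrow> real) \<Rightarrow> ('w \<Rightarrow> real \<Rightarrow> real) \<Rightarrow> bool" where
  "random_bvp_solution P A f W \<longleftrightarrow>
     (\<forall>\<omega>\<in>space P. C1_unit (W \<omega>)) \<and>
     (\<forall>x\<in>{0..1}. (\<lambda>\<omega>. W \<omega> x) \<in> borel_measurable P) \<and>
     (AE \<omega> in P. bvp_solution (A \<omega>) f (W \<omega>))"

text \<open>The value of \<^term>\<open>deriv w\<close> at the end points does not affect the integral.\<close>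
definition gradient_functional :: "(real \<Rightarrow> real) \<Rightarrow> (real \<Rightarrow> real) \<Rightarrow> real" where
  "gradient_functional w g = integral {0..1} (\<lambda>x. deriv w x * g x)"

definition sigma_scaled :: "'w measure \<Rightarrow> real \<Rightarrow> real \<Rightarrow> ('w \<Rightarrow> real) \<Rightarrow> real" where
  "sigma_scaled P \<beta> \<epsilon> X = sqrt (prob_space.variance P X) / pi_scale \<beta> \<epsilon>"

text \<open>Total variation distance of two laws on the real line (Borel probability measures).\<close>
definition d_TV :: "real measure \<Rightarrow> real measure \<Rightarrow> real" where
  "d_TV \<mu> \<nu> = (SUP A\<in>sets borel. \<bar>measure \<mu> A - measure \<nu> A\<bar>)"

end

theory Submission
  imports Defs "HOL-Real_Asymp.Real_Asymp"
begin

text \<open>Write \<open>a = exp (G(\<cdot>/\<epsilon>))\<close>. Integrating the equation once shows \<open>a u' = f + const\<close>, and the boundary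
values fix the constant, so that \<open>I = A - B C / D\<close>, where \<open>A\<close>, \<open>B\<close>, \<open>C\<close>, \<open>D\<close> are the integrals over
\<open>[0,1]\<close> of \<open>f g\<close>, \<open>f\<close>, \<open>g\<close>, \<open>1\<close> against \<open>1/a\<close> (\<open>bvp_gradient_formula\<close>). This expression is symmetric in
\<open>f\<close> and \<open>g\<close>, which is the first claim. For the second one it exhibits \<open>I\<close> as a smooth functional \<open>F\<close> of
a Gaussian field \<open>X\<close>, and normality is measured by a second-order Poincare inequality.

Let \<open>X'\<close> be an independent copy and \<open>X\<^sub>\<theta> = cos \<theta> X + sin \<theta> X'\<close>. The rotation interpolates between
\<open>X\<close> and \<open>X'\<close>, and its velocity is uncorrelated with \<open>X\<^sub>\<theta>\<close>; Gaussian integration by parts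
(\<open>gauss_ibp\<close>) therefore gives the covariance identity
\<open>Cov (F(X), H(X)) = \<integral> sin \<theta> E[\<Sum> \<Gamma>\<^sub>i\<^sub>j \<partial>\<^sub>iF(X\<^sub>\<theta>) \<partial>\<^sub>jH(X)] d\<theta>\<close> over \<open>0 \<le> \<theta> \<le> pi/2\<close>
(\<open>covariance_identity\<close>). It is used twice. With \<open>H = \<psi> \<circ> F\<close> and \<open>\<psi>\<close> the solution of Stein's equation
for a test function \<open>h\<close>, it bounds \<open>E h(W) - E h(N)\<close>, \<open>W\<close> being \<open>F\<close> standardised by \<open>s\<^sup>2 = Var F\<close>, by
\<open>s\<^sup>-\<^sup>2\<close> times the standard deviation of the Stein kernel \<open>T = \<Sum> \<Gamma>\<^sub>i\<^sub>j \<partial>\<^sub>iF(X\<^sub>\<theta>) \<partial>\<^sub>jF(X)\<close>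
(\<open>stein_bound\<close>). Applied to \<open>T\<close> itself, as a function of the Gaussian family \<open>(X, X')\<close>, it bounds \<open>Var T\<close>
through first and second derivatives of \<open>F\<close> (\<open>poincare_type_bound\<close>).

The first derivative of \<open>F\<close> has a density with respect to the position \<open>x\<close>, the second one a density in two
positions plus a multiple of the diagonal, all with moments bounded by those of exponentials of the field.
Hence each of the three covariances that occur in \<open>Var T\<close> contributes a factor
\<open>\<kappa> = sup \<integral> |C((x - y)/\<epsilon>)| dy\<close>, and \<open>Var T \<le> c \<kappa>\<^sup>3\<close> (\<open>variance_kernel_le\<close>). The decay of \<open>C\<close> gives
\<open>\<kappa> \<le> c \<pi>\<^sub>\<beta>(\<epsilon>)\<^sup>2\<close> (\<open>decay_row_sum\<close>), so the distance is at most \<open>c \<pi>\<^sub>\<beta>(\<epsilon>)\<^sup>3 / s\<^sup>2\<close>, which is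
\<open>c \<pi>\<^sub>\<beta>(\<epsilon>) / \<sigma>\<^sup>2\<close> because \<open>s = \<pi>\<^sub>\<beta>(\<epsilon>) \<sigma>\<close>.

All of this is done for finitely many values of the field: replacing \<open>G(x/\<epsilon>)\<close> by its value at the left
end point of a cell of length \<open>1/n\<close> changes \<open>F\<close> by an error that vanishes in mean square, and the bounds do
not deteriorate with \<open>n\<close> (\<open>lipschitz_test_bound\<close>). Total variation is recovered from Lipschitz test functions
by inner regularity (\<open>d_TV_le_Lipschitz\<close>). That Gaussian laws are governed by their covariance, as needed for
the integration by parts, is the Cramer-Wold principle (\<open>cramer_wold\<close>).\<close>

section \<open>Laws of families are determined by linear combinations\<close>

lemma prob_space_density_normalised:
  fixes u :: "'a \<Rightarrow> real"
  assumes u: "integrable Q u" "\<And>\<omega>. 0 \<le> u \<omega>" and m: "m = (LINT \<omega>|Q. u \<omega>)" "0 < m"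
  shows "prob_space (density Q (\<lambda>\<omega>. ennreal (u \<omega> / m)))"
proof
  have [measurable]: "u \<in> borel_measurable Q" using u by auto
  have "emeasure (density Q (\<lambda>\<omega>. ennreal (u \<omega> / m))) (space (density Q (\<lambda>\<omega>. ennreal (u \<omega> / m))))
    = (\<integral>\<^sup>+\<omega>. ennreal (u \<omega> / m) \<partial>Q)"
    by (simp add: emeasure_density cong: nn_integral_cong)
  also have "\<dots> = ennreal (LINT \<omega>|Q. u \<omega> / m)"
    using u m by (intro nn_integral_eq_integral) auto
  also have "\<dots> = 1" using m by simp
  finally show "emeasure (density Q (\<lambda>\<omega>. ennreal (u \<omega> / m))) (space (density Q (\<lambda>\<omega>. ennreal (u \<omega> / m)))) = 1" .
qed

text \<open>Levy's uniqueness theorem for the finite measures with densities \<open>w\<close> and \<open>w'\<close>, pushed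
  forward to the line: after division by the common mass \<open>m\<close> they are probability measures. The
  weights are what allows coordinates to be treated one after the other below.\<close>
lemma weighted_fourier_uniqueness:
  fixes w x :: "'a \<Rightarrow> real" and w' x' :: "'b \<Rightarrow> real"
  assumes M: "prob_space M" and N: "prob_space N"
    and [measurable]: "x \<in> borel_measurable M" "x' \<in> borel_measurable N"
    and w: "integrable M w" "\<And>\<omega>. 0 \<le> w \<omega>" and w': "integrable N w'" "\<And>\<omega>. 0 \<le> w' \<omega>"
    and eq: "\<And>t. (CLINT \<omega>|M. of_real (w \<omega>) * iexp (t * x \<omega>)) =
                  (CLINT \<omega>|N. of_real (w' \<omega>) * iexp (t * x' \<omega>))"
    and A: "A \<in> sets borel"
  shows "(LINT \<omega>|M. w \<omega> * indicator A (x \<omega>)) = (LINT \<omega>|N. w' \<omega> * indicator A (x' \<omega>))"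
proof -
  have wm[measurable]: "w \<in> borel_measurable M" "w' \<in> borel_measurable N"
    using w w' by auto
  have [measurable]: "A \<in> sets borel" by fact
  define m where "m = (LINT \<omega>|M. w \<omega>)"
  have m': "m = (LINT \<omega>|N. w' \<omega>)"
  proof -
    have "complex_of_real (LINT \<omega>|M. w \<omega>) = complex_of_real (LINT \<omega>|N. w' \<omega>)"
      using eq[of 0] by simp
    then show ?thesis unfolding m_def using of_real_eq_iff by blast
  qed
  have m0: "0 \<le> m" unfolding m_def using w(2) by (intro integral_nonneg_AE) auto
  show ?thesis
  proof (cases "m = 0")
    case True
    have z: "AE \<omega> in M. w \<omega> = 0"
      using True w integral_nonneg_eq_0_iff_AE[of M w] by (auto simp: m_def)
    have z': "AE \<omega> in N. w' \<omega> = 0"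
      using True w' m' integral_nonneg_eq_0_iff_AE[of N w'] by auto
    have "(LINT \<omega>|M. w \<omega> * indicator A (x \<omega>)) = (LINT \<omega>|M. 0)"
      using z by (intro integral_cong_AE) (auto elim: eventually_mono)
    moreover have "(LINT \<omega>|N. w' \<omega> * indicator A (x' \<omega>)) = (LINT \<omega>|N. 0)"
      using z' by (intro integral_cong_AE) (auto elim: eventually_mono)
    ultimately show ?thesis by simp
  next
    case False
    with m0 have mp: "0 < m" by simp
    define L1 where "L1 = distr (density M (\<lambda>\<omega>. ennreal (w \<omega> / m))) borel x"
    define L2 where "L2 = distr (density N (\<lambda>\<omega>. ennreal (w' \<omega> / m))) borel x'"
    interpret D1: prob_space "density M (\<lambda>\<omega>. ennreal (w \<omega> / m))"
      using prob_space_density_normalised[OF w m_def mp] .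
    interpret D2: prob_space "density N (\<lambda>\<omega>. ennreal (w' \<omega> / m))"
      using prob_space_density_normalised[OF w' m' mp] .
    have r1: "real_distribution L1" unfolding L1_def
      by (intro D1.real_distribution_distr) auto
    have r2: "real_distribution L2" unfolding L2_def
      by (intro D2.real_distribution_distr) auto
    have "char L1 t = char L2 t" for t
    proof -
      have "char L1 t = (CLINT \<omega>|M. (w \<omega> / m) *\<^sub>R iexp (t * x \<omega>))"
        unfolding char_def L1_def using w mp
        by (subst integral_distr) (auto intro!: integral_density)
      also have "\<dots> = (CLINT \<omega>|M. of_real (w \<omega>) * iexp (t * x \<omega>) / of_real m)"
        by (intro Bochner_Integration.integral_cong) (auto simp: scaleR_conv_of_real)
      also have "\<dots> = (CLINT \<omega>|N. of_real (w' \<omega>) * iexp (t * x' \<omega>) / of_real m)"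
        using eq[of t] by simp
      also have "\<dots> = (CLINT \<omega>|N. (w' \<omega> / m) *\<^sub>R iexp (t * x' \<omega>))"
        by (intro Bochner_Integration.integral_cong) (auto simp: scaleR_conv_of_real)
      also have "\<dots> = char L2 t"
        unfolding char_def L2_def using w' mp
        by (subst integral_distr) (auto intro!: integral_density[symmetric])
      finally show ?thesis .
    qed
    then have LL: "L1 = L2" using Levy_uniqueness[OF r1 r2] by auto
    have e1: "(LINT y|L1. indicator A y) = (LINT \<omega>|M. w \<omega> * indicator A (x \<omega>)) / m" (is "_ = ?r")
    proof -
      have "(LINT y|L1. indicator A y) = (LINT \<omega>|density M (\<lambda>\<omega>. ennreal (w \<omega> / m)). (indicator A (x \<omega>) :: real))"
        unfolding L1_def by (rule integral_distr) auto
      also have "\<dots> = (LINT \<omega>|M. (w \<omega> / m) *\<^sub>R indicator A (x \<omega>))"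
        using w mp by (intro integral_density) auto
      also have "\<dots> = ?r" by simp
      finally show ?thesis .
    qed
    have e2: "(LINT y|L2. indicator A y) = (LINT \<omega>|N. w' \<omega> * indicator A (x' \<omega>)) / m" (is "_ = ?r")
    proof -
      have "(LINT y|L2. indicator A y) = (LINT \<omega>|density N (\<lambda>\<omega>. ennreal (w' \<omega> / m)). (indicator A (x' \<omega>) :: real))"
        unfolding L2_def by (rule integral_distr) auto
      also have "\<dots> = (LINT \<omega>|N. (w' \<omega> / m) *\<^sub>R indicator A (x' \<omega>))"
        using w' mp by (intro integral_density) auto
      also have "\<dots> = ?r" by simp
      finally show ?thesis .
    qed
    have "(LINT \<omega>|M. w \<omega> * indicator A (x \<omega>)) / m = (LINT \<omega>|N. w' \<omega> * indicator A (x' \<omega>)) / m"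
      using e1 e2 LL by metis
    then show ?thesis using mp by simp
  qed
qed

text \<open>Trades one Fourier mode for one indicator. A signed weight such as \<open>w cos \<theta>\<close> is not a density,
  but \<open>w (1 + cos \<theta>)\<close> and \<open>w (1 + sin \<theta>)\<close> are, and their transforms in \<open>x\<close> are combinations of the
  transforms of \<open>w\<close> at \<open>(t, s)\<close> with \<open>s = 0, 1, -1\<close>.\<close>
lemma fourier_indicator_step:
  fixes w x \<theta> :: "'a \<Rightarrow> real" and w' x' \<theta>' :: "'b \<Rightarrow> real"
  assumes M: "prob_space M" and N: "prob_space N"
    and [measurable]: "x \<in> borel_measurable M" "x' \<in> borel_measurable N"
       "\<theta> \<in> borel_measurable M" "\<theta>' \<in> borel_measurable N"
    and w[measurable]: "w \<in> borel_measurable M" and w0: "\<And>\<omega>. 0 \<le> w \<omega>" "\<And>\<omega>. w \<omega> \<le> 1"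
    and w'[measurable]: "w' \<in> borel_measurable N" and w'0: "\<And>\<omega>. 0 \<le> w' \<omega>" "\<And>\<omega>. w' \<omega> \<le> 1"
    and eq: "\<And>s t. (CLINT \<omega>|M. of_real (w \<omega>) * iexp (t * x \<omega> + s * \<theta> \<omega>)) =
                  (CLINT \<omega>|N. of_real (w' \<omega>) * iexp (t * x' \<omega> + s * \<theta>' \<omega>))"
    and A[measurable]: "A \<in> sets borel"
  shows "(CLINT \<omega>|M. of_real (w \<omega> * indicator A (x \<omega>)) * iexp (\<theta> \<omega>)) =
         (CLINT \<omega>|N. of_real (w' \<omega> * indicator A (x' \<omega>)) * iexp (\<theta>' \<omega>))"
proof -
  interpret M: prob_space M by fact
  interpret N: prob_space N by fact
  have wi: "integrable M w" "integrable N w'"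
    using w0 w'0 by (auto intro!: M.integrable_const_bound[where B=1] N.integrable_const_bound[where B=1])
  have bd: "\<bar>u * (1 + y)\<bar> \<le> 2" "\<bar>u * indicator A z * y\<bar> \<le> 2" "\<bar>u * indicator A z\<bar> \<le> 2"
    if "\<bar>y\<bar> \<le> 1" "0 \<le> u" "u \<le> 1" for u y :: real and z
  proof -
    have "\<bar>u * (1 + y)\<bar> \<le> 1 * 2" unfolding abs_mult using that by (intro mult_mono) auto
    then show "\<bar>u * (1 + y)\<bar> \<le> 2" by simp
    have "u * \<bar>y\<bar> \<le> 1 * 1" using that by (intro mult_mono) auto
    then show "\<bar>u * indicator A z * y\<bar> \<le> 2" "\<bar>u * indicator A z\<bar> \<le> 2"
      using that by (auto simp: indicator_def abs_mult)
  qed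
  have ge_minus_one: "0 \<le> 1 + cos y" "0 \<le> 1 + sin y" for y :: real
    using cos_ge_minus_one[of y] sin_ge_minus_one[of y] by linarith+
  have iM: "integrable M k" if "k \<in> borel_measurable M" "\<And>\<omega>. \<bar>k \<omega>\<bar> \<le> 2" for k :: "'a \<Rightarrow> real"
    using that by (intro M.integrable_const_bound[where B=2]) auto
  have iN: "integrable N k" if "k \<in> borel_measurable N" "\<And>\<omega>. \<bar>k \<omega>\<bar> \<le> 2" for k :: "'b \<Rightarrow> real"
    using that by (intro N.integrable_const_bound[where B=2]) auto
  have int[simp]: "integrable M (\<lambda>\<omega>. w \<omega> * (1 + cos (\<theta> \<omega>)))" "integrable M (\<lambda>\<omega>. w \<omega> * (1 + sin (\<theta> \<omega>)))"
    "integrable M (\<lambda>\<omega>. w \<omega> * indicator A (x \<omega>) * cos (\<theta> \<omega>))" "integrable M (\<lambda>\<omega>. w \<omega> * indicator A (x \<omega>) * sin (\<theta> \<omega>))"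
    "integrable M (\<lambda>\<omega>. w \<omega> * indicator A (x \<omega>))"
    "integrable N (\<lambda>\<omega>. w' \<omega> * (1 + cos (\<theta>' \<omega>)))" "integrable N (\<lambda>\<omega>. w' \<omega> * (1 + sin (\<theta>' \<omega>)))"
    "integrable N (\<lambda>\<omega>. w' \<omega> * indicator A (x' \<omega>) * cos (\<theta>' \<omega>))" "integrable N (\<lambda>\<omega>. w' \<omega> * indicator A (x' \<omega>) * sin (\<theta>' \<omega>))"
    "integrable N (\<lambda>\<omega>. w' \<omega> * indicator A (x' \<omega>))"
    by (rule iM iN, measurable, rule bd, rule abs_cos_le_one abs_sin_le_one, rule w0 w'0, rule w0 w'0)+
  have ce: "complex_of_real (w \<omega> * (1 + cos (\<theta> \<omega>))) * iexp (t * x \<omega>) =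
     of_real (w \<omega>) * iexp (t * x \<omega> + 0 * \<theta> \<omega>) + of_real (w \<omega>) * iexp (t * x \<omega> + 1 * \<theta> \<omega>) / 2
     + of_real (w \<omega>) * iexp (t * x \<omega> + (-1) * \<theta> \<omega>) / 2"
    and se: "complex_of_real (w \<omega> * (1 + sin (\<theta> \<omega>))) * iexp (t * x \<omega>) =
     of_real (w \<omega>) * iexp (t * x \<omega> + 0 * \<theta> \<omega>) + of_real (w \<omega>) * iexp (t * x \<omega> + 1 * \<theta> \<omega>) / (2 * \<i>)
     - of_real (w \<omega>) * iexp (t * x \<omega> + (-1) * \<theta> \<omega>) / (2 * \<i>)"
    for t :: real and w x \<theta> :: "'c \<Rightarrow> real" and \<omega>
    by (simp_all add: cos_exp_eq sin_exp_eq exp_add exp_diff algebra_simps exp_minus flip: cos_of_real sin_of_real)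
       (simp_all add: divide_simps)
  have Mi[simp]: "integrable M (\<lambda>\<omega>. of_real (w \<omega>) * iexp (t * x \<omega> + s * \<theta> \<omega>))" for s t
    using w0 by (intro M.integrable_const_bound[where B=1]) (auto simp: norm_mult intro!: AE_I2)
  have Ni[simp]: "integrable N (\<lambda>\<omega>. of_real (w' \<omega>) * iexp (t * x' \<omega> + s * \<theta>' \<omega>))" for s t
    using w'0 by (intro N.integrable_const_bound[where B=1]) (auto simp: norm_mult intro!: AE_I2)
  have c1: "(LINT \<omega>|M. w \<omega> * (1 + cos (\<theta> \<omega>)) * indicator A (x \<omega>)) = (LINT \<omega>|N. w' \<omega> * (1 + cos (\<theta>' \<omega>)) * indicator A (x' \<omega>))"
  proof (rule weighted_fourier_uniqueness[OF M N])
    show "0 \<le> w \<omega> * (1 + cos (\<theta> \<omega>))" for \<omega> by (intro mult_nonneg_nonneg w0 ge_minus_one)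
    show "0 \<le> w' \<omega> * (1 + cos (\<theta>' \<omega>))" for \<omega> by (intro mult_nonneg_nonneg w'0 ge_minus_one)
    show "(CLINT \<omega>|M. of_real (w \<omega> * (1 + cos (\<theta> \<omega>))) * iexp (t * x \<omega>)) =
          (CLINT \<omega>|N. of_real (w' \<omega> * (1 + cos (\<theta>' \<omega>))) * iexp (t * x' \<omega>))" for t
      unfolding ce using eq
      by (simp only: Bochner_Integration.integral_add Bochner_Integration.integrable_add
          integral_divide_zero integrable_divide_zero Mi Ni simp_thms)
  qed (auto)
  have s1: "(LINT \<omega>|M. w \<omega> * (1 + sin (\<theta> \<omega>)) * indicator A (x \<omega>)) = (LINT \<omega>|N. w' \<omega> * (1 + sin (\<theta>' \<omega>)) * indicator A (x' \<omega>))"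
  proof (rule weighted_fourier_uniqueness[OF M N])
    show "0 \<le> w \<omega> * (1 + sin (\<theta> \<omega>))" for \<omega> by (intro mult_nonneg_nonneg w0 ge_minus_one)
    show "0 \<le> w' \<omega> * (1 + sin (\<theta>' \<omega>))" for \<omega> by (intro mult_nonneg_nonneg w'0 ge_minus_one)
    show "(CLINT \<omega>|M. of_real (w \<omega> * (1 + sin (\<theta> \<omega>))) * iexp (t * x \<omega>)) =
          (CLINT \<omega>|N. of_real (w' \<omega> * (1 + sin (\<theta>' \<omega>))) * iexp (t * x' \<omega>))" for t
      unfolding se using eq
      by (simp only: Bochner_Integration.integral_add Bochner_Integration.integrable_add Bochner_Integration.integral_diff
          integral_divide_zero integrable_divide_zero Mi Ni simp_thms)
  qed (auto)
  have n1: "(LINT \<omega>|M. w \<omega> * indicator A (x \<omega>)) = (LINT \<omega>|N. w' \<omega> * indicator A (x' \<omega>))"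
    using eq[where s = 0] w0 w'0 wi by (intro weighted_fourier_uniqueness[OF M N]) auto
  have c2: "(LINT \<omega>|M. w \<omega> * indicator A (x \<omega>) * cos (\<theta> \<omega>)) = (LINT \<omega>|N. w' \<omega> * indicator A (x' \<omega>) * cos (\<theta>' \<omega>))"
  proof -
    have "(LINT \<omega>|M. w \<omega> * indicator A (x \<omega>) + w \<omega> * indicator A (x \<omega>) * cos (\<theta> \<omega>))
       = (LINT \<omega>|N. w' \<omega> * indicator A (x' \<omega>) + w' \<omega> * indicator A (x' \<omega>) * cos (\<theta>' \<omega>))"
      using c1 by (simp add: algebra_simps)
    then show ?thesis using n1 by simp
  qed
  have s2: "(LINT \<omega>|M. w \<omega> * indicator A (x \<omega>) * sin (\<theta> \<omega>)) = (LINT \<omega>|N. w' \<omega> * indicator A (x' \<omega>) * sin (\<theta>' \<omega>))"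
  proof -
    have "(LINT \<omega>|M. w \<omega> * indicator A (x \<omega>) + w \<omega> * indicator A (x \<omega>) * sin (\<theta> \<omega>))
       = (LINT \<omega>|N. w' \<omega> * indicator A (x' \<omega>) + w' \<omega> * indicator A (x' \<omega>) * sin (\<theta>' \<omega>))"
      using s1 by (simp add: algebra_simps)
    then show ?thesis using n1 by simp
  qed
  have ee: "complex_of_real u * iexp y = complex_of_real (u * cos y) + \<i> * complex_of_real (u * sin y)" for u y
    by (simp add: exp_Euler algebra_simps flip: cos_of_real sin_of_real)
  have ci: "(CLINT \<omega>|Q. complex_of_real (a \<omega>) + \<i> * complex_of_real (b \<omega>)) = complex_of_real (LINT \<omega>|Q. a \<omega>) + \<i> * complex_of_real (LINT \<omega>|Q. b \<omega>)"
    if "integrable Q a" "integrable Q b" for Q :: "'a measure" and a b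
    using that by (simp add: integrable_of_real)
  have ci': "(CLINT \<omega>|Q. complex_of_real (a \<omega>) + \<i> * complex_of_real (b \<omega>)) = complex_of_real (LINT \<omega>|Q. a \<omega>) + \<i> * complex_of_real (LINT \<omega>|Q. b \<omega>)"
    if "integrable Q a" "integrable Q b" for Q :: "'b measure" and a b
    using that by (simp add: integrable_of_real)
  show ?thesis
    unfolding ee by (subst ci, simp, simp, subst ci', simp, simp) (simp only: c2 s2)
qed

text \<open>On cylinder sets, the indicators of the coordinates are introduced one at a time by
  \<open>fourier_indicator_step\<close>; the remaining coordinates stay in the exponent.\<close>
theorem cramer_wold:
  fixes X :: "'i \<Rightarrow> 'a \<Rightarrow> real" and Y :: "'i \<Rightarrow> 'b \<Rightarrow> real"
  assumes M: "prob_space M" and N: "prob_space N"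
    and X[measurable]: "\<And>i. X i \<in> borel_measurable M" and Y[measurable]: "\<And>i. Y i \<in> borel_measurable N"
    and eq: "\<And>J c. finite J \<Longrightarrow> (CLINT \<omega>|M. iexp (\<Sum>i\<in>J. c i * X i \<omega>)) = (CLINT \<omega>|N. iexp (\<Sum>i\<in>J. c i * Y i \<omega>))"
  shows "distr M (PiM UNIV (\<lambda>_. borel)) (\<lambda>\<omega> i. X i \<omega>) = distr N (PiM UNIV (\<lambda>_. borel)) (\<lambda>\<omega> i. Y i \<omega>)"
proof -
  interpret M: prob_space M by fact
  interpret N: prob_space N by fact
  have [measurable]: "(\<lambda>\<omega> i. X i \<omega>) \<in> measurable M (PiM UNIV (\<lambda>_. borel))"
    "(\<lambda>\<omega> i. Y i \<omega>) \<in> measurable N (PiM UNIV (\<lambda>_. borel))"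
    by (auto intro!: measurable_PiM_single')
  have claim: "finite J \<Longrightarrow> K \<inter> J = {} \<Longrightarrow>
     (CLINT \<omega>|M. of_real (\<Prod>i\<in>K. indicator (A i) (X i \<omega>)) * iexp (\<Sum>i\<in>J. c i * X i \<omega>)) =
     (CLINT \<omega>|N. of_real (\<Prod>i\<in>K. indicator (A i) (Y i \<omega>)) * iexp (\<Sum>i\<in>J. c i * Y i \<omega>))"
    if "finite K" and [measurable]: "\<And>i. A i \<in> sets borel" for K J and A :: "'i \<Rightarrow> real set" and c
    using that(1)
  proof (induction K arbitrary: J c rule: finite_induct)
    case empty
    then show ?case using eq by simp
  next
    case (insert j K)
    then have jJ: "j \<notin> J" "K \<inter> J = {}" by auto
    have step: "(CLINT \<omega>|M. of_real ((\<Prod>i\<in>K. indicator (A i) (X i \<omega>)) * indicator (A j) (X j \<omega>)) * iexp (\<Sum>i\<in>J. c i * X i \<omega>)) =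
      (CLINT \<omega>|N. of_real ((\<Prod>i\<in>K. indicator (A i) (Y i \<omega>)) * indicator (A j) (Y j \<omega>)) * iexp (\<Sum>i\<in>J. c i * Y i \<omega>))"
    proof (rule fourier_indicator_step[OF M N])
      fix s t :: real
      let ?c = "(\<lambda>i. s * c i)(j := t)"
      have "(\<Sum>i\<in>insert j J. ?c i * Z i) = t * Z j + s * (\<Sum>i\<in>J. c i * Z i)" for Z :: "'i \<Rightarrow> real"
      proof -
        have "(\<Sum>i\<in>J. ?c i * Z i) = (\<Sum>i\<in>J. s * (c i * Z i))"
          using jJ by (intro sum.cong) auto
        then show ?thesis using insert.prems jJ by (simp add: sum_distrib_left)
      qed
      then show "(CLINT \<omega>|M. of_real (\<Prod>i\<in>K. indicator (A i) (X i \<omega>)) * iexp (t * X j \<omega> + s * (\<Sum>i\<in>J. c i * X i \<omega>))) =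
         (CLINT \<omega>|N. of_real (\<Prod>i\<in>K. indicator (A i) (Y i \<omega>)) * iexp (t * Y j \<omega> + s * (\<Sum>i\<in>J. c i * Y i \<omega>)))"
        using insert.IH[of "insert j J" ?c] insert.prems insert.hyps jJ by simp
    qed (auto intro!: prod_nonneg prod_le_1)
    then show ?case using insert.hyps by (simp add: mult.commute)
  qed
  show ?thesis
  proof (rule measure_eqI_PiM_infinite)
    fix J and A :: "'i \<Rightarrow> real set"
    assume J: "finite J" "J \<subseteq> (UNIV::'i set)" and A: "\<And>i. i \<in> J \<Longrightarrow> A i \<in> sets borel"
    define B where "B i = (if i \<in> J then A i else {})" for i
    have B[measurable]: "B i \<in> sets borel" for i using A by (auto simp: B_def)
    have AB: "Pi\<^sub>E J A = Pi\<^sub>E J B" by (auto simp: B_def PiE_def Pi_def)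
    have em: "prod_emb UNIV (\<lambda>_. borel) J (Pi\<^sub>E J B) = {x. \<forall>i\<in>J. x i \<in> B i}"
      by (auto simp: prod_emb_def restrict_def PiE_def Pi_def extensional_def)
    have [measurable]: "{x. \<forall>i\<in>J. x i \<in> B i} \<in> sets (PiM UNIV (\<lambda>_. borel))"
      unfolding em[symmetric] using J by (intro sets_PiM_I) auto
    have pr: "(\<Prod>i\<in>J. indicator (B i) (Z i)) = (indicator {x. \<forall>i\<in>J. x i \<in> B i} Z :: real)" for Z
    proof (cases "\<forall>i\<in>J. Z i \<in> B i")
      case False
      then have "\<exists>i\<in>J. indicator (B i) (Z i) = (0::real)" by (auto simp: indicator_def)
      then show ?thesis using False J by (auto simp: prod_zero_iff)
    qed (auto intro!: prod.neutral)
    have LM: "(LINT \<omega>|M. indicator {x. \<forall>i\<in>J. x i \<in> B i} (\<lambda>i. X i \<omega>)) =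
       measure (distr M (PiM UNIV (\<lambda>_. borel)) (\<lambda>\<omega> i. X i \<omega>)) {x. \<forall>i\<in>J. x i \<in> B i}"
      by (subst integral_distr[symmetric, where N = "PiM UNIV (\<lambda>_. borel)" and g = "\<lambda>\<omega> i. X i \<omega>"]) (auto simp: space_PiM)
    have LN: "(LINT \<omega>|N. indicator {x. \<forall>i\<in>J. x i \<in> B i} (\<lambda>i. Y i \<omega>)) =
       measure (distr N (PiM UNIV (\<lambda>_. borel)) (\<lambda>\<omega> i. Y i \<omega>)) {x. \<forall>i\<in>J. x i \<in> B i}"
      by (subst integral_distr[symmetric, where N = "PiM UNIV (\<lambda>_. borel)" and g = "\<lambda>\<omega> i. Y i \<omega>"]) (auto simp: space_PiM)
    interpret D1: prob_space "distr M (PiM UNIV (\<lambda>_. borel)) (\<lambda>\<omega> i. X i \<omega>)"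
      by (rule M.prob_space_distr) simp
    interpret D2: prob_space "distr N (PiM UNIV (\<lambda>_. borel)) (\<lambda>\<omega> i. Y i \<omega>)"
      by (rule N.prob_space_distr) simp
    have "complex_of_real (LINT \<omega>|M. indicator {x. \<forall>i\<in>J. x i \<in> B i} (\<lambda>i. X i \<omega>) :: real) =
          complex_of_real (LINT \<omega>|N. indicator {x. \<forall>i\<in>J. x i \<in> B i} (\<lambda>i. Y i \<omega>))"
    proof -
      have "(CLINT \<omega>|M. of_real (\<Prod>i\<in>J. indicator (B i) (X i \<omega>)) * iexp (\<Sum>i\<in>{}. 0 * X i \<omega>)) =
        (CLINT \<omega>|N. of_real (\<Prod>i\<in>J. indicator (B i) (Y i \<omega>)) * iexp (\<Sum>i\<in>{}. 0 * Y i \<omega>))"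
        by (rule claim) (use J B in auto)
      then show ?thesis by (simp add: pr del: of_real_prod)
    qed
    then have "(LINT \<omega>|M. indicator {x. \<forall>i\<in>J. x i \<in> B i} (\<lambda>i. X i \<omega>)) =
          (LINT \<omega>|N. indicator {x. \<forall>i\<in>J. x i \<in> B i} (\<lambda>i. Y i \<omega>) :: real)"
      using of_real_eq_iff by blast
    then show "emeasure (distr M (PiM UNIV (\<lambda>_. borel)) (\<lambda>\<omega> i. X i \<omega>)) (prod_emb UNIV (\<lambda>_. borel) J (Pi\<^sub>E J A)) =
      emeasure (distr N (PiM UNIV (\<lambda>_. borel)) (\<lambda>\<omega> i. Y i \<omega>)) (prod_emb UNIV (\<lambda>_. borel) J (Pi\<^sub>E J A))"
      unfolding AB em by (simp add: LM LN D1.emeasure_eq_measure D2.emeasure_eq_measure)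
  next
    interpret D1: prob_space "distr M (PiM UNIV (\<lambda>_. borel)) (\<lambda>\<omega> i. X i \<omega>)"
      by (rule M.prob_space_distr) simp
    show "finite_measure (distr M (PiM UNIV (\<lambda>_. borel)) (\<lambda>\<omega> i. X i \<omega>))" by unfold_locales
  qed auto
qed

section \<open>Gaussian families\<close>

abbreviation path_borel :: "('i \<Rightarrow> real) measure" where
  "path_borel \<equiv> PiM UNIV (\<lambda>_. borel)"

text \<open>The covariance of two linear combinations of a family with covariance \<open>\<Gamma>\<close>.\<close>
definition bilin :: "('i \<Rightarrow> 'i \<Rightarrow> real) \<Rightarrow> 'i set \<Rightarrow> ('i \<Rightarrow> real) \<Rightarrow> ('i \<Rightarrow> real) \<Rightarrow> real" where
  "bilin \<Gamma> U c d = (\<Sum>i\<in>U. \<Sum>j\<in>U. c i * d j * \<Gamma> i j)"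

lemma bilin_affine:
  assumes "\<And>i j. \<Gamma> i j = \<Gamma> j i"
  shows "bilin \<Gamma> U (\<lambda>i. c i + t * d i) (\<lambda>i. c i + t * d i) = bilin \<Gamma> U c c + 2 * t * bilin \<Gamma> U c d + t\<^sup>2 * bilin \<Gamma> U d d"
proof -
  have s: "bilin \<Gamma> U d c = bilin \<Gamma> U c d"
    unfolding bilin_def by (subst sum.swap) (simp add: assms mult.commute mult.left_commute)
  have "bilin \<Gamma> U (\<lambda>i. c i + t * d i) (\<lambda>i. c i + t * d i) =
    bilin \<Gamma> U c c + t * bilin \<Gamma> U c d + t * bilin \<Gamma> U d c + t\<^sup>2 * bilin \<Gamma> U d d"
    unfolding bilin_def by (simp add: algebra_simps sum.distrib sum_distrib_left power2_eq_square)
  then show ?thesis using s by simp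
qed

text \<open>Coefficients are extended by zero in order to compare combinations over different index sets.\<close>
lemma sum_extend:
  fixes f g :: "'i \<Rightarrow> real"
  assumes "finite U" "J \<subseteq> U"
  shows "(\<Sum>i\<in>U. (if i \<in> J then f i else 0) * g i) = (\<Sum>i\<in>J. f i * g i)"
proof -
  have "(\<Sum>i\<in>J. f i * g i) = (\<Sum>i\<in>U. if i \<in> J then f i * g i else 0)"
    using assms by (simp add: sum.If_cases Int_absorb1)
  also have "\<dots> = (\<Sum>i\<in>U. (if i \<in> J then f i else 0) * g i)" by (intro sum.cong) auto
  finally show ?thesis by simp
qed

text \<open>Joint Gaussianity through characteristic functions, so that degenerate covariances need no
  special treatment. Families are indexed by a whole type and their laws live on the full product
  space; then functions of a path need no restriction to a finite index set.\<close>
definition gauss_fam :: "'w measure \<Rightarrow> ('i \<Rightarrow> 'w \<Rightarrow> real) \<Rightarrow> ('i \<Rightarrow> 'i \<Rightarrow> real) \<Rightarrow> bool" where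
  "gauss_fam M X \<Gamma> \<longleftrightarrow> prob_space M \<and> (\<forall>i. X i \<in> borel_measurable M) \<and> (\<forall>i j. \<Gamma> i j = \<Gamma> j i) \<and>
     (\<forall>J c. finite J \<longrightarrow> (CLINT \<omega>|M. iexp (\<Sum>i\<in>J. c i * X i \<omega>)) = of_real (exp (- bilin \<Gamma> J c c / 2)))"

lemma gauss_famD:
  assumes "gauss_fam M X \<Gamma>"
  shows "prob_space M" "X i \<in> borel_measurable M" "\<Gamma> i j = \<Gamma> j i"
    "finite J \<Longrightarrow> (CLINT \<omega>|M. iexp (\<Sum>i\<in>J. c i * X i \<omega>)) = of_real (exp (- bilin \<Gamma> J c c / 2))"
  using assms unfolding gauss_fam_def by auto

lemma measurable_path[measurable (raw)]:
  "(\<And>i. (\<lambda>\<omega>. f \<omega> i) \<in> borel_measurable M) \<Longrightarrow> (\<lambda>\<omega> i. f \<omega> i) \<in> measurable M path_borel"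
  by (auto intro!: measurable_PiM_single')

lemma gauss_fam_law_eq:
  assumes "gauss_fam M X \<Gamma>" "gauss_fam N Y \<Gamma>"
  shows "distr M path_borel (\<lambda>\<omega> i. X i \<omega>) = distr N path_borel (\<lambda>\<omega> i. Y i \<omega>)"
  by (intro cramer_wold gauss_famD(1)[OF assms(1)] gauss_famD(1)[OF assms(2)] gauss_famD(2)[OF assms(1)] gauss_famD(2)[OF assms(2)])
     (simp only: gauss_famD(4)[OF assms(1)] gauss_famD(4)[OF assms(2)])

lemma gauss_fam_variance_nonneg:
  assumes "gauss_fam M X \<Gamma>" "finite J"
  shows "0 \<le> bilin \<Gamma> J b b"
proof -
  interpret prob_space M by (rule gauss_famD(1)[OF assms(1)])
  have [measurable]: "X i \<in> borel_measurable M" for i by (rule gauss_famD(2)[OF assms(1)])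
  have "exp (- bilin \<Gamma> J b b / 2) = norm (CLINT \<omega>|M. iexp (\<Sum>i\<in>J. b i * X i \<omega>))"
    using gauss_famD(4)[OF assms(1), OF assms(2)] by simp
  also have "\<dots> \<le> (LINT \<omega>|M. norm (iexp (\<Sum>i\<in>J. b i * X i \<omega>)))" by (rule integral_norm_bound)
  also have "\<dots> = 1" by (simp add: prob_space)
  finally show ?thesis by simp
qed

text \<open>Reduces the one-dimensional facts to the standard normal law, degenerate combinations included.\<close>
lemma gauss_fam_combination_law:
  assumes g: "gauss_fam M X \<Gamma>" and J: "finite J"
  shows "distr M borel (\<lambda>\<omega>. \<Sum>i\<in>J. b i * X i \<omega>) =
         distr std_normal_distribution borel (\<lambda>z. sqrt (bilin \<Gamma> J b b) * z)"
proof -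
  interpret prob_space M by (rule gauss_famD(1)[OF g])
  have [measurable]: "X i \<in> borel_measurable M" for i by (rule gauss_famD(2)[OF g])
  interpret S: real_distribution std_normal_distribution by (rule real_dist_normal_dist)
  let ?v = "bilin \<Gamma> J b b"
  have v: "0 \<le> ?v" by (rule gauss_fam_variance_nonneg[OF g J])
  show ?thesis
  proof (rule Levy_uniqueness)
    show "real_distribution (distr M borel (\<lambda>\<omega>. \<Sum>i\<in>J. b i * X i \<omega>))"
      by (intro real_distribution_distr) auto
    show "real_distribution (distr std_normal_distribution borel (\<lambda>z. sqrt ?v * z))"
      by (intro S.real_distribution_distr) auto
    show "char (distr M borel (\<lambda>\<omega>. \<Sum>i\<in>J. b i * X i \<omega>)) = char (distr std_normal_distribution borel (\<lambda>z. sqrt ?v * z))"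
    proof
      fix t
      have "char (distr M borel (\<lambda>\<omega>. \<Sum>i\<in>J. b i * X i \<omega>)) t = (CLINT \<omega>|M. iexp (t * (\<Sum>i\<in>J. b i * X i \<omega>)))"
        unfolding char_def by (subst integral_distr) auto
      also have "\<dots> = (CLINT \<omega>|M. iexp (\<Sum>i\<in>J. (t * b i) * X i \<omega>))"
        by (simp add: sum_distrib_left mult.assoc)
      also have "\<dots> = of_real (exp (- bilin \<Gamma> J (\<lambda>i. t * b i) (\<lambda>i. t * b i) / 2))"
        by (rule gauss_famD(4)[OF g J])
      also have "bilin \<Gamma> J (\<lambda>i. t * b i) (\<lambda>i. t * b i) = t\<^sup>2 * ?v"
        unfolding bilin_def by (simp add: sum_distrib_left power2_eq_square mult_ac)
      also have "complex_of_real (exp (- (t\<^sup>2 * ?v) / 2)) = char std_normal_distribution (t * sqrt ?v)"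
        using v by (simp add: char_std_normal_distribution power_mult_distrib)
      also have "\<dots> = char (distr std_normal_distribution borel (\<lambda>z. sqrt ?v * z)) t"
        unfolding char_def by (subst integral_distr) (auto simp: mult_ac)
      finally show "char (distr M borel (\<lambda>\<omega>. \<Sum>i\<in>J. b i * X i \<omega>)) t = char (distr std_normal_distribution borel (\<lambda>z. sqrt ?v * z)) t" .
    qed
  qed
qed

lemma std_normal_exp:
  "integrable std_normal_distribution (\<lambda>z. exp (k * z))" (is ?A)
  "(LINT z|std_normal_distribution. exp (k * z)) = exp (k\<^sup>2 / 2)" (is ?B)
proof -
  have eq: "normal_density 0 1 z *\<^sub>R exp (k * z) = exp (k\<^sup>2 / 2) * normal_density k 1 z" for z
    unfolding normal_density_def by (simp add: field_simps power2_eq_square flip: exp_add)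
  show ?A by (subst integrable_density) (auto simp: eq simp del: real_scaleR_def)
  show ?B by (subst integral_density) (auto simp: eq simp del: real_scaleR_def)
qed

lemma std_normal_exp_abs: "integrable std_normal_distribution (\<lambda>z. exp (k * \<bar>z\<bar>))"
proof (rule Bochner_Integration.integrable_bound)
  show "integrable std_normal_distribution (\<lambda>z. exp (k * z) + exp ((-k) * z))"
    by (intro Bochner_Integration.integrable_add std_normal_exp)
  have "exp (k * \<bar>z\<bar>) \<le> exp (k * z) + exp ((-k) * z)" for z
    by (cases "0 \<le> z") (auto simp: abs_if)
  then show "AE z in std_normal_distribution. norm (exp (k * \<bar>z\<bar>)) \<le> norm (exp (k * z) + exp ((-k) * z))"
    by (auto intro!: AE_I2 order_trans[OF _ abs_ge_self])
qed auto

lemma real_std_normal_prob: "prob_space std_normal_distribution"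
  using real_dist_normal_dist unfolding real_distribution_def by auto

lemma integrable_lborel_std_normal:
  assumes "f \<in> borel_measurable borel"
  shows "integrable std_normal_distribution f \<longleftrightarrow> integrable lborel (\<lambda>x. std_normal_density x * f x)"
  using assms by (subst integrable_density) auto

lemma integral_lborel_std_normal:
  fixes f :: "real \<Rightarrow> real"
  assumes "f \<in> borel_measurable borel"
  shows "(LINT z|std_normal_distribution. f z) = (LINT z|lborel. std_normal_density z * f z)"
  using assms by (subst integral_density) auto

lemma integrable_std_normal_growth:
  fixes f :: "real \<Rightarrow> real"
  assumes [measurable]: "f \<in> borel_measurable borel" and "\<And>z. \<bar>f z\<bar> \<le> c * exp (k * \<bar>z\<bar>)"
  shows "integrable std_normal_distribution f"
proof (rule Bochner_Integration.integrable_bound)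
  show "integrable std_normal_distribution (\<lambda>z. c * exp (k * \<bar>z\<bar>))"
    by (intro integrable_mult_right std_normal_exp_abs)
  show "AE x in std_normal_distribution. norm (f x) \<le> norm (c * exp (k * \<bar>x\<bar>))"
    using order_trans[OF assms(2) abs_ge_self] by (intro AE_I2) simp
qed simp

text \<open>The fundamental theorem is taken from the gauge integral, for which an arbitrary derivative is
  integrable over a compact interval; dominated convergence extends it to the line.\<close>
lemma integral_derivative_zero:
  fixes F F' :: "real \<Rightarrow> real"
  assumes F: "\<And>x. (F has_real_derivative F' x) (at x)" and F'[measurable]: "integrable lborel F'"
    and lim: "(\<lambda>n. F (real n)) \<longlonglongrightarrow> 0" "(\<lambda>n. F (- real n)) \<longlonglongrightarrow> 0"
  shows "(LINT x|lborel. F' x) = 0"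
proof -
  have [measurable]: "F' \<in> borel_measurable borel" using F' by auto
  have "(LINT x:{-real n..real n}|lborel. F' x) = F (real n) - F (- real n)" for n
  proof -
    have "(F' has_integral F (real n) - F (- real n)) {- real n..real n}"
      using F by (intro fundamental_theorem_of_calculus)
        (auto simp: has_real_derivative_iff_has_vector_derivative[symmetric] intro: has_field_derivative_at_within)
    moreover have "set_integrable lborel {-real n..real n} F'"
      unfolding set_integrable_def using F' by (intro integrable_mult_indicator) auto
    ultimately show ?thesis
      using set_borel_integral_eq_integral(2) integral_unique by metis
  qed
  then have "(\<lambda>n. LINT x|lborel. indicator {-real n..real n} x *\<^sub>R F' x) \<longlonglongrightarrow> 0"
    using tendsto_diff[OF lim] by (simp add: set_lebesgue_integral_def)
  moreover have "(\<lambda>n. LINT x|lborel. indicator {-real n..real n} x *\<^sub>R F' x) \<longlonglongrightarrow> (LINT x|lborel. F' x)"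
  proof (rule integral_dominated_convergence[where w = "\<lambda>x. \<bar>F' x\<bar>"])
    show "AE x in lborel. (\<lambda>n. indicator {-real n..real n} x *\<^sub>R F' x) \<longlonglongrightarrow> F' x"
    proof (rule AE_I2, rule tendsto_eventually)
      fix x :: real
      obtain N :: nat where "\<bar>x\<bar> \<le> real N" using real_arch_simple by blast
      then show "\<forall>\<^sub>F n in sequentially. indicator {-real n..real n} x *\<^sub>R F' x = F' x"
        by (intro eventually_sequentiallyI[of N]) (auto simp: indicator_def abs_le_iff)
    qed
    show "AE x in lborel. norm (indicator {-real n..real n} x *\<^sub>R F' x) \<le> \<bar>F' x\<bar>" for n
      by (auto simp: indicator_def)
  qed (use F' in auto)
  ultimately show ?thesis using LIMSEQ_unique by blast
qed

lemma std_normal_ibp: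
  fixes h h' :: "real \<Rightarrow> real"
  assumes h: "\<And>x. (h has_real_derivative h' x) (at x)"
    and [measurable]: "h' \<in> borel_measurable borel"
    and b: "\<And>z. \<bar>h z\<bar> \<le> c * exp (k * \<bar>z\<bar>)" and b': "\<And>z. \<bar>h' z\<bar> \<le> c' * exp (k' * \<bar>z\<bar>)"
  shows "(LINT z|std_normal_distribution. z * h z) = (LINT z|std_normal_distribution. h' z)"
proof -
  have [measurable]: "h \<in> borel_measurable borel"
    using h by (intro borel_measurable_continuous_onI continuous_at_imp_continuous_on ballI) (auto dest: DERIV_isCont)
  have c0: "0 \<le> c" using b[of 0] abs_ge_zero[of "h 0"] by (simp del: abs_ge_zero)
  have i2: "integrable std_normal_distribution (\<lambda>z. z * h z)"
  proof (rule integrable_std_normal_growth)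
    fix z :: real
    have "\<bar>z\<bar> \<le> exp \<bar>z\<bar>" using exp_ge_add_one_self[of "\<bar>z\<bar>"] by linarith
    then have "\<bar>z * h z\<bar> \<le> exp \<bar>z\<bar> * (c * exp (k * \<bar>z\<bar>))" unfolding abs_mult using b by (intro mult_mono) auto
    then show "\<bar>z * h z\<bar> \<le> c * exp ((k + 1) * \<bar>z\<bar>)" by (simp add: algebra_simps exp_add)
  qed simp
  have i1: "integrable std_normal_distribution h'" by (rule integrable_std_normal_growth[OF _ b']) simp
  define F where "F x = std_normal_density x * h x" for x
  define F' where "F' x = std_normal_density x * h' x - std_normal_density x * (x * h x)" for x
  have F: "(F has_real_derivative F' x) (at x)" for x
    unfolding F_def F'_def normal_density_def
    by (rule derivative_eq_intros h refl | simp)+ (simp add: algebra_simps power2_eq_square)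
  have Fb: "\<bar>F x\<bar> \<le> (c * exp ((k+1)\<^sup>2/2)) * exp (- \<bar>x\<bar>)" for x
  proof -
    have s1: "1 / sqrt (2 * pi) \<le> 1" using pi_ge_two by (simp add: divide_le_eq_1)
    have "\<bar>F x\<bar> = \<bar>h x\<bar> * (1 / sqrt (2 * pi) * exp (- x\<^sup>2/2))"
      unfolding F_def std_normal_density_def abs_mult by (simp add: abs_mult)
    also have "\<dots> \<le> (c * exp (k * \<bar>x\<bar>)) * (1 * exp (- x\<^sup>2/2))"
      using s1 b c0 by (intro mult_mono) auto
    also have "\<dots> = c * exp (k * \<bar>x\<bar> - x\<^sup>2/2)" by (simp flip: exp_add)
    also have "\<dots> \<le> c * exp ((k+1)\<^sup>2/2 - \<bar>x\<bar>)"
    proof -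
      \<comment> \<open>\<open>k|x| - x\<^sup>2/2 \<le> (k+1)\<^sup>2/2 - |x|\<close> turns Gaussian into exponential decay.\<close>
      have "0 \<le> (\<bar>x\<bar> - (k+1))\<^sup>2" by simp
      then have "k * \<bar>x\<bar> - x\<^sup>2/2 \<le> (k+1)\<^sup>2/2 - \<bar>x\<bar>"
        unfolding power2_abs[of x, symmetric] by (simp add: power2_eq_square algebra_simps)
      then show ?thesis using c0 by (intro mult_left_mono) auto
    qed
    also have "\<dots> = (c * exp ((k+1)\<^sup>2/2)) * exp (- \<bar>x\<bar>)" by (simp only: diff_conv_add_uminus exp_add mult.assoc)
    finally show ?thesis .
  qed
  have e0: "(\<lambda>n. (c * exp ((k+1)\<^sup>2/2)) * exp (- real n)) \<longlonglongrightarrow> 0"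
    by (intro tendsto_mult_right_zero filterlim_compose[OF exp_at_bot] filterlim_compose[OF filterlim_uminus_at_bot_at_top]
        filterlim_real_sequentially)
  have iF: "integrable lborel F'"
    unfolding F'_def using i1 i2 by (intro Bochner_Integration.integrable_diff) (simp_all add: integrable_lborel_std_normal)
  have "(LINT x|lborel. F' x) = 0"
  proof (rule integral_derivative_zero[OF F iF])
    show "(\<lambda>n. F (real n)) \<longlonglongrightarrow> 0"
      by (rule Lim_null_comparison[OF _ e0]) (use Fb[of "real n" for n] in \<open>auto intro!: always_eventually\<close>)
    show "(\<lambda>n. F (- real n)) \<longlonglongrightarrow> 0"
      by (rule Lim_null_comparison[OF _ e0]) (use Fb[of "- real n" for n] in \<open>auto intro!: always_eventually\<close>)
  qed
  moreover have "(LINT x|lborel. F' x) = (LINT z|std_normal_distribution. h' z) - (LINT z|std_normal_distribution. z * h z)"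
    unfolding F'_def using i1 i2
    by (subst Bochner_Integration.integral_diff) (simp_all add: integral_lborel_std_normal integrable_lborel_std_normal)
  ultimately show ?thesis by simp
qed

text \<open>A class of functions of a path that is stable under sums, products and rotations, and that
  consists of integrable functions for every Gaussian law.\<close>
definition exp_growth :: "(('i \<Rightarrow> real) \<Rightarrow> real) \<Rightarrow> bool" where
  "exp_growth H \<longleftrightarrow> H \<in> borel_measurable path_borel \<and>
     (\<exists>J c k. finite J \<and> 0 \<le> c \<and> 0 \<le> k \<and> (\<forall>x. \<bar>H x\<bar> \<le> c * exp (k * (\<Sum>i\<in>J. \<bar>x i\<bar>))))"

lemma exp_growth_measurable[measurable_dest]: "exp_growth H \<Longrightarrow> H \<in> borel_measurable path_borel"
  by (simp add: exp_growth_def)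

lemma exp_growthI:
  assumes "H \<in> borel_measurable path_borel" "finite J" "\<And>x. \<bar>H x\<bar> \<le> c * exp (k * (\<Sum>i\<in>J. \<bar>x i\<bar>))"
  shows "exp_growth H"
proof -
  have "\<bar>H x\<bar> \<le> \<bar>c\<bar> * exp (\<bar>k\<bar> * (\<Sum>i\<in>J. \<bar>x i\<bar>))" for x
  proof -
    have "\<bar>H x\<bar> \<le> \<bar>c\<bar> * exp (k * (\<Sum>i\<in>J. \<bar>x i\<bar>))"
      using assms(3)[of x] by (rule order_trans) (rule mult_right_mono, auto)
    also have "\<dots> \<le> \<bar>c\<bar> * exp (\<bar>k\<bar> * (\<Sum>i\<in>J. \<bar>x i\<bar>))"
      by (intro mult_left_mono) (auto intro!: mult_right_mono sum_nonneg)
    finally show ?thesis .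
  qed
  then show ?thesis
    using assms(1,2) abs_ge_zero[of c] abs_ge_zero[of k] unfolding exp_growth_def by blast
qed

lemma exp_growth_bound:
  assumes "exp_growth F" "\<And>x. \<bar>H x\<bar> \<le> c * \<bar>F x\<bar>" "H \<in> borel_measurable path_borel"
  shows "exp_growth H"
proof -
  obtain J a k where *: "finite J" "0 \<le> a" "0 \<le> k" "\<And>x. \<bar>F x\<bar> \<le> a * exp (k * (\<Sum>i\<in>J. \<bar>x i\<bar>))"
    using assms(1) unfolding exp_growth_def by blast
  have "\<bar>H x\<bar> \<le> (\<bar>c\<bar> * a) * exp (k * (\<Sum>i\<in>J. \<bar>x i\<bar>))" for x
  proof -
    have "\<bar>H x\<bar> \<le> \<bar>c\<bar> * \<bar>F x\<bar>" using assms(2)[of x] by (rule order_trans) (rule mult_right_mono, auto)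
    also have "\<dots> \<le> \<bar>c\<bar> * (a * exp (k * (\<Sum>i\<in>J. \<bar>x i\<bar>)))" using * by (intro mult_left_mono) auto
    finally show ?thesis by (simp add: mult.assoc)
  qed
  then show ?thesis using assms * by (intro exp_growthI)
qed

lemma exp_growth_const: "exp_growth (\<lambda>x. c)"
  by (rule exp_growthI[of _ "{}" "\<bar>c\<bar>" 0]) auto

lemma exp_growth_coord:
  fixes i :: 'i
  shows "exp_growth (\<lambda>x. x i)"
proof (rule exp_growthI[of _ "{i}" 1 1])
  show "\<bar>x i\<bar> \<le> 1 * exp (1 * (\<Sum>i\<in>{i}. \<bar>x i\<bar>))" for x :: "'i \<Rightarrow> real"
  proof -
    have "\<bar>x i\<bar> \<le> exp \<bar>x i\<bar>" using exp_ge_add_one_self[of "\<bar>x i\<bar>"] by linarith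
    then show ?thesis by simp
  qed
qed auto

lemma exp_growth_exp:
  fixes i :: 'i
  shows "exp_growth (\<lambda>x. exp (a * x i))"
proof (rule exp_growthI[of _ "{i}" 1 "\<bar>a\<bar>"])
  show "\<bar>exp (a * x i)\<bar> \<le> 1 * exp (\<bar>a\<bar> * (\<Sum>i\<in>{i}. \<bar>x i\<bar>))" for x :: "'i \<Rightarrow> real"
    by (simp add: abs_mult[symmetric])
qed auto

lemma exp_growth_add:
  assumes "exp_growth F" "exp_growth H"
  shows "exp_growth (\<lambda>x. F x + H x)"
proof -
  obtain J a k where *: "finite J" "0 \<le> a" "0 \<le> k" "\<And>x. \<bar>F x\<bar> \<le> a * exp (k * (\<Sum>i\<in>J. \<bar>x i\<bar>))"
    using assms(1) unfolding exp_growth_def by blast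
  obtain J' a' k' where **: "finite J'" "0 \<le> a'" "0 \<le> k'" "\<And>x. \<bar>H x\<bar> \<le> a' * exp (k' * (\<Sum>i\<in>J'. \<bar>x i\<bar>))"
    using assms(2) unfolding exp_growth_def by blast
  have "\<bar>F x + H x\<bar> \<le> (a + a') * exp ((k + k') * (\<Sum>i\<in>J \<union> J'. \<bar>x i\<bar>))" for x
  proof -
    have "k * (\<Sum>i\<in>J. \<bar>x i\<bar>) \<le> (k + k') * (\<Sum>i\<in>J \<union> J'. \<bar>x i\<bar>)"
      "k' * (\<Sum>i\<in>J'. \<bar>x i\<bar>) \<le> (k + k') * (\<Sum>i\<in>J \<union> J'. \<bar>x i\<bar>)"
      using * ** by (auto intro!: mult_mono sum_mono2 sum_nonneg)
    then have "a * exp (k * (\<Sum>i\<in>J. \<bar>x i\<bar>)) \<le> a * exp ((k + k') * (\<Sum>i\<in>J \<union> J'. \<bar>x i\<bar>))"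
      "a' * exp (k' * (\<Sum>i\<in>J'. \<bar>x i\<bar>)) \<le> a' * exp ((k + k') * (\<Sum>i\<in>J \<union> J'. \<bar>x i\<bar>))"
      using * ** by (auto intro!: mult_left_mono)
    then show ?thesis using *(4)[of x] **(4)[of x] by (simp add: distrib_right)
  qed
  then show ?thesis using * ** assms[THEN exp_growth_measurable] by (intro exp_growthI[of _ "J \<union> J'"]) auto
qed

lemma exp_growth_mult:
  assumes "exp_growth F" "exp_growth H"
  shows "exp_growth (\<lambda>x. F x * H x)"
proof -
  obtain J a k where *: "finite J" "0 \<le> a" "0 \<le> k" "\<And>x. \<bar>F x\<bar> \<le> a * exp (k * (\<Sum>i\<in>J. \<bar>x i\<bar>))"
    using assms(1) unfolding exp_growth_def by blast
  obtain J' a' k' where **: "finite J'" "0 \<le> a'" "0 \<le> k'" "\<And>x. \<bar>H x\<bar> \<le> a' * exp (k' * (\<Sum>i\<in>J'. \<bar>x i\<bar>))"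
    using assms(2) unfolding exp_growth_def by blast
  have "\<bar>F x * H x\<bar> \<le> (a * a') * exp ((k + k') * (\<Sum>i\<in>J \<union> J'. \<bar>x i\<bar>))" for x
  proof -
    have "k * (\<Sum>i\<in>J. \<bar>x i\<bar>) + k' * (\<Sum>i\<in>J'. \<bar>x i\<bar>) \<le> k * (\<Sum>i\<in>J \<union> J'. \<bar>x i\<bar>) + k' * (\<Sum>i\<in>J \<union> J'. \<bar>x i\<bar>)"
      using * ** by (intro add_mono mult_left_mono sum_mono2) auto
    then have e: "a * a' * exp (k * (\<Sum>i\<in>J. \<bar>x i\<bar>) + k' * (\<Sum>i\<in>J'. \<bar>x i\<bar>)) \<le> a * a' * exp ((k + k') * (\<Sum>i\<in>J \<union> J'. \<bar>x i\<bar>))"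
      using * ** by (intro mult_left_mono) (auto simp: distrib_right)
    have "\<bar>F x * H x\<bar> \<le> (a * exp (k * (\<Sum>i\<in>J. \<bar>x i\<bar>))) * (a' * exp (k' * (\<Sum>i\<in>J'. \<bar>x i\<bar>)))"
      unfolding abs_mult using * ** by (intro mult_mono) auto
    also have "\<dots> = a * a' * exp (k * (\<Sum>i\<in>J. \<bar>x i\<bar>) + k' * (\<Sum>i\<in>J'. \<bar>x i\<bar>))" by (simp add: exp_add)
    finally show ?thesis using e by linarith
  qed
  then show ?thesis using * ** assms[THEN exp_growth_measurable] by (intro exp_growthI[of _ "J \<union> J'"]) auto
qed

lemma exp_growth_sum:
  assumes "\<And>i. i \<in> I \<Longrightarrow> exp_growth (F i)" shows "exp_growth (\<lambda>x. \<Sum>i\<in>I. F i x)"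
  using assms
  by (induction I rule: infinite_finite_induct) (auto intro: exp_growth_const exp_growth_add)

lemma exp_growth_diff:
  assumes "exp_growth F" "exp_growth H"
  shows "exp_growth (\<lambda>x. F x - H x)"
  using exp_growth_add[OF assms(1) exp_growth_mult[OF exp_growth_const[of "-1"] assms(2)]] by simp

lemmas exp_growth_intros = exp_growth_const exp_growth_coord exp_growth_exp exp_growth_add exp_growth_diff
  exp_growth_mult exp_growth_sum

text \<open>The sum is at most \<open>card J\<close> times its largest term.\<close>
lemma exp_sum_le_sum_exp:
  fixes x :: "'i \<Rightarrow> real"
  assumes "finite J" "0 \<le> k"
  shows "exp (k * (\<Sum>i\<in>J. \<bar>x i\<bar>)) \<le> 1 + (\<Sum>i\<in>J. exp (k * card J * \<bar>x i\<bar>))"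
proof (cases "J = {}")
  case False
  have "Max ((\<lambda>i. \<bar>x i\<bar>) ` J) \<in> (\<lambda>i. \<bar>x i\<bar>) ` J" using assms(1) False by (intro Max_in) auto
  then obtain m where m0: "m \<in> J" "Max ((\<lambda>i. \<bar>x i\<bar>) ` J) = \<bar>x m\<bar>" by auto
  have m: "m \<in> J" "\<And>i. i \<in> J \<Longrightarrow> \<bar>x i\<bar> \<le> \<bar>x m\<bar>"
    using m0 assms(1) by (auto simp flip: m0(2))
  have "(\<Sum>i\<in>J. \<bar>x i\<bar>) \<le> card J * \<bar>x m\<bar>" using m(2) by (rule sum_bounded_above)
  then have "k * (\<Sum>i\<in>J. \<bar>x i\<bar>) \<le> k * card J * \<bar>x m\<bar>"
    using assms(2) by (metis mult.assoc mult_left_mono)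
  then have "exp (k * (\<Sum>i\<in>J. \<bar>x i\<bar>)) \<le> exp (k * card J * \<bar>x m\<bar>)" by simp
  also have "\<dots> \<le> (\<Sum>i\<in>J. exp (k * card J * \<bar>x i\<bar>))"
    using assms(1) m(1) by (intro member_le_sum) auto
  finally show ?thesis by linarith
qed simp

lemma gauss_fam_exp_abs:
  assumes "gauss_fam M X \<Gamma>"
  shows "integrable M (\<lambda>\<omega>. exp (k * \<bar>X i \<omega>\<bar>))"
proof -
  have [measurable]: "X i \<in> borel_measurable M" by (rule gauss_famD(2)[OF assms(1)])
  have d: "distr M borel (X i) = distr std_normal_distribution borel (\<lambda>z. sqrt (\<Gamma> i i) * z)"
    using gauss_fam_combination_law[OF assms, of "{i}" "\<lambda>_. 1"] by (simp add: bilin_def)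
  have "integrable (distr std_normal_distribution borel (\<lambda>z. sqrt (\<Gamma> i i) * z)) (\<lambda>y. exp (k * \<bar>y\<bar>))"
    by (subst integrable_distr_eq) (auto simp: abs_mult intro!: integrable_std_normal_growth[of _ 1 "k * \<bar>sqrt (\<Gamma> i i)\<bar>"])
  then show ?thesis unfolding d[symmetric] by (subst (asm) integrable_distr_eq) auto
qed

lemma gauss_fam_integrable:
  assumes g: "gauss_fam M X \<Gamma>" and H: "exp_growth H"
  shows "integrable M (\<lambda>\<omega>. H (\<lambda>i. X i \<omega>))"
proof -
  interpret prob_space M by (rule gauss_famD(1)[OF g])
  have [measurable]: "X i \<in> borel_measurable M" for i by (rule gauss_famD(2)[OF g])
  have [measurable]: "H \<in> borel_measurable path_borel" using H by (rule exp_growth_measurable)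
  obtain J a k where *: "finite J" "0 \<le> a" "0 \<le> k" "\<And>x. \<bar>H x\<bar> \<le> a * exp (k * (\<Sum>i\<in>J. \<bar>x i\<bar>))"
    using H unfolding exp_growth_def by blast
  show ?thesis
  proof (rule Bochner_Integration.integrable_bound)
    show "integrable M (\<lambda>\<omega>. a * (1 + (\<Sum>i\<in>J. exp (k * card J * \<bar>X i \<omega>\<bar>))))"
      using gauss_fam_exp_abs[OF g] by (intro integrable_mult_right Bochner_Integration.integrable_add Bochner_Integration.integrable_sum) auto
    show "AE \<omega> in M. norm (H (\<lambda>i. X i \<omega>)) \<le> norm (a * (1 + (\<Sum>i\<in>J. exp (k * card J * \<bar>X i \<omega>\<bar>))))"
    proof (rule AE_I2)
      fix \<omega>
      have "\<bar>H (\<lambda>i. X i \<omega>)\<bar> \<le> a * exp (k * (\<Sum>i\<in>J. \<bar>X i \<omega>\<bar>))" using *(4) .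
      also have "\<dots> \<le> a * (1 + (\<Sum>i\<in>J. exp (k * card J * \<bar>X i \<omega>\<bar>)))"
        using exp_sum_le_sum_exp[OF *(1,3), of "\<lambda>i. X i \<omega>"] *(2) by (rule mult_left_mono)
      finally show "norm (H (\<lambda>i. X i \<omega>)) \<le> norm (a * (1 + (\<Sum>i\<in>J. exp (k * card J * \<bar>X i \<omega>\<bar>))))" by simp
    qed
  qed simp
qed

section \<open>Gaussian integration by parts\<close>

lemma integral_pair_mult:
  fixes f g :: "'a \<Rightarrow> 'b::{real_normed_field, banach, second_countable_topology}"
  assumes M: "prob_space M" and f: "integrable M f" and g: "integrable M g"
  shows "integrable (M \<Otimes>\<^sub>M M) (\<lambda>\<omega>. f (fst \<omega>) * g (snd \<omega>))" (is ?A)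
    and "(LINT \<omega>|(M \<Otimes>\<^sub>M M). f (fst \<omega>) * g (snd \<omega>)) = (LINT \<omega>|M. f \<omega>) * (LINT \<omega>|M. g \<omega>)" (is ?B)
proof -
  interpret prob_space M by fact
  interpret P: pair_prob_space M M ..
  have [measurable]: "f \<in> borel_measurable M" "g \<in> borel_measurable M" using f g by auto
  show A: ?A
    using f g by (intro P.Fubini_integrable) (auto simp: norm_mult)
  show ?B using P.integral_fst'[OF A] f g by simp
qed

text \<open>A family together with an independent copy of it, as one family: the index
  \<open>(True, i)\<close> belongs to the first factor of the product space.\<close>
definition pair_fam :: "('i \<Rightarrow> 'w \<Rightarrow> real) \<Rightarrow> bool \<times> 'i \<Rightarrow> 'w \<times> 'w \<Rightarrow> real" where
  "pair_fam X p \<omega> = X (snd p) (if fst p then fst \<omega> else snd \<omega>)"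

definition pair_cov :: "('i \<Rightarrow> 'i \<Rightarrow> real) \<Rightarrow> bool \<times> 'i \<Rightarrow> bool \<times> 'i \<Rightarrow> real" where
  "pair_cov \<Gamma> p q = (if fst p = fst q then \<Gamma> (snd p) (snd q) else 0)"

lemma gauss_fam_pair_char:
  assumes g: "gauss_fam M X \<Gamma>" and U: "finite U"
  shows "(CLINT \<omega>|(M \<Otimes>\<^sub>M M). iexp ((\<Sum>i\<in>U. p i * X i (fst \<omega>)) + (\<Sum>i\<in>U. q i * X i (snd \<omega>)))) =
    of_real (exp (- (bilin \<Gamma> U p p + bilin \<Gamma> U q q) / 2))"
proof -
  interpret prob_space M by (rule gauss_famD(1)[OF g])
  have [measurable]: "X i \<in> borel_measurable M" for i by (rule gauss_famD(2)[OF g])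
  have i: "integrable M (\<lambda>\<omega>. iexp (\<Sum>i\<in>U. p i * X i \<omega>))" for p
    by (intro integrable_const_bound[where B = 1]) auto
  have "(CLINT \<omega>|(M \<Otimes>\<^sub>M M). iexp ((\<Sum>i\<in>U. p i * X i (fst \<omega>)) + (\<Sum>i\<in>U. q i * X i (snd \<omega>)))) =
    (CLINT \<omega>|(M \<Otimes>\<^sub>M M). iexp (\<Sum>i\<in>U. p i * X i (fst \<omega>)) * iexp (\<Sum>i\<in>U. q i * X i (snd \<omega>)))"
    by (intro Bochner_Integration.integral_cong) (simp_all add: exp_add distrib_left)
  also have "\<dots> = (CLINT \<omega>|M. iexp (\<Sum>i\<in>U. p i * X i \<omega>)) * (CLINT \<omega>|M. iexp (\<Sum>i\<in>U. q i * X i \<omega>))"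
    by (rule integral_pair_mult(2)[OF prob_space_axioms i i])
  also have "\<dots> = of_real (exp (- (bilin \<Gamma> U p p + bilin \<Gamma> U q q) / 2))"
    unfolding gauss_famD(4)[OF g U] of_real_mult[symmetric] exp_add[symmetric] by (simp add: field_simps)
  finally show ?thesis .
qed

lemma pair_prob: "prob_space M \<Longrightarrow> prob_space (M \<Otimes>\<^sub>M M)"
proof -
  assume "prob_space M"
  then interpret prob_space M .
  interpret pair_prob_space M M ..
  show ?thesis by (rule P.prob_space_axioms)
qed

lemma gauss_fam_pair:
  assumes g: "gauss_fam M X \<Gamma>"
  shows "gauss_fam (M \<Otimes>\<^sub>M M) (pair_fam X) (pair_cov \<Gamma>)"
  unfolding gauss_fam_def
proof (intro conjI allI impI)
  have [measurable]: "X i \<in> borel_measurable M" for i by (rule gauss_famD(2)[OF g])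
  show "prob_space (M \<Otimes>\<^sub>M M)" by (rule pair_prob[OF gauss_famD(1)[OF g]])
  show "pair_fam X p \<in> borel_measurable (M \<Otimes>\<^sub>M M)" for p
    by (cases "fst p") (simp_all add: pair_fam_def[abs_def])
  show "pair_cov \<Gamma> p q = pair_cov \<Gamma> q p" for p q
    by (simp add: pair_cov_def gauss_famD(3)[OF g])
  fix J :: "(bool \<times> 'b) set" and c :: "bool \<times> 'b \<Rightarrow> real" assume J: "finite J"
  define U where "U = snd ` J"
  define c' where "c' p = (if p \<in> J then c p else 0)" for p
  have U: "finite U" using J by (simp add: U_def)
  have JU: "J \<subseteq> UNIV \<times> U" by (force simp: U_def)
  have fU: "finite (UNIV \<times> U :: (bool \<times> 'b) set)" using U by simp
  have split: "(\<Sum>p\<in>J. c p * h p) = (\<Sum>i\<in>U. c' (True, i) * h (True, i)) + (\<Sum>i\<in>U. c' (False, i) * h (False, i))"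
    for h :: "bool \<times> 'b \<Rightarrow> real"
  proof -
    have "(\<Sum>p\<in>J. c p * h p) = (\<Sum>p\<in>UNIV \<times> U. c' p * h p)"
      unfolding c'_def using sum_extend[OF fU JU, of c h] by simp
    also have "\<dots> = (\<Sum>b\<in>UNIV. \<Sum>i\<in>U. c' (b, i) * h (b, i))"
      by (simp add: sum.cartesian_product)
    finally show ?thesis by (simp add: UNIV_bool)
  qed
  have b: "bilin (pair_cov \<Gamma>) J c c = bilin \<Gamma> U (\<lambda>i. c' (True, i)) (\<lambda>i. c' (True, i)) + bilin \<Gamma> U (\<lambda>i. c' (False, i)) (\<lambda>i. c' (False, i))"
  proof -
    have "bilin (pair_cov \<Gamma>) J c c = (\<Sum>p\<in>J. c p * (\<Sum>q\<in>J. c q * pair_cov \<Gamma> p q))"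
      by (simp add: bilin_def sum_distrib_left mult.assoc)
    then show ?thesis
      unfolding split by (simp add: pair_cov_def bilin_def sum_distrib_left mult.assoc)
  qed
  show "(CLINT \<omega>|(M \<Otimes>\<^sub>M M). iexp (\<Sum>p\<in>J. c p * pair_fam X p \<omega>)) = of_real (exp (- bilin (pair_cov \<Gamma>) J c c / 2))"
    unfolding split b gauss_fam_pair_char[OF g U, symmetric] by (simp add: pair_fam_def)
qed

text \<open>The covariance form is nonnegative, and a nonnegative quadratic polynomial that vanishes to first
  order in a direction has no linear term in that direction.\<close>
lemma gauss_fam_degenerate:
  assumes g: "gauss_fam M X \<Gamma>" and J: "finite J" and v: "bilin \<Gamma> J b b = 0"
  shows "AE \<omega> in M. (\<Sum>i\<in>J. b i * X i \<omega>) = 0" "(\<Sum>i\<in>J. b i * \<Gamma> i j) = 0"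
proof -
  interpret prob_space M by (rule gauss_famD(1)[OF g])
  have [measurable]: "X i \<in> borel_measurable M" for i by (rule gauss_famD(2)[OF g])
  have "AE y in distr M borel (\<lambda>\<omega>. \<Sum>i\<in>J. b i * X i \<omega>). y = 0"
    unfolding gauss_fam_combination_law[OF g J] v by (subst AE_distr_iff) auto
  then show "AE \<omega> in M. (\<Sum>i\<in>J. b i * X i \<omega>) = 0"
    by (subst (asm) AE_distr_iff) auto
  define U where "U = insert j J"
  have U: "finite U" "J \<subseteq> U" "j \<in> U" using J by (auto simp: U_def)
  define e where "e i = (if i = j then 1 else 0 :: real)" for i
  define b' where "b' i = (if i \<in> J then b i else 0)" for i
  have be: "bilin \<Gamma> U e b' = (\<Sum>i\<in>J. b i * \<Gamma> i j)"
  proof -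
    have "bilin \<Gamma> U e b' = (\<Sum>i\<in>U. e i * (\<Sum>k\<in>U. b' k * \<Gamma> i k))"
      by (simp add: bilin_def sum_distrib_left mult.assoc)
    also have "\<dots> = (\<Sum>k\<in>U. b' k * \<Gamma> j k)"
      using U by (simp add: e_def if_distrib[of "\<lambda>x. x * _"] sum.delta cong: if_cong)
    also have "\<dots> = (\<Sum>i\<in>J. b i * \<Gamma> i j)"
      unfolding b'_def sum_extend[OF U(1,2)] by (simp add: gauss_famD(3)[OF g, of j])
    finally show ?thesis .
  qed
  have bb: "bilin \<Gamma> U b' b' = 0"
  proof -
    have "bilin \<Gamma> U b' b' = (\<Sum>i\<in>U. b' i * (\<Sum>k\<in>U. b' k * \<Gamma> i k))"
      by (simp add: bilin_def sum_distrib_left mult.assoc)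
    also have "\<dots> = bilin \<Gamma> J b b"
      unfolding b'_def sum_extend[OF U(1,2)] by (simp add: bilin_def sum_distrib_left mult.assoc)
    finally show ?thesis using v by simp
  qed
  have nn: "0 \<le> bilin \<Gamma> U e e + 2 * t * bilin \<Gamma> U e b'" for t
    using gauss_fam_variance_nonneg[OF g U(1), of "\<lambda>i. e i + t * b' i"] gauss_famD(3)[OF g]
    by (subst (asm) bilin_affine) (auto simp: bb)
  show "(\<Sum>i\<in>J. b i * \<Gamma> i j) = 0"
  proof (rule ccontr)
    assume "(\<Sum>i\<in>J. b i * \<Gamma> i j) \<noteq> 0"
    then have n: "bilin \<Gamma> U e b' \<noteq> 0" by (simp add: be)
    \<comment> \<open>The value of \<open>t\<close> makes the affine function in \<open>nn\<close> equal to \<open>-1\<close>.\<close>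
    have "0 \<le> bilin \<Gamma> U e e + 2 * (- (bilin \<Gamma> U e e + 1) / (2 * bilin \<Gamma> U e b')) * bilin \<Gamma> U e b'" by (rule nn)
    also have "\<dots> = -1" using n by (simp add: field_simps)
    finally show False by simp
  qed
qed

text \<open>Replacing the component of each \<open>X j\<close> along \<open>Y\<close> by an independent copy does not change the joint
  law. This expresses that \<open>Y\<close> is independent of the residuals of the regression on \<open>Y\<close>.\<close>
lemma gauss_fam_resample:
  assumes g: "gauss_fam M X \<Gamma>" and J: "finite J" and v: "v = bilin \<Gamma> J b b" "v \<noteq> 0"
    and c: "\<And>j. c j = (\<Sum>i\<in>J. b i * \<Gamma> i j)"
  defines "Y \<equiv> \<lambda>\<omega>. \<Sum>i\<in>J. b i * X i \<omega>"
  shows "gauss_fam (M \<Otimes>\<^sub>M M) (\<lambda>j \<omega>. X j (fst \<omega>) - c j / v * Y (fst \<omega>) + c j / v * Y (snd \<omega>)) \<Gamma>"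
  unfolding gauss_fam_def
proof (intro conjI allI impI)
  have [measurable]: "X i \<in> borel_measurable M" for i by (rule gauss_famD(2)[OF g])
  have [measurable]: "Y \<in> borel_measurable M" by (simp add: Y_def[abs_def])
  show "prob_space (M \<Otimes>\<^sub>M M)" by (rule pair_prob[OF gauss_famD(1)[OF g]])
  show "(\<lambda>\<omega>. X j (fst \<omega>) - c j / v * Y (fst \<omega>) + c j / v * Y (snd \<omega>)) \<in> borel_measurable (M \<Otimes>\<^sub>M M)" for j
    by measurable
  show "\<Gamma> p q = \<Gamma> q p" for p q by (rule gauss_famD(3)[OF g])
  fix J0 :: "'b set" and a :: "'b \<Rightarrow> real" assume J0: "finite J0"
  define U where "U = J0 \<union> J"
  have U: "finite U" "J0 \<subseteq> U" "J \<subseteq> U" using J J0 by (auto simp: U_def)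
  define a' where "a' i = (if i \<in> J0 then a i else 0)" for i
  define b' where "b' i = (if i \<in> J then b i else 0)" for i
  define l where "l = (\<Sum>j\<in>J0. a j * (c j / v))"
  have aU: "(\<Sum>i\<in>J0. a i * h i) = (\<Sum>i\<in>U. a' i * h i)" for h :: "'b \<Rightarrow> real"
    unfolding a'_def sum_extend[OF U(1,2)] ..
  have bU: "(\<Sum>i\<in>J. b i * h i) = (\<Sum>i\<in>U. b' i * h i)" for h :: "'b \<Rightarrow> real"
    unfolding b'_def sum_extend[OF U(1,3)] ..
  have bl: "bilin \<Gamma> V p q = (\<Sum>i\<in>V. p i * (\<Sum>k\<in>V. q k * \<Gamma> i k))" for V p q
    by (simp add: bilin_def sum_distrib_left mult.assoc)
  have bb: "bilin \<Gamma> U b' b' = v" unfolding v bl bU ..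
  have aa: "bilin \<Gamma> U a' a' = bilin \<Gamma> J0 a a" unfolding bl aU ..
  have ab: "bilin \<Gamma> U a' b' = l * v"
  proof -
    have "l * v = (\<Sum>j\<in>J0. a j * c j)" using v(2) by (simp add: l_def sum_distrib_right)
    also have "\<dots> = (\<Sum>j\<in>U. a' j * (\<Sum>i\<in>U. b' i * \<Gamma> i j))" unfolding aU c bU ..
    also have "\<dots> = bilin \<Gamma> U a' b'" unfolding bl by (simp add: gauss_famD(3)[OF g])
    finally show ?thesis by simp
  qed
  have "(\<Sum>j\<in>J0. a j * (X j (fst \<omega>) - c j / v * Y (fst \<omega>) + c j / v * Y (snd \<omega>))) =
    (\<Sum>i\<in>U. (a' i + (- l) * b' i) * X i (fst \<omega>)) + (\<Sum>i\<in>U. (l * b' i) * X i (snd \<omega>))" for \<omega>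
  proof -
    have "(\<Sum>j\<in>J0. a j * (X j (fst \<omega>) - c j / v * Y (fst \<omega>) + c j / v * Y (snd \<omega>))) =
      (\<Sum>j\<in>J0. a j * X j (fst \<omega>)) - l * Y (fst \<omega>) + l * Y (snd \<omega>)"
      by (simp add: l_def algebra_simps sum.distrib sum_subtractf sum_distrib_left)
    also have "\<dots> = (\<Sum>i\<in>U. (a' i + (- l) * b' i) * X i (fst \<omega>)) + (\<Sum>i\<in>U. (l * b' i) * X i (snd \<omega>))"
      unfolding Y_def aU bU by (simp add: algebra_simps sum.distrib sum_subtractf sum_distrib_left)
    finally show ?thesis .
  qed
  note E = this
  have "(CLINT \<omega>|(M \<Otimes>\<^sub>M M). iexp (\<Sum>j\<in>J0. a j * (X j (fst \<omega>) - c j / v * Y (fst \<omega>) + c j / v * Y (snd \<omega>)))) =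
    of_real (exp (- (bilin \<Gamma> U (\<lambda>i. a' i + (- l) * b' i) (\<lambda>i. a' i + (- l) * b' i) + bilin \<Gamma> U (\<lambda>i. l * b' i) (\<lambda>i. l * b' i)) / 2))"
    unfolding E by (rule gauss_fam_pair_char[OF g U(1)])
  also have "bilin \<Gamma> U (\<lambda>i. a' i + (- l) * b' i) (\<lambda>i. a' i + (- l) * b' i) = bilin \<Gamma> J0 a a - l\<^sup>2 * v"
    by (subst bilin_affine[OF gauss_famD(3)[OF g]]) (simp add: bb ab aa power2_eq_square)
  also have "bilin \<Gamma> U (\<lambda>i. l * b' i) (\<lambda>i. l * b' i) = l\<^sup>2 * v"
    unfolding bb[symmetric] by (simp add: bilin_def sum_distrib_left power2_eq_square mult_ac)
  finally show "(CLINT \<omega>|(M \<Otimes>\<^sub>M M). iexp (\<Sum>j\<in>J0. a j * (X j (fst \<omega>) - c j / v * Y (fst \<omega>) + c j / v * Y (snd \<omega>)))) =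
    of_real (exp (- bilin \<Gamma> J0 a a / 2))" by simp
qed

text \<open>Since \<open>c j\<close> is the covariance of \<open>X j\<close> with \<open>Y = \<Sum> b i X i\<close>, the function \<open>H'\<close> is the derivative of
  \<open>H\<close> in the direction of these covariances. After resampling \<open>Y\<close>, the identity is one-dimensional
  integration by parts in \<open>Y\<close> with the residuals frozen.\<close>
theorem gauss_ibp:
  assumes g: "gauss_fam M X \<Gamma>" and J: "finite J"
    and c: "\<And>j. c j = (\<Sum>i\<in>J. b i * \<Gamma> i j)"
    and H: "exp_growth H" and H': "exp_growth H'"
    and d: "\<And>x t. ((\<lambda>t. H (\<lambda>j. x j + t * c j)) has_real_derivative H' (\<lambda>j. x j + t * c j)) (at t)"
  shows "(LINT \<omega>|M. (\<Sum>i\<in>J. b i * X i \<omega>) * H (\<lambda>j. X j \<omega>)) = (LINT \<omega>|M. H' (\<lambda>j. X j \<omega>))"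
proof -
  interpret prob_space M by (rule gauss_famD(1)[OF g])
  interpret P: pair_prob_space M M ..
  interpret S: prob_space std_normal_distribution by (rule real_std_normal_prob)
  have [measurable]: "X i \<in> borel_measurable M" for i by (rule gauss_famD(2)[OF g])
  have [measurable]: "H \<in> borel_measurable path_borel" "H' \<in> borel_measurable path_borel" using H H' exp_growth_measurable by auto
  define v where "v = bilin \<Gamma> J b b"
  define Y where "Y \<omega> = (\<Sum>i\<in>J. b i * X i \<omega>)" for \<omega>
  have [measurable]: "Y \<in> borel_measurable M" by (simp add: Y_def[abs_def])
  show ?thesis
  proof (cases "v = 0")
    case True
    have Y0: "AE \<omega> in M. (\<Sum>i\<in>J. b i * X i \<omega>) = 0" and c0: "c j = 0" for j
      using gauss_fam_degenerate[OF g J] True unfolding v_def c by auto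
    have "H' x = 0" for x
      using d[of x 0] DERIV_unique[OF _ DERIV_const, of "H x" "H' x" 0] by (simp add: c0)
    moreover have "(LINT \<omega>|M. (\<Sum>i\<in>J. b i * X i \<omega>) * H (\<lambda>j. X j \<omega>)) = (LINT \<omega>|M. 0)"
      using Y0 by (intro integral_cong_AE) auto
    ultimately show ?thesis by simp
  next
    case False
    have v0: "0 < v" using False gauss_fam_variance_nonneg[OF g J, of b] by (simp add: v_def)
    define Z where "Z j \<omega> = X j (fst \<omega>) - c j / v * Y (fst \<omega>) + c j / v * Y (snd \<omega>)" for j \<omega>
    have gZ: "gauss_fam (M \<Otimes>\<^sub>M M) Z \<Gamma>"
      unfolding Z_def Y_def by (rule gauss_fam_resample[OF g J v_def False c])
    have [measurable]: "Z j \<in> borel_measurable (M \<Otimes>\<^sub>M M)" for j by (rule gauss_famD(2)[OF gZ])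
    have bc: "(\<Sum>i\<in>J. b i * c i) = v"
      unfolding v_def bilin_def c by (subst sum.swap) (simp add: sum_distrib_left mult_ac)
    have bZ: "(\<Sum>i\<in>J. b i * Z i \<omega>) = Y (snd \<omega>)" for \<omega>
    proof -
      have "(\<Sum>i\<in>J. b i * Z i \<omega>) = Y (fst \<omega>) - (\<Sum>i\<in>J. b i * c i) / v * Y (fst \<omega>) + (\<Sum>i\<in>J. b i * c i) / v * Y (snd \<omega>)"
        unfolding Z_def Y_def
        by (simp add: algebra_simps sum.distrib sum_subtractf sum_distrib_left sum_distrib_right sum_divide_distrib)
      then show ?thesis using v0 by (simp add: bc)
    qed
    have law: "(LINT \<omega>|M. K (\<lambda>j. X j \<omega>)) = (LINT \<omega>|(M \<Otimes>\<^sub>M M). K (\<lambda>j. Z j \<omega>))"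
      if [measurable]: "K \<in> borel_measurable path_borel" for K :: "('b \<Rightarrow> real) \<Rightarrow> real"
    proof -
      have "(LINT \<omega>|M. K (\<lambda>j. X j \<omega>)) = (LINT x|distr M path_borel (\<lambda>\<omega> i. X i \<omega>). K x)"
        by (subst integral_distr) auto
      also have "\<dots> = (LINT x|distr (M \<Otimes>\<^sub>M M) path_borel (\<lambda>\<omega> i. Z i \<omega>). K x)"
        by (simp add: gauss_fam_law_eq[OF g gZ])
      also have "\<dots> = (LINT \<omega>|(M \<Otimes>\<^sub>M M). K (\<lambda>j. Z j \<omega>))" by (subst integral_distr) auto
      finally show ?thesis .
    qed
    have eg: "exp_growth (\<lambda>x. (\<Sum>i\<in>J. b i * x i) * H x)"
      by (intro exp_growth_intros H)
    have Ylaw: "distr M borel Y = distr std_normal_distribution borel (\<lambda>z. sqrt v * z)"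
      unfolding Y_def v_def by (rule gauss_fam_combination_law[OF g J])
    have inner: "(LINT \<omega>'|M. Y \<omega>' * H (\<lambda>j. r j + c j / v * Y \<omega>')) = (LINT \<omega>'|M. H' (\<lambda>j. r j + c j / v * Y \<omega>'))" for r
    proof -
      have tr: "(LINT \<omega>'|M. k (Y \<omega>')) = (LINT z|std_normal_distribution. k (sqrt v * z))"
        if [measurable]: "k \<in> borel_measurable borel" for k :: "real \<Rightarrow> real"
      proof -
        have "(LINT \<omega>'|M. k (Y \<omega>')) = (LINT y|distr M borel Y. k y)" by (subst integral_distr) auto
        then show ?thesis unfolding Ylaw by (subst (asm) integral_distr) auto
      qed
      have sv: "c j / v * (sqrt v * z) = z * (c j / sqrt v)" for j z
      proof -
        define s where "s = sqrt v"
        have s: "0 < s" "v = s * s" using v0 by (auto simp: s_def)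
        show ?thesis unfolding s_def[symmetric] s(2) using s(1) by (simp add: field_simps)
      qed
      have dk: "((\<lambda>z. H (\<lambda>j. r j + z * (c j / sqrt v))) has_real_derivative H' (\<lambda>j. r j + z * (c j / sqrt v)) * (1 / sqrt v)) (at z)" for z
      proof -
        have "((\<lambda>z. (\<lambda>t. H (\<lambda>j. r j + t * c j)) (z / sqrt v)) has_real_derivative H' (\<lambda>j. r j + (z / sqrt v) * c j) * (1 / sqrt v)) (at z)"
          by (rule DERIV_chain2[OF d DERIV_cdivide[OF DERIV_ident]])
        then show ?thesis by simp
      qed
      have gr: "\<exists>a k. \<forall>z. \<bar>K (\<lambda>j. r j + z * (c j / sqrt v))\<bar> \<le> a * exp (k * \<bar>z\<bar>)" if K: "exp_growth K" for K
      proof -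
        obtain J' a k where *: "finite J'" "0 \<le> a" "0 \<le> k" "\<And>x. \<bar>K x\<bar> \<le> a * exp (k * (\<Sum>i\<in>J'. \<bar>x i\<bar>))"
          using K unfolding exp_growth_def by blast
        have "\<bar>K (\<lambda>j. r j + z * (c j / sqrt v))\<bar> \<le> (a * exp (k * (\<Sum>i\<in>J'. \<bar>r i\<bar>))) * exp ((k * (\<Sum>i\<in>J'. \<bar>c i / sqrt v\<bar>)) * \<bar>z\<bar>)" for z
        proof -
          have "(\<Sum>i\<in>J'. \<bar>r i + z * (c i / sqrt v)\<bar>) \<le> (\<Sum>i\<in>J'. \<bar>r i\<bar> + \<bar>c i / sqrt v\<bar> * \<bar>z\<bar>)"
            by (intro sum_mono order_trans[OF abs_triangle_ineq]) (simp add: abs_mult mult.commute)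
          also have "\<dots> = (\<Sum>i\<in>J'. \<bar>r i\<bar>) + (\<Sum>i\<in>J'. \<bar>c i / sqrt v\<bar>) * \<bar>z\<bar>"
            by (simp add: sum.distrib sum_distrib_right)
          finally have "k * (\<Sum>i\<in>J'. \<bar>r i + z * (c i / sqrt v)\<bar>) \<le> k * (\<Sum>i\<in>J'. \<bar>r i\<bar>) + k * (\<Sum>i\<in>J'. \<bar>c i / sqrt v\<bar>) * \<bar>z\<bar>"
            using *(3) by (metis mult_left_mono distrib_left mult.assoc)
          then have "exp (k * (\<Sum>i\<in>J'. \<bar>r i + z * (c i / sqrt v)\<bar>)) \<le> exp (k * (\<Sum>i\<in>J'. \<bar>r i\<bar>)) * exp (k * (\<Sum>i\<in>J'. \<bar>c i / sqrt v\<bar>) * \<bar>z\<bar>)"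
            by (simp flip: exp_add)
          then have "a * exp (k * (\<Sum>i\<in>J'. \<bar>r i + z * (c i / sqrt v)\<bar>)) \<le> a * (exp (k * (\<Sum>i\<in>J'. \<bar>r i\<bar>)) * exp (k * (\<Sum>i\<in>J'. \<bar>c i / sqrt v\<bar>) * \<bar>z\<bar>))"
            using *(2) by (rule mult_left_mono)
          then show ?thesis using *(4)[of "\<lambda>j. r j + z * (c j / sqrt v)"] by (simp only: mult.assoc)
        qed
        then show ?thesis by blast
      qed
      obtain a1 k1 where g1: "\<And>z. \<bar>H (\<lambda>j. r j + z * (c j / sqrt v))\<bar> \<le> a1 * exp (k1 * \<bar>z\<bar>)" using gr[OF H] by blast
      obtain a2 k2 where g2: "\<And>z. \<bar>H' (\<lambda>j. r j + z * (c j / sqrt v)) * (1 / sqrt v)\<bar> \<le> a2 * exp (k2 * \<bar>z\<bar>)"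
        using gr[OF exp_growth_mult[OF H' exp_growth_const[of "1 / sqrt v"]]] by blast
      have "(LINT \<omega>'|M. Y \<omega>' * H (\<lambda>j. r j + c j / v * Y \<omega>')) = (LINT z|std_normal_distribution. sqrt v * (z * H (\<lambda>j. r j + z * (c j / sqrt v))))"
        unfolding mult.assoc[symmetric, of "sqrt v"]
        using tr[of "\<lambda>y. y * H (\<lambda>j. r j + c j / v * y)"] by (simp only: sv) measurable
      also have "\<dots> = sqrt v * (LINT z|std_normal_distribution. z * H (\<lambda>j. r j + z * (c j / sqrt v)))" by simp
      also have "\<dots> = sqrt v * (LINT z|std_normal_distribution. H' (\<lambda>j. r j + z * (c j / sqrt v)) * (1 / sqrt v))"
        by (subst std_normal_ibp[OF dk _ g1 g2]) auto
      also have "\<dots> = (LINT z|std_normal_distribution. H' (\<lambda>j. r j + z * (c j / sqrt v)))" using v0 by simp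
      also have "\<dots> = (LINT \<omega>'|M. H' (\<lambda>j. r j + c j / v * Y \<omega>'))"
        using tr[of "\<lambda>y. H' (\<lambda>j. r j + c j / v * y)"] by (simp only: sv) measurable
      finally show ?thesis .
    qed
    have i1: "integrable (M \<Otimes>\<^sub>M M) (\<lambda>\<omega>. Y (snd \<omega>) * H (\<lambda>j. Z j \<omega>))"
      using gauss_fam_integrable[OF gZ eg] by (simp add: bZ)
    have i2: "integrable (M \<Otimes>\<^sub>M M) (\<lambda>\<omega>. H' (\<lambda>j. Z j \<omega>))" by (rule gauss_fam_integrable[OF gZ H'])
    have "(LINT \<omega>|M. (\<Sum>i\<in>J. b i * X i \<omega>) * H (\<lambda>j. X j \<omega>)) = (LINT \<omega>|(M \<Otimes>\<^sub>M M). Y (snd \<omega>) * H (\<lambda>j. Z j \<omega>))"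
      using law[of "\<lambda>x. (\<Sum>i\<in>J. b i * x i) * H x"] by (simp add: bZ)
    also have "\<dots> = (LINT \<omega>|M. LINT \<omega>'|M. Y \<omega>' * H (\<lambda>j. (X j \<omega> - c j / v * Y \<omega>) + c j / v * Y \<omega>'))"
      using P.integral_fst'[OF i1] by (simp add: Z_def)
    also have "\<dots> = (LINT \<omega>|M. LINT \<omega>'|M. H' (\<lambda>j. (X j \<omega> - c j / v * Y \<omega>) + c j / v * Y \<omega>'))"
      by (simp only: inner)
    also have "\<dots> = (LINT \<omega>|(M \<Otimes>\<^sub>M M). H' (\<lambda>j. Z j \<omega>))"
      using P.integral_fst'[OF i2] by (simp add: Z_def)
    also have "\<dots> = (LINT \<omega>|M. H' (\<lambda>j. X j \<omega>))" by (rule law[symmetric]) simp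
    finally show ?thesis .
  qed
qed

section \<open>A covariance identity along rotations\<close>

text \<open>Differentiability is tested along all curves, which makes the chain rule immediate and avoids a
  topology on paths. The coordinates of the curve outside \<open>J\<close> are arbitrary, so the partial
  derivatives with index in \<open>J\<close> are the only ones.\<close>
definition has_grad :: "'i set \<Rightarrow> (('i \<Rightarrow> real) \<Rightarrow> real) \<Rightarrow> ('i \<Rightarrow> ('i \<Rightarrow> real) \<Rightarrow> real) \<Rightarrow> bool" where
  "has_grad J F F' \<longleftrightarrow> (\<forall>\<gamma> \<gamma>' t. (\<forall>i\<in>J. ((\<lambda>s. \<gamma> s i) has_real_derivative \<gamma>' i) (at t)) \<longrightarrow>
     ((\<lambda>s. F (\<gamma> s)) has_real_derivative (\<Sum>i\<in>J. F' i (\<gamma> t) * \<gamma>' i)) (at t))"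

lemma has_gradD:
  assumes "has_grad J F F'" "\<And>i. i \<in> J \<Longrightarrow> ((\<lambda>s. \<gamma> s i) has_real_derivative \<gamma>' i) (at t)"
  shows "((\<lambda>s. F (\<gamma> s)) has_real_derivative (\<Sum>i\<in>J. F' i (\<gamma> t) * \<gamma>' i)) (at t)"
  using assms unfolding has_grad_def by blast

text \<open>The first copy at angle \<open>0\<close>, the second one at angle \<open>pi / 2\<close>.\<close>
definition rot :: "real \<Rightarrow> (bool \<times> 'i \<Rightarrow> real) \<Rightarrow> 'i \<Rightarrow> real" where
  "rot \<theta> z i = cos \<theta> * z (True, i) + sin \<theta> * z (False, i)"

lemma rot_0: "rot 0 z = (\<lambda>i. z (True, i))" by (simp add: rot_def fun_eq_iff)

lemma rot_half_pi: "rot (pi / 2) z = (\<lambda>i. z (False, i))" by (simp add: rot_def fun_eq_iff)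

lemma measurable_rot[measurable (raw)]:
  assumes [measurable]: "t \<in> borel_measurable M" "z \<in> measurable M path_borel"
  shows "(\<lambda>x. rot (t x) (z x)) \<in> measurable M path_borel"
proof -
  have [measurable]: "(\<lambda>x. z x p) \<in> borel_measurable M" for p
    by (rule measurable_compose[OF assms(2)]) simp
  show ?thesis unfolding rot_def[abs_def] by measurable
qed

lemma exp_growth_abs: "exp_growth F \<Longrightarrow> exp_growth (\<lambda>x. \<bar>F x\<bar>)"
  by (rule exp_growth_bound[where c = 1]) (auto dest: exp_growth_measurable)

text \<open>A bound that is uniform in the angle, as required for exchanging expectation and integration
  over the angle.\<close>
lemma exp_growth_rot_dominated:
  assumes "exp_growth F"
  shows "\<exists>g. exp_growth g \<and> (\<forall>\<theta> z. \<bar>F (rot \<theta> z)\<bar> \<le> g z)"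
proof -
  obtain J a k where *: "finite J" "0 \<le> a" "0 \<le> k" "\<And>x. \<bar>F x\<bar> \<le> a * exp (k * (\<Sum>i\<in>J. \<bar>x i\<bar>))"
    using assms unfolding exp_growth_def by blast
  define g :: "(bool \<times> 'a \<Rightarrow> real) \<Rightarrow> real" where "g z = a * exp (k * (\<Sum>p\<in>UNIV \<times> J. \<bar>z p\<bar>))" for z
  have "exp_growth g"
    using * by (intro exp_growthI[of g "UNIV \<times> J" a k]) (auto simp: g_def[abs_def])
  moreover have "\<bar>F (rot \<theta> z)\<bar> \<le> g z" for \<theta> z
  proof -
    have "(\<Sum>i\<in>J. \<bar>rot \<theta> z i\<bar>) \<le> (\<Sum>i\<in>J. \<bar>z (True, i)\<bar> + \<bar>z (False, i)\<bar>)"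
    proof (rule sum_mono)
      fix i
      have "\<bar>cos \<theta>\<bar> * \<bar>z (True, i)\<bar> \<le> 1 * \<bar>z (True, i)\<bar>" "\<bar>sin \<theta>\<bar> * \<bar>z (False, i)\<bar> \<le> 1 * \<bar>z (False, i)\<bar>"
        by (intro mult_right_mono; simp)+
      then show "\<bar>rot \<theta> z i\<bar> \<le> \<bar>z (True, i)\<bar> + \<bar>z (False, i)\<bar>"
        unfolding rot_def abs_mult[symmetric] by linarith
    qed
    also have "\<dots> = (\<Sum>b\<in>UNIV. \<Sum>i\<in>J. \<bar>z (b, i)\<bar>)" by (simp add: UNIV_bool sum.distrib)
    also have "\<dots> = (\<Sum>p\<in>UNIV \<times> J. \<bar>z p\<bar>)" by (simp add: sum.cartesian_product)
    finally have "exp (k * (\<Sum>i\<in>J. \<bar>rot \<theta> z i\<bar>)) \<le> exp (k * (\<Sum>p\<in>UNIV \<times> J. \<bar>z p\<bar>))"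
      using *(3) by (auto intro: mult_left_mono)
    then show ?thesis using *(2) unfolding g_def by (intro order_trans[OF *(4)] mult_left_mono)
  qed
  ultimately show ?thesis by blast
qed

lemma exp_growth_rot:
  assumes "exp_growth F" shows "exp_growth (\<lambda>z. F (rot \<theta> z))"
proof -
  have [measurable]: "F \<in> borel_measurable path_borel" using assms by (rule exp_growth_measurable)
  obtain g where g: "exp_growth g" "\<And>z. \<bar>F (rot \<theta> z)\<bar> \<le> g z" using exp_growth_rot_dominated[OF assms] by blast
  show ?thesis by (rule exp_growth_bound[OF g(1), where c = 1]) (auto intro: order_trans[OF g(2)])
qed

lemma exp_growth_fst: "exp_growth F \<Longrightarrow> exp_growth (\<lambda>z. F (\<lambda>i. z (True, i)))"
  using exp_growth_rot[of F 0] by (simp add: rot_0)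

text \<open>Rotation invariance: \<open>cos\<^sup>2 + sin\<^sup>2 = 1\<close> in the covariance form.\<close>
lemma gauss_fam_rot:
  assumes g: "gauss_fam M V (pair_cov \<Gamma>)" and sym: "\<And>i j. \<Gamma> i j = \<Gamma> j i"
  shows "gauss_fam M (\<lambda>i \<omega>. rot \<theta> (\<lambda>p. V p \<omega>) i) \<Gamma>"
  unfolding gauss_fam_def
proof (intro conjI allI impI)
  have [measurable]: "V p \<in> borel_measurable M" for p by (rule gauss_famD(2)[OF g])
  show "prob_space M" by (rule gauss_famD(1)[OF g])
  show "(\<lambda>\<omega>. rot \<theta> (\<lambda>p. V p \<omega>) i) \<in> borel_measurable M" for i unfolding rot_def by measurable
  show "\<Gamma> i j = \<Gamma> j i" for i j by (rule sym)
  fix J :: "'b set" and c :: "'b \<Rightarrow> real" assume J: "finite J"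
  define d where "d p = (if fst p then cos \<theta> else sin \<theta>) * c (snd p)" for p
  have f: "finite (UNIV \<times> J :: (bool \<times> 'b) set)" using J by simp
  have sp: "(\<Sum>p\<in>UNIV \<times> J. d p * h p) = (\<Sum>i\<in>J. c i * (cos \<theta> * h (True, i) + sin \<theta> * h (False, i)))" for h
  proof -
    have "(\<Sum>p\<in>UNIV \<times> J. d p * h p) = (\<Sum>b\<in>UNIV. \<Sum>i\<in>J. d (b, i) * h (b, i))"
      by (simp add: sum.cartesian_product)
    also have "\<dots> = (\<Sum>i\<in>J. c i * (cos \<theta> * h (True, i) + sin \<theta> * h (False, i)))"
      by (simp add: UNIV_bool d_def sum.distrib algebra_simps)
    finally show ?thesis .
  qed
  have "bilin (pair_cov \<Gamma>) (UNIV \<times> J) d d = (\<Sum>p\<in>UNIV \<times> J. d p * (\<Sum>q\<in>UNIV \<times> J. d q * pair_cov \<Gamma> p q))"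
    by (simp add: bilin_def sum_distrib_left mult.assoc)
  also have "\<dots> = (\<Sum>i\<in>J. c i * ((cos \<theta>)\<^sup>2 * (\<Sum>j\<in>J. c j * \<Gamma> i j) + (sin \<theta>)\<^sup>2 * (\<Sum>j\<in>J. c j * \<Gamma> i j)))"
    unfolding sp by (simp add: pair_cov_def sum_distrib_left power2_eq_square mult_ac)
  also have "\<dots> = bilin \<Gamma> J c c"
    unfolding distrib_right[symmetric] sin_cos_squared_add2 by (simp add: bilin_def sum_distrib_left mult.assoc)
  finally have b: "bilin (pair_cov \<Gamma>) (UNIV \<times> J) d d = bilin \<Gamma> J c c" .
  show "(CLINT \<omega>|M. iexp (\<Sum>i\<in>J. c i * rot \<theta> (\<lambda>p. V p \<omega>) i)) = of_real (exp (- bilin \<Gamma> J c c / 2))"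
    using gauss_famD(4)[OF g f, of d] unfolding sp b rot_def .
qed

abbreviation pair_path :: "('i \<Rightarrow> 'w \<Rightarrow> real) \<Rightarrow> 'w \<times> 'w \<Rightarrow> bool \<times> 'i \<Rightarrow> real" where
  "pair_path X \<omega> \<equiv> (\<lambda>p. pair_fam X p \<omega>)"

lemma pair_path_simps: "pair_path X \<omega> (True, i) = X i (fst \<omega>)" "pair_path X \<omega> (False, i) = X i (snd \<omega>)"
  by (simp_all add: pair_fam_def)

text \<open>The velocity of the rotation is uncorrelated with its position, so the integration by parts
  does not differentiate \<open>K\<close>; its covariance with the first copy is \<open>- sin \<theta> \<Gamma>\<close>.\<close>
lemma rotation_ibp:
  assumes g: "gauss_fam M X \<Gamma>" and J: "finite J"
    and K: "exp_growth K" and H: "exp_growth H" and H': "\<And>j. j \<in> J \<Longrightarrow> exp_growth (H' j)"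
    and d: "has_grad J H H'"
  shows "(LINT \<omega>|(M \<Otimes>\<^sub>M M). (cos \<theta> * X i (snd \<omega>) - sin \<theta> * X i (fst \<omega>)) * (K (rot \<theta> (pair_path X \<omega>)) * H (\<lambda>j. X j (fst \<omega>)))) =
    - sin \<theta> * (LINT \<omega>|(M \<Otimes>\<^sub>M M). (\<Sum>j\<in>J. \<Gamma> i j * K (rot \<theta> (pair_path X \<omega>)) * H' j (\<lambda>j. X j (fst \<omega>))))"
proof -
  have gp: "gauss_fam (M \<Otimes>\<^sub>M M) (pair_fam X) (pair_cov \<Gamma>)" by (rule gauss_fam_pair[OF g])
  define b where "b p = (if fst p then - sin \<theta> else cos \<theta>)" for p :: "bool \<times> 'b"
  define c where "c p = (\<Sum>q\<in>{(True, i), (False, i)}. b q * pair_cov \<Gamma> q p)" for p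
  have c: "c (True, j) = - sin \<theta> * \<Gamma> i j" "c (False, j) = cos \<theta> * \<Gamma> i j" for j
    by (simp_all add: c_def b_def pair_cov_def)
  define HH where "HH z = K (rot \<theta> z) * H (\<lambda>j. z (True, j))" for z
  define HH' where "HH' z = K (rot \<theta> z) * (\<Sum>j\<in>J. H' j (\<lambda>j. z (True, j)) * (- sin \<theta> * \<Gamma> i j))" for z
  have e: "exp_growth HH" "exp_growth HH'"
    unfolding HH_def[abs_def] HH'_def[abs_def]
    by (intro exp_growth_mult exp_growth_sum exp_growth_const exp_growth_rot[OF K] exp_growth_fst H H'; assumption)+
  have rc: "rot \<theta> (\<lambda>p. z p + t * c p) = rot \<theta> z" for z t
    by (simp add: rot_def fun_eq_iff c algebra_simps)
  have der: "((\<lambda>t. HH (\<lambda>p. z p + t * c p)) has_real_derivative HH' (\<lambda>p. z p + t * c p)) (at t)" for z t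
  proof -
    have "((\<lambda>t. H (\<lambda>j. z (True, j) + t * c (True, j))) has_real_derivative
       (\<Sum>j\<in>J. H' j (\<lambda>j. z (True, j) + t * c (True, j)) * c (True, j))) (at t)"
      by (rule has_gradD[OF d]) (auto intro!: derivative_eq_intros)
    then show ?thesis
      unfolding HH_def HH'_def rc c by (rule DERIV_cmult)
  qed
  have "(LINT \<omega>|(M \<Otimes>\<^sub>M M). (\<Sum>p\<in>{(True, i), (False, i)}. b p * pair_fam X p \<omega>) * HH (pair_path X \<omega>)) = (LINT \<omega>|(M \<Otimes>\<^sub>M M). HH' (pair_path X \<omega>))"
    by (rule gauss_ibp[OF gp _ c_def e der]) simp
  also have "\<dots> = (LINT \<omega>|(M \<Otimes>\<^sub>M M). - sin \<theta> * (\<Sum>j\<in>J. \<Gamma> i j * K (rot \<theta> (pair_path X \<omega>)) * H' j (\<lambda>j. X j (fst \<omega>))))"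
    by (intro Bochner_Integration.integral_cong refl) (simp add: HH'_def pair_path_simps sum_distrib_left mult_ac)
  finally show ?thesis
    by (simp add: HH_def b_def pair_path_simps)
qed

text \<open>\<open>F(X) - F(X')\<close> is minus the integral of the derivative of \<open>F\<close> along the rotation. Multiply by \<open>H(X)\<close>,
  take expectations, exchange the integrals and apply \<open>rotation_ibp\<close> to each summand.\<close>
theorem covariance_identity:
  assumes g: "gauss_fam M X \<Gamma>" and J: "finite J"
    and F: "exp_growth F" and F': "\<And>j. j \<in> J \<Longrightarrow> exp_growth (F' j)" and dF: "has_grad J F F'"
    and H: "exp_growth H" and H': "\<And>j. j \<in> J \<Longrightarrow> exp_growth (H' j)" and dH: "has_grad J H H'"
  shows "(LINT \<omega>|M. F (\<lambda>i. X i \<omega>) * H (\<lambda>i. X i \<omega>)) - (LINT \<omega>|M. F (\<lambda>i. X i \<omega>)) * (LINT \<omega>|M. H (\<lambda>i. X i \<omega>)) =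
    (LINT \<theta>:{0..pi/2}|lborel. sin \<theta> * (LINT \<omega>|(M \<Otimes>\<^sub>M M). (\<Sum>i\<in>J. \<Sum>j\<in>J. \<Gamma> i j * F' i (rot \<theta> (pair_path X \<omega>)) * H' j (\<lambda>j. X j (fst \<omega>)))))" (is "?L = ?R")
    and "set_integrable lborel {0..pi/2} (\<lambda>\<theta>. sin \<theta> * (LINT \<omega>|(M \<Otimes>\<^sub>M M). (\<Sum>i\<in>J. \<Sum>j\<in>J. \<Gamma> i j * F' i (rot \<theta> (pair_path X \<omega>)) * H' j (\<lambda>j. X j (fst \<omega>)))))" (is ?SI)
proof -
  interpret prob_space M by (rule gauss_famD(1)[OF g])
  interpret P: pair_prob_space M M ..
  have gp: "gauss_fam (M \<Otimes>\<^sub>M M) (pair_fam X) (pair_cov \<Gamma>)" by (rule gauss_fam_pair[OF g])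
  interpret LP: pair_sigma_finite lborel "M \<Otimes>\<^sub>M M" ..
  have [measurable]: "X i \<in> borel_measurable M" for i by (rule gauss_famD(2)[OF g])
  have [measurable]: "pair_fam X p \<in> borel_measurable (M \<Otimes>\<^sub>M M)" for p by (rule gauss_famD(2)[OF gp])
  have [measurable]: "F \<in> borel_measurable path_borel" "H \<in> borel_measurable path_borel" using F H exp_growth_measurable by auto
  have F'm: "F' i \<in> borel_measurable path_borel" if "i \<in> J" for i using F'[OF that] exp_growth_measurable by auto
  define V where "V \<theta> i z = cos \<theta> * z (False, i) - sin \<theta> * z (True, i)" for \<theta> i and z :: "bool \<times> 'b \<Rightarrow> real"
  define D where "D \<theta> z = (\<Sum>i\<in>J. F' i (rot \<theta> z) * V \<theta> i z)" for \<theta> z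
  obtain G where G: "\<And>i. i \<in> J \<Longrightarrow> exp_growth (G i)" "\<And>i \<theta> z. i \<in> J \<Longrightarrow> \<bar>F' i (rot \<theta> z)\<bar> \<le> G i z"
  proof -
    have "\<forall>i\<in>J. \<exists>g. exp_growth g \<and> (\<forall>\<theta> z. \<bar>F' i (rot \<theta> z)\<bar> \<le> g z)"
      using exp_growth_rot_dominated F' by blast
    then show ?thesis using that by metis
  qed
  define W where "W z = (\<Sum>i\<in>J. G i z * (\<bar>z (False, i)\<bar> + \<bar>z (True, i)\<bar>))" for z
  have W: "exp_growth W" unfolding W_def[abs_def] by (intro exp_growth_sum exp_growth_mult exp_growth_add exp_growth_abs exp_growth_coord G)
  have DW: "\<bar>D \<theta> z\<bar> \<le> W z" for \<theta> z
    unfolding D_def W_def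
  proof (rule order_trans[OF sum_abs], rule sum_mono)
    fix i assume i: "i \<in> J"
    have "\<bar>cos \<theta>\<bar> * \<bar>z (False, i)\<bar> \<le> 1 * \<bar>z (False, i)\<bar>" "\<bar>sin \<theta>\<bar> * \<bar>z (True, i)\<bar> \<le> 1 * \<bar>z (True, i)\<bar>"
      by (intro mult_right_mono; simp)+
    then have "\<bar>V \<theta> i z\<bar> \<le> \<bar>z (False, i)\<bar> + \<bar>z (True, i)\<bar>"
      unfolding V_def abs_mult[symmetric] by linarith
    then show "\<bar>F' i (rot \<theta> z) * V \<theta> i z\<bar> \<le> G i z * (\<bar>z (False, i)\<bar> + \<bar>z (True, i)\<bar>)"
      unfolding abs_mult using G(2)[OF i, of \<theta> z] by (intro mult_mono) auto
  qed
  have Dm[measurable]: "(\<lambda>x. D (fst x) (pair_path X (snd x))) \<in> borel_measurable (lborel \<Otimes>\<^sub>M (M \<Otimes>\<^sub>M M))"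
    unfolding D_def V_def
  proof (intro borel_measurable_sum borel_measurable_times)
    show "(\<lambda>x. F' i (rot (fst x) (pair_path X (snd x)))) \<in> borel_measurable (lborel \<Otimes>\<^sub>M (M \<Otimes>\<^sub>M M))" if "i \<in> J" for i
      by (rule measurable_compose[OF _ F'm[OF that]]) measurable
  qed measurable
  have ind_int: "integrable lborel (\<lambda>\<theta>. indicator {0..pi/2} \<theta> * c)" for c :: real
    by (intro integrable_mult_left integrable_real_indicator) auto
  have ftc: "F (\<lambda>i. z (True, i)) - F (\<lambda>i. z (False, i)) = - (LINT \<theta>:{0..pi/2}|lborel. D \<theta> z)"
    if Dz[measurable]: "(\<lambda>\<theta>. D \<theta> z) \<in> borel_measurable borel" for z
  proof -
    have dd: "((\<lambda>\<theta>. F (rot \<theta> z)) has_real_derivative D \<theta> z) (at \<theta>)" for \<theta>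
      unfolding D_def by (rule has_gradD[OF dF]) (auto simp: rot_def V_def intro!: derivative_eq_intros)
    have "((\<lambda>\<theta>. D \<theta> z) has_integral F (rot (pi/2) z) - F (rot 0 z)) {0..pi/2}"
      using dd by (intro fundamental_theorem_of_calculus)
        (auto simp: has_real_derivative_iff_has_vector_derivative[symmetric] intro: has_field_derivative_at_within)
    moreover have "set_integrable lborel {0..pi/2} (\<lambda>\<theta>. D \<theta> z)"
      unfolding set_integrable_def
    proof (rule Bochner_Integration.integrable_bound[OF ind_int[of "W z"]])
      show "AE \<theta> in lborel. norm (indicator {0..pi/2} \<theta> *\<^sub>R D \<theta> z) \<le> norm (indicator {0..pi/2} \<theta> * W z)"
        using order_trans[OF DW abs_ge_self] by (intro AE_I2) (simp add: indicator_def)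
    qed measurable
    ultimately have "(LINT \<theta>:{0..pi/2}|lborel. D \<theta> z) = F (rot (pi/2) z) - F (rot 0 z)"
      using set_borel_integral_eq_integral(2) integral_unique by metis
    then show ?thesis by (simp add: rot_0 rot_half_pi)
  qed
  have WH: "exp_growth (\<lambda>z. W z * H (\<lambda>i. z (True, i)))" by (intro exp_growth_mult W exp_growth_fst H)
  have WHa: "exp_growth (\<lambda>z. W z * \<bar>H (\<lambda>i. z (True, i))\<bar>)" by (intro exp_growth_mult W exp_growth_abs exp_growth_fst H)
  let ?f = "\<lambda>\<theta> \<omega>. indicator {0..pi/2} \<theta> * (D \<theta> (pair_path X \<omega>) * H (\<lambda>i. X i (fst \<omega>)))"
  have fb: "\<bar>?f \<theta> \<omega>\<bar> \<le> indicator {0..pi/2} \<theta> * (W (pair_path X \<omega>) * \<bar>H (\<lambda>i. pair_path X \<omega> (True, i))\<bar>)" for \<theta> \<omega>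
    using DW[of \<theta> "pair_path X \<omega>"] by (auto simp: indicator_def abs_mult pair_path_simps intro!: mult_right_mono)
  have WHi: "integrable (M \<Otimes>\<^sub>M M) (\<lambda>\<omega>. W (pair_path X \<omega>) * \<bar>H (\<lambda>i. pair_path X \<omega> (True, i))\<bar>)"
    by (rule gauss_fam_integrable[OF gp WHa])
  have Dt[measurable]: "(\<lambda>\<omega>. D \<theta> (pair_path X \<omega>)) \<in> borel_measurable (M \<Otimes>\<^sub>M M)" for \<theta>
    using measurable_compose[OF measurable_Pair1' Dm, of \<theta>] by simp
  have fi: "integrable (M \<Otimes>\<^sub>M M) (?f \<theta>)" for \<theta>
    by (rule Bochner_Integration.integrable_bound[OF integrable_mult_right[OF WHi, of "indicator {0..pi/2} \<theta>"]])
       (use fb[of \<theta>] Dt[of \<theta>] in \<open>auto intro!: AE_I2 order_trans[OF _ abs_ge_self]\<close>)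
  have int: "integrable (lborel \<Otimes>\<^sub>M (M \<Otimes>\<^sub>M M)) (\<lambda>x. ?f (fst x) (snd x))"
  proof (rule LP.Fubini_integrable)
    show "(\<lambda>x. ?f (fst x) (snd x)) \<in> borel_measurable (lborel \<Otimes>\<^sub>M (M \<Otimes>\<^sub>M M))" by measurable
    show "AE \<theta> in lborel. integrable (M \<Otimes>\<^sub>M M) (\<lambda>\<omega>. ?f (fst (\<theta>, \<omega>)) (snd (\<theta>, \<omega>)))"
      using fi by simp
    let ?I = "LINT \<omega>|(M \<Otimes>\<^sub>M M). W (pair_path X \<omega>) * \<bar>H (\<lambda>i. pair_path X \<omega> (True, i))\<bar>"
    show "integrable lborel (\<lambda>\<theta>. LINT \<omega>|(M \<Otimes>\<^sub>M M). norm (?f (fst (\<theta>, \<omega>)) (snd (\<theta>, \<omega>))))"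
    proof (rule Bochner_Integration.integrable_bound)
      show "integrable lborel (\<lambda>\<theta>. indicator {0..pi/2} \<theta> * ?I)"
        by (rule ind_int)
      show "AE \<theta> in lborel. norm (LINT \<omega>|(M \<Otimes>\<^sub>M M). norm (?f (fst (\<theta>, \<omega>)) (snd (\<theta>, \<omega>)))) \<le> norm (indicator {0..pi/2} \<theta> * ?I)"
      proof (rule AE_I2)
        fix \<theta> :: real
        have "(LINT \<omega>|(M \<Otimes>\<^sub>M M). \<bar>?f \<theta> \<omega>\<bar>) \<le> (LINT \<omega>|(M \<Otimes>\<^sub>M M). indicator {0..pi/2} \<theta> * (W (pair_path X \<omega>) * \<bar>H (\<lambda>i. pair_path X \<omega> (True, i))\<bar>))"
          using fb[of \<theta>] fi[of \<theta>] WHi by (intro integral_mono integrable_abs) auto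
        then have "norm (LINT \<omega>|(M \<Otimes>\<^sub>M M). norm (?f (fst (\<theta>, \<omega>)) (snd (\<theta>, \<omega>)))) \<le> indicator {0..pi/2} \<theta> * ?I"
          by (simp add: abs_mult)
        also have "\<dots> \<le> norm (indicator {0..pi/2} \<theta> * ?I)" by simp
        finally show "norm (LINT \<omega>|(M \<Otimes>\<^sub>M M). norm (?f (fst (\<theta>, \<omega>)) (snd (\<theta>, \<omega>)))) \<le> norm (indicator {0..pi/2} \<theta> * ?I)" .
      qed
    qed measurable
  qed
  have key: "(LINT \<omega>|(M \<Otimes>\<^sub>M M). ?f \<theta> \<omega>) = - (indicator {0..pi/2} \<theta> * (sin \<theta> * (LINT \<omega>|(M \<Otimes>\<^sub>M M). (\<Sum>i\<in>J. \<Sum>j\<in>J. \<Gamma> i j * F' i (rot \<theta> (pair_path X \<omega>)) * H' j (\<lambda>j. X j (fst \<omega>))))))" for \<theta>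
  proof -
    have ie: "integrable (M \<Otimes>\<^sub>M M) (\<lambda>\<omega>. (cos \<theta> * X i (snd \<omega>) - sin \<theta> * X i (fst \<omega>)) * (F' i (rot \<theta> (pair_path X \<omega>)) * H (\<lambda>j. X j (fst \<omega>))))" if "i \<in> J" for i
    proof -
      have "exp_growth (\<lambda>z. (cos \<theta> * z (False, i) - sin \<theta> * z (True, i)) * (F' i (rot \<theta> z) * H (\<lambda>j. z (True, j))))"
        by (intro exp_growth_intros exp_growth_rot F' that exp_growth_fst H)
      from gauss_fam_integrable[OF gp this] show ?thesis by (simp add: pair_path_simps)
    qed
    have if': "integrable (M \<Otimes>\<^sub>M M) (\<lambda>\<omega>. \<Sum>j\<in>J. \<Gamma> i j * F' i (rot \<theta> (pair_path X \<omega>)) * H' j (\<lambda>j. X j (fst \<omega>)))" if "i \<in> J" for i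
    proof -
      have "exp_growth (\<lambda>z. \<Sum>j\<in>J. \<Gamma> i j * F' i (rot \<theta> z) * H' j (\<lambda>j. z (True, j)))"
        by (intro exp_growth_sum exp_growth_mult exp_growth_const exp_growth_rot F' that exp_growth_fst H')
      from gauss_fam_integrable[OF gp this] show ?thesis by (simp add: pair_path_simps)
    qed
    have "(LINT \<omega>|(M \<Otimes>\<^sub>M M). D \<theta> (pair_path X \<omega>) * H (\<lambda>i. X i (fst \<omega>))) =
      (LINT \<omega>|(M \<Otimes>\<^sub>M M). (\<Sum>i\<in>J. (cos \<theta> * X i (snd \<omega>) - sin \<theta> * X i (fst \<omega>)) * (F' i (rot \<theta> (pair_path X \<omega>)) * H (\<lambda>j. X j (fst \<omega>)))))"
      by (intro Bochner_Integration.integral_cong refl) (simp add: D_def V_def pair_path_simps sum_distrib_right sum_distrib_left mult_ac)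
    also have "\<dots> = (\<Sum>i\<in>J. (LINT \<omega>|(M \<Otimes>\<^sub>M M). (cos \<theta> * X i (snd \<omega>) - sin \<theta> * X i (fst \<omega>)) * (F' i (rot \<theta> (pair_path X \<omega>)) * H (\<lambda>j. X j (fst \<omega>)))))"
      using ie by (rule Bochner_Integration.integral_sum)
    also have "\<dots> = (\<Sum>i\<in>J. - sin \<theta> * (LINT \<omega>|(M \<Otimes>\<^sub>M M). (\<Sum>j\<in>J. \<Gamma> i j * F' i (rot \<theta> (pair_path X \<omega>)) * H' j (\<lambda>j. X j (fst \<omega>)))))"
      by (intro sum.cong refl rotation_ibp[OF g J _ H H' dH] F')
    also have "\<dots> = - sin \<theta> * (LINT \<omega>|(M \<Otimes>\<^sub>M M). (\<Sum>i\<in>J. \<Sum>j\<in>J. \<Gamma> i j * F' i (rot \<theta> (pair_path X \<omega>)) * H' j (\<lambda>j. X j (fst \<omega>))))"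
      using Bochner_Integration.integral_sum[of J "M \<Otimes>\<^sub>M M", OF if'] by (simp add: sum_distrib_left)
    finally show ?thesis by simp
  qed
  have FH: "exp_growth (\<lambda>x. F x * H x)" by (intro exp_growth_mult F H)
  have iM: "integrable M (\<lambda>\<omega>. F (\<lambda>i. X i \<omega>))" "integrable M (\<lambda>\<omega>. H (\<lambda>i. X i \<omega>))" "integrable M (\<lambda>\<omega>. F (\<lambda>i. X i \<omega>) * H (\<lambda>i. X i \<omega>))"
    using gauss_fam_integrable[OF g F] gauss_fam_integrable[OF g H] gauss_fam_integrable[OF g FH] by auto
  have one: "integrable M (\<lambda>\<omega>. 1::real)" by simp
  note p1 = integral_pair_mult[OF prob_space_axioms iM(3) one]
  note p2 = integral_pair_mult[OF prob_space_axioms iM(2) iM(1)]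
  have "?L = (LINT \<omega>|(M \<Otimes>\<^sub>M M). (F (\<lambda>i. X i (fst \<omega>)) - F (\<lambda>i. X i (snd \<omega>))) * H (\<lambda>i. X i (fst \<omega>)))"
  proof -
    have "(LINT \<omega>|(M \<Otimes>\<^sub>M M). (F (\<lambda>i. X i (fst \<omega>)) - F (\<lambda>i. X i (snd \<omega>))) * H (\<lambda>i. X i (fst \<omega>))) =
       (LINT \<omega>|(M \<Otimes>\<^sub>M M). (F (\<lambda>i. X i (fst \<omega>)) * H (\<lambda>i. X i (fst \<omega>))) * 1 - H (\<lambda>i. X i (fst \<omega>)) * F (\<lambda>i. X i (snd \<omega>)))"
      by (intro Bochner_Integration.integral_cong refl) (simp add: algebra_simps)
    also have "\<dots> = ?L"
      using p1 p2 by (subst Bochner_Integration.integral_diff) (simp_all add: prob_space mult.commute)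
    finally show ?thesis by simp
  qed
  also have "\<dots> = (LINT \<omega>|(M \<Otimes>\<^sub>M M). - (LINT \<theta>|lborel. ?f \<theta> \<omega>))"
  proof (intro Bochner_Integration.integral_cong refl)
    fix \<omega> assume w: "\<omega> \<in> space (M \<Otimes>\<^sub>M M)"
    have "(\<lambda>\<theta>. D \<theta> (pair_path X \<omega>)) \<in> borel_measurable lborel"
      using measurable_compose[OF measurable_Pair2'[OF w] Dm] by simp
    then have "F (\<lambda>i. X i (fst \<omega>)) - F (\<lambda>i. X i (snd \<omega>)) = - (LINT \<theta>:{0..pi/2}|lborel. D \<theta> (pair_path X \<omega>))"
      using ftc[of "pair_path X \<omega>"] by (simp add: pair_path_simps)
    then show "(F (\<lambda>i. X i (fst \<omega>)) - F (\<lambda>i. X i (snd \<omega>))) * H (\<lambda>i. X i (fst \<omega>)) = - (LINT \<theta>|lborel. ?f \<theta> \<omega>)"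
      by (simp add: set_lebesgue_integral_def mult.assoc[symmetric])
  qed
  also have "\<dots> = - (LINT \<theta>|lborel. LINT \<omega>|(M \<Otimes>\<^sub>M M). ?f \<theta> \<omega>)"
    using LP.Fubini_integral[of ?f] int by (simp add: case_prod_beta')
  also have "\<dots> = ?R"
    unfolding key by (simp add: set_lebesgue_integral_def)
  finally show "?L = ?R" .
  have "integrable lborel (\<lambda>\<theta>. LINT \<omega>|(M \<Otimes>\<^sub>M M). ?f \<theta> \<omega>)"
    using LP.integrable_fst'[OF int] by simp
  then show ?SI unfolding key set_integrable_def by simp
qed

section \<open>Stein's method\<close>

text \<open>Mills' ratio: \<open>y / w \<ge> 1\<close> on the domain of integration, and \<open>y\<close> times the density is a derivative.\<close>
lemma std_normal_tail:
  assumes w: "0 < w"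
  shows "(LINT y:{w..}|lborel. std_normal_density y) \<le> std_normal_density w / w"
proof -
  have "(\<integral>\<^sup>+y. ennreal (y * std_normal_density y) * indicator {w..} y \<partial>lborel) = ennreal (0 - (- std_normal_density w))"
  proof (rule nn_integral_FTC_atLeast)
    fix y assume "w \<le> y"
    show "((\<lambda>y. - std_normal_density y) has_real_derivative y * std_normal_density y) (at y)"
      unfolding normal_density_def
      by (rule derivative_eq_intros refl | simp)+
    show "0 \<le> y * std_normal_density y" using w \<open>w \<le> y\<close> by simp
  next
    have "((\<lambda>y::real. - (1 / sqrt (2 * pi) * exp (- y\<^sup>2 / 2))) \<longlongrightarrow> - (1 / sqrt (2 * pi) * 0)) at_top"
      by (intro tendsto_intros) real_asymp
    then show "((\<lambda>y. - std_normal_density y) \<longlongrightarrow> 0) at_top"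
      by (simp add: std_normal_density_def)
  qed simp
  then have e: "(\<integral>\<^sup>+y. ennreal (y * std_normal_density y) * indicator {w..} y \<partial>lborel) = ennreal (std_normal_density w)" by simp
  have si: "set_integrable lborel {w..} std_normal_density"
    unfolding set_integrable_def by (intro integrable_mult_indicator) auto
  have "ennreal (LINT y:{w..}|lborel. std_normal_density y) = (\<integral>\<^sup>+y. ennreal (indicator {w..} y *\<^sub>R std_normal_density y) \<partial>lborel)"
    unfolding set_lebesgue_integral_def using si unfolding set_integrable_def
    by (subst nn_integral_eq_integral) auto
  also have "\<dots> \<le> (\<integral>\<^sup>+y. ennreal (1 / w) * (ennreal (y * std_normal_density y) * indicator {w..} y) \<partial>lborel)"
  proof (rule nn_integral_mono)
    fix y
    show "ennreal (indicator {w..} y *\<^sub>R std_normal_density y) \<le> ennreal (1 / w) * (ennreal (y * std_normal_density y) * indicator {w..} y)"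
    proof (cases "w \<le> y")
      case True
      then have "1 * std_normal_density y \<le> (y / w) * std_normal_density y"
        using w by (intro mult_right_mono) auto
      then show ?thesis using True w by (simp add: ennreal_mult[symmetric] field_simps)
    qed simp
  qed
  also have "\<dots> = ennreal (1 / w) * ennreal (std_normal_density w)"
    by (subst nn_integral_cmult) (simp_all add: e)
  also have "\<dots> = ennreal (std_normal_density w / w)" using w by (simp add: ennreal_mult[symmetric])
  finally show ?thesis using w by (subst (asm) ennreal_le_iff) auto
qed

lemma std_normal_tail_left:
  assumes w: "w < 0"
  shows "(LINT y:{..w}|lborel. std_normal_density y) \<le> std_normal_density w / (- w)"
proof -
  have "(LINT y:{..w}|lborel. std_normal_density y) = (LINT y|lborel. indicator {..w} (0 + (-1) * y) *\<^sub>R std_normal_density (0 + (-1) * y))"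
    unfolding set_lebesgue_integral_def by (subst lborel_integral_real_affine[of "-1" _ 0]) auto
  also have "\<dots> = (LINT y:{-w..}|lborel. std_normal_density y)"
    unfolding set_lebesgue_integral_def
    by (intro Bochner_Integration.integral_cong refl) (auto simp: indicator_def std_normal_density_def)
  also have "\<dots> \<le> std_normal_density w / (- w)"
    using std_normal_tail[of "- w"] w by (simp add: std_normal_density_def)
  finally show ?thesis .
qed

text \<open>The solution is \<open>G / \<phi>\<close>, where \<open>\<phi>\<close> is the normal density and \<open>G\<close> the primitive of \<open>(h - m) \<phi>\<close>
  vanishing at both ends of the line. Integrating from the nearer end, Mills' ratio gives
  \<open>|w \<psi> w| \<le> 1\<close>, and the equation then bounds \<open>\<psi>'\<close>.\<close>
lemma stein_equation:
  fixes h :: "real \<Rightarrow> real"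
  assumes h: "continuous_on UNIV h" "\<And>x. 0 \<le> h x" "\<And>x. h x \<le> 1"
  obtains \<psi> \<psi>' where "\<And>w. (\<psi> has_real_derivative \<psi>' w) (at w)"
    "\<And>w. \<psi>' w - w * \<psi> w = h w - (LINT z|std_normal_distribution. h z)"
    "\<And>w. \<bar>\<psi>' w\<bar> \<le> 2" "continuous_on UNIV \<psi>'"
proof -
  interpret S: prob_space std_normal_distribution by (rule real_std_normal_prob)
  define m where "m = (LINT z|std_normal_distribution. h z)"
  have hm[measurable]: "h \<in> borel_measurable borel" using h(1) by (rule borel_measurable_continuous_onI)
  have hi: "integrable std_normal_distribution h"
    using h by (intro S.integrable_const_bound[where B = 1]) auto
  have m01: "0 \<le> m" "m \<le> 1"
  proof -
    show "0 \<le> m" unfolding m_def using h by (intro integral_nonneg_AE) auto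
    have "m \<le> (LINT z|std_normal_distribution. 1)" unfolding m_def using h hi by (intro integral_mono) auto
    then show "m \<le> 1" using S.prob_space by simp
  qed
  have hb: "\<bar>h x - m\<bar> \<le> 1" for x using h(2,3)[of x] m01 by (simp add: abs_le_iff)
  let ?\<phi> = std_normal_density
  define g where "g y = (h y - m) * ?\<phi> y" for y
  have gm[measurable]: "g \<in> borel_measurable borel" unfolding g_def by measurable
  have gc: "continuous_on A g" for A unfolding g_def normal_density_def
    using continuous_on_subset[OF h(1)] by (intro continuous_intros) auto
  have gb: "\<bar>g y\<bar> \<le> ?\<phi> y" for y
    using mult_right_mono[OF hb, of "?\<phi> y" y] by (simp add: g_def abs_mult)
  have gi: "integrable lborel g"
    by (rule Bochner_Integration.integrable_bound[of lborel ?\<phi>]) (use gb in auto)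
  have gs: "set_integrable lborel A g" if "A \<in> sets borel" for A
    unfolding set_integrable_def using that gi by (intro integrable_mult_indicator) auto
  have ps: "set_integrable lborel A ?\<phi>" if "A \<in> sets borel" for A
    unfolding set_integrable_def using that by (intro integrable_mult_indicator) auto
  have g0: "(LINT y|lborel. g y) = 0"
  proof -
    have i: "integrable lborel (\<lambda>y. ?\<phi> y * h y)" using hi integrable_lborel_std_normal[OF hm] by simp
    have "(LINT y|lborel. g y) = (LINT y|lborel. ?\<phi> y * h y - m * ?\<phi> y)"
      by (intro Bochner_Integration.integral_cong refl) (simp add: g_def algebra_simps)
    also have "\<dots> = m - m * 1"
      using i by (subst Bochner_Integration.integral_diff) (simp_all add: m_def integral_lborel_std_normal)
    finally show ?thesis by simp
  qed
  define G where "G w = (LINT y:{..w}|lborel. g y)" for w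
  have G2: "G w = - (LINT y:{w..}|lborel. g y)" for w
  proof -
    have "(LINT y|lborel. indicator {..w} y *\<^sub>R g y + indicator {w..} y *\<^sub>R g y) = (LINT y|lborel. g y)"
      by (rule integral_cong_AE) (use AE_lborel_singleton[of w] in \<open>auto simp: indicator_def elim!: eventually_mono\<close>)
    then show ?thesis
      using gs[of "{..w}"] gs[of "{w..}"] g0 unfolding G_def set_lebesgue_integral_def set_integrable_def
      by (subst (asm) Bochner_Integration.integral_add) auto
  qed
  have Gd: "(G has_real_derivative g w) (at w)" for w
  proof -
    have "((\<lambda>u. integral {w - 1..u} g) has_real_derivative g w) (at w within {w - 1..w + 1})"
      unfolding has_real_derivative_iff_has_vector_derivative
      by (rule integral_has_vector_derivative) (use gc in auto)
    then have d: "((\<lambda>u. G (w - 1) + integral {w - 1..u} g) has_real_derivative g w) (at w)"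
      by (subst (asm) at_within_interior) (auto intro!: derivative_eq_intros)
    have e: "G u = G (w - 1) + integral {w - 1..u} g" if "u > w - 1" for u
    proof -
      have "G u = (LINT y|lborel. indicator {..w-1} y *\<^sub>R g y + indicator {w-1..u} y *\<^sub>R g y)"
        unfolding G_def set_lebesgue_integral_def
        by (rule integral_cong_AE) (use AE_lborel_singleton[of "w-1"] that in \<open>auto simp: indicator_def elim!: eventually_mono\<close>)
      also have "\<dots> = G (w - 1) + (LINT y:{w-1..u}|lborel. g y)"
        using gs[of "{..w-1}"] gs[of "{w-1..u}"] unfolding G_def set_lebesgue_integral_def set_integrable_def
        by (subst Bochner_Integration.integral_add) auto
      also have "(LINT y:{w-1..u}|lborel. g y) = integral {w - 1..u} g"
        using gs[of "{w-1..u}"] by (intro set_borel_integral_eq_integral) auto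
      finally show ?thesis .
    qed
    show ?thesis
    proof (rule DERIV_cong_ev[THEN iffD1, OF refl _ refl d])
      have "eventually (\<lambda>u. u \<in> {w - 1<..}) (nhds w)" by (intro eventually_nhds_in_open) auto
      then show "\<forall>\<^sub>F u in nhds w. G (w - 1) + integral {w - 1..u} g = G u"
        by eventually_elim (simp add: e)
    qed
  qed
  define \<psi> where "\<psi> w = G w / ?\<phi> w" for w
  define \<psi>' where "\<psi>' w = w * \<psi> w + (h w - m)" for w
  have pp: "0 < ?\<phi> w" for w by (rule normal_density_pos) simp
  have dphi: "(?\<phi> has_real_derivative - w * ?\<phi> w) (at w)" for w
    unfolding normal_density_def
    by (rule derivative_eq_intros refl | simp)+
  have d\<psi>: "(\<psi> has_real_derivative \<psi>' w) (at w)" for w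
  proof -
    have "((\<lambda>w. G w / ?\<phi> w) has_real_derivative (g w * ?\<phi> w - G w * (- w * ?\<phi> w)) / (?\<phi> w * ?\<phi> w)) (at w)"
      by (rule DERIV_divide[OF Gd dphi]) (use pp[of w] in simp)
    moreover have "(g w * ?\<phi> w - G w * (- w * ?\<phi> w)) / (?\<phi> w * ?\<phi> w) = \<psi>' w"
      using pp[of w] by (simp add: \<psi>'_def \<psi>_def g_def field_simps)
    ultimately show ?thesis unfolding \<psi>_def[abs_def] by simp
  qed
  have Gabs: "\<bar>LINT y:A|lborel. g y\<bar> \<le> (LINT y:A|lborel. ?\<phi> y)" if "A \<in> sets borel" for A
  proof -
    have "\<bar>LINT y:A|lborel. g y\<bar> \<le> (LINT y:A|lborel. \<bar>g y\<bar>)"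
      using set_integral_norm_bound[OF gs[OF that]] by simp
    also have "\<dots> \<le> (LINT y:A|lborel. ?\<phi> y)"
      using gs[OF that] ps[OF that] gb by (intro set_integral_mono set_integrable_abs) auto
    finally show ?thesis .
  qed
  have w\<psi>: "\<bar>w * \<psi> w\<bar> \<le> 1" for w
  proof -
    have "\<bar>w\<bar> * \<bar>G w\<bar> \<le> ?\<phi> w"
    proof (cases w "0::real" rule: linorder_cases)
      case less
      have "\<bar>G w\<bar> \<le> ?\<phi> w / (- w)"
        unfolding G_def using Gabs[of "{..w}"] std_normal_tail_left[OF less] by simp
      then show ?thesis using less by (simp add: field_simps)
    next
      case greater
      have "\<bar>G w\<bar> \<le> ?\<phi> w / w"
        unfolding G2 using Gabs[of "{w..}"] std_normal_tail[OF greater] by simp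
      then show ?thesis using greater by (simp add: field_simps)
    qed simp
    then show ?thesis using pp[of w] by (simp add: \<psi>_def abs_mult field_simps)
  qed
  have "\<bar>\<psi>' w\<bar> \<le> 2" for w unfolding \<psi>'_def using w\<psi>[of w] hb[of w] by linarith
  moreover have "continuous_on UNIV \<psi>'"
  proof -
    have "continuous_on UNIV \<psi>" using d\<psi> by (meson DERIV_isCont continuous_at_imp_continuous_on)
    then show ?thesis unfolding \<psi>'_def by (intro continuous_intros h(1))
  qed
  moreover have "\<psi>' w - w * \<psi> w = h w - (LINT z|std_normal_distribution. h z)" for w
    by (simp add: \<psi>'_def m_def)
  ultimately show ?thesis using that[of \<psi> \<psi>'] d\<psi> by blast
qed

lemma has_grad_compose:
  assumes F: "has_grad J F F'" and p: "\<And>w. (p has_real_derivative p' w) (at w)"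
  shows "has_grad J (\<lambda>x. p (F x)) (\<lambda>j x. p' (F x) * F' j x)"
  unfolding has_grad_def
proof (intro allI impI)
  fix \<gamma> \<gamma>' t assume "\<forall>i\<in>J. ((\<lambda>s. \<gamma> s i) has_real_derivative \<gamma>' i) (at t)"
  then have "((\<lambda>s. F (\<gamma> s)) has_real_derivative (\<Sum>i\<in>J. F' i (\<gamma> t) * \<gamma>' i)) (at t)"
    using F by (intro has_gradD) auto
  from DERIV_chain2[OF p this]
  show "((\<lambda>s. p (F (\<gamma> s))) has_real_derivative (\<Sum>i\<in>J. p' (F (\<gamma> t)) * F' i (\<gamma> t) * \<gamma>' i)) (at t)"
    by (simp add: sum_distrib_left mult.assoc)
qed

lemma sin_half_period: "(LINT \<theta>:{0..pi/2}|lborel. sin \<theta>) = 1" "set_integrable lborel {0..pi/2} sin"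
proof -
  show i: "set_integrable lborel {0..pi/2} sin"
    by (rule borel_integrable_atLeastAtMost') (intro continuous_intros)
  have "(sin has_integral (- cos (pi/2)) - (- cos 0)) {0..pi/2}"
    by (rule fundamental_theorem_of_calculus)
       (auto intro!: derivative_eq_intros simp: has_real_derivative_iff_has_vector_derivative[symmetric])
  then show "(LINT \<theta>:{0..pi/2}|lborel. sin \<theta>) = 1"
    using set_borel_integral_eq_integral(2)[OF i] by (simp add: integral_unique)
qed

lemma (in prob_space) abs_expectation_le_sqrt:
  assumes "integrable M (\<lambda>\<omega>. (Z \<omega>)\<^sup>2)" and [measurable]: "Z \<in> borel_measurable M"
  shows "integrable M Z" "expectation (\<lambda>\<omega>. \<bar>Z \<omega>\<bar>) \<le> sqrt (expectation (\<lambda>\<omega>. (Z \<omega>)\<^sup>2))"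
proof -
  show i: "integrable M Z"
    by (rule square_integrable_imp_integrable[OF _ assms(1)]) simp
  have "(expectation (\<lambda>\<omega>. \<bar>Z \<omega>\<bar>))\<^sup>2 \<le> expectation (\<lambda>\<omega>. (Z \<omega>)\<^sup>2)"
    using variance_positive[of "\<lambda>\<omega>. \<bar>Z \<omega>\<bar>"] variance_eq[of "\<lambda>\<omega>. \<bar>Z \<omega>\<bar>"] assms(1) i by simp
  then show "expectation (\<lambda>\<omega>. \<bar>Z \<omega>\<bar>) \<le> sqrt (expectation (\<lambda>\<omega>. (Z \<omega>)\<^sup>2))"
    by (rule real_le_rsqrt)
qed

text \<open>The integrand of \<open>covariance_identity\<close> for \<open>H = F\<close>, as a function of the pair of paths. Its
  mean over \<open>z\<close> and over the density \<open>sin \<theta>\<close> is the variance of \<open>F\<close>.\<close>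
definition stein_kernel :: "('i \<Rightarrow> 'i \<Rightarrow> real) \<Rightarrow> 'i set \<Rightarrow> ('i \<Rightarrow> ('i \<Rightarrow> real) \<Rightarrow> real) \<Rightarrow> real \<Rightarrow> (bool \<times> 'i \<Rightarrow> real) \<Rightarrow> real" where
  "stein_kernel \<Gamma> J F' \<theta> z = (\<Sum>i\<in>J. \<Sum>j\<in>J. \<Gamma> i j * F' i (rot \<theta> z) * F' j (\<lambda>j. z (True, j)))"

text \<open>By Stein's equation the left side is \<open>E[\<psi>'(W)] - E[W \<psi>(W)]\<close>, and the covariance identity writes the
  second term as \<open>s\<^sup>-\<^sup>2\<close> times the mean of \<open>\<psi>'(W)\<close> times the kernel. Replacing the kernel by its mean
  costs at most its standard deviation times \<open>sup |\<psi>'| \<le> 2\<close>. The scale \<open>s\<close> is not tied to the variance of \<open>F\<close>: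
  this lets \<open>F\<close> be an approximation of a variable with variance \<open>s\<^sup>2\<close>.\<close>
theorem stein_bound:
  assumes g: "gauss_fam M X \<Gamma>" and J: "finite J"
    and F: "exp_growth F" and F': "\<And>j. j \<in> J \<Longrightarrow> exp_growth (F' j)" and dF: "has_grad J F F'"
    and h: "continuous_on UNIV h" "\<And>x. 0 \<le> h x" "\<And>x. h x \<le> 1" and s: "0 < s"
    and V: "\<And>\<theta>. \<theta> \<in> {0..pi/2} \<Longrightarrow> prob_space.variance (M \<Otimes>\<^sub>M M) (\<lambda>\<omega>. stein_kernel \<Gamma> J F' \<theta> (pair_path X \<omega>)) \<le> V"
  defines "m \<equiv> (LINT \<omega>|M. F (\<lambda>i. X i \<omega>))"
  shows "\<bar>(LINT \<omega>|M. h ((F (\<lambda>i. X i \<omega>) - m) / s)) - (LINT z|std_normal_distribution. h z)\<bar>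
    \<le> (2 * \<bar>s\<^sup>2 - prob_space.variance M (\<lambda>\<omega>. F (\<lambda>i. X i \<omega>))\<bar> + 2 * sqrt V) / s\<^sup>2"
proof -
  interpret prob_space M by (rule gauss_famD(1)[OF g])
  interpret P: pair_prob_space M M ..
  have gp: "gauss_fam (M \<Otimes>\<^sub>M M) (pair_fam X) (pair_cov \<Gamma>)" by (rule gauss_fam_pair[OF g])
  have [measurable]: "X i \<in> borel_measurable M" for i by (rule gauss_famD(2)[OF g])
  have Fm[measurable]: "F \<in> borel_measurable path_borel" using F exp_growth_measurable by auto
  obtain \<psi> \<psi>' where st: "\<And>w. (\<psi> has_real_derivative \<psi>' w) (at w)"
    "\<And>w. \<psi>' w - w * \<psi> w = h w - (LINT z|std_normal_distribution. h z)"
    "\<And>w. \<bar>\<psi>' w\<bar> \<le> 2" "continuous_on UNIV \<psi>'"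
    using stein_equation[OF h] by blast
  have [measurable]: "\<psi> \<in> borel_measurable borel" "\<psi>' \<in> borel_measurable borel"
    using st(1,4) by (auto intro!: borel_measurable_continuous_onI continuous_at_imp_continuous_on dest: DERIV_isCont)
  have \<psi>lin: "\<bar>\<psi> w\<bar> \<le> \<bar>\<psi> 0\<bar> + 2 * \<bar>w\<bar>" for w
  proof -
    have "norm (\<psi> w - \<psi> 0) \<le> 2 * norm (w - 0)"
      by (rule field_differentiable_bound[of UNIV \<psi> \<psi>']) (use st(1,3) in auto)
    then show ?thesis by simp
  qed
  define W where "W x = (F x - m) / s" for x
  have W: "exp_growth W"
    using exp_growth_mult[OF exp_growth_diff[OF F exp_growth_const[of m]] exp_growth_const[of "1 / s"]] by (simp add: W_def[abs_def])
  have Wm[measurable]: "W \<in> borel_measurable path_borel" using W exp_growth_measurable by auto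
  have H: "exp_growth (\<lambda>x. \<psi> (W x))"
    by (rule exp_growth_bound[OF exp_growth_add[OF exp_growth_const[of "\<bar>\<psi> 0\<bar>"] exp_growth_mult[OF exp_growth_const[of 2] exp_growth_abs[OF W]]], where c = 1])
       (use \<psi>lin in \<open>auto intro: order_trans[OF \<psi>lin]\<close>)
  have P: "exp_growth (\<lambda>x. \<psi>' (W x))"
    by (rule exp_growth_bound[OF exp_growth_const[of 2], where c = 1]) (use st(3) in auto)
  define H' where "H' j x = \<psi>' (W x) * (1 / s) * F' j x" for j x
  have H': "exp_growth (H' j)" if "j \<in> J" for j unfolding H'_def[abs_def] by (intro exp_growth_mult P exp_growth_const F' that)
  have dH: "has_grad J (\<lambda>x. \<psi> (W x)) H'"
    unfolding H'_def[abs_def] W_def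
  proof (rule has_grad_compose[OF dF])
    show "((\<lambda>y. \<psi> ((y - m) / s)) has_real_derivative \<psi>' ((w - m) / s) * (1 / s)) (at w)" for w
      by (rule DERIV_chain2[OF st(1)]) (rule DERIV_cdivide, auto intro!: derivative_eq_intros)
  qed
  let ?Q = "\<lambda>\<theta> \<omega>. stein_kernel \<Gamma> J F' \<theta> (pair_path X \<omega>)"
  let ?p = "\<lambda>\<omega>. \<psi>' (W (\<lambda>i. X i (fst \<omega>)))"
  have kg: "exp_growth (stein_kernel \<Gamma> J F' \<theta>)" for \<theta>
    unfolding stein_kernel_def[abs_def] by (intro exp_growth_sum exp_growth_mult exp_growth_const exp_growth_rot exp_growth_fst F')
  have Qi: "integrable (M \<Otimes>\<^sub>M M) (?Q \<theta>)" for \<theta> by (rule gauss_fam_integrable[OF gp kg])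
  have Q2i: "integrable (M \<Otimes>\<^sub>M M) (\<lambda>\<omega>. (?Q \<theta> \<omega> - c)\<^sup>2)" for \<theta> c
    using gauss_fam_integrable[OF gp exp_growth_mult[OF exp_growth_diff[OF kg exp_growth_const[of c]] exp_growth_diff[OF kg exp_growth_const[of c]]]]
    by (simp add: power2_eq_square)
  have pQi: "integrable (M \<Otimes>\<^sub>M M) (\<lambda>\<omega>. ?p \<omega> * ?Q \<theta> \<omega>)" for \<theta>
    using gauss_fam_integrable[OF gp exp_growth_mult[OF exp_growth_fst[OF P] kg]] by (simp add: pair_path_simps)
  have pi: "integrable (M \<Otimes>\<^sub>M M) ?p"
    using gauss_fam_integrable[OF gp exp_growth_fst[OF P]] by (simp add: pair_path_simps)
  define A where "A \<theta> = (LINT \<omega>|(M \<Otimes>\<^sub>M M). ?Q \<theta> \<omega>)" for \<theta>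
  define B where "B \<theta> = (LINT \<omega>|(M \<Otimes>\<^sub>M M). ?p \<omega> * ?Q \<theta> \<omega>)" for \<theta>
  define e where "e = (LINT \<omega>|M. \<psi>' (W (\<lambda>i. X i \<omega>)))"
  have e2: "(LINT \<omega>|(M \<Otimes>\<^sub>M M). ?p \<omega>) = e"
    using integral_pair_mult(2)[OF prob_space_axioms gauss_fam_integrable[OF g P], of "\<lambda>_. 1"] by (simp add: e_def prob_space)
  note c1 = covariance_identity[OF g J F F' dF F F' dF]
  note c2 = covariance_identity[OF g J F F' dF H H' dH]
  have A1: "variance (\<lambda>\<omega>. F (\<lambda>i. X i \<omega>)) = (LINT \<theta>:{0..pi/2}|lborel. sin \<theta> * A \<theta>)"
    "set_integrable lborel {0..pi/2} (\<lambda>\<theta>. sin \<theta> * A \<theta>)"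
  proof -
    have "variance (\<lambda>\<omega>. F (\<lambda>i. X i \<omega>)) = (LINT \<omega>|M. F (\<lambda>i. X i \<omega>) * F (\<lambda>i. X i \<omega>)) - (LINT \<omega>|M. F (\<lambda>i. X i \<omega>)) * (LINT \<omega>|M. F (\<lambda>i. X i \<omega>))"
      using gauss_fam_integrable[OF g F] gauss_fam_integrable[OF g exp_growth_mult[OF F F]] by (subst variance_eq) (auto simp: power2_eq_square)
    then show "variance (\<lambda>\<omega>. F (\<lambda>i. X i \<omega>)) = (LINT \<theta>:{0..pi/2}|lborel. sin \<theta> * A \<theta>)"
      using c1(1) by (simp add: A_def stein_kernel_def pair_path_simps)
    show "set_integrable lborel {0..pi/2} (\<lambda>\<theta>. sin \<theta> * A \<theta>)"
      using c1(2) by (simp add: A_def stein_kernel_def pair_path_simps)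
  qed
  have Bk: "(LINT \<omega>|(M \<Otimes>\<^sub>M M). (\<Sum>i\<in>J. \<Sum>j\<in>J. \<Gamma> i j * F' i (rot \<theta> (pair_path X \<omega>)) * H' j (\<lambda>j. X j (fst \<omega>)))) = B \<theta> / s" for \<theta>
  proof -
    have "(LINT \<omega>|(M \<Otimes>\<^sub>M M). (\<Sum>i\<in>J. \<Sum>j\<in>J. \<Gamma> i j * F' i (rot \<theta> (pair_path X \<omega>)) * H' j (\<lambda>j. X j (fst \<omega>)))) =
      (LINT \<omega>|(M \<Otimes>\<^sub>M M). (?p \<omega> * ?Q \<theta> \<omega>) / s)"
      by (intro Bochner_Integration.integral_cong refl)
         (simp add: stein_kernel_def H'_def pair_path_simps sum_distrib_left sum_divide_distrib mult_ac)
    then show ?thesis by (simp add: B_def)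
  qed
  have B1: "(LINT \<omega>|M. F (\<lambda>i. X i \<omega>) * \<psi> (W (\<lambda>i. X i \<omega>))) - m * (LINT \<omega>|M. \<psi> (W (\<lambda>i. X i \<omega>))) = (LINT \<theta>:{0..pi/2}|lborel. sin \<theta> * B \<theta>) / s"
    using c2(1) unfolding Bk m_def by simp
  have B2: "set_integrable lborel {0..pi/2} (\<lambda>\<theta>. sin \<theta> * B \<theta>)"
  proof -
    have "set_integrable lborel {0..pi/2} (\<lambda>\<theta>. s * (sin \<theta> * (B \<theta> / s)))"
      using c2(2) unfolding Bk by (rule set_integrable_mult_right)
    then show ?thesis using s by simp
  qed
  have key: "\<bar>e * A \<theta> - B \<theta>\<bar> \<le> 2 * sqrt V" if th: "\<theta> \<in> {0..pi/2}" for \<theta>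
  proof -
    have "e * A \<theta> - B \<theta> = (LINT \<omega>|(M \<Otimes>\<^sub>M M). ?p \<omega> * A \<theta> - ?p \<omega> * ?Q \<theta> \<omega>)"
      using pi pQi by (subst Bochner_Integration.integral_diff) (simp_all add: e2 B_def)
    then have "\<bar>e * A \<theta> - B \<theta>\<bar> \<le> (LINT \<omega>|(M \<Otimes>\<^sub>M M). \<bar>?p \<omega> * A \<theta> - ?p \<omega> * ?Q \<theta> \<omega>\<bar>)"
      by (simp add: integral_abs_bound)
    also have "\<dots> \<le> (LINT \<omega>|(M \<Otimes>\<^sub>M M). 2 * \<bar>?Q \<theta> \<omega> - A \<theta>\<bar>)"
    proof (rule integral_mono)
      fix \<omega>
      have "\<bar>?p \<omega> * A \<theta> - ?p \<omega> * ?Q \<theta> \<omega>\<bar> = \<bar>?p \<omega>\<bar> * \<bar>?Q \<theta> \<omega> - A \<theta>\<bar>"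
        by (simp add: right_diff_distrib[symmetric] abs_mult abs_minus_commute)
      then show "\<bar>?p \<omega> * A \<theta> - ?p \<omega> * ?Q \<theta> \<omega>\<bar> \<le> 2 * \<bar>?Q \<theta> \<omega> - A \<theta>\<bar>"
        using mult_right_mono[OF st(3), of "\<bar>?Q \<theta> \<omega> - A \<theta>\<bar>"] by simp
    qed (use pi pQi Qi in auto)
    also have "\<dots> \<le> 2 * sqrt V"
      using P.abs_expectation_le_sqrt(2)[OF Q2i[of \<theta> "A \<theta>"]] Qi[of \<theta>] V[OF th]
      by (auto simp: A_def intro: order_trans)
    finally show ?thesis .
  qed
  have Wi: "integrable M (\<lambda>\<omega>. W (\<lambda>i. X i \<omega>) * \<psi> (W (\<lambda>i. X i \<omega>)))" "integrable M (\<lambda>\<omega>. \<psi>' (W (\<lambda>i. X i \<omega>)))"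
    "integrable M (\<lambda>\<omega>. F (\<lambda>i. X i \<omega>) * \<psi> (W (\<lambda>i. X i \<omega>)))" "integrable M (\<lambda>\<omega>. \<psi> (W (\<lambda>i. X i \<omega>)))"
    using gauss_fam_integrable[OF g exp_growth_mult[OF W H]] gauss_fam_integrable[OF g P]
      gauss_fam_integrable[OF g exp_growth_mult[OF F H]] gauss_fam_integrable[OF g H] by auto
  have [measurable]: "h \<in> borel_measurable borel" using h(1) by (rule borel_measurable_continuous_onI)
  have hint: "integrable M (\<lambda>\<omega>. h (W (\<lambda>i. X i \<omega>)))"
    using h by (intro integrable_const_bound[where B = 1]) auto
  have "(LINT \<omega>|M. h (W (\<lambda>i. X i \<omega>))) - (LINT z|std_normal_distribution. h z) = (LINT \<omega>|M. h (W (\<lambda>i. X i \<omega>)) - (LINT z|std_normal_distribution. h z))"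
    using hint by (simp add: prob_space)
  also have "\<dots> = e - (LINT \<omega>|M. W (\<lambda>i. X i \<omega>) * \<psi> (W (\<lambda>i. X i \<omega>)))"
    unfolding st(2)[symmetric] e_def using Wi by simp
  also have "(LINT \<omega>|M. W (\<lambda>i. X i \<omega>) * \<psi> (W (\<lambda>i. X i \<omega>))) = (LINT \<theta>:{0..pi/2}|lborel. sin \<theta> * B \<theta>) / s\<^sup>2"
  proof -
    have "(LINT \<omega>|M. W (\<lambda>i. X i \<omega>) * \<psi> (W (\<lambda>i. X i \<omega>))) = (LINT \<omega>|M. (F (\<lambda>i. X i \<omega>) * \<psi> (W (\<lambda>i. X i \<omega>)) - m * \<psi> (W (\<lambda>i. X i \<omega>))) / s)"
      by (intro Bochner_Integration.integral_cong refl) (simp add: W_def field_simps)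
    also have "\<dots> = ((LINT \<omega>|M. F (\<lambda>i. X i \<omega>) * \<psi> (W (\<lambda>i. X i \<omega>))) - m * (LINT \<omega>|M. \<psi> (W (\<lambda>i. X i \<omega>)))) / s"
      using Wi by simp
    finally show ?thesis unfolding B1 by (simp add: power2_eq_square)
  qed
  finally have E: "(LINT \<omega>|M. h (W (\<lambda>i. X i \<omega>))) - (LINT z|std_normal_distribution. h z) = e - (LINT \<theta>:{0..pi/2}|lborel. sin \<theta> * B \<theta>) / s\<^sup>2" .
  define v where "v = variance (\<lambda>\<omega>. F (\<lambda>i. X i \<omega>))"
  have ev: "e * v - (LINT \<theta>:{0..pi/2}|lborel. sin \<theta> * B \<theta>) = (LINT \<theta>:{0..pi/2}|lborel. sin \<theta> * (e * A \<theta> - B \<theta>))"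
  proof -
    have "(LINT \<theta>:{0..pi/2}|lborel. sin \<theta> * (e * A \<theta> - B \<theta>)) = (LINT \<theta>:{0..pi/2}|lborel. e * (sin \<theta> * A \<theta>) - sin \<theta> * B \<theta>)"
      by (intro set_lebesgue_integral_cong) (auto simp: algebra_simps)
    also have "\<dots> = e * v - (LINT \<theta>:{0..pi/2}|lborel. sin \<theta> * B \<theta>)"
      using A1(2) B2 by (subst set_integral_diff(2)) (auto simp: v_def A1(1))
    finally show ?thesis by simp
  qed
  have si: "set_integrable lborel {0..pi/2} (\<lambda>\<theta>. sin \<theta> * (e * A \<theta> - B \<theta>))"
  proof -
    have "set_integrable lborel {0..pi/2} (\<lambda>\<theta>. e * (sin \<theta> * A \<theta>) - sin \<theta> * B \<theta>)"
      using A1(2) B2 by (intro set_integral_diff(1)) auto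
    then show ?thesis by (simp add: algebra_simps)
  qed
  have "\<bar>LINT \<theta>:{0..pi/2}|lborel. sin \<theta> * (e * A \<theta> - B \<theta>)\<bar> \<le> (LINT \<theta>:{0..pi/2}|lborel. \<bar>sin \<theta> * (e * A \<theta> - B \<theta>)\<bar>)"
    using set_integral_norm_bound[OF si] by simp
  also have "\<dots> \<le> (LINT \<theta>:{0..pi/2}|lborel. (2 * sqrt V) * sin \<theta>)"
  proof (rule set_integral_mono)
    fix \<theta> assume t: "\<theta> \<in> {0..pi/2}"
    then have "0 \<le> sin \<theta>" by (intro sin_ge_zero) auto
    then show "\<bar>sin \<theta> * (e * A \<theta> - B \<theta>)\<bar> \<le> (2 * sqrt V) * sin \<theta>"
      using mult_left_mono[OF key[OF t]] by (simp add: abs_mult mult.commute)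
  qed (use si sin_half_period(2) in \<open>auto intro: set_integrable_abs\<close>)
  also have "\<dots> = 2 * sqrt V" using sin_half_period by simp
  finally have b1: "\<bar>e * v - (LINT \<theta>:{0..pi/2}|lborel. sin \<theta> * B \<theta>)\<bar> \<le> 2 * sqrt V" unfolding ev .
  have "\<bar>e\<bar> \<le> (LINT \<omega>|M. \<bar>\<psi>' (W (\<lambda>i. X i \<omega>))\<bar>)" unfolding e_def by (rule integral_abs_bound)
  also have "\<dots> \<le> (LINT \<omega>|M. 2)" using Wi(2) st(3) by (intro integral_mono) auto
  finally have eb: "\<bar>e\<bar> \<le> 2" by (simp add: prob_space)
  have "\<bar>e * (s\<^sup>2 - v)\<bar> \<le> 2 * \<bar>s\<^sup>2 - v\<bar>" unfolding abs_mult by (intro mult_right_mono eb) auto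
  then have "\<bar>e * (s\<^sup>2 - v) + (e * v - (LINT \<theta>:{0..pi/2}|lborel. sin \<theta> * B \<theta>))\<bar> \<le> 2 * \<bar>s\<^sup>2 - v\<bar> + 2 * sqrt V"
    using b1 by linarith
  then have "\<bar>e - (LINT \<theta>:{0..pi/2}|lborel. sin \<theta> * B \<theta>) / s\<^sup>2\<bar> \<le> (2 * \<bar>s\<^sup>2 - v\<bar> + 2 * sqrt V) / s\<^sup>2"
  proof -
    assume a: "\<bar>e * (s\<^sup>2 - v) + (e * v - (LINT \<theta>:{0..pi/2}|lborel. sin \<theta> * B \<theta>))\<bar> \<le> 2 * \<bar>s\<^sup>2 - v\<bar> + 2 * sqrt V"
    have "e - (LINT \<theta>:{0..pi/2}|lborel. sin \<theta> * B \<theta>) / s\<^sup>2 = (e * (s\<^sup>2 - v) + (e * v - (LINT \<theta>:{0..pi/2}|lborel. sin \<theta> * B \<theta>))) / s\<^sup>2"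
      using s by (simp add: field_simps)
    then show ?thesis using a s by (simp add: abs_divide divide_right_mono)
  qed
  then show ?thesis unfolding E[symmetric] W_def v_def .
qed

text \<open>Lipschitz functions decrease to indicators of compact sets, and finite Borel measures on the line
  are inner regular.\<close>
lemma d_TV_le_Lipschitz:
  assumes M: "prob_space \<mu>" "sets \<mu> = sets borel" and N: "prob_space \<nu>" "sets \<nu> = sets borel"
    and b: "\<And>h L. L-lipschitz_on UNIV h \<Longrightarrow> (\<And>x. 0 \<le> h x) \<Longrightarrow> (\<And>x. h x \<le> 1) \<Longrightarrow> \<bar>(LINT x|\<mu>. h x) - (LINT x|\<nu>. h x)\<bar> \<le> b"
  shows "d_TV \<mu> \<nu> \<le> b"
proof -
  interpret M: prob_space \<mu> by fact
  interpret N: prob_space \<nu> by fact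
  have [measurable_cong]: "sets \<mu> = sets borel" "sets \<nu> = sets borel" by fact+
  have compact: "\<bar>measure \<mu> K - measure \<nu> K\<bar> \<le> b" if K: "compact K" for K :: "real set"
  proof (cases "K = {}")
    case True
    then show ?thesis using b[of 0 "\<lambda>_. 0"] by (simp add: lipschitz_on_def)
  next
    case False
    define h where "h n x = max 0 (1 - real n * infdist x K)" for n x
    have lip: "(real n)-lipschitz_on UNIV (h n)" for n
    proof (rule lipschitz_onI)
      fix x y :: real
      have "\<bar>infdist x K - infdist y K\<bar> \<le> dist x y" by (rule infdist_triangle_abs)
      then have "real n * \<bar>infdist x K - infdist y K\<bar> \<le> real n * dist x y" by (rule mult_left_mono) simp
      then have "\<bar>real n * infdist x K - real n * infdist y K\<bar> \<le> real n * dist x y"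
        by (simp add: abs_mult flip: right_diff_distrib)
      then show "dist (h n x) (h n y) \<le> real n * dist x y" unfolding h_def dist_real_def by linarith
    qed simp
    have hm[measurable]: "h n \<in> borel_measurable borel" for n
      by (intro borel_measurable_continuous_onI lipschitz_on_continuous_on[OF lip])
    have h01: "0 \<le> h n x" "h n x \<le> 1" for n x by (auto simp: h_def infdist_nonneg)
    have lim: "(\<lambda>n. h n x) \<longlonglongrightarrow> indicator K x" for x
    proof (cases "x \<in> K")
      case True then show ?thesis by (simp add: h_def)
    next
      case nK: False
      have "0 < infdist x K" using nK K False by (metis compact_imp_closed in_closed_iff_infdist_zero infdist_nonneg less_eq_real_def)
      then obtain N where N: "1 < real N * infdist x K" using reals_Archimedean3 by blast
      have "h n x = 0" if "n \<ge> N" for n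
      proof -
        have "real N * infdist x K \<le> real n * infdist x K" using that by (intro mult_right_mono infdist_nonneg) auto
        then show ?thesis using N by (simp add: h_def)
      qed
      then show ?thesis using nK by (intro tendsto_eventually eventually_sequentiallyI[of N]) auto
    qed
    have Km[measurable]: "K \<in> sets borel" using K by (simp add: borel_compact)
    have "(\<lambda>n. LINT x|\<mu>. h n x) \<longlonglongrightarrow> (LINT x|\<mu>. indicator K x)"
      by (rule integral_dominated_convergence[where w = "\<lambda>_. 1"]) (auto simp: lim h01)
    moreover have "(\<lambda>n. LINT x|\<nu>. h n x) \<longlonglongrightarrow> (LINT x|\<nu>. indicator K x)"
      by (rule integral_dominated_convergence[where w = "\<lambda>_. 1"]) (auto simp: lim h01)
    ultimately have "(\<lambda>n. \<bar>(LINT x|\<mu>. h n x) - (LINT x|\<nu>. h n x)\<bar>) \<longlonglongrightarrow> \<bar>measure \<mu> K - measure \<nu> K\<bar>"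
      by (auto intro!: tendsto_intros simp: sets_eq_imp_space_eq[OF M(2)] sets_eq_imp_space_eq[OF N(2)])
    then show ?thesis by (rule LIMSEQ_le_const2) (use b[OF lip h01] in auto)
  qed
  have one: "measure \<mu>' A - measure \<nu>' A \<le> b"
    if p: "prob_space \<mu>'" "prob_space \<nu>'" and s: "sets \<mu>' = sets borel" "sets \<nu>' = sets borel" and A: "A \<in> sets borel"
      and c: "\<And>K. compact K \<Longrightarrow> measure \<mu>' K - measure \<nu>' K \<le> b" for \<mu>' \<nu>' :: "real measure" and A
  proof (rule field_le_epsilon)
    interpret p: prob_space \<mu>' by fact
    interpret q: prob_space \<nu>' by fact
    fix e :: real assume e: "0 < e"
    have sup: "emeasure \<mu>' A = (SUP K\<in>{K. K \<subseteq> A \<and> compact K}. emeasure \<mu>' K)"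
      by (rule inner_regular) (use s A in \<open>auto simp: p.emeasure_eq_measure\<close>)
    have "\<exists>K. K \<subseteq> A \<and> compact K \<and> measure \<mu>' A < measure \<mu>' K + e"
      proof (rule ccontr)
        assume "\<not> ?thesis"
        then have *: "K \<subseteq> A \<Longrightarrow> compact K \<Longrightarrow> measure \<mu>' K \<le> measure \<mu>' A - e" for K by force
        have nn: "0 \<le> measure \<mu>' A - e" using *[of "{}"] by simp
        have "emeasure \<mu>' A \<le> ennreal (measure \<mu>' A - e)"
          unfolding sup by (rule SUP_least) (use * in \<open>auto simp: p.emeasure_eq_measure intro!: ennreal_leI\<close>)
        then show False using e nn by (simp add: p.emeasure_eq_measure)
      qed
    then obtain K where K: "K \<subseteq> A" "compact K" "measure \<mu>' A < measure \<mu>' K + e" by blast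
    have "measure \<nu>' K \<le> measure \<nu>' A" using K s A by (intro q.finite_measure_mono) auto
    then show "measure \<mu>' A - measure \<nu>' A \<le> b + e" using K(3) c[OF K(2)] by linarith
  qed
  have "\<bar>measure \<mu> A - measure \<nu> A\<bar> \<le> b" if "A \<in> sets borel" for A
    using one[OF M(1) N(1) M(2) N(2) that] one[OF N(1) M(1) N(2) M(2) that] compact
    by (smt (verit))
  then show ?thesis unfolding d_TV_def by (intro cSUP_least) auto
qed

text \<open>The covariance identity with \<open>H = F\<close> and \<open>\<integral> sin \<theta> d\<theta> = 1\<close>. Cauchy--Schwarz would turn this into the
  Poincare inequality; absolute values suffice because the derivatives will be bounded one by one.\<close>
theorem poincare_type_bound:
  assumes g: "gauss_fam M X \<Gamma>" and J: "finite J"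
    and F: "exp_growth F" and F': "\<And>j. j \<in> J \<Longrightarrow> exp_growth (F' j)" and dF: "has_grad J F F'"
    and B: "\<And>\<theta>. (LINT \<omega>|(M \<Otimes>\<^sub>M M). (\<Sum>i\<in>J. \<Sum>j\<in>J. \<bar>\<Gamma> i j\<bar> * \<bar>F' i (rot \<theta> (pair_path X \<omega>))\<bar> * \<bar>F' j (\<lambda>j. X j (fst \<omega>))\<bar>)) \<le> B"
  shows "prob_space.variance M (\<lambda>\<omega>. F (\<lambda>i. X i \<omega>)) \<le> B"
proof -
  interpret prob_space M by (rule gauss_famD(1)[OF g])
  have gp: "gauss_fam (M \<Otimes>\<^sub>M M) (pair_fam X) (pair_cov \<Gamma>)" by (rule gauss_fam_pair[OF g])
  let ?E = "\<lambda>\<theta>. LINT \<omega>|(M \<Otimes>\<^sub>M M). (\<Sum>i\<in>J. \<Sum>j\<in>J. \<Gamma> i j * F' i (rot \<theta> (pair_path X \<omega>)) * F' j (\<lambda>j. X j (fst \<omega>)))"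
  note c = covariance_identity[OF g J F F' dF F F' dF]
  have b: "?E \<theta> \<le> B" for \<theta>
  proof -
    have "?E \<theta> \<le> (LINT \<omega>|(M \<Otimes>\<^sub>M M). (\<Sum>i\<in>J. \<Sum>j\<in>J. \<bar>\<Gamma> i j\<bar> * \<bar>F' i (rot \<theta> (pair_path X \<omega>))\<bar> * \<bar>F' j (\<lambda>j. X j (fst \<omega>))\<bar>))"
    proof (rule integral_mono)
      have "exp_growth (\<lambda>z. \<Sum>i\<in>J. \<Sum>j\<in>J. \<Gamma> i j * F' i (rot \<theta> z) * F' j (\<lambda>j. z (True, j)))"
        by (intro exp_growth_sum exp_growth_mult exp_growth_const exp_growth_rot exp_growth_fst F')
      from gauss_fam_integrable[OF gp this]
      show "integrable (M \<Otimes>\<^sub>M M) (\<lambda>\<omega>. \<Sum>i\<in>J. \<Sum>j\<in>J. \<Gamma> i j * F' i (rot \<theta> (pair_path X \<omega>)) * F' j (\<lambda>j. X j (fst \<omega>)))"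
        by (simp add: pair_path_simps)
      have "exp_growth (\<lambda>z. \<Sum>i\<in>J. \<Sum>j\<in>J. \<bar>\<Gamma> i j\<bar> * \<bar>F' i (rot \<theta> z)\<bar> * \<bar>F' j (\<lambda>j. z (True, j))\<bar>)"
        by (intro exp_growth_sum exp_growth_mult exp_growth_const exp_growth_abs exp_growth_rot exp_growth_fst F')
      from gauss_fam_integrable[OF gp this]
      show "integrable (M \<Otimes>\<^sub>M M) (\<lambda>\<omega>. \<Sum>i\<in>J. \<Sum>j\<in>J. \<bar>\<Gamma> i j\<bar> * \<bar>F' i (rot \<theta> (pair_path X \<omega>))\<bar> * \<bar>F' j (\<lambda>j. X j (fst \<omega>))\<bar>)"
        by (simp add: pair_path_simps)
      show "(\<Sum>i\<in>J. \<Sum>j\<in>J. \<Gamma> i j * F' i (rot \<theta> (pair_path X \<omega>)) * F' j (\<lambda>j. X j (fst \<omega>)))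
        \<le> (\<Sum>i\<in>J. \<Sum>j\<in>J. \<bar>\<Gamma> i j\<bar> * \<bar>F' i (rot \<theta> (pair_path X \<omega>))\<bar> * \<bar>F' j (\<lambda>j. X j (fst \<omega>))\<bar>)" for \<omega>
        by (intro sum_mono) (simp flip: abs_mult)
    qed
    then show ?thesis using B[of \<theta>] by simp
  qed
  have "variance (\<lambda>\<omega>. F (\<lambda>i. X i \<omega>)) = (LINT \<omega>|M. F (\<lambda>i. X i \<omega>) * F (\<lambda>i. X i \<omega>)) - (LINT \<omega>|M. F (\<lambda>i. X i \<omega>)) * (LINT \<omega>|M. F (\<lambda>i. X i \<omega>))"
    using gauss_fam_integrable[OF g F] gauss_fam_integrable[OF g exp_growth_mult[OF F F]] by (subst variance_eq) (auto simp: power2_eq_square)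
  also have "\<dots> = (LINT \<theta>:{0..pi/2}|lborel. sin \<theta> * ?E \<theta>)" by (rule c(1))
  also have "\<dots> \<le> (LINT \<theta>:{0..pi/2}|lborel. B * sin \<theta>)"
  proof (rule set_integral_mono[OF c(2)])
    show "set_integrable lborel {0..pi/2} (\<lambda>\<theta>. B * sin \<theta>)" using sin_half_period(2) by simp
    fix \<theta> :: real assume "\<theta> \<in> {0..pi/2}"
    then have "0 \<le> sin \<theta>" by (intro sin_ge_zero) auto
    then show "sin \<theta> * ?E \<theta> \<le> B * sin \<theta>" unfolding mult.commute[of B] by (rule mult_left_mono[OF b])
  qed
  also have "\<dots> = B" using sin_half_period by simp
  finally show ?thesis .
qed

lemma gauss_fam_exp_moment:
  assumes "gauss_fam M X \<Gamma>"
  shows "(LINT \<omega>|M. exp (k * X i \<omega>)) = exp (k\<^sup>2 * \<Gamma> i i / 2)" and "0 \<le> \<Gamma> i i"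
proof -
  have [measurable]: "X i \<in> borel_measurable M" by (rule gauss_famD(2)[OF assms])
  have v: "bilin \<Gamma> {i} (\<lambda>_. 1) (\<lambda>_. 1) = \<Gamma> i i" by (simp add: bilin_def)
  show p: "0 \<le> \<Gamma> i i" using gauss_fam_variance_nonneg[OF assms, of "{i}" "\<lambda>_. 1"] v by simp
  have d: "distr M borel (X i) = distr std_normal_distribution borel (\<lambda>z. sqrt (\<Gamma> i i) * z)"
    using gauss_fam_combination_law[OF assms, of "{i}" "\<lambda>_. 1"] by (simp add: v)
  have "(LINT \<omega>|M. exp (k * X i \<omega>)) = (LINT y|distr M borel (X i). exp (k * y))" by (subst integral_distr) auto
  also have "\<dots> = (LINT z|std_normal_distribution. exp ((k * sqrt (\<Gamma> i i)) * z))"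
    unfolding d by (subst integral_distr) (auto simp: mult.assoc)
  also have "\<dots> = exp ((k * sqrt (\<Gamma> i i))\<^sup>2 / 2)" by (rule std_normal_exp)
  finally show "(LINT \<omega>|M. exp (k * X i \<omega>)) = exp (k\<^sup>2 * \<Gamma> i i / 2)" using p by (simp add: power_mult_distrib)
qed

lemma expectation_double_sum_le:
  assumes "finite I" "finite I'" "\<And>r. r \<in> I \<Longrightarrow> 0 \<le> \<alpha> r" "\<And>r. r \<in> I' \<Longrightarrow> 0 \<le> \<beta> r"
    and i: "\<And>r s. r \<in> I \<Longrightarrow> s \<in> I' \<Longrightarrow> integrable M (\<lambda>\<omega>. \<tau> r \<omega> * \<rho> s \<omega>)"
    and k: "\<And>r s. r \<in> I \<Longrightarrow> s \<in> I' \<Longrightarrow> (LINT \<omega>|M. \<tau> r \<omega> * \<rho> s \<omega>) \<le> (k :: real)"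
  shows "(LINT \<omega>|M. (\<Sum>r\<in>I. \<alpha> r * \<tau> r \<omega>) * (\<Sum>s\<in>I'. \<beta> s * \<rho> s \<omega>)) \<le> k * (\<Sum>r\<in>I. \<alpha> r) * (\<Sum>s\<in>I'. \<beta> s)"
proof -
  have "(LINT \<omega>|M. (\<Sum>r\<in>I. \<alpha> r * \<tau> r \<omega>) * (\<Sum>s\<in>I'. \<beta> s * \<rho> s \<omega>)) = (LINT \<omega>|M. (\<Sum>r\<in>I. \<Sum>s\<in>I'. (\<alpha> r * \<beta> s) * (\<tau> r \<omega> * \<rho> s \<omega>)))"
    by (simp add: sum_product mult_ac)
  also have "\<dots> = (\<Sum>r\<in>I. \<Sum>s\<in>I'. (\<alpha> r * \<beta> s) * (LINT \<omega>|M. \<tau> r \<omega> * \<rho> s \<omega>))"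
  proof -
    have "(LINT \<omega>|M. (\<Sum>r\<in>I. \<Sum>s\<in>I'. (\<alpha> r * \<beta> s) * (\<tau> r \<omega> * \<rho> s \<omega>))) = (\<Sum>r\<in>I. LINT \<omega>|M. (\<Sum>s\<in>I'. (\<alpha> r * \<beta> s) * (\<tau> r \<omega> * \<rho> s \<omega>)))"
      by (intro Bochner_Integration.integral_sum Bochner_Integration.integrable_sum integrable_mult_right i)
    also have "\<dots> = (\<Sum>r\<in>I. \<Sum>s\<in>I'. LINT \<omega>|M. (\<alpha> r * \<beta> s) * (\<tau> r \<omega> * \<rho> s \<omega>))"
      by (intro sum.cong refl Bochner_Integration.integral_sum integrable_mult_right i)
    finally show ?thesis by simp
  qed
  also have "\<dots> \<le> (\<Sum>r\<in>I. \<Sum>s\<in>I'. (\<alpha> r * \<beta> s) * k)"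
    using assms by (intro sum_mono mult_left_mono) auto
  also have "\<dots> = k * (\<Sum>r\<in>I. \<alpha> r) * (\<Sum>s\<in>I'. \<beta> s)"
    by (simp add: sum_product sum_distrib_left mult_ac)
  finally show ?thesis .
qed

section \<open>The functional on finitely many field values\<close>

text \<open>The functional \<open>A - B C / D\<close> for quadrature sums with equal weights \<open>1 / n\<close>. The coefficients
  \<open>a\<close>, \<open>b\<close>, \<open>c\<close> stand for integrals of \<open>f g\<close>, \<open>f\<close>, \<open>g\<close> over the cells, whence their bounds.\<close>
locale quadrature =
  fixes n :: nat and a b c :: "nat \<Rightarrow> real" and L :: real
  assumes n: "0 < n" and L: "0 \<le> L"
    and a: "\<And>i. i < n \<Longrightarrow> \<bar>a i\<bar> \<le> L\<^sup>2 * (1 / n)"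
    and b: "\<And>i. i < n \<Longrightarrow> \<bar>b i\<bar> \<le> L * (1 / n)"
    and c: "\<And>i. i < n \<Longrightarrow> \<bar>c i\<bar> \<le> L * (1 / n)"
begin

text \<open>Here \<open>e\<close> is the inverse of the random coefficient, \<open>P = B / D\<close> and \<open>Q = C / D\<close> are weighted averages and hence bounded, and the
  suffixes \<open>1\<close> and \<open>2\<close> denote first and second partial derivatives. In particular \<open>\<Phi> = A - D P Q\<close>.\<close>
definition w :: real where "w = 1 / n"
definition e :: "nat \<Rightarrow> (nat \<Rightarrow> real) \<Rightarrow> real" where "e i x = exp ((-1) * x i)"
definition D :: "(nat \<Rightarrow> real) \<Rightarrow> real" where "D x = (\<Sum>i<n. w * e i x)"
definition P :: "(nat \<Rightarrow> real) \<Rightarrow> real" where "P x = (\<Sum>i<n. b i * e i x) / D x"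
definition Q :: "(nat \<Rightarrow> real) \<Rightarrow> real" where "Q x = (\<Sum>i<n. c i * e i x) / D x"
definition \<Phi> :: "(nat \<Rightarrow> real) \<Rightarrow> real" where "\<Phi> x = (\<Sum>i<n. a i * e i x) - D x * (P x * Q x)"
definition m :: "nat \<Rightarrow> (nat \<Rightarrow> real) \<Rightarrow> real" where "m i x = a i - b i * Q x - c i * P x + w * (P x * Q x)"
definition \<Phi>1 :: "nat \<Rightarrow> (nat \<Rightarrow> real) \<Rightarrow> real" where "\<Phi>1 i x = - (e i x * m i x)"
definition P1 :: "nat \<Rightarrow> (nat \<Rightarrow> real) \<Rightarrow> real" where "P1 k x = - (e k x * (b k - w * P x)) / D x"
definition Q1 :: "nat \<Rightarrow> (nat \<Rightarrow> real) \<Rightarrow> real" where "Q1 k x = - (e k x * (c k - w * Q x)) / D x"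
definition m1 :: "nat \<Rightarrow> nat \<Rightarrow> (nat \<Rightarrow> real) \<Rightarrow> real" where
  "m1 i k x = w * (P1 k x * Q x + P x * Q1 k x) - b i * Q1 k x - c i * P1 k x"
definition \<Phi>2 :: "nat \<Rightarrow> nat \<Rightarrow> (nat \<Rightarrow> real) \<Rightarrow> real" where
  "\<Phi>2 i k x = (if k = i then e i x * m i x else 0) - e i x * m1 i k x"
definition Di :: "(nat \<Rightarrow> real) \<Rightarrow> real" where "Di x = (\<Sum>i<n. w * exp (1 * x i))"

lemma w: "0 < w" "real n * w = 1" using n by (simp_all add: w_def)

lemma abw: "i < n \<Longrightarrow> \<bar>a i\<bar> \<le> L\<^sup>2 * w" "i < n \<Longrightarrow> \<bar>b i\<bar> \<le> L * w" "i < n \<Longrightarrow> \<bar>c i\<bar> \<le> L * w"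
  using a b c by (simp_all add: w_def)

lemma e_pos: "0 < e i x" by (simp add: e_def)

lemma D_pos: "0 < D x"
  unfolding D_def using w n e_pos by (intro sum_pos) auto

lemma average_bound:
  assumes "\<And>i. i < n \<Longrightarrow> \<bar>r i\<bar> \<le> R * w"
  shows "\<bar>\<Sum>i<n. r i * e i x\<bar> \<le> R * D x"
proof -
  have "\<bar>\<Sum>i<n. r i * e i x\<bar> \<le> (\<Sum>i<n. \<bar>r i * e i x\<bar>)" by (rule sum_abs)
  also have "\<dots> \<le> (\<Sum>i<n. (R * w) * e i x)"
    unfolding abs_mult using assms e_pos by (intro sum_mono mult_mono) (auto simp: less_imp_le intro: order_trans[OF abs_ge_zero])
  also have "\<dots> = R * D x" by (simp add: D_def sum_distrib_left mult.assoc)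
  finally show ?thesis .
qed

lemma PQ_bound: "\<bar>P x\<bar> \<le> L" "\<bar>Q x\<bar> \<le> L"
  using average_bound[of b L x] average_bound[of c L x] abw D_pos[of x]
  by (simp_all add: P_def Q_def abs_divide pos_divide_le_eq)

lemma m_bound: "i < n \<Longrightarrow> \<bar>m i x\<bar> \<le> 4 * L\<^sup>2 * w"
proof -
  assume i: "i < n"
  have "\<bar>b i\<bar> * \<bar>Q x\<bar> \<le> (L * w) * L" "\<bar>c i\<bar> * \<bar>P x\<bar> \<le> (L * w) * L" "\<bar>P x\<bar> * \<bar>Q x\<bar> \<le> L * L"
    using abw[OF i] PQ_bound L w by (auto intro!: mult_mono)
  note b3 = this[folded abs_mult]
  have "\<bar>w * (P x * Q x)\<bar> \<le> w * (L * L)"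
    unfolding abs_mult[of w] using w b3(3) by (intro mult_mono) auto
  then have "\<bar>m i x\<bar> \<le> L\<^sup>2 * w + (L * w) * L + (L * w) * L + w * (L * L)"
    unfolding m_def using b3(1,2) abw(1)[OF i] by linarith
  also have "\<dots> = 4 * L\<^sup>2 * w" by (simp add: power2_eq_square)
  finally show ?thesis .
qed

lemma P1Q1_bound:
  assumes "k < n"
  shows "\<bar>P1 k x\<bar> \<le> 2 * L * w * (e k x / D x)" "\<bar>Q1 k x\<bar> \<le> 2 * L * w * (e k x / D x)"
proof -
  have *: "\<bar>- (e k x * (r - w * R)) / D x\<bar> \<le> 2 * L * w * (e k x / D x)"
    if "\<bar>r\<bar> \<le> L * w" "\<bar>R\<bar> \<le> L" for r R
  proof -
    have "\<bar>w * R\<bar> \<le> w * L" unfolding abs_mult using that w by (intro mult_mono) auto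
    then have "\<bar>r - w * R\<bar> \<le> L * w + w * L" using that by linarith
    also have "\<dots> = 2 * L * w" by simp
    finally have "\<bar>r - w * R\<bar> \<le> 2 * L * w" .
    then have "e k x / D x * \<bar>r - w * R\<bar> \<le> e k x / D x * (2 * L * w)"
      using e_pos[of k x] D_pos[of x] by (intro mult_left_mono) auto
    then show ?thesis using e_pos[of k x] D_pos[of x] by (simp add: abs_mult abs_divide mult_ac)
  qed
  show "\<bar>P1 k x\<bar> \<le> 2 * L * w * (e k x / D x)" "\<bar>Q1 k x\<bar> \<le> 2 * L * w * (e k x / D x)"
    unfolding P1_def Q1_def by (rule *; intro abw assms PQ_bound)+
qed

text \<open>The harmonic mean is at most the arithmetic mean; \<open>u + 1/u \<ge> 2\<close> with \<open>u = e i x / D x\<close>, averaged over \<open>i\<close>.\<close>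
lemma inverse_D_bound: "1 / D x \<le> Di x"
proof -
  have "2 \<le> 1 / D x * e i x + D x * exp (1 * x i)" for i
  proof -
    define u where "u = e i x / D x"
    have u: "0 < u" unfolding u_def using e_pos[of i x] D_pos[of x] by simp
    have "0 \<le> (u - 1)\<^sup>2 / u" using u by simp
    also have "\<dots> = u + 1 / u - 2" using u by (simp add: power2_eq_square field_simps)
    also have "1 / u = D x * exp (1 * x i)" by (simp add: u_def e_def exp_minus field_simps)
    finally show ?thesis by (simp add: u_def)
  qed
  then have "(\<Sum>i<n. w * 2) \<le> (\<Sum>i<n. w * (1 / D x * e i x + D x * exp (1 * x i)))"
    using w by (intro sum_mono mult_left_mono) auto
  also have "\<dots> = (\<Sum>i<n. 1 / D x * (w * e i x) + D x * (w * exp (1 * x i)))"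
    by (intro sum.cong refl) (simp only: distrib_left mult_ac)
  also have "\<dots> = 1 / D x * (\<Sum>i<n. w * e i x) + D x * Di x"
    unfolding Di_def by (simp only: sum.distrib sum_distrib_left)
  also have "(\<Sum>i<n. w * e i x) = D x" by (simp only: D_def)
  also have "1 / D x * D x + D x * Di x = 1 + D x * Di x" using D_pos[of x] by simp
  finally have "1 \<le> D x * Di x" using w(2) by simp
  then show ?thesis using D_pos[of x] by (simp add: field_simps)
qed

lemma m1_bound:
  assumes "i < n" "k < n"
  shows "\<bar>m1 i k x\<bar> \<le> 8 * L\<^sup>2 * w\<^sup>2 * (e k x / D x)"
proof -
  define t where "t = 2 * L * w * (e k x / D x)"
  have t: "0 \<le> t" unfolding t_def using L w e_pos[of k x] D_pos[of x] by auto
  note pq = P1Q1_bound[OF assms(2), of x, folded t_def]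
  have "\<bar>P1 k x\<bar> * \<bar>Q x\<bar> \<le> t * L" "\<bar>P x\<bar> * \<bar>Q1 k x\<bar> \<le> L * t"
    "\<bar>b i\<bar> * \<bar>Q1 k x\<bar> \<le> (L * w) * t" "\<bar>c i\<bar> * \<bar>P1 k x\<bar> \<le> (L * w) * t"
    using pq PQ_bound abw[OF assms(1)] L w t by (auto intro!: mult_mono)
  note b4 = this[folded abs_mult]
  have "\<bar>w * (P1 k x * Q x + P x * Q1 k x)\<bar> \<le> w * (t * L + L * t)"
  proof -
    have "\<bar>P1 k x * Q x + P x * Q1 k x\<bar> \<le> t * L + L * t" using b4 by linarith
    then show ?thesis unfolding abs_mult[of w] using w by (intro mult_mono) auto
  qed
  then have "\<bar>m1 i k x\<bar> \<le> w * (t * L + L * t) + (L * w) * t + (L * w) * t"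
    unfolding m1_def using b4 by linarith
  also have "\<dots> = 8 * L\<^sup>2 * w\<^sup>2 * (e k x / D x)" unfolding t_def by (simp add: power2_eq_square algebra_simps)
  finally show ?thesis .
qed

text \<open>The common majorant of the random factors in \<open>\<Phi>2 i k\<close>; the second summand is \<open>e i e k / D\<close> with \<open>1 / D\<close>
  replaced by its bound, which has moments.\<close>
definition \<sigma> :: "nat \<Rightarrow> nat \<Rightarrow> (nat \<Rightarrow> real) \<Rightarrow> real" where "\<sigma> i k x = e i x + e i x * (e k x * Di x)"

lemma Di_pos: "0 < Di x" using inverse_D_bound[of x] D_pos[of x] by (auto intro: less_le_trans[rotated])

lemma \<sigma>_pos: "0 < \<sigma> i k x" unfolding \<sigma>_def using e_pos Di_pos by (intro add_pos_pos mult_pos_pos)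

lemma \<Phi>1_bound: "i < n \<Longrightarrow> \<bar>\<Phi>1 i x\<bar> \<le> 8 * L\<^sup>2 * w * e i x"
proof -
  assume i: "i < n"
  have "e i x * \<bar>m i x\<bar> \<le> e i x * (8 * L\<^sup>2 * w)"
  proof (rule mult_left_mono)
    have "4 * L\<^sup>2 * w \<le> 8 * L\<^sup>2 * w" using w by simp
    then show "\<bar>m i x\<bar> \<le> 8 * L\<^sup>2 * w" using m_bound[OF i, of x] by linarith
  qed (use e_pos[of i x] in simp)
  then show ?thesis using e_pos[of i x] by (simp add: \<Phi>1_def abs_mult mult_ac)
qed

text \<open>The diagonal of the Hessian is of order \<open>w\<close>, the rest of order \<open>w\<^sup>2\<close>: in the limit of small cells, a
  multiple of the diagonal and a density.\<close>
lemma \<Phi>2_bound: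
  assumes "i < n" "k < n"
  shows "\<bar>\<Phi>2 i k x\<bar> \<le> 8 * L\<^sup>2 * ((if k = i then w else 0) + w\<^sup>2) * \<sigma> i k x"
proof -
  have e0: "0 \<le> e i x" "0 \<le> e k x" using e_pos[of i x] e_pos[of k x] by simp_all
  have mb: "\<bar>m i x\<bar> \<le> 8 * L\<^sup>2 * w"
  proof -
    have "4 * L\<^sup>2 * w \<le> 8 * L\<^sup>2 * w" using w by simp
    then show "\<bar>m i x\<bar> \<le> 8 * L\<^sup>2 * w" using m_bound[OF assms(1), of x] by linarith
  qed
  have es: "e i x \<le> \<sigma> i k x" "e i x * (e k x * Di x) \<le> \<sigma> i k x"
    unfolding \<sigma>_def using e0 Di_pos[of x] by simp_all
  have t1: "\<bar>if k = i then e i x * m i x else 0\<bar> \<le> 8 * L\<^sup>2 * (if k = i then w else 0) * \<sigma> i k x"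
  proof (cases "k = i")
    case True
    have "e i x * \<bar>m i x\<bar> \<le> \<sigma> i k x * (8 * L\<^sup>2 * w)" using es(1) mb e0 \<sigma>_pos[of i k x] by (intro mult_mono) auto
    then show ?thesis using True e0 by (simp add: abs_mult mult_ac)
  qed simp
  have t2: "\<bar>e i x * m1 i k x\<bar> \<le> 8 * L\<^sup>2 * w\<^sup>2 * \<sigma> i k x"
  proof -
    have "\<bar>e i x * m1 i k x\<bar> \<le> e i x * (8 * L\<^sup>2 * w\<^sup>2 * (e k x / D x))"
      unfolding abs_mult using m1_bound[OF assms] e0 by (intro mult_mono) auto
    also have "\<dots> = 8 * L\<^sup>2 * w\<^sup>2 * (e i x * (e k x * (1 / D x)))" by simp
    also have "\<dots> \<le> 8 * L\<^sup>2 * w\<^sup>2 * (e i x * (e k x * Di x))"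
      using inverse_D_bound[of x] e0 by (intro mult_left_mono) auto
    also have "\<dots> \<le> 8 * L\<^sup>2 * w\<^sup>2 * \<sigma> i k x" using es(2) by (intro mult_left_mono) auto
    finally show ?thesis .
  qed
  have "\<bar>\<Phi>2 i k x\<bar> \<le> 8 * L\<^sup>2 * (if k = i then w else 0) * \<sigma> i k x + 8 * L\<^sup>2 * w\<^sup>2 * \<sigma> i k x"
    unfolding \<Phi>2_def using t1 t2 by linarith
  then show ?thesis by (simp add: algebra_simps)
qed

lemma growth_e: "exp_growth (e i)" unfolding e_def[abs_def] by (rule exp_growth_exp)

lemma growth_D: "exp_growth D" unfolding D_def[abs_def] by (intro exp_growth_intros growth_e)

lemma growth_Di: "exp_growth Di" unfolding Di_def[abs_def] by (intro exp_growth_intros)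

lemma growth_\<sigma>: "exp_growth (\<sigma> i k)" unfolding \<sigma>_def[abs_def] by (intro exp_growth_intros growth_e growth_Di)

lemma measurable_ePQ[measurable]: "e i \<in> borel_measurable path_borel" "D \<in> borel_measurable path_borel"
  "P \<in> borel_measurable path_borel" "Q \<in> borel_measurable path_borel"
proof -
  show [measurable]: "e i \<in> borel_measurable path_borel" for i by (rule exp_growth_measurable[OF growth_e])
  show [measurable]: "D \<in> borel_measurable path_borel" by (rule exp_growth_measurable[OF growth_D])
  show "P \<in> borel_measurable path_borel" "Q \<in> borel_measurable path_borel"
    unfolding P_def[abs_def] Q_def[abs_def] by measurable
qed

lemma growth_P: "exp_growth P" "exp_growth Q"
  by (rule exp_growth_bound[OF exp_growth_const[of L], where c = 1]; use PQ_bound L in auto)+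

lemma growth_\<Phi>: "exp_growth \<Phi>"
  unfolding \<Phi>_def[abs_def] by (intro exp_growth_intros growth_e growth_D growth_P)

lemma growth_m: "exp_growth (m i)"
  unfolding m_def[abs_def] by (intro exp_growth_intros growth_P)

lemma growth_\<Phi>1: "exp_growth (\<Phi>1 i)"
proof -
  have "exp_growth (\<lambda>x. (-1) * (e i x * m i x))" by (intro exp_growth_intros growth_e growth_m)
  then show ?thesis unfolding \<Phi>1_def[abs_def] by simp
qed

lemma growth_\<Phi>2:
  assumes "i < n" "k < n" shows "exp_growth (\<Phi>2 i k)"
proof (rule exp_growth_bound)
  show "exp_growth (\<lambda>x. 8 * L\<^sup>2 * ((if k = i then w else 0) + w\<^sup>2) * \<sigma> i k x)" by (intro exp_growth_intros growth_\<sigma>)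
  show "\<bar>\<Phi>2 i k x\<bar> \<le> 1 * \<bar>8 * L\<^sup>2 * ((if k = i then w else 0) + w\<^sup>2) * \<sigma> i k x\<bar>" for x
    using \<Phi>2_bound[OF assms, of x] by linarith
  show "\<Phi>2 i k \<in> borel_measurable path_borel"
    unfolding \<Phi>2_def[abs_def] m_def m1_def P1_def Q1_def by measurable
qed

lemma has_grad_linear:
  assumes "\<And>i. i < n \<Longrightarrow> ((\<lambda>s. \<gamma> s i) has_real_derivative \<gamma>' i) (at t)"
  shows "((\<lambda>s. \<Sum>i<n. r i * e i (\<gamma> s)) has_real_derivative (\<Sum>i<n. - (r i * e i (\<gamma> t)) * \<gamma>' i)) (at t)"
  unfolding e_def by (rule derivative_eq_intros assms refl | simp)+ (simp add: mult_ac)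

lemma has_grad_ratio:
  shows "has_grad {..<n} P P1" "has_grad {..<n} Q Q1"
proof -
  have *: "((\<lambda>s. (\<Sum>i<n. r i * e i (\<gamma> s)) / D (\<gamma> s)) has_real_derivative
     (\<Sum>k<n. - (e k (\<gamma> t) * (r k - w * ((\<Sum>i<n. r i * e i (\<gamma> t)) / D (\<gamma> t)))) / D (\<gamma> t) * \<gamma>' k)) (at t)"
    if "\<And>i. i < n \<Longrightarrow> ((\<lambda>s. \<gamma> s i) has_real_derivative \<gamma>' i) (at t)" for \<gamma> \<gamma>' t r
  proof -
    let ?S = "\<Sum>i<n. r i * e i (\<gamma> t)"
    have D': "((\<lambda>s. D (\<gamma> s)) has_real_derivative (\<Sum>i<n. - (w * e i (\<gamma> t)) * \<gamma>' i)) (at t)"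
      unfolding D_def by (rule has_grad_linear[OF that])
    have "((\<lambda>s. (\<Sum>i<n. r i * e i (\<gamma> s)) / D (\<gamma> s)) has_real_derivative
      ((\<Sum>i<n. - (r i * e i (\<gamma> t)) * \<gamma>' i) * D (\<gamma> t) - ?S * (\<Sum>i<n. - (w * e i (\<gamma> t)) * \<gamma>' i)) / (D (\<gamma> t) * D (\<gamma> t))) (at t)"
      by (rule DERIV_divide[OF has_grad_linear[OF that] D']) (use D_pos[of "\<gamma> t"] in auto)
    moreover have "((\<Sum>i<n. - (r i * e i (\<gamma> t)) * \<gamma>' i) * D (\<gamma> t) - ?S * (\<Sum>i<n. - (w * e i (\<gamma> t)) * \<gamma>' i)) / (D (\<gamma> t) * D (\<gamma> t))
      = (\<Sum>k<n. - (e k (\<gamma> t) * (r k - w * (?S / D (\<gamma> t)))) / D (\<gamma> t) * \<gamma>' k)"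
    proof -
      define S d where "S = ?S" and "d = D (\<gamma> t)"
      have d: "0 < d" unfolding d_def by (rule D_pos)
      have "((\<Sum>i<n. - (r i * e i (\<gamma> t)) * \<gamma>' i) * d - S * (\<Sum>i<n. - (w * e i (\<gamma> t)) * \<gamma>' i)) / (d * d)
        = (\<Sum>k<n. (- (r k * e k (\<gamma> t)) * \<gamma>' k * d - S * (- (w * e k (\<gamma> t)) * \<gamma>' k)) / (d * d))"
        by (simp only: sum_distrib_left sum_distrib_right sum_subtractf[symmetric] sum_divide_distrib)
      also have "\<dots> = (\<Sum>k<n. - (e k (\<gamma> t) * (r k - w * (S / d))) / d * \<gamma>' k)"
        using d by (intro sum.cong refl) (simp add: field_simps)
      finally show ?thesis unfolding S_def d_def .
    qed
    ultimately show ?thesis by simp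
  qed
  show "has_grad {..<n} P P1" "has_grad {..<n} Q Q1"
    unfolding has_grad_def P_def[abs_def] Q_def[abs_def] P1_def[abs_def] Q1_def[abs_def] by (intro allI impI *; simp)+
qed

lemma has_grad_\<Phi>: "has_grad {..<n} \<Phi> \<Phi>1"
  unfolding has_grad_def
proof (intro allI impI)
  fix \<gamma> \<gamma>' t assume "\<forall>i\<in>{..<n}. ((\<lambda>s. \<gamma> s i) has_real_derivative \<gamma>' i) (at t)"
  then have g: "((\<lambda>s. \<gamma> s i) has_real_derivative \<gamma>' i) (at t)" if "i < n" for i using that by auto
  have D': "((\<lambda>s. D (\<gamma> s)) has_real_derivative (\<Sum>i<n. - (w * e i (\<gamma> t)) * \<gamma>' i)) (at t)"
    unfolding D_def by (rule has_grad_linear[OF g])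
  have P': "((\<lambda>s. P (\<gamma> s)) has_real_derivative (\<Sum>i<n. P1 i (\<gamma> t) * \<gamma>' i)) (at t)"
    by (rule has_gradD[OF has_grad_ratio(1)]) (auto intro: g)
  have Q': "((\<lambda>s. Q (\<gamma> s)) has_real_derivative (\<Sum>i<n. Q1 i (\<gamma> t) * \<gamma>' i)) (at t)"
    by (rule has_gradD[OF has_grad_ratio(2)]) (auto intro: g)
  let ?p = "P (\<gamma> t)" and ?q = "Q (\<gamma> t)" and ?d = "D (\<gamma> t)"
  have "((\<lambda>s. \<Phi> (\<gamma> s)) has_real_derivative (\<Sum>i<n. - (a i * e i (\<gamma> t)) * \<gamma>' i) -
     ((\<Sum>i<n. - (w * e i (\<gamma> t)) * \<gamma>' i) * (?p * ?q) + ((\<Sum>i<n. P1 i (\<gamma> t) * \<gamma>' i) * ?q + (\<Sum>i<n. Q1 i (\<gamma> t) * \<gamma>' i) * ?p) * ?d)) (at t)"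
    unfolding \<Phi>_def by (intro DERIV_diff DERIV_mult has_grad_linear g D' P' Q')
  also have "(\<Sum>i<n. - (a i * e i (\<gamma> t)) * \<gamma>' i) -
     ((\<Sum>i<n. - (w * e i (\<gamma> t)) * \<gamma>' i) * (?p * ?q) + ((\<Sum>i<n. P1 i (\<gamma> t) * \<gamma>' i) * ?q + (\<Sum>i<n. Q1 i (\<gamma> t) * \<gamma>' i) * ?p) * ?d)
    = (\<Sum>i<n. - (a i * e i (\<gamma> t)) * \<gamma>' i - ((- (w * e i (\<gamma> t)) * \<gamma>' i) * (?p * ?q) + ((P1 i (\<gamma> t) * \<gamma>' i) * ?q + (Q1 i (\<gamma> t) * \<gamma>' i) * ?p) * ?d))"
    by (simp only: sum_distrib_left sum_distrib_right sum_subtractf[symmetric] sum.distrib[symmetric])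
  also have "\<dots> = (\<Sum>i<n. \<Phi>1 i (\<gamma> t) * \<gamma>' i)"
  proof (intro sum.cong refl)
    fix i
    have pq: "P1 i (\<gamma> t) * ?d = - (e i (\<gamma> t) * (b i - w * ?p))" "Q1 i (\<gamma> t) * ?d = - (e i (\<gamma> t) * (c i - w * ?q))"
      using D_pos[of "\<gamma> t"] by (simp_all add: P1_def Q1_def)
    have "- (a i * e i (\<gamma> t)) * \<gamma>' i - ((- (w * e i (\<gamma> t)) * \<gamma>' i) * (?p * ?q) + ((P1 i (\<gamma> t) * \<gamma>' i) * ?q + (Q1 i (\<gamma> t) * \<gamma>' i) * ?p) * ?d)
      = - (a i * e i (\<gamma> t)) * \<gamma>' i - ((- (w * e i (\<gamma> t)) * \<gamma>' i) * (?p * ?q) + (((P1 i (\<gamma> t) * ?d) * \<gamma>' i) * ?q + ((Q1 i (\<gamma> t) * ?d) * \<gamma>' i) * ?p))"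
      by (simp add: algebra_simps)
    also have "\<dots> = \<Phi>1 i (\<gamma> t) * \<gamma>' i" unfolding pq \<Phi>1_def m_def by (simp add: algebra_simps)
    finally show "- (a i * e i (\<gamma> t)) * \<gamma>' i - ((- (w * e i (\<gamma> t)) * \<gamma>' i) * (?p * ?q) + ((P1 i (\<gamma> t) * \<gamma>' i) * ?q + (Q1 i (\<gamma> t) * \<gamma>' i) * ?p) * ?d) = \<Phi>1 i (\<gamma> t) * \<gamma>' i" .
  qed
  finally show "((\<lambda>s. \<Phi> (\<gamma> s)) has_real_derivative (\<Sum>i<n. \<Phi>1 i (\<gamma> t) * \<gamma>' i)) (at t)" .
qed

lemma has_grad_\<Phi>1:
  assumes i: "i < n"
  shows "has_grad {..<n} (\<Phi>1 i) (\<Phi>2 i)"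
  unfolding has_grad_def
proof (intro allI impI)
  fix \<gamma> \<gamma>' t assume "\<forall>i\<in>{..<n}. ((\<lambda>s. \<gamma> s i) has_real_derivative \<gamma>' i) (at t)"
  then have g: "((\<lambda>s. \<gamma> s i) has_real_derivative \<gamma>' i) (at t)" if "i < n" for i using that by auto
  have P': "((\<lambda>s. P (\<gamma> s)) has_real_derivative (\<Sum>i<n. P1 i (\<gamma> t) * \<gamma>' i)) (at t)"
    by (rule has_gradD[OF has_grad_ratio(1)]) (auto intro: g)
  have Q': "((\<lambda>s. Q (\<gamma> s)) has_real_derivative (\<Sum>i<n. Q1 i (\<gamma> t) * \<gamma>' i)) (at t)"
    by (rule has_gradD[OF has_grad_ratio(2)]) (auto intro: g)
  have e': "((\<lambda>s. e i (\<gamma> s)) has_real_derivative - (e i (\<gamma> t)) * \<gamma>' i) (at t)"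
    unfolding e_def by (rule derivative_eq_intros g i refl | simp)+
  let ?p = "P (\<gamma> t)" and ?q = "Q (\<gamma> t)" and ?SP = "\<Sum>i<n. P1 i (\<gamma> t) * \<gamma>' i" and ?SQ = "\<Sum>i<n. Q1 i (\<gamma> t) * \<gamma>' i"
  have m': "((\<lambda>s. m i (\<gamma> s)) has_real_derivative 0 - b i * ?SQ - c i * ?SP + w * (?SP * ?q + ?SQ * ?p)) (at t)"
    unfolding m_def by (intro DERIV_add DERIV_diff DERIV_cmult DERIV_mult P' Q' DERIV_const)
  have m1: "0 - b i * ?SQ - c i * ?SP + w * (?SP * ?q + ?SQ * ?p) = (\<Sum>k<n. m1 i k (\<gamma> t) * \<gamma>' k)"
  proof -
    have "(\<Sum>k<n. m1 i k (\<gamma> t) * \<gamma>' k) = (\<Sum>k<n. w * ((P1 k (\<gamma> t) * \<gamma>' k) * ?q + (Q1 k (\<gamma> t) * \<gamma>' k) * ?p) - b i * (Q1 k (\<gamma> t) * \<gamma>' k) - c i * (P1 k (\<gamma> t) * \<gamma>' k))"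
      by (intro sum.cong refl) (simp add: m1_def algebra_simps)
    also have "\<dots> = w * (?SP * ?q + ?SQ * ?p) - b i * ?SQ - c i * ?SP"
      by (simp only: sum_distrib_left[symmetric] sum_distrib_right[symmetric] sum_subtractf sum.distrib)
    finally show ?thesis by simp
  qed
  have "((\<lambda>s. \<Phi>1 i (\<gamma> s)) has_real_derivative - ((- (e i (\<gamma> t)) * \<gamma>' i) * m i (\<gamma> t) + (\<Sum>k<n. m1 i k (\<gamma> t) * \<gamma>' k) * e i (\<gamma> t))) (at t)"
    unfolding \<Phi>1_def by (intro DERIV_minus DERIV_mult e' m'[unfolded m1])
  also have "- ((- (e i (\<gamma> t)) * \<gamma>' i) * m i (\<gamma> t) + (\<Sum>k<n. m1 i k (\<gamma> t) * \<gamma>' k) * e i (\<gamma> t)) = (\<Sum>k<n. \<Phi>2 i k (\<gamma> t) * \<gamma>' k)"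
  proof -
    have "(\<Sum>k<n. \<Phi>2 i k (\<gamma> t) * \<gamma>' k) = (\<Sum>k<n. (if k = i then e i (\<gamma> t) * m i (\<gamma> t) * \<gamma>' i else 0) - e i (\<gamma> t) * (m1 i k (\<gamma> t) * \<gamma>' k))"
      by (intro sum.cong refl) (auto simp: \<Phi>2_def algebra_simps)
    also have "\<dots> = e i (\<gamma> t) * m i (\<gamma> t) * \<gamma>' i - e i (\<gamma> t) * (\<Sum>k<n. m1 i k (\<gamma> t) * \<gamma>' k)"
      using i by (simp add: sum_subtractf sum_distrib_left)
    finally show ?thesis by (simp add: algebra_simps)
  qed
  finally show "((\<lambda>s. \<Phi>1 i (\<gamma> s)) has_real_derivative (\<Sum>k<n. \<Phi>2 i k (\<gamma> t) * \<gamma>' k)) (at t)" .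
qed

end

section \<open>Variance of the Stein kernel\<close>

lemma am_gm_4: "x * y * (z * u) \<le> (x^4 + y^4 + z^4 + u^4) / (4::real)"
proof -
  have s: "p * q \<le> (p\<^sup>2 + q\<^sup>2) / 2" for p q :: real
    using sum_squares_bound[of p q] by simp
  have "x * y * (z * u) \<le> ((x * y)\<^sup>2 + (z * u)\<^sup>2) / 2" by (rule s)
  also have "\<dots> = (x\<^sup>2 * y\<^sup>2 + z\<^sup>2 * u\<^sup>2) / 2" by (simp add: power_mult_distrib)
  also have "\<dots> \<le> ((x\<^sup>2)\<^sup>2 + (y\<^sup>2)\<^sup>2 + ((z\<^sup>2)\<^sup>2 + (u\<^sup>2)\<^sup>2)) / 4"
    using s[of "x\<^sup>2" "y\<^sup>2"] s[of "z\<^sup>2" "u\<^sup>2"] by (simp add: field_simps)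
  finally show ?thesis by simp
qed

lemma add_power4_le: "(x + y)^4 \<le> 8 * (x^4 + y^4 :: real)"
proof -
  have s: "(p + q)\<^sup>2 \<le> 2 * (p\<^sup>2 + q\<^sup>2)" for p q :: real
    using sum_squares_bound[of p q] by (simp add: power2_sum)
  have "((x + y)\<^sup>2)\<^sup>2 \<le> (2 * (x\<^sup>2 + y\<^sup>2))\<^sup>2" by (intro power_mono s) simp
  also have "\<dots> = 4 * (x\<^sup>2 + y\<^sup>2)\<^sup>2" by (simp only: power_mult_distrib) simp
  also have "\<dots> \<le> 4 * (2 * ((x\<^sup>2)\<^sup>2 + (y\<^sup>2)\<^sup>2))" by (intro mult_left_mono s) simp
  finally show ?thesis by simp
qed

lemma exp_growth_power: "exp_growth F \<Longrightarrow> exp_growth (\<lambda>x. F x ^ k)"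
  by (induction k) (auto intro: exp_growth_const exp_growth_mult)

context quadrature
begin

lemma Di_power: "Di x ^ 16 \<le> (\<Sum>i<n. w * exp (16 * x i))"
proof -
  have "(\<Sum>i<n. w *\<^sub>R exp (1 * x i)) ^ 16 \<le> (\<Sum>i<n. w * (exp (1 * x i)) ^ 16)"
    by (rule convex_on_sum[OF _ _ convex_power_even[of 16]]) (use n w in auto)
  then show ?thesis by (simp add: Di_def flip: exp_of_nat_mult)
qed

text \<open>Products are separated by the inequality between arithmetic and geometric means, so that only
  exponential moments of single coordinates remain.\<close>
lemma \<sigma>_power: "\<sigma> i k x ^ 4 \<le> 8 * exp ((-4) * x i) + 2 * (exp ((-16) * x i) + exp ((-16) * x k) + (\<Sum>i<n. w * exp (16 * x i)) + 1)"
proof -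
  have e4: "e i x ^ 4 = exp ((-4) * x i)" for i by (simp add: e_def flip: exp_of_nat_mult)
  have e16: "e i x ^ 16 = exp ((-16) * x i)" for i by (simp add: e_def flip: exp_of_nat_mult)
  have "(e i x * (e k x * Di x)) ^ 4 = (e i x)^4 * (e k x)^4 * ((Di x)^4 * 1)" by (simp add: power_mult_distrib)
  also have "\<dots> \<le> (((e i x)^4)^4 + ((e k x)^4)^4 + ((Di x)^4)^4 + 1^4) / 4" by (rule am_gm_4)
  also have "\<dots> = (e i x ^ 16 + e k x ^ 16 + Di x ^ 16 + 1) / 4" by (simp flip: power_mult)
  also have "\<dots> \<le> (exp ((-16) * x i) + exp ((-16) * x k) + (\<Sum>i<n. w * exp (16 * x i)) + 1) / 4"
    unfolding e16 by (intro divide_right_mono add_mono order_refl Di_power) simp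
  finally have "(e i x * (e k x * Di x)) ^ 4 \<le> (exp ((-16) * x i) + exp ((-16) * x k) + (\<Sum>i<n. w * exp (16 * x i)) + 1) / 4" .
  moreover have "\<sigma> i k x ^ 4 \<le> 8 * (e i x ^ 4 + (e i x * (e k x * Di x)) ^ 4)"
    unfolding \<sigma>_def by (rule add_power4_le)
  moreover have "y \<le> 8 * p + 2 * S" if "q \<le> S / 4" "y \<le> 8 * (p + q)" for y p q S :: real using that by simp
  ultimately show ?thesis unfolding e4 by blast
qed

context
  fixes \<Gamma> :: "nat \<Rightarrow> nat \<Rightarrow> real" and v :: real
  assumes v: "\<And>i. i < n \<Longrightarrow> \<Gamma> i i \<le> v" and v0: "0 \<le> v"
begin

abbreviation moment_bound :: real where "moment_bound \<equiv> 16 * exp (128 * v)"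

text \<open>The exponent \<open>128\<close> is \<open>16\<^sup>2 / 2\<close>, from the largest multiple \<open>16\<close> of a coordinate that occurs.\<close>
lemma exp_moment_le:
  assumes g: "gauss_fam M X \<Gamma>" and i: "i < n" and k: "k\<^sup>2 \<le> 256"
  shows "(LINT \<omega>|M. exp (k * X i \<omega>)) \<le> exp (128 * v)"
proof -
  have "k\<^sup>2 * \<Gamma> i i \<le> 256 * v"
    using v[OF i] k gauss_fam_exp_moment(2)[OF g, of i] by (intro mult_mono) auto
  then show ?thesis unfolding gauss_fam_exp_moment(1)[OF g] by simp
qed

lemma moments:
  assumes g: "gauss_fam M X \<Gamma>" and i: "i < n" "k < n"
  shows "(LINT \<omega>|M. e i (\<lambda>i. X i \<omega>) ^ 4) \<le> moment_bound"
    and "(LINT \<omega>|M. \<sigma> i k (\<lambda>i. X i \<omega>) ^ 4) \<le> moment_bound"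
proof -
  interpret prob_space M by (rule gauss_famD(1)[OF g])
  let ?K = "exp (128 * v)"
  have K1: "1 \<le> ?K" using v0 by simp
  have ei: "integrable M (\<lambda>\<omega>. exp (t * X i \<omega>))" for t i by (rule gauss_fam_integrable[OF g exp_growth_exp])
  have e4: "e i x ^ 4 = exp ((-4) * x i)" for i x by (simp add: e_def flip: exp_of_nat_mult)
  have "(LINT \<omega>|M. e i (\<lambda>i. X i \<omega>) ^ 4) \<le> ?K"
    unfolding e4 by (rule exp_moment_le[OF g i(1)]) simp
  also have "?K \<le> moment_bound" by simp
  finally show "(LINT \<omega>|M. e i (\<lambda>i. X i \<omega>) ^ 4) \<le> moment_bound" .
  have "(LINT \<omega>|M. \<sigma> i k (\<lambda>i. X i \<omega>) ^ 4) \<le> (LINT \<omega>|M. 8 * exp ((-4) * X i \<omega>) + 2 * (exp ((-16) * X i \<omega>) + exp ((-16) * X k \<omega>) + (\<Sum>i<n. w * exp (16 * X i \<omega>)) + 1))"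
    by (intro integral_mono \<sigma>_power gauss_fam_integrable[OF g exp_growth_power[OF growth_\<sigma>]]
        Bochner_Integration.integrable_add integrable_mult_right Bochner_Integration.integrable_sum ei integrable_const)
  also have "\<dots> = 8 * (LINT \<omega>|M. exp ((-4) * X i \<omega>)) + 2 * ((LINT \<omega>|M. exp ((-16) * X i \<omega>)) + (LINT \<omega>|M. exp ((-16) * X k \<omega>)) + (\<Sum>i<n. w * (LINT \<omega>|M. exp (16 * X i \<omega>))) + 1)"
    using ei[of "-4"] ei[of "-16"] ei[of 16] by (simp add: prob_space)
  also have "\<dots> \<le> 8 * ?K + 2 * (?K + ?K + (\<Sum>i<n. w * ?K) + 1)"
    using i w by (intro add_mono mult_left_mono sum_mono exp_moment_le[OF g]) auto
  also have "(\<Sum>i<n. w * ?K) = ?K" using w(2) by (simp add: mult.assoc[symmetric])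
  also have "8 * ?K + 2 * (?K + ?K + ?K + 1) \<le> moment_bound" using K1 by simp
  finally show "(LINT \<omega>|M. \<sigma> i k (\<lambda>i. X i \<omega>) ^ 4) \<le> moment_bound" .
qed

text \<open>The random part of a summand in the derivative of the kernel: a factor from the Hessian at one of
  the two arguments and a factor from the gradient at the other one.\<close>
definition \<tau> :: "real \<Rightarrow> nat \<Rightarrow> nat \<Rightarrow> nat \<Rightarrow> (bool \<times> nat \<Rightarrow> real) \<Rightarrow> real" where
  "\<tau> \<theta> i j k z = \<sigma> i k (rot \<theta> z) * e j (rot 0 z) + \<sigma> i k (rot 0 z) * e j (rot \<theta> z)"

lemma growth_\<tau>: "exp_growth (\<tau> \<theta> i j k)"
  unfolding \<tau>_def[abs_def] by (intro exp_growth_add exp_growth_mult exp_growth_rot growth_\<sigma> growth_e)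

lemma \<tau>_pos: "0 < \<tau> \<theta> i j k z"
  unfolding \<tau>_def by (intro add_pos_pos mult_pos_pos \<sigma>_pos e_pos)

lemma \<tau>_second_moment:
  assumes g: "gauss_fam M V (pair_cov \<Gamma>)" and sym: "\<And>i j. \<Gamma> i j = \<Gamma> j i" and i: "i < n" "j < n" "k < n"
  shows "(LINT \<omega>|M. (\<tau> \<theta> i j k (\<lambda>p. V p \<omega>))\<^sup>2) \<le> 4 * moment_bound"
proof -
  note gr = gauss_fam_rot[OF g sym]
  let ?A = "\<lambda>\<theta> \<omega>. \<sigma> i k (rot \<theta> (\<lambda>p. V p \<omega>)) ^ 4" and ?B = "\<lambda>\<theta> \<omega>. e j (rot \<theta> (\<lambda>p. V p \<omega>)) ^ 4"
  have AB: "integrable M (?A \<theta>)" "integrable M (?B \<theta>)" for \<theta>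
    by (rule gauss_fam_integrable[OF gr exp_growth_power[OF growth_\<sigma>]] gauss_fam_integrable[OF gr exp_growth_power[OF growth_e]])+
  have pw: "(\<tau> \<theta> i j k z)\<^sup>2 \<le> \<sigma> i k (rot \<theta> z)^4 + e j (rot 0 z)^4 + (\<sigma> i k (rot 0 z)^4 + e j (rot \<theta> z)^4)" for z
  proof -
    have s: "(p * q + r * t)\<^sup>2 \<le> p^4 + q^4 + (r^4 + t^4)" for p q r t :: real
    proof -
      have "(p * q + r * t)\<^sup>2 \<le> 2 * ((p * q)\<^sup>2 + (r * t)\<^sup>2)"
        using sum_squares_bound[of "p * q" "r * t"] by (simp add: power2_sum)
      also have "\<dots> = 2 * p\<^sup>2 * q\<^sup>2 + 2 * r\<^sup>2 * t\<^sup>2" by (simp add: power_mult_distrib)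
      also have "\<dots> \<le> (p\<^sup>2)\<^sup>2 + (q\<^sup>2)\<^sup>2 + ((r\<^sup>2)\<^sup>2 + (t\<^sup>2)\<^sup>2)"
        by (intro add_mono sum_squares_bound)
      finally show ?thesis by simp
    qed
    show ?thesis unfolding \<tau>_def by (rule s)
  qed
  have "(LINT \<omega>|M. (\<tau> \<theta> i j k (\<lambda>p. V p \<omega>))\<^sup>2) \<le> (LINT \<omega>|M. ?A \<theta> \<omega> + ?B 0 \<omega> + (?A 0 \<omega> + ?B \<theta> \<omega>))"
    by (intro integral_mono pw gauss_fam_integrable[OF g exp_growth_power[OF growth_\<tau>]] Bochner_Integration.integrable_add AB)
  also have "\<dots> = (LINT \<omega>|M. ?A \<theta> \<omega>) + (LINT \<omega>|M. ?B 0 \<omega>) + ((LINT \<omega>|M. ?A 0 \<omega>) + (LINT \<omega>|M. ?B \<theta> \<omega>))"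
    using AB by simp
  also have "\<dots> \<le> moment_bound + moment_bound + (moment_bound + moment_bound)"
    using moments(2)[OF gr i(1,3)] moments(1)[OF gr i(2,2)] by (intro add_mono) simp_all
  finally show ?thesis by simp
qed

text \<open>Only \<open>rot \<theta> z\<close> depends on the second copy, which explains the two factors that depend on \<open>fst p\<close>.\<close>
definition kernel_grad :: "real \<Rightarrow> bool \<times> nat \<Rightarrow> (bool \<times> nat \<Rightarrow> real) \<Rightarrow> real" where
  "kernel_grad \<theta> p z = (\<Sum>i<n. \<Sum>j<n. \<Gamma> i j *
     ((if fst p then cos \<theta> else sin \<theta>) * \<Phi>2 i (snd p) (rot \<theta> z) * \<Phi>1 j (rot 0 z) +
      (if fst p then 1 else 0) * \<Phi>1 i (rot \<theta> z) * \<Phi>2 j (snd p) (rot 0 z)))"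

lemma has_grad_kernel: "has_grad (UNIV \<times> {..<n}) (stein_kernel \<Gamma> {..<n} \<Phi>1 \<theta>) (kernel_grad \<theta>)"
  unfolding has_grad_def
proof (intro allI impI)
  fix \<gamma> :: "real \<Rightarrow> bool \<times> nat \<Rightarrow> real" and \<gamma>' t
  assume "\<forall>p\<in>UNIV \<times> {..<n}. ((\<lambda>s. \<gamma> s p) has_real_derivative \<gamma>' p) (at t)"
  then have g: "((\<lambda>s. \<gamma> s (b, i)) has_real_derivative \<gamma>' (b, i)) (at t)" if "i < n" for b i using that by auto
  have r: "((\<lambda>s. rot \<theta> (\<gamma> s) i) has_real_derivative (cos \<theta> * \<gamma>' (True, i) + sin \<theta> * \<gamma>' (False, i))) (at t)" if "i < n" for i \<theta>
    unfolding rot_def by (intro DERIV_add DERIV_cmult g that)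
  have d: "((\<lambda>s. \<Phi>1 i (rot \<theta> (\<gamma> s))) has_real_derivative
     (\<Sum>k<n. \<Phi>2 i k (rot \<theta> (\<gamma> t)) * (cos \<theta> * \<gamma>' (True, k) + sin \<theta> * \<gamma>' (False, k)))) (at t)" if "i < n" for i \<theta>
    by (rule has_gradD[OF has_grad_\<Phi>1[OF that]]) (auto intro: r)
  let ?d = "\<lambda>\<theta> i. (\<Sum>k<n. \<Phi>2 i k (rot \<theta> (\<gamma> t)) * (cos \<theta> * \<gamma>' (True, k) + sin \<theta> * \<gamma>' (False, k)))"
  have "((\<lambda>s. \<Sum>i<n. \<Sum>j<n. \<Gamma> i j * (\<Phi>1 i (rot \<theta> (\<gamma> s)) * \<Phi>1 j (rot 0 (\<gamma> s)))) has_real_derivative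
    (\<Sum>i<n. \<Sum>j<n. \<Gamma> i j * (?d \<theta> i * \<Phi>1 j (rot 0 (\<gamma> t)) + ?d 0 j * \<Phi>1 i (rot \<theta> (\<gamma> t))))) (at t)"
    by (intro DERIV_sum DERIV_cmult DERIV_mult d) auto
  moreover have "(\<Sum>i<n. \<Sum>j<n. \<Gamma> i j * (?d \<theta> i * \<Phi>1 j (rot 0 (\<gamma> t)) + ?d 0 j * \<Phi>1 i (rot \<theta> (\<gamma> t)))) =
    (\<Sum>p\<in>UNIV \<times> {..<n}. kernel_grad \<theta> p (\<gamma> t) * \<gamma>' p)"
  proof -
    let ?t = "\<lambda>i j p. \<Gamma> i j * ((if fst p then cos \<theta> else sin \<theta>) * \<Phi>2 i (snd p) (rot \<theta> (\<gamma> t)) * \<Phi>1 j (rot 0 (\<gamma> t)) +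
      (if fst p then 1 else 0) * \<Phi>1 i (rot \<theta> (\<gamma> t)) * \<Phi>2 j (snd p) (rot 0 (\<gamma> t))) * \<gamma>' p"
    have "(\<Sum>p\<in>UNIV \<times> {..<n}. kernel_grad \<theta> p (\<gamma> t) * \<gamma>' p) = (\<Sum>p\<in>UNIV \<times> {..<n}. \<Sum>i<n. \<Sum>j<n. ?t i j p)"
      unfolding kernel_grad_def sum_distrib_right ..
    also have "\<dots> = (\<Sum>i<n. \<Sum>j<n. \<Sum>p\<in>UNIV \<times> {..<n}. ?t i j p)"
      by (subst sum.swap, rule sum.cong[OF refl], rule sum.swap)
    also have "\<dots> = (\<Sum>i<n. \<Sum>j<n. \<Gamma> i j * (?d \<theta> i * \<Phi>1 j (rot 0 (\<gamma> t)) + ?d 0 j * \<Phi>1 i (rot \<theta> (\<gamma> t))))"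
    proof (intro sum.cong refl)
      fix i j
      have "(\<Sum>p\<in>UNIV \<times> {..<n}. ?t i j p) = (\<Sum>b\<in>UNIV. \<Sum>k<n. ?t i j (b, k))"
        by (simp add: sum.cartesian_product case_prod_beta)
      also have "\<dots> = (\<Sum>k<n. ?t i j (True, k) + ?t i j (False, k))" by (simp add: UNIV_bool sum.distrib)
      also have "\<dots> = (\<Sum>k<n. \<Gamma> i j * (\<Phi>2 i k (rot \<theta> (\<gamma> t)) * (cos \<theta> * \<gamma>' (True, k) + sin \<theta> * \<gamma>' (False, k)) * \<Phi>1 j (rot 0 (\<gamma> t))
         + \<Phi>2 j k (rot 0 (\<gamma> t)) * (cos 0 * \<gamma>' (True, k) + sin 0 * \<gamma>' (False, k)) * \<Phi>1 i (rot \<theta> (\<gamma> t))))"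
        by (intro sum.cong refl) (simp add: algebra_simps)
      also have "\<dots> = \<Gamma> i j * (?d \<theta> i * \<Phi>1 j (rot 0 (\<gamma> t)) + ?d 0 j * \<Phi>1 i (rot \<theta> (\<gamma> t)))"
        by (simp only: sum_distrib_left[symmetric] sum_distrib_right[symmetric] sum.distrib)
      finally show "(\<Sum>p\<in>UNIV \<times> {..<n}. ?t i j p) = \<Gamma> i j * (?d \<theta> i * \<Phi>1 j (rot 0 (\<gamma> t)) + ?d 0 j * \<Phi>1 i (rot \<theta> (\<gamma> t)))" .
    qed
    finally show ?thesis by simp
  qed
  ultimately show "((\<lambda>s. stein_kernel \<Gamma> {..<n} \<Phi>1 \<theta> (\<gamma> s)) has_real_derivative (\<Sum>p\<in>UNIV \<times> {..<n}. kernel_grad \<theta> p (\<gamma> t) * \<gamma>' p)) (at t)"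
    by (simp add: stein_kernel_def rot_0 mult.assoc)
qed

text \<open>The deterministic part of a summand in the derivative of the kernel with respect to the value at
  point \<open>k\<close>.\<close>
definition weight :: "nat \<Rightarrow> nat \<times> nat \<Rightarrow> real" where
  "weight k r = (8 * L\<^sup>2)\<^sup>2 * w * (\<bar>\<Gamma> (fst r) (snd r)\<bar> * ((if k = fst r then w else 0) + w\<^sup>2))"

lemma weight_nonneg: "0 \<le> weight k r" unfolding weight_def using w by simp

text \<open>The symmetry of \<open>\<Gamma>\<close> lets the two terms of the product rule share the weight.\<close>
lemma kernel_grad_bound:
  assumes p: "snd p < n" and sym: "\<And>i j. \<Gamma> i j = \<Gamma> j i"
  shows "\<bar>kernel_grad \<theta> p z\<bar> \<le> (\<Sum>r\<in>{..<n} \<times> {..<n}. weight (snd p) r * \<tau> \<theta> (fst r) (snd r) (snd p) z)"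
proof -
  define k where "k = snd p"
  define C where "C = 8 * L\<^sup>2"
  define o' where "o' i = (if k = i then w else 0) + w\<^sup>2" for i
  have C: "0 \<le> C" by (simp add: C_def)
  have o': "0 \<le> o' i" for i using w by (simp add: o'_def)
  have k: "k < n" using p by (simp add: k_def)
  have F1: "\<bar>\<Phi>1 j x\<bar> \<le> C * w * e j x" if "j < n" for j x using \<Phi>1_bound[OF that] by (simp add: C_def)
  have F2: "\<bar>\<Phi>2 i k x\<bar> \<le> C * o' i * \<sigma> i k x" if "i < n" for i x using \<Phi>2_bound[OF that k] by (simp add: C_def o'_def)
  have t: "\<bar>s * \<Phi>2 i k x * \<Phi>1 j y\<bar> \<le> C\<^sup>2 * w * o' i * (\<sigma> i k x * e j y)" if "i < n" "j < n" "\<bar>s\<bar> \<le> 1" for i j s x y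
  proof -
    have "\<bar>s\<bar> * \<bar>\<Phi>2 i k x\<bar> * \<bar>\<Phi>1 j y\<bar> \<le> 1 * (C * o' i * \<sigma> i k x) * (C * w * e j y)"
      using that F1 F2 C o' w \<sigma>_pos[of i k x] by (intro mult_mono) (auto simp: less_imp_le)
    then show ?thesis by (simp add: abs_mult power2_eq_square mult_ac)
  qed
  have "\<bar>kernel_grad \<theta> p z\<bar> \<le> (\<Sum>i<n. \<Sum>j<n. \<bar>\<Gamma> i j\<bar> * (C\<^sup>2 * w * o' i * (\<sigma> i k (rot \<theta> z) * e j (rot 0 z)) + C\<^sup>2 * w * o' j * (\<sigma> j k (rot 0 z) * e i (rot \<theta> z))))"
    unfolding kernel_grad_def k_def[symmetric]
  proof (intro order_trans[OF sum_abs] sum_mono)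
    fix i j assume ij: "i \<in> {..<n}" "j \<in> {..<n}"
    let ?s = "if fst p then cos \<theta> else sin \<theta>" and ?s' = "if fst p then 1 else 0 :: real"
    have 1: "\<bar>?s * \<Phi>2 i k (rot \<theta> z) * \<Phi>1 j (rot 0 z)\<bar> \<le> C\<^sup>2 * w * o' i * (\<sigma> i k (rot \<theta> z) * e j (rot 0 z))"
      using ij by (intro t) auto
    have 2: "\<bar>?s' * \<Phi>2 j k (rot 0 z) * \<Phi>1 i (rot \<theta> z)\<bar> \<le> C\<^sup>2 * w * o' j * (\<sigma> j k (rot 0 z) * e i (rot \<theta> z))"
      using ij by (intro t) auto
    have 3: "?s' * \<Phi>1 i (rot \<theta> z) * \<Phi>2 j k (rot 0 z) = ?s' * \<Phi>2 j k (rot 0 z) * \<Phi>1 i (rot \<theta> z)" by simp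
    show "\<bar>\<Gamma> i j * (?s * \<Phi>2 i k (rot \<theta> z) * \<Phi>1 j (rot 0 z) + ?s' * \<Phi>1 i (rot \<theta> z) * \<Phi>2 j k (rot 0 z))\<bar>
      \<le> \<bar>\<Gamma> i j\<bar> * (C\<^sup>2 * w * o' i * (\<sigma> i k (rot \<theta> z) * e j (rot 0 z)) + C\<^sup>2 * w * o' j * (\<sigma> j k (rot 0 z) * e i (rot \<theta> z)))"
      unfolding abs_mult[of "\<Gamma> i j"] 3 by (intro mult_left_mono order_trans[OF abs_triangle_ineq] add_mono 1 2) simp
  qed
  also have "\<dots> = (\<Sum>i<n. \<Sum>j<n. \<bar>\<Gamma> i j\<bar> * (C\<^sup>2 * w * o' i * (\<sigma> i k (rot \<theta> z) * e j (rot 0 z)))) +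
     (\<Sum>i<n. \<Sum>j<n. \<bar>\<Gamma> i j\<bar> * (C\<^sup>2 * w * o' j * (\<sigma> j k (rot 0 z) * e i (rot \<theta> z))))"
    by (simp only: distrib_left sum.distrib)
  also have "(\<Sum>i<n. \<Sum>j<n. \<bar>\<Gamma> i j\<bar> * (C\<^sup>2 * w * o' j * (\<sigma> j k (rot 0 z) * e i (rot \<theta> z)))) =
     (\<Sum>i<n. \<Sum>j<n. \<bar>\<Gamma> i j\<bar> * (C\<^sup>2 * w * o' i * (\<sigma> i k (rot 0 z) * e j (rot \<theta> z))))"
    by (subst sum.swap) (simp add: sym)
  also have "(\<Sum>i<n. \<Sum>j<n. \<bar>\<Gamma> i j\<bar> * (C\<^sup>2 * w * o' i * (\<sigma> i k (rot \<theta> z) * e j (rot 0 z)))) + \<dots> =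
    (\<Sum>i<n. \<Sum>j<n. weight k (i, j) * \<tau> \<theta> i j k z)"
    unfolding sum.distrib[symmetric] by (intro sum.cong refl) (simp add: weight_def \<tau>_def C_def o'_def algebra_simps)
  also have "\<dots> = (\<Sum>r\<in>{..<n} \<times> {..<n}. weight k r * \<tau> \<theta> (fst r) (snd r) k z)"
    by (simp add: sum.cartesian_product case_prod_beta')
  finally show ?thesis by (simp add: k_def)
qed

text \<open>The sum over the second point costs \<open>\<kappa>\<close>; the sum over the first one costs \<open>w\<close>, both for the diagonal
  and, since \<open>n w = 1\<close>, for the density part.\<close>
lemma weight_sum:
  assumes k: "k < n" and \<kappa>: "\<And>i. i < n \<Longrightarrow> (\<Sum>j<n. \<bar>\<Gamma> i j\<bar> * w) \<le> \<kappa>"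
  shows "(\<Sum>r\<in>{..<n} \<times> {..<n}. weight k r) \<le> (8 * L\<^sup>2)\<^sup>2 * (2 * w * \<kappa>)"
proof -
  have "(\<Sum>r\<in>{..<n} \<times> {..<n}. weight k r) = (\<Sum>i<n. \<Sum>j<n. weight k (i, j))"
    by (simp add: sum.cartesian_product)
  also have "\<dots> = (\<Sum>i<n. (8 * L\<^sup>2)\<^sup>2 * (((if k = i then w else 0) + w\<^sup>2) * (\<Sum>j<n. \<bar>\<Gamma> i j\<bar> * w)))"
    by (simp only: weight_def fst_conv snd_conv sum_distrib_left) (simp only: mult_ac)
  also have "\<dots> \<le> (\<Sum>i<n. (8 * L\<^sup>2)\<^sup>2 * (((if k = i then w else 0) + w\<^sup>2) * \<kappa>))"
    using w \<kappa> by (intro sum_mono mult_left_mono) auto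
  also have "\<dots> = (8 * L\<^sup>2)\<^sup>2 * ((\<Sum>i<n. (if k = i then w else 0) + w\<^sup>2) * \<kappa>)"
    by (simp only: sum_distrib_left sum_distrib_right)
  also have "(\<Sum>i<n. (if k = i then w else 0) + w\<^sup>2) = 2 * w"
    using k w(2) by (simp add: sum.distrib power2_eq_square mult.assoc[symmetric])
  finally show ?thesis .
qed

text \<open>Each of the two derivatives of the kernel contributes \<open>\<kappa> w\<close>, and summing \<open>w\<^sup>2 |\<Gamma> k l|\<close> over the
  remaining pair of points contributes the third factor \<open>\<kappa>\<close>.\<close>
theorem variance_kernel_le:
  assumes g: "gauss_fam M X \<Gamma>" and \<kappa>: "\<And>i. i < n \<Longrightarrow> (\<Sum>j<n. \<bar>\<Gamma> i j\<bar> * w) \<le> \<kappa>"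
  shows "prob_space.variance (M \<Otimes>\<^sub>M M) (\<lambda>\<omega>. stein_kernel \<Gamma> {..<n} \<Phi>1 \<theta> (pair_path X \<omega>))
    \<le> 32 * moment_bound * (8 * L\<^sup>2)^4 * \<kappa>^3"
proof -
  note sym = gauss_famD(3)[OF g]
  define N where "N = M \<Otimes>\<^sub>M M"
  define Z where "Z = pair_fam X"
  have gN: "gauss_fam N Z (pair_cov \<Gamma>)" unfolding N_def Z_def by (rule gauss_fam_pair[OF g])
  have gNN: "gauss_fam (N \<Otimes>\<^sub>M N) (pair_fam Z) (pair_cov (pair_cov \<Gamma>))" by (rule gauss_fam_pair[OF gN])
  have symp: "pair_cov \<Gamma> p q = pair_cov \<Gamma> q p" for p q by (rule gauss_famD(3)[OF gN])
  let ?JJ = "(UNIV :: bool set) \<times> {..<n}"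
  let ?I = "{..<n} \<times> {..<n}"
  have "0 \<le> (\<Sum>j<n. \<bar>\<Gamma> 0 j\<bar> * w)" using w by (intro sum_nonneg) auto
  then have \<kappa>0: "0 \<le> \<kappa>" using \<kappa>[OF n] by (rule order_trans)
  let ?K = "4 * moment_bound"
  let ?R = "\<lambda>p z. (\<Sum>r\<in>?I. weight (snd p) r * \<tau> \<theta> (fst r) (snd r) (snd p) z)"
  have R0: "0 \<le> ?R p z" for p :: "bool \<times> nat" and z using weight_nonneg \<tau>_pos by (intro sum_nonneg mult_nonneg_nonneg) (auto simp: less_imp_le)
  have kg: "exp_growth (kernel_grad \<theta> p)" if "p \<in> ?JJ" for p
    unfolding kernel_grad_def[abs_def] using that
    by (intro exp_growth_sum exp_growth_mult exp_growth_add exp_growth_const exp_growth_rot growth_\<Phi>1 growth_\<Phi>2) auto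
  have sk: "exp_growth (stein_kernel \<Gamma> {..<n} \<Phi>1 \<theta>)"
    unfolding stein_kernel_def[abs_def] by (intro exp_growth_sum exp_growth_mult exp_growth_const exp_growth_rot exp_growth_fst growth_\<Phi>1)
  have Rg: "exp_growth (?R p)" for p :: "bool \<times> nat" by (intro exp_growth_sum exp_growth_mult exp_growth_const growth_\<tau>)
  have fstrot: "(\<lambda>p. Z p (fst \<omega>)) = rot 0 (pair_path Z \<omega>)" for \<omega> by (simp add: rot_0 pair_path_simps)
  show ?thesis
    unfolding N_def[symmetric] Z_def[symmetric]
  proof (rule poincare_type_bound[OF gN _ sk kg has_grad_kernel])
    fix \<eta> :: real
    interpret NN: prob_space "N \<Otimes>\<^sub>M N" by (rule gauss_famD(1)[OF gNN])
    note gr = gauss_fam_rot[OF gNN symp]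
    have single: "(LINT \<omega>|(N \<Otimes>\<^sub>M N). ?R p (rot \<eta> (pair_path Z \<omega>)) * ?R q (rot 0 (pair_path Z \<omega>))) \<le> ?K * ((8 * L\<^sup>2)\<^sup>2 * (2 * w * \<kappa>)) * ((8 * L\<^sup>2)\<^sup>2 * (2 * w * \<kappa>))"
      if pq: "p \<in> ?JJ" "q \<in> ?JJ" for p q
    proof -
      let ?T = "\<lambda>\<eta> p r \<omega>. \<tau> \<theta> (fst r) (snd r) (snd p) (rot \<eta> (pair_path Z \<omega>))"
      have T2: "integrable (N \<Otimes>\<^sub>M N) (\<lambda>\<omega>. (?T \<eta> p r \<omega>)\<^sup>2)" for \<eta> r and p :: "bool \<times> nat"
        by (rule gauss_fam_integrable[OF gr exp_growth_power[OF growth_\<tau>]])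
      have TT: "integrable (N \<Otimes>\<^sub>M N) (\<lambda>\<omega>. ?T \<eta> p r \<omega> * ?T 0 q s \<omega>)" for r s
        using gauss_fam_integrable[OF gNN exp_growth_mult[OF exp_growth_rot[OF growth_\<tau>] exp_growth_rot[OF growth_\<tau>]]] by simp
      have E: "(LINT \<omega>|(N \<Otimes>\<^sub>M N). ?T \<eta> p r \<omega> * ?T 0 q s \<omega>) \<le> ?K" if rs: "r \<in> ?I" "s \<in> ?I" for r s
      proof -
        have "(LINT \<omega>|(N \<Otimes>\<^sub>M N). ?T \<eta> p r \<omega> * ?T 0 q s \<omega>) \<le> (LINT \<omega>|(N \<Otimes>\<^sub>M N). ((?T \<eta> p r \<omega>)\<^sup>2 + (?T 0 q s \<omega>)\<^sup>2) / 2)"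
        proof (rule integral_mono)
          show "integrable (N \<Otimes>\<^sub>M N) (\<lambda>\<omega>. ((?T \<eta> p r \<omega>)\<^sup>2 + (?T 0 q s \<omega>)\<^sup>2) / 2)" using T2 by simp
          show "?T \<eta> p r \<omega> * ?T 0 q s \<omega> \<le> ((?T \<eta> p r \<omega>)\<^sup>2 + (?T 0 q s \<omega>)\<^sup>2) / 2" for \<omega>
            using sum_squares_bound[of "?T \<eta> p r \<omega>" "?T 0 q s \<omega>"] by simp
        qed (rule TT)
        also have "\<dots> = ((LINT \<omega>|(N \<Otimes>\<^sub>M N). (?T \<eta> p r \<omega>)\<^sup>2) + (LINT \<omega>|(N \<Otimes>\<^sub>M N). (?T 0 q s \<omega>)\<^sup>2)) / 2"
          using T2 by simp
        also have "\<dots> \<le> (?K + ?K) / 2"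
          using rs pq by (intro divide_right_mono add_mono \<tau>_second_moment[OF gr sym]) auto
        finally show ?thesis by simp
      qed
      have "(LINT \<omega>|(N \<Otimes>\<^sub>M N). ?R p (rot \<eta> (pair_path Z \<omega>)) * ?R q (rot 0 (pair_path Z \<omega>))) \<le> ?K * (\<Sum>r\<in>?I. weight (snd p) r) * (\<Sum>r\<in>?I. weight (snd q) r)"
        by (rule expectation_double_sum_le) (use weight_nonneg TT E in auto)
      also have "\<dots> \<le> ?K * ((8 * L\<^sup>2)\<^sup>2 * (2 * w * \<kappa>)) * ((8 * L\<^sup>2)\<^sup>2 * (2 * w * \<kappa>))"
        using pq w \<kappa>0 weight_sum[OF _ \<kappa>] weight_nonneg
        by (intro mult_mono mult_nonneg_nonneg sum_nonneg) auto
      finally show ?thesis .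
    qed
    let ?c = "?K * ((8 * L\<^sup>2)\<^sup>2 * (2 * w * \<kappa>)) * ((8 * L\<^sup>2)\<^sup>2 * (2 * w * \<kappa>))"
    have RRi: "integrable (N \<Otimes>\<^sub>M N) (\<lambda>\<omega>. ?R p (rot \<eta> (pair_path Z \<omega>)) * ?R q (rot 0 (pair_path Z \<omega>)))" for p q :: "bool \<times> nat"
      using gauss_fam_integrable[OF gNN exp_growth_mult[OF exp_growth_rot[OF Rg] exp_growth_rot[OF Rg]]] by simp
    have "(LINT \<omega>|(N \<Otimes>\<^sub>M N). (\<Sum>p\<in>?JJ. \<Sum>q\<in>?JJ. \<bar>pair_cov \<Gamma> p q\<bar> * \<bar>kernel_grad \<theta> p (rot \<eta> (pair_path Z \<omega>))\<bar> * \<bar>kernel_grad \<theta> q (\<lambda>j. Z j (fst \<omega>))\<bar>))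
      \<le> (LINT \<omega>|(N \<Otimes>\<^sub>M N). (\<Sum>p\<in>?JJ. \<Sum>q\<in>?JJ. \<bar>pair_cov \<Gamma> p q\<bar> * (?R p (rot \<eta> (pair_path Z \<omega>)) * ?R q (rot 0 (pair_path Z \<omega>)))))"
      unfolding fstrot
    proof (rule integral_mono)
      have "exp_growth (\<lambda>z. \<Sum>p\<in>?JJ. \<Sum>q\<in>?JJ. \<bar>pair_cov \<Gamma> p q\<bar> * \<bar>kernel_grad \<theta> p (rot \<eta> z)\<bar> * \<bar>kernel_grad \<theta> q (rot 0 z)\<bar>)"
        by (intro exp_growth_sum exp_growth_mult exp_growth_const exp_growth_abs exp_growth_rot kg)
      from gauss_fam_integrable[OF gNN this]
      show "integrable (N \<Otimes>\<^sub>M N) (\<lambda>\<omega>. \<Sum>p\<in>?JJ. \<Sum>q\<in>?JJ. \<bar>pair_cov \<Gamma> p q\<bar> * \<bar>kernel_grad \<theta> p (rot \<eta> (pair_path Z \<omega>))\<bar> * \<bar>kernel_grad \<theta> q (rot 0 (pair_path Z \<omega>))\<bar>)" by simp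
      show "integrable (N \<Otimes>\<^sub>M N) (\<lambda>\<omega>. \<Sum>p\<in>?JJ. \<Sum>q\<in>?JJ. \<bar>pair_cov \<Gamma> p q\<bar> * (?R p (rot \<eta> (pair_path Z \<omega>)) * ?R q (rot 0 (pair_path Z \<omega>))))"
        by (intro Bochner_Integration.integrable_sum integrable_mult_right RRi)
      fix \<omega>
      show "(\<Sum>p\<in>?JJ. \<Sum>q\<in>?JJ. \<bar>pair_cov \<Gamma> p q\<bar> * \<bar>kernel_grad \<theta> p (rot \<eta> (pair_path Z \<omega>))\<bar> * \<bar>kernel_grad \<theta> q (rot 0 (pair_path Z \<omega>))\<bar>)
        \<le> (\<Sum>p\<in>?JJ. \<Sum>q\<in>?JJ. \<bar>pair_cov \<Gamma> p q\<bar> * (?R p (rot \<eta> (pair_path Z \<omega>)) * ?R q (rot 0 (pair_path Z \<omega>))))"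
        unfolding mult.assoc
        by (intro sum_mono mult_left_mono mult_mono kernel_grad_bound sym R0) auto
    qed
    also have "\<dots> = (\<Sum>p\<in>?JJ. \<Sum>q\<in>?JJ. \<bar>pair_cov \<Gamma> p q\<bar> * (LINT \<omega>|(N \<Otimes>\<^sub>M N). ?R p (rot \<eta> (pair_path Z \<omega>)) * ?R q (rot 0 (pair_path Z \<omega>))))"
    proof -
      have "(LINT \<omega>|(N \<Otimes>\<^sub>M N). (\<Sum>p\<in>?JJ. \<Sum>q\<in>?JJ. \<bar>pair_cov \<Gamma> p q\<bar> * (?R p (rot \<eta> (pair_path Z \<omega>)) * ?R q (rot 0 (pair_path Z \<omega>))))) =
        (\<Sum>p\<in>?JJ. LINT \<omega>|(N \<Otimes>\<^sub>M N). (\<Sum>q\<in>?JJ. \<bar>pair_cov \<Gamma> p q\<bar> * (?R p (rot \<eta> (pair_path Z \<omega>)) * ?R q (rot 0 (pair_path Z \<omega>)))))"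
        by (intro Bochner_Integration.integral_sum Bochner_Integration.integrable_sum integrable_mult_right RRi)
      also have "\<dots> = (\<Sum>p\<in>?JJ. \<Sum>q\<in>?JJ. LINT \<omega>|(N \<Otimes>\<^sub>M N). \<bar>pair_cov \<Gamma> p q\<bar> * (?R p (rot \<eta> (pair_path Z \<omega>)) * ?R q (rot 0 (pair_path Z \<omega>))))"
        by (intro sum.cong refl Bochner_Integration.integral_sum integrable_mult_right RRi)
      finally show ?thesis by simp
    qed
    also have "\<dots> \<le> (\<Sum>p\<in>?JJ. \<Sum>q\<in>?JJ. \<bar>pair_cov \<Gamma> p q\<bar> * ?c)"
      by (intro sum_mono mult_left_mono single) auto
    also have "\<dots> = 2 * (\<Sum>k<n. (\<Sum>l<n. \<bar>\<Gamma> k l\<bar> * ?c))"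
    proof -
      have hs: "(\<Sum>p\<in>?JJ. h p) = (\<Sum>k<n. h (True, k)) + (\<Sum>k<n. h (False, k))" for h :: "bool \<times> nat \<Rightarrow> real"
      proof -
        have "(\<Sum>p\<in>?JJ. h p) = (\<Sum>b\<in>UNIV. \<Sum>k<n. h (b, k))" by (simp add: sum.cartesian_product case_prod_beta)
        then show ?thesis by (simp add: UNIV_bool)
      qed
      show ?thesis unfolding hs pair_cov_def by simp
    qed
    also have "\<dots> = 2 * (\<Sum>k<n. (\<Sum>l<n. \<bar>\<Gamma> k l\<bar> * w) * (16 * moment_bound * (8 * L\<^sup>2)^4 * w * \<kappa>\<^sup>2))"
    proof -
      have "x * ?c = (x * w) * (16 * moment_bound * (8 * L\<^sup>2)^4 * w * \<kappa>\<^sup>2)" for x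
        by (simp add: power2_eq_square power4_eq_xxxx)
      then show ?thesis by (simp only: sum_distrib_right)
    qed
    also have "\<dots> \<le> 2 * (\<Sum>k<n. \<kappa> * (16 * moment_bound * (8 * L\<^sup>2)^4 * w * \<kappa>\<^sup>2))"
      using \<kappa> w by (intro mult_left_mono sum_mono mult_right_mono) auto
    also have "\<dots> = 32 * moment_bound * (8 * L\<^sup>2)^4 * \<kappa>^3 * (real n * w)"
      by (simp add: power2_eq_square power3_eq_cube)
    also have "\<dots> = 32 * moment_bound * (8 * L\<^sup>2)^4 * \<kappa>^3" using w(2) by simp
    finally show "(LINT \<omega>|(N \<Otimes>\<^sub>M N). (\<Sum>p\<in>?JJ. \<Sum>q\<in>?JJ. \<bar>pair_cov \<Gamma> p q\<bar> * \<bar>kernel_grad \<theta> p (rot \<eta> (pair_path Z \<omega>))\<bar> * \<bar>kernel_grad \<theta> q (\<lambda>j. Z j (fst \<omega>))\<bar>))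
      \<le> 32 * moment_bound * (8 * L\<^sup>2)^4 * \<kappa>^3" .
  qed simp
qed

end

end

section \<open>Averages of the covariance\<close>

lemma sum_abs_diff_le:
  fixes \<phi> :: "nat \<Rightarrow> real"
  assumes "i < n" and \<phi>: "\<And>m. 0 \<le> \<phi> m"
  shows "(\<Sum>j<n. \<phi> (if j \<le> i then i - j else j - i)) \<le> 2 * (\<Sum>m<n. \<phi> m)"
proof -
  have s: "{..<n} = {..i} \<union> {i<..<n}" using assms(1) by auto
  have "(\<Sum>j<n. \<phi> (if j \<le> i then i - j else j - i)) = (\<Sum>j\<le>i. \<phi> (i - j)) + (\<Sum>j\<in>{i<..<n}. \<phi> (j - i))"
    unfolding s by (subst sum.union_disjoint) (auto intro!: sum.cong)
  also have "(\<Sum>j\<le>i. \<phi> (i - j)) = (\<Sum>m\<in>(\<lambda>j. i - j) ` {..i}. \<phi> m)"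
    by (subst sum.reindex) (auto simp: inj_on_def)
  also have "\<dots> \<le> (\<Sum>m<n. \<phi> m)" using assms by (intro sum_mono2) auto
  also have "(\<Sum>j\<in>{i<..<n}. \<phi> (j - i)) = (\<Sum>m\<in>(\<lambda>j. j - i) ` {i<..<n}. \<phi> m)"
    by (subst sum.reindex) (auto simp: inj_on_def)
  also have "\<dots> \<le> (\<Sum>m<n. \<phi> m)" using assms by (intro sum_mono2) auto
  finally show ?thesis by simp
qed

text \<open>The integrand decreases, so every term but the first is at most the increment of the
  antiderivative over the cell to its left.\<close>
lemma riemann_sum_le_antiderivative:
  fixes k \<Psi> :: "real \<Rightarrow> real" and n :: nat
  assumes n: "0 < n" and d: "\<And>x. 0 \<le> x \<Longrightarrow> (\<Psi> has_real_derivative k x) (at x)"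
    and mono: "\<And>x y. 0 \<le> x \<Longrightarrow> x \<le> y \<Longrightarrow> k y \<le> k x" and k0: "\<And>x. 0 \<le> x \<Longrightarrow> 0 \<le> k x"
  shows "(\<Sum>m<n. k (m / n)) / n \<le> k 0 / n + (\<Psi> 1 - \<Psi> 0)"
proof -
  have step: "(\<Sum>m<N. k (Suc m / n)) / n \<le> \<Psi> (N / n) - \<Psi> 0" for N
  proof (induction N)
    case (Suc N)
    have lt: "real N / n < real (Suc N) / n" using n by (simp add: divide_strict_right_mono)
    have N0: "0 \<le> real N / n" by simp
    have "\<exists>z. real N / n < z \<and> z < real (Suc N) / n \<and> \<Psi> (real (Suc N) / n) - \<Psi> (real N / n) = (real (Suc N) / n - real N / n) * k z"
      by (rule MVT2[OF lt]) (rule d, rule order_trans[OF N0])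
    then obtain z where z: "real N / n < z" "z < real (Suc N) / n"
      "\<Psi> (real (Suc N) / n) - \<Psi> (real N / n) = (real (Suc N) / n - real N / n) * k z" by blast
    have "k (real (Suc N) / n) \<le> k z" using z N0 by (intro mono) linarith+
    then have "k (real (Suc N) / n) / n \<le> \<Psi> (real (Suc N) / n) - \<Psi> (real N / n)"
      unfolding z(3) using n by (simp add: field_simps)
    then show ?case using Suc by (simp add: add_divide_distrib)
  qed simp
  have "(\<Sum>m<n. k (m / n)) \<le> (\<Sum>m<Suc n. k (m / n))" using k0 by simp
  also have "\<dots> = k 0 + (\<Sum>m<n. k (Suc m / n))" by (subst sum.lessThan_Suc_shift) simp
  finally have "(\<Sum>m<n. k (m / n)) / n \<le> (k 0 + (\<Sum>m<n. k (Suc m / n))) / n" using n by (intro divide_right_mono) auto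
  also have "\<dots> = k 0 / n + (\<Sum>m<n. k (Suc m / n)) / n" by (simp add: add_divide_distrib)
  also have "\<dots> \<le> k 0 / n + (\<Psi> 1 - \<Psi> 0)" using step[of n] n by simp
  finally show ?thesis .
qed

definition decay_const :: "real \<Rightarrow> real" where
  "decay_const \<beta> = (if \<beta> = 1 then 2 else 2 / (1 - \<beta>))"

lemma pi_scale_pos: "\<epsilon> \<in> {0<..1/2} \<Longrightarrow> 0 < pi_scale \<beta> \<epsilon>"
  by (auto simp: pi_scale_def)

lemma pi_scale_sq:
  assumes "\<epsilon> \<in> {0<..1/2}"
  shows "(pi_scale \<beta> \<epsilon>)\<^sup>2 = (if \<beta> = 1 then \<epsilon> * \<bar>ln \<epsilon>\<bar> else \<epsilon> powr \<beta>)"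
proof (cases "\<beta> = 1")
  case True
  then show ?thesis using assms by (simp add: pi_scale_def power_mult_distrib powr_half_sqrt)
next
  case False
  then show ?thesis using assms by (simp add: pi_scale_def power2_eq_square flip: powr_add)
qed

text \<open>The integral of \<open>(1 + x/\<epsilon>) powr (-\<beta>)\<close> over the unit interval is at most a multiple of the square of
  \<open>pi_scale \<beta> \<epsilon>\<close>; the logarithm at \<open>\<beta> = 1\<close> comes from the antiderivative.\<close>
lemma averaged_decay:
  fixes n :: nat
  assumes \<epsilon>: "\<epsilon> \<in> {0<..1/2}" and \<beta>: "0 < \<beta>" "\<beta> \<le> 1" and n: "0 < n"
  shows "(\<Sum>m<n. (1 + (m / n) / \<epsilon>) powr (- \<beta>)) / n \<le> decay_const \<beta> * (1 / n + (pi_scale \<beta> \<epsilon>)\<^sup>2)"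
proof -
  have e0: "0 < \<epsilon>" "\<epsilon> \<le> 1/2" using \<epsilon> by auto
  define k where "k x = (1 + x / \<epsilon>) powr (- \<beta>)" for x
  have pos: "0 < 1 + x / \<epsilon>" if "0 \<le> x" for x using that e0 by (simp add: add_pos_nonneg)
  have mono: "k y \<le> k x" if "0 \<le> x" "x \<le> y" for x y
    unfolding k_def using that e0 \<beta> pos by (intro powr_mono2') (auto simp: divide_right_mono)
  have k0: "0 \<le> k x" for x by (simp add: k_def)
  define \<Psi> where "\<Psi> x = (if \<beta> = 1 then \<epsilon> * ln (1 + x / \<epsilon>) else \<epsilon> / (1 - \<beta>) * (1 + x / \<epsilon>) powr (1 - \<beta>))" for x
  have d: "(\<Psi> has_real_derivative k x) (at x)" if x: "0 \<le> x" for x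
  proof (cases "\<beta> = 1")
    case True
    have "((\<lambda>x. \<epsilon> * ln (1 + x / \<epsilon>)) has_real_derivative \<epsilon> * (1 / (1 + x / \<epsilon>) * (0 + 1 / \<epsilon>))) (at x)"
      using pos[OF x] by (intro DERIV_cmult DERIV_chain2[where f = ln] DERIV_ln_divide DERIV_add DERIV_const DERIV_cdivide DERIV_ident)
    then show ?thesis using True e0 pos[OF x] unfolding \<Psi>_def[abs_def] k_def by (simp add: powr_minus_divide)
  next
    case False
    have "((\<lambda>x. \<epsilon> / (1 - \<beta>) * (1 + x / \<epsilon>) powr (1 - \<beta>)) has_real_derivative \<epsilon> / (1 - \<beta>) * ((1 - \<beta>) * (1 + x / \<epsilon>) powr (1 - \<beta> - 1) * (0 + 1 / \<epsilon>))) (at x)"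
      using pos[OF x] by (intro DERIV_cmult DERIV_chain2[where f = "\<lambda>y. y powr (1 - \<beta>)"] has_real_derivative_powr DERIV_add DERIV_const DERIV_cdivide DERIV_ident)
    then show ?thesis using False e0 unfolding \<Psi>_def[abs_def] k_def by simp
  qed
  have "(\<Sum>m<n. k (m / n)) / n \<le> k 0 / n + (\<Psi> 1 - \<Psi> 0)"
    by (rule riemann_sum_le_antiderivative[OF n d mono k0])
  also have "k 0 = 1" by (simp add: k_def)
  also have "\<Psi> 1 - \<Psi> 0 \<le> decay_const \<beta> * (pi_scale \<beta> \<epsilon>)\<^sup>2"
  proof (cases "\<beta> = 1")
    case True
    \<comment> \<open>\<open>1 + 1/\<epsilon> \<le> \<epsilon>\<^sup>-\<^sup>2\<close>, so the logarithm is at most \<open>2 |ln \<epsilon>|\<close>.\<close>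
    have "\<epsilon> + \<epsilon>\<^sup>2 \<le> 1"
    proof -
      have "\<epsilon>\<^sup>2 \<le> (1/2)\<^sup>2" using e0 by (intro power_mono) auto
      then show ?thesis using e0 by (simp add: power2_eq_square)
    qed
    then have "0 \<le> (1 - (\<epsilon> + \<epsilon>\<^sup>2)) / \<epsilon>\<^sup>2" by simp
    also have "\<dots> = (1 / \<epsilon>)\<^sup>2 - (1 + 1 / \<epsilon>)"
      using e0 by (simp add: diff_divide_distrib add_divide_distrib power2_eq_square)
    finally have "1 + 1 / \<epsilon> \<le> (1 / \<epsilon>)\<^sup>2" by simp
    then have "ln (1 + 1 / \<epsilon>) \<le> ln ((1 / \<epsilon>)\<^sup>2)" using e0 by (intro ln_mono) (auto simp: add_pos_nonneg)
    also have "\<dots> = 2 * ln (1 / \<epsilon>)" using e0 by (subst ln_realpow) auto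
    also have "ln (1 / \<epsilon>) = \<bar>ln \<epsilon>\<bar>" using e0 by (simp add: ln_div)
    finally have "\<epsilon> * ln (1 + 1 / \<epsilon>) \<le> \<epsilon> * (2 * \<bar>ln \<epsilon>\<bar>)" using e0 by (intro mult_left_mono) auto
    then show ?thesis using True by (simp add: \<Psi>_def pi_scale_sq[OF \<epsilon>] decay_const_def)
  next
    case False
    then have b: "0 < 1 - \<beta>" using \<beta> by simp
    have "\<Psi> 1 - \<Psi> 0 \<le> \<epsilon> / (1 - \<beta>) * (1 + 1 / \<epsilon>) powr (1 - \<beta>)" using False b e0 by (simp add: \<Psi>_def)
    also have "\<dots> \<le> \<epsilon> / (1 - \<beta>) * (2 / \<epsilon>) powr (1 - \<beta>)"
      using e0 b by (intro mult_left_mono powr_mono2) (auto simp: field_simps)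
    also have "\<dots> = 2 powr (1 - \<beta>) / (1 - \<beta>) * (\<epsilon> / \<epsilon> powr (1 - \<beta>))" using e0 by (simp add: powr_divide)
    also have "\<epsilon> / \<epsilon> powr (1 - \<beta>) = \<epsilon> powr \<beta>" using e0 powr_diff[of \<epsilon> 1 "1 - \<beta>"] by simp
    also have "2 powr (1 - \<beta>) / (1 - \<beta>) * \<epsilon> powr \<beta> \<le> 2 / (1 - \<beta>) * \<epsilon> powr \<beta>"
    proof (rule mult_right_mono)
      have "2 powr (1 - \<beta>) \<le> 2 powr 1" using \<beta> by (intro powr_mono) auto
      then show "2 powr (1 - \<beta>) / (1 - \<beta>) \<le> 2 / (1 - \<beta>)" using b by (intro divide_right_mono) auto
    qed simp
    finally show ?thesis using False by (simp add: pi_scale_sq[OF \<epsilon>] decay_const_def)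
  qed
  also have "1 / n + decay_const \<beta> * (pi_scale \<beta> \<epsilon>)\<^sup>2 \<le> decay_const \<beta> * (1 / n + (pi_scale \<beta> \<epsilon>)\<^sup>2)"
  proof -
    have "1 \<le> decay_const \<beta>" using \<beta> by (auto simp: decay_const_def pos_le_divide_eq)
    then have "1 * (1 / n) \<le> decay_const \<beta> * (1 / n)" by (intro mult_right_mono) auto
    then show ?thesis by (simp only: distrib_left mult_1)
  qed
  finally show ?thesis by (simp add: k_def)
qed

lemma decay_row_sum:
  fixes C :: "real \<Rightarrow> real" and n :: nat
  assumes C: "\<And>x. \<bar>C x\<bar> \<le> K * (1 + \<bar>x\<bar>) powr (- \<beta>)"
    and \<epsilon>: "\<epsilon> \<in> {0<..1/2}" and \<beta>: "0 < \<beta>" "\<beta> \<le> 1" and n: "0 < n" and i: "i < n"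
  shows "(\<Sum>j<n. \<bar>C (real i / n / \<epsilon> - real j / n / \<epsilon>)\<bar> * (1 / n)) \<le> 2 * K * decay_const \<beta> * (1 / n + (pi_scale \<beta> \<epsilon>)\<^sup>2)"
proof -
  have e0: "0 < \<epsilon>" using \<epsilon> by auto
  have K0: "0 \<le> K" using C[of 0] by (simp add: order_trans[OF abs_ge_zero])
  define \<phi> where "\<phi> m = (1 + (real m / n) / \<epsilon>) powr (- \<beta>)" for m :: nat
  have "\<bar>C (real i / n / \<epsilon> - real j / n / \<epsilon>)\<bar> \<le> K * \<phi> (if j \<le> i then i - j else j - i)" for j
  proof -
    have "\<bar>real i / n / \<epsilon> - real j / n / \<epsilon>\<bar> = real (if j \<le> i then i - j else j - i) / n / \<epsilon>"
      using e0 n by (auto simp: diff_divide_distrib[symmetric] abs_divide of_nat_diff)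
    then show ?thesis using C[of "real i / n / \<epsilon> - real j / n / \<epsilon>"] by (simp add: \<phi>_def)
  qed
  then have "(\<Sum>j<n. \<bar>C (real i / n / \<epsilon> - real j / n / \<epsilon>)\<bar> * (1 / n)) \<le> (\<Sum>j<n. K * \<phi> (if j \<le> i then i - j else j - i) * (1 / n))"
    by (intro sum_mono mult_right_mono) auto
  also have "\<dots> = K * ((\<Sum>j<n. \<phi> (if j \<le> i then i - j else j - i)) / n)"
    by (simp only: sum_distrib_left sum_divide_distrib) simp
  also have "\<dots> \<le> K * ((2 * (\<Sum>m<n. \<phi> m)) / n)"
    using K0 by (intro mult_left_mono divide_right_mono sum_abs_diff_le i) (auto simp: \<phi>_def)
  also have "\<dots> = 2 * K * ((\<Sum>m<n. \<phi> m) / n)" by simp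
  also have "\<dots> \<le> 2 * K * (decay_const \<beta> * (1 / n + (pi_scale \<beta> \<epsilon>)\<^sup>2))"
    unfolding \<phi>_def using K0 by (intro mult_left_mono averaged_decay \<epsilon> \<beta> n) auto
  finally show ?thesis by (simp add: mult.assoc)
qed

section \<open>The boundary value problem\<close>

lemma C1_unit_continuous:
  assumes "C1_unit h" shows "continuous_on {0..1} h"
  using assms unfolding C1_unit_def by (meson DERIV_continuous continuous_on_eq_continuous_within)

lemma continuous_on_unit_bounded:
  fixes h :: "real \<Rightarrow> real"
  assumes "continuous_on {0..1} h"
  obtains B where "\<And>x. x \<in> {0..1} \<Longrightarrow> \<bar>h x\<bar> \<le> B"
proof -
  have "bounded (h ` {0..1})" by (intro compact_imp_bounded compact_continuous_image assms) simp
  then obtain B where "\<forall>y\<in>h ` {0..1}. norm y \<le> B" unfolding bounded_iff by blast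
  then have "\<bar>h x\<bar> \<le> B" if "x \<in> {0..1}" for x using that by simp
  then show ?thesis by (rule that)
qed

lemma C1_unit_obtain:
  assumes "C1_unit w"
  obtains w' where "\<And>x. x \<in> {0..1} \<Longrightarrow> (w has_real_derivative w' x) (at x within {0..1})" "continuous_on {0..1} w'"
    "\<And>x. x \<in> {0<..<1} \<Longrightarrow> (w has_real_derivative w' x) (at x)" "\<And>x. x \<in> {0<..<1} \<Longrightarrow> deriv w x = w' x"
proof -
  obtain w' where w': "\<And>x. x \<in> {0..1} \<Longrightarrow> (w has_real_derivative w' x) (at x within {0..1})" "continuous_on {0..1} w'"
    using assms unfolding C1_unit_def by blast
  have "(w has_real_derivative w' x) (at x)" if "x \<in> {0<..<1}" for x
    using w'(1)[of x] that at_within_Icc_at[of 0 x 1] by auto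
  then show ?thesis using that w' DERIV_imp_deriv by blast
qed

text \<open>\<open>A w' - f\<close> is constant on the open interval, and the boundary values determine the constant because
  the integral of \<open>w'\<close> vanishes.\<close>
theorem bvp_gradient_formula:
  fixes A f g w :: "real \<Rightarrow> real"
  assumes A: "continuous_on {0..1} A" "\<And>x. 0 < A x" and f: "C1_unit f" and g: "continuous_on {0..1} g"
    and w: "bvp_solution A f w"
  defines "S \<equiv> \<lambda>\<phi>. integral {0..1} (\<lambda>x. \<phi> x / A x)"
  shows "gradient_functional w g = S (\<lambda>x. f x * g x) - S f * S g / S (\<lambda>_. 1)"
proof -
  obtain w' where w': "\<And>x. x \<in> {0..1} \<Longrightarrow> (w has_real_derivative w' x) (at x within {0..1})" "continuous_on {0..1} w'"
    "\<And>x. x \<in> {0<..<1} \<Longrightarrow> (w has_real_derivative w' x) (at x)" "\<And>x. x \<in> {0<..<1} \<Longrightarrow> deriv w x = w' x"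
  proof -
    have "C1_unit w" using w by (simp add: bvp_solution_def)
    then show ?thesis by (rule C1_unit_obtain) (rule that)
  qed
  obtain f' where f': "\<And>x. x \<in> {0..1} \<Longrightarrow> (f has_real_derivative f' x) (at x within {0..1})" "continuous_on {0..1} f'"
    "\<And>x. x \<in> {0<..<1} \<Longrightarrow> (f has_real_derivative f' x) (at x)" "\<And>x. x \<in> {0<..<1} \<Longrightarrow> deriv f x = f' x"
    by (rule C1_unit_obtain[OF f]) (rule that)
  have fc: "continuous_on {0..1} f" by (rule C1_unit_continuous[OF f])
  have "\<exists>c. \<forall>x\<in>{0<..<1}. A x * deriv w x - f x = c"
  proof (rule has_field_derivative_zero_constant)
    show "((\<lambda>x. A x * deriv w x - f x) has_real_derivative 0) (at x within {0<..<1})" if x: "x \<in> {0<..<1}" for x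
    proof -
      have "((\<lambda>x. A x * deriv w x - f x) has_real_derivative deriv f x - deriv f x) (at x)"
        using w x f' unfolding bvp_solution_def by (intro DERIV_diff) auto
      then show ?thesis by (auto intro: has_field_derivative_at_within)
    qed
  qed simp
  then obtain c where c: "\<And>x. x \<in> {0<..<1} \<Longrightarrow> A x * deriv w x - f x = c" by blast
  have dw: "deriv w x = (f x + c) / A x" if "x \<in> {0<..<1}" for x
    using c[OF that] A(2)[of x] by (simp add: field_simps)
  have A0: "A x \<noteq> 0" for x using A(2)[of x] by simp
  have int: "(\<lambda>x. \<phi> x / A x) integrable_on {0..1}" if "continuous_on {0..1} \<phi>" for \<phi>
    by (intro integrable_continuous_real continuous_intros that A A0 ballI)
  have "(w' has_integral w 1 - w 0) {0..1}"
    using w'(1) by (intro fundamental_theorem_of_calculus) (auto simp: has_real_derivative_iff_has_vector_derivative[symmetric])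
  then have "((\<lambda>x. (f x + c) / A x) has_integral w 1 - w 0) {0..1}"
    by (rule has_integral_spike[of "{0, 1}", rotated 2]) (use dw w'(4) in auto)
  moreover have "((\<lambda>x. (f x + c) / A x) has_integral (S f + c * S (\<lambda>_. 1))) {0..1}"
  proof -
    have "((\<lambda>x. f x / A x + c * (1 / A x)) has_integral (S f + c * S (\<lambda>_. 1))) {0..1}"
      unfolding S_def by (intro has_integral_add has_integral_mult_right integrable_integral int fc continuous_on_const)
    then show ?thesis by (simp add: add_divide_distrib)
  qed
  ultimately have zero: "S f + c * S (\<lambda>_. 1) = 0"
    using w has_integral_unique[of "\<lambda>x. (f x + c) / A x"] by (fastforce simp: bvp_solution_def)
  have S1: "0 < S (\<lambda>_. 1)"
  proof -
    have cA: "continuous_on {0..1} (\<lambda>x. 1 / A x)" using A0 by (intro continuous_intros A ballI)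
    have "\<exists>z\<in>{0..1}. \<forall>y\<in>{0..1}. 1 / A z \<le> 1 / A y"
      by (rule continuous_attains_inf[OF _ _ cA]) auto
    then obtain z where z: "z \<in> {0..1}" "\<And>y. y \<in> {0..1} \<Longrightarrow> 1 / A z \<le> 1 / A y" by blast
    have "integral {0..1::real} (\<lambda>_. 1 / A z) \<le> S (\<lambda>_. 1)"
      unfolding S_def
      by (rule Henstock_Kurzweil_Integration.integral_le[OF integrable_continuous_real[OF continuous_on_const] integrable_continuous_real[OF cA] z(2)])
    then show ?thesis using A(2)[of z] by (simp add: less_le_trans[of 0 "1 / A z"])
  qed
  have "gradient_functional w g = integral {0..1} (\<lambda>x. (f x + c) / A x * g x)"
    unfolding gradient_functional_def using dw by (intro integral_spike[of "{0, 1}"]) auto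
  also have "\<dots> = integral {0..1} (\<lambda>x. f x * g x / A x + c * (g x / A x))"
    by (simp add: add_divide_distrib distrib_right)
  also have "\<dots> = S (\<lambda>x. f x * g x) + c * S g"
    unfolding S_def
    by (intro integral_unique has_integral_add has_integral_mult_right integrable_integral int continuous_intros fc g)
  also have "c = - S f / S (\<lambda>_. 1)" using zero S1 by (simp add: field_simps)
  finally show ?thesis by simp
qed

lemma integral_cells:
  fixes h :: "real \<Rightarrow> real"
  assumes h: "continuous_on {0..1} h" and n: "0 < n" and k: "k \<le> n"
  shows "integral {0..real k / n} h = (\<Sum>i<k. integral {real i / n..real (Suc i) / n} h)"
  using k
proof (induction k)
  case (Suc k)
  have le: "real k / n \<le> real (Suc k) / n" "real (Suc k) / n \<le> 1"
    using n Suc.prems by (auto simp: divide_right_mono)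
  have "h integrable_on {0..real (Suc k) / n}"
    using h le by (intro integrable_continuous_real) (auto intro: continuous_on_subset)
  then have "integral {0..real k / n} h + integral {real k / n..real (Suc k) / n} h = integral {0..real (Suc k) / n} h"
    using le by (intro Henstock_Kurzweil_Integration.integral_combine) auto
  then show ?case using Suc by simp
qed simp

text \<open>Riemann--Stieltjes sums express the functional through countably many values of the solution.\<close>
lemma gradient_functional_limit:
  assumes w: "C1_unit w" and g: "C1_unit g"
  shows "(\<lambda>n. \<Sum>i<Suc n. (w (real (Suc i) / Suc n) - w (real i / Suc n)) * g (real i / Suc n)) \<longlonglongrightarrow> gradient_functional w g"
proof -
  obtain w' where w': "\<And>x. x \<in> {0..1} \<Longrightarrow> (w has_real_derivative w' x) (at x within {0..1})" "continuous_on {0..1} w'"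
    "\<And>x. x \<in> {0<..<1} \<Longrightarrow> (w has_real_derivative w' x) (at x)" "\<And>x. x \<in> {0<..<1} \<Longrightarrow> deriv w x = w' x"
    by (rule C1_unit_obtain[OF w]) (rule that)
  obtain g' where g': "\<And>x. x \<in> {0..1} \<Longrightarrow> (g has_real_derivative g' x) (at x within {0..1})" "continuous_on {0..1} g'"
    "\<And>x. x \<in> {0<..<1} \<Longrightarrow> (g has_real_derivative g' x) (at x)" "\<And>x. x \<in> {0<..<1} \<Longrightarrow> deriv g x = g' x"
    by (rule C1_unit_obtain[OF g]) (rule that)
  have gc: "continuous_on {0..1} g" by (rule C1_unit_continuous[OF g])
  obtain Bw where Bw: "\<And>x. x \<in> {0..1} \<Longrightarrow> \<bar>w' x\<bar> \<le> Bw"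
    by (rule continuous_on_unit_bounded[OF w'(2)]) (rule that)
  obtain Bg where Bg: "\<And>x. x \<in> {0..1} \<Longrightarrow> \<bar>g' x\<bar> \<le> Bg"
    by (rule continuous_on_unit_bounded[OF g'(2)]) (rule that)
  have Bw0: "0 \<le> Bw" and Bg0: "0 \<le> Bg" using Bw[of 0] Bg[of 0] by auto
  have gl: "\<bar>g x - g y\<bar> \<le> Bg * \<bar>x - y\<bar>" if "x \<in> {0..1}" "y \<in> {0..1}" for x y
    using field_differentiable_bound[of "{0..1}" g g' Bg x y] g' Bg that by auto
  have gf: "gradient_functional w g = integral {0..1} (\<lambda>x. w' x * g x)"
    unfolding gradient_functional_def using w'(4) by (intro integral_spike[of "{0, 1}"]) auto
  have key: "\<bar>(\<Sum>i<n. (w (real (Suc i) / n) - w (real i / n)) * g (real i / n)) - gradient_functional w g\<bar> \<le> Bw * Bg * (1 / n)" if n: "0 < n" for n :: nat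
  proof -
    have "gradient_functional w g = (\<Sum>i<n. integral {real i / n..real (Suc i) / n} (\<lambda>x. w' x * g x))"
      using integral_cells[of "\<lambda>x. w' x * g x" n n] n w'(2) gc unfolding gf by (simp add: continuous_on_mult)
    then have "\<bar>(\<Sum>i<n. (w (real (Suc i) / n) - w (real i / n)) * g (real i / n)) - gradient_functional w g\<bar>
      = \<bar>\<Sum>i<n. (w (real (Suc i) / n) - w (real i / n)) * g (real i / n) - integral {real i / n..real (Suc i) / n} (\<lambda>x. w' x * g x)\<bar>"
      by (simp add: sum_subtractf)
    also have "\<dots> \<le> (\<Sum>i<n. Bw * (Bg * (1 / n)) * (1 / n))"
    proof (rule order_trans[OF sum_abs], rule sum_mono)
      fix i assume "i \<in> {..<n}"
      then have i: "0 \<le> real i / n" "real i / n \<le> real (Suc i) / n" "real (Suc i) / n \<le> 1"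
        using n by (auto simp: divide_right_mono)
      let ?I = "{real i / n..real (Suc i) / n}"
      have sub: "?I \<subseteq> {0..1}" using i by auto
      have len: "real (Suc i) / n - real i / n = 1 / n" by (simp add: diff_divide_distrib[symmetric])
      have "(w has_real_derivative w' x) (at x within ?I)" if "x \<in> ?I" for x
        by (rule DERIV_subset[OF w'(1) sub]) (use that sub in blast)
      then have "(w' has_integral w (real (Suc i) / n) - w (real i / n)) ?I"
        using i(2) by (intro fundamental_theorem_of_calculus) (simp_all only: has_real_derivative_iff_has_vector_derivative[symmetric])
      then have h1: "((\<lambda>x. w' x * g (real i / n)) has_integral (w (real (Suc i) / n) - w (real i / n)) * g (real i / n)) ?I"
        by (rule has_integral_mult_left)
      have c: "continuous_on ?I w'" "continuous_on ?I g" using w'(2) gc sub continuous_on_subset by blast+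
      have h2: "((\<lambda>x. w' x * g x) has_integral integral ?I (\<lambda>x. w' x * g x)) ?I"
        by (intro integrable_integral integrable_continuous_real continuous_intros c)
      have h: "((\<lambda>x. w' x * g (real i / n) - w' x * g x) has_integral (w (real (Suc i) / n) - w (real i / n)) * g (real i / n) - integral ?I (\<lambda>x. w' x * g x)) ?I"
        by (rule has_integral_diff[OF h1 h2])
      have "norm ((w (real (Suc i) / n) - w (real i / n)) * g (real i / n) - integral ?I (\<lambda>x. w' x * g x)) \<le> (Bw * (Bg * (1 / n))) * measure lborel ?I"
      proof (rule has_integral_bound_real[OF _ finite.emptyI h])
        show "norm (w' x * g (real i / n) - w' x * g x) \<le> Bw * (Bg * (1 / n))" if x': "x \<in> ?I - {}" for x
        proof -
          have x: "x \<in> ?I" using x' by blast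
          have x01: "x \<in> {0..1}" "real i / n \<in> {0..1}" using sub x i by (blast, auto)
          have "\<bar>g (real i / n) - g x\<bar> \<le> Bg * \<bar>real i / n - x\<bar>" by (rule gl[OF x01(2,1)])
          also have "\<dots> \<le> Bg * (1 / n)" using x len Bg0 by (intro mult_left_mono) auto
          finally have "\<bar>w' x\<bar> * \<bar>g (real i / n) - g x\<bar> \<le> Bw * (Bg * (1 / n))"
            using Bw[OF x01(1)] Bw0 by (intro mult_mono) auto
          then show ?thesis by (simp add: abs_mult[symmetric] right_diff_distrib)
        qed
      qed (use Bw0 Bg0 in auto)
      then show "\<bar>(w (real (Suc i) / n) - w (real i / n)) * g (real i / n) - integral ?I (\<lambda>x. w' x * g x)\<bar> \<le> Bw * (Bg * (1 / n)) * (1 / n)"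
        using i(2) len by simp
    qed
    also have "\<dots> = Bw * Bg * (1 / n)" using n by simp
    finally show ?thesis .
  qed
  have "(\<lambda>n. Bw * Bg * (1 / real (Suc n))) \<longlonglongrightarrow> Bw * Bg * 0"
    using lim_inverse_n' [THEN LIMSEQ_Suc] by (intro tendsto_mult tendsto_const) (simp add: inverse_eq_divide)
  then have z: "(\<lambda>n. Bw * Bg * (1 / real (Suc n))) \<longlonglongrightarrow> 0" by simp
  have "(\<lambda>n. (\<Sum>i<Suc n. (w (real (Suc i) / Suc n) - w (real i / Suc n)) * g (real i / Suc n)) - gradient_functional w g) \<longlonglongrightarrow> 0"
    by (rule Lim_null_comparison[OF _ z]) (use key[OF zero_less_Suc] in \<open>auto intro!: always_eventually simp del: of_nat_Suc sum.lessThan_Suc\<close>)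
  then show ?thesis by (rule LIM_zero_cancel)
qed

text \<open>Measurability must hold for the functional itself and not only up to null sets, since its law is a
  push-forward under a measure that need not be complete.\<close>
lemma gradient_functional_measurable:
  assumes "random_bvp_solution P A f W" "C1_unit g"
  shows "(\<lambda>\<omega>. gradient_functional (W \<omega>) g) \<in> borel_measurable P"
proof (rule borel_measurable_LIMSEQ_real)
  show "(\<lambda>n. \<Sum>i<Suc n. (W \<omega> (real (Suc i) / Suc n) - W \<omega> (real i / Suc n)) * g (real i / Suc n)) \<longlonglongrightarrow> gradient_functional (W \<omega>) g"
    if "\<omega> \<in> space P" for \<omega>
    using assms that unfolding random_bvp_solution_def by (intro gradient_functional_limit) auto
  show "(\<lambda>\<omega>. \<Sum>i<Suc n. (W \<omega> (real (Suc i) / Suc n) - W \<omega> (real i / Suc n)) * g (real i / Suc n)) \<in> borel_measurable P" for n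
  proof (intro borel_measurable_sum borel_measurable_times borel_measurable_diff borel_measurable_const)
    fix i assume "i \<in> {..<Suc n}"
    then have "real (Suc i) / Suc n \<in> {0..1}" "real i / Suc n \<in> {0..1}" by auto
    then show "(\<lambda>\<omega>. W \<omega> (real (Suc i) / Suc n)) \<in> borel_measurable P" "(\<lambda>\<omega>. W \<omega> (real i / Suc n)) \<in> borel_measurable P"
      using assms(1) unfolding random_bvp_solution_def by blast+
  qed
qed

section \<open>The stationary field and limits in mean square\<close>

text \<open>Both alternatives in the definition of a Gaussian variable lead to the same characteristic
  function; the constant is zero.\<close>
lemma (in prob_space) gaussian_rv_centered:
  assumes X: "gaussian_rv M X" and m0: "expectation X = 0"
  shows "integrable M (\<lambda>\<omega>. (X \<omega>)\<^sup>2)"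
    and "(CLINT \<omega>|M. iexp (X \<omega>)) = of_real (exp (- expectation (\<lambda>\<omega>. (X \<omega>)\<^sup>2) / 2))"
proof -
  have [measurable]: "X \<in> borel_measurable M" using X by (simp add: gaussian_rv_def)
  have "integrable M (\<lambda>\<omega>. (X \<omega>)\<^sup>2) \<and> (CLINT \<omega>|M. iexp (X \<omega>)) = of_real (exp (- expectation (\<lambda>\<omega>. (X \<omega>)\<^sup>2) / 2))"
  proof -
    consider m where "AE \<omega> in M. X \<omega> = m" | m s where "0 < s" "distributed M lborel X (normal_density m s)"
      using X unfolding gaussian_rv_def by blast
    then show ?thesis
    proof cases
      case 1
      have "expectation X = expectation (\<lambda>_. m)" using 1 by (intro integral_cong_AE) auto
      then have m: "m = 0" using m0 by (simp add: prob_space)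
      have "integrable M (\<lambda>\<omega>. (X \<omega>)\<^sup>2) \<longleftrightarrow> integrable M (\<lambda>_. 0::real)" using 1 m by (intro integrable_cong_AE) auto
      moreover have "expectation (\<lambda>\<omega>. (X \<omega>)\<^sup>2) = expectation (\<lambda>_. 0)" using 1 m by (intro integral_cong_AE) auto
      moreover have "(CLINT \<omega>|M. iexp (X \<omega>)) = (CLINT \<omega>|M. 1)" using 1 m by (intro integral_cong_AE) auto
      ultimately show ?thesis by (simp add: prob_space)
    next
      case 2
      have m: "m = 0" using normal_distributed_expectation[OF 2] m0 by simp
      have d: "distributed M lborel X (normal_density 0 s)" using 2 m by simp
      have i: "integrable M (\<lambda>\<omega>. (X \<omega>)\<^sup>2)"
        using integrable_normal_moment[OF 2(1), of 0 2] distributed_integrable[OF d, of "\<lambda>x. x\<^sup>2"] by simp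
      have v: "expectation (\<lambda>\<omega>. (X \<omega>)\<^sup>2) = s\<^sup>2"
        using normal_distributed_variance[OF 2(1) d] m0 by simp
      define Z where "Z \<omega> = X \<omega> / s" for \<omega>
      have [measurable]: "Z \<in> borel_measurable M" unfolding Z_def[abs_def] by measurable
      have dZ: "distributed M lborel Z std_normal_density"
        using normal_standard_normal_convert[OF 2(1), of X 0] d by (simp add: Z_def[abs_def])
      have "distr M borel Z = distr M lborel Z" by (rule distr_cong) auto
      also have "\<dots> = std_normal_distribution" by (rule distributed_distr_eq_density[OF dZ])
      finally have l: "distr M borel Z = std_normal_distribution" .
      have "(CLINT \<omega>|M. iexp (X \<omega>)) = (CLINT \<omega>|M. iexp (s * Z \<omega>))" using 2(1) by (simp add: Z_def)
      also have "\<dots> = char (distr M borel Z) s" unfolding char_def by (subst integral_distr) auto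
      also have "\<dots> = of_real (exp (- s\<^sup>2 / 2))" unfolding l by (simp add: char_std_normal_distribution)
      finally show ?thesis using i v by simp
    qed
  qed
  then show "integrable M (\<lambda>\<omega>. (X \<omega>)\<^sup>2)"
    "(CLINT \<omega>|M. iexp (X \<omega>)) = of_real (exp (- expectation (\<lambda>\<omega>. (X \<omega>)\<^sup>2) / 2))" by auto
qed

lemma product_integrable_of_squares:
  fixes X Y :: "'a \<Rightarrow> real"
  assumes [measurable]: "X \<in> borel_measurable M" "Y \<in> borel_measurable M"
    and "integrable M (\<lambda>\<omega>. (X \<omega>)\<^sup>2)" "integrable M (\<lambda>\<omega>. (Y \<omega>)\<^sup>2)"
  shows "integrable M (\<lambda>\<omega>. X \<omega> * Y \<omega>)"
proof (rule Bochner_Integration.integrable_bound)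
  show "integrable M (\<lambda>\<omega>. (X \<omega>)\<^sup>2 + (Y \<omega>)\<^sup>2)" using assms by simp
  show "AE \<omega> in M. norm (X \<omega> * Y \<omega>) \<le> norm ((X \<omega>)\<^sup>2 + (Y \<omega>)\<^sup>2)"
  proof (rule AE_I2)
    fix \<omega>
    have "2 * \<bar>X \<omega>\<bar> * \<bar>Y \<omega>\<bar> \<le> \<bar>X \<omega>\<bar>\<^sup>2 + \<bar>Y \<omega>\<bar>\<^sup>2" by (rule sum_squares_bound)
    moreover have "0 \<le> \<bar>X \<omega>\<bar> * \<bar>Y \<omega>\<bar>" by simp
    ultimately have "\<bar>X \<omega>\<bar> * \<bar>Y \<omega>\<bar> \<le> (X \<omega>)\<^sup>2 + (Y \<omega>)\<^sup>2" unfolding power2_abs mult.assoc by linarith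
    then show "norm (X \<omega> * Y \<omega>) \<le> norm ((X \<omega>)\<^sup>2 + (Y \<omega>)\<^sup>2)" by (simp add: abs_mult)
  qed
qed simp

lemma stationary_field_gauss_fam:
  assumes P: "prob_space P" and S: "stationary_centered_gaussian_field P G C"
  shows "gauss_fam P G (\<lambda>x y. C (x - y))"
  unfolding gauss_fam_def
proof (intro conjI allI impI)
  interpret prob_space P by fact
  have gf: "gaussian_rv P (\<lambda>\<omega>. \<Sum>x\<in>J. c x * G x \<omega>)" if "finite J" for J c
    using S that unfolding stationary_centered_gaussian_field_def gaussian_field_def by blast
  have rv: "gaussian_rv P (G x)" for x using gf[of "{x}" "\<lambda>_. 1"] by simp
  have m: "expectation (G x) = 0" and c: "expectation (\<lambda>\<omega>. G x \<omega> * G y \<omega>) = C (x - y)" for x y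
    using S unfolding stationary_centered_gaussian_field_def by auto
  show Gm[measurable]: "G x \<in> borel_measurable P" for x using rv by (simp add: gaussian_rv_def)
  have G2: "integrable P (\<lambda>\<omega>. (G x \<omega>)\<^sup>2)" for x by (rule gaussian_rv_centered(1)[OF rv m])
  have G1: "integrable P (G x)" for x by (rule square_integrable_imp_integrable[OF Gm G2])
  have GG: "integrable P (\<lambda>\<omega>. G x \<omega> * G y \<omega>)" for x y by (intro product_integrable_of_squares Gm G2)
  show "C (x - y) = C (y - x)" for x y using c[of x y] c[of y x] by (simp add: mult.commute)
  fix J :: "real set" and k :: "real \<Rightarrow> real" assume J: "finite J"
  have e0: "expectation (\<lambda>\<omega>. \<Sum>x\<in>J. k x * G x \<omega>) = 0"
    using G1 m by (subst Bochner_Integration.integral_sum) auto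
  have "expectation (\<lambda>\<omega>. (\<Sum>x\<in>J. k x * G x \<omega>)\<^sup>2) = expectation (\<lambda>\<omega>. \<Sum>x\<in>J. \<Sum>y\<in>J. (k x * k y) * (G x \<omega> * G y \<omega>))"
    by (simp add: power2_eq_square sum_product mult_ac)
  also have "\<dots> = (\<Sum>x\<in>J. expectation (\<lambda>\<omega>. \<Sum>y\<in>J. (k x * k y) * (G x \<omega> * G y \<omega>)))"
    by (intro Bochner_Integration.integral_sum Bochner_Integration.integrable_sum integrable_mult_right GG)
  also have "\<dots> = (\<Sum>x\<in>J. \<Sum>y\<in>J. expectation (\<lambda>\<omega>. (k x * k y) * (G x \<omega> * G y \<omega>)))"
    by (intro sum.cong refl Bochner_Integration.integral_sum integrable_mult_right GG)
  also have "\<dots> = bilin (\<lambda>x y. C (x - y)) J k k" by (simp add: bilin_def c)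
  finally have v: "expectation (\<lambda>\<omega>. (\<Sum>x\<in>J. k x * G x \<omega>)\<^sup>2) = bilin (\<lambda>x y. C (x - y)) J k k" .
  show "(CLINT \<omega>|P. iexp (\<Sum>x\<in>J. k x * G x \<omega>)) = of_real (exp (- bilin (\<lambda>x y. C (x - y)) J k k / 2))"
    using gaussian_rv_centered(2)[OF gf[OF J] e0] unfolding v .
qed fact

lemma gauss_fam_cong_AE:
  fixes X Y :: "'i \<Rightarrow> 'w \<Rightarrow> real"
  assumes g: "gauss_fam M X \<Gamma>" and Y: "\<And>i. Y i \<in> borel_measurable M" "\<And>i. AE \<omega> in M. Y i \<omega> = X i \<omega>"
  shows "gauss_fam M Y \<Gamma>"
  unfolding gauss_fam_def
proof (intro conjI allI impI)
  have [measurable]: "X i \<in> borel_measurable M" "Y i \<in> borel_measurable M" for i by (rule gauss_famD(2)[OF g], rule Y)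
  show "prob_space M" "\<And>i. Y i \<in> borel_measurable M" "\<And>i j. \<Gamma> i j = \<Gamma> j i"
    by (rule gauss_famD(1)[OF g], rule Y, rule gauss_famD(3)[OF g])
  fix J :: "'i set" and c :: "'i \<Rightarrow> real" assume J: "finite J"
  have "AE \<omega> in M. \<forall>i\<in>J. Y i \<omega> = X i \<omega>" using J Y(2) by (intro AE_finite_allI)
  then have "(CLINT \<omega>|M. iexp (\<Sum>i\<in>J. c i * Y i \<omega>)) = (CLINT \<omega>|M. iexp (\<Sum>i\<in>J. c i * X i \<omega>))"
    by (intro integral_cong_AE) (auto elim!: eventually_mono intro!: arg_cong[where f = exp] sum.cong)
  then show "(CLINT \<omega>|M. iexp (\<Sum>i\<in>J. c i * Y i \<omega>)) = of_real (exp (- bilin \<Gamma> J c c / 2))"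
    using gauss_famD(4)[OF g J] by simp
qed

lemma gauss_fam_reindex:
  fixes p :: "'j \<Rightarrow> 'i"
  assumes g: "gauss_fam M X \<Gamma>" and p: "inj p"
  shows "gauss_fam M (\<lambda>i. X (p i)) (\<lambda>i j. \<Gamma> (p i) (p j))"
  unfolding gauss_fam_def
proof (intro conjI allI impI)
  show "prob_space M" "\<And>i. X (p i) \<in> borel_measurable M" "\<And>i j. \<Gamma> (p i) (p j) = \<Gamma> (p j) (p i)"
    by (rule gauss_famD(1)[OF g], rule gauss_famD(2)[OF g], rule gauss_famD(3)[OF g])
  fix J :: "'j set" and c :: "'j \<Rightarrow> real" assume J: "finite J"
  have s: "(\<Sum>x\<in>p ` J. c (inv p x) * h x) = (\<Sum>i\<in>J. c i * h (p i))" for h :: "'i \<Rightarrow> real"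
    using p by (subst sum.reindex) (auto simp: inj_on_def)
  have b: "bilin \<Gamma> (p ` J) (\<lambda>x. c (inv p x)) (\<lambda>x. c (inv p x)) = bilin (\<lambda>i j. \<Gamma> (p i) (p j)) J c c"
  proof -
    have "bilin \<Gamma> (p ` J) (\<lambda>x. c (inv p x)) (\<lambda>x. c (inv p x)) = (\<Sum>x\<in>p ` J. c (inv p x) * (\<Sum>y\<in>p ` J. c (inv p y) * \<Gamma> x y))"
      by (simp add: bilin_def sum_distrib_left mult.assoc)
    then show ?thesis unfolding s by (simp add: bilin_def sum_distrib_left mult.assoc)
  qed
  show "(CLINT \<omega>|M. iexp (\<Sum>i\<in>J. c i * X (p i) \<omega>)) = of_real (exp (- bilin (\<lambda>i j. \<Gamma> (p i) (p j)) J c c / 2))"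
    using gauss_famD(4)[OF g finite_imageI[OF J, of p], of "\<lambda>x. c (inv p x)"] unfolding b s .
qed

lemma gauss_fam_mgf:
  assumes g: "gauss_fam M X \<Gamma>" and J: "finite J"
  shows "(LINT \<omega>|M. exp (\<Sum>i\<in>J. b i * X i \<omega>)) = exp (bilin \<Gamma> J b b / 2)"
proof -
  have [measurable]: "X i \<in> borel_measurable M" for i by (rule gauss_famD(2)[OF g])
  let ?v = "bilin \<Gamma> J b b"
  have "(LINT \<omega>|M. exp (\<Sum>i\<in>J. b i * X i \<omega>)) = (LINT y|distr M borel (\<lambda>\<omega>. \<Sum>i\<in>J. b i * X i \<omega>). exp y)"
    by (subst integral_distr) auto
  also have "\<dots> = (LINT z|std_normal_distribution. exp (sqrt ?v * z))"
    unfolding gauss_fam_combination_law[OF g J] by (subst integral_distr) auto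
  also have "\<dots> = exp ((sqrt ?v)\<^sup>2 / 2)" by (rule std_normal_exp)
  finally show ?thesis using gauss_fam_variance_nonneg[OF g J, of b] by simp
qed

text \<open>Expand the square and use the moment generating function.\<close>
lemma exp_increment_second_moment:
  fixes C :: "real \<Rightarrow> real"
  assumes g: "gauss_fam P Y (\<lambda>x y. C (x - y))"
  shows "(LINT \<omega>|P. (exp (- Y s \<omega>) - exp (- Y t \<omega>))\<^sup>2) \<le> 2 * exp (2 * C 0) * \<bar>C 0 - C (s - t)\<bar>"
proof (cases "s = t")
  case False
  have sym: "C (t - s) = C (s - t)" by (rule gauss_famD(3)[OF g])
  have i: "integrable P (\<lambda>\<omega>. exp (k * Y x \<omega>))" for k x by (rule gauss_fam_integrable[OF g exp_growth_exp])
  have i2: "integrable P (\<lambda>\<omega>. exp (k * Y x \<omega>) * exp (l * Y y \<omega>))" for k l x y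
    by (rule gauss_fam_integrable[OF g exp_growth_mult[OF exp_growth_exp exp_growth_exp]])
  have "(LINT \<omega>|P. (exp (- Y s \<omega>) - exp (- Y t \<omega>))\<^sup>2) = (LINT \<omega>|P. exp ((-2) * Y s \<omega>) + exp ((-2) * Y t \<omega>) - 2 * (exp ((-1) * Y s \<omega>) * exp ((-1) * Y t \<omega>)))"
    by (intro Bochner_Integration.integral_cong refl) (simp add: power2_diff flip: exp_double)
  also have "\<dots> = (LINT \<omega>|P. exp ((-2) * Y s \<omega>)) + (LINT \<omega>|P. exp ((-2) * Y t \<omega>)) - 2 * (LINT \<omega>|P. exp ((-1) * Y s \<omega>) * exp ((-1) * Y t \<omega>))"
    by (subst Bochner_Integration.integral_diff Bochner_Integration.integral_add;
        (intro Bochner_Integration.integrable_add integrable_mult_right i i2)?)+ simp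
  also have "(LINT \<omega>|P. exp ((-2) * Y s \<omega>)) = exp (2 * C 0)" using gauss_fam_exp_moment(1)[OF g, of "-2" s] by simp
  also have "(LINT \<omega>|P. exp ((-2) * Y t \<omega>)) = exp (2 * C 0)" using gauss_fam_exp_moment(1)[OF g, of "-2" t] by simp
  also have "(LINT \<omega>|P. exp ((-1) * Y s \<omega>) * exp ((-1) * Y t \<omega>)) = exp (C 0 + C (s - t))"
    using gauss_fam_mgf[OF g, of "{s, t}" "\<lambda>_. -1"] False by (simp add: bilin_def sym exp_add[symmetric])
  also have "exp (2 * C 0) + exp (2 * C 0) - 2 * exp (C 0 + C (s - t)) = 2 * exp (2 * C 0) * (1 - exp (- (C 0 - C (s - t))))"
    by (simp add: algebra_simps flip: exp_add)
  also have "\<dots> \<le> 2 * exp (2 * C 0) * \<bar>C 0 - C (s - t)\<bar>"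
  proof (rule mult_left_mono)
    show "1 - exp (- (C 0 - C (s - t))) \<le> \<bar>C 0 - C (s - t)\<bar>"
      using exp_ge_add_one_self[of "- (C 0 - C (s - t))"] by linarith
  qed simp
  finally show ?thesis .
qed simp

text \<open>Passes from functionals of the field on a grid to their limit.\<close>
lemma (in prob_space) mean_square_limit:
  fixes F :: "'a \<Rightarrow> real" and Fn :: "nat \<Rightarrow> 'a \<Rightarrow> real" and h :: "real \<Rightarrow> real"
  assumes [measurable]: "F \<in> borel_measurable M" "\<And>n. Fn n \<in> borel_measurable M"
    and F2: "integrable M (\<lambda>\<omega>. (F \<omega>)\<^sup>2)" and D2: "\<And>n. integrable M (\<lambda>\<omega>. (Fn n \<omega> - F \<omega>)\<^sup>2)"
    and lim: "(\<lambda>n. expectation (\<lambda>\<omega>. (Fn n \<omega> - F \<omega>)\<^sup>2)) \<longlonglongrightarrow> 0"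
  shows "(\<lambda>n. variance (Fn n)) \<longlonglongrightarrow> variance F"
    and "L-lipschitz_on UNIV h \<Longrightarrow> (\<And>x. \<bar>h x\<bar> \<le> 1) \<Longrightarrow> 0 < s \<Longrightarrow>
      (\<lambda>n. expectation (\<lambda>\<omega>. h ((Fn n \<omega> - expectation (Fn n)) / s))) \<longlonglongrightarrow> expectation (\<lambda>\<omega>. h ((F \<omega> - expectation F) / s))"
proof -
  define D where "D n \<omega> = Fn n \<omega> - F \<omega>" for n \<omega>
  define d where "d n = expectation (\<lambda>\<omega>. (D n \<omega>)\<^sup>2)" for n
  have Dm[measurable]: "D n \<in> borel_measurable M" for n unfolding D_def[abs_def] by measurable
  have D2i: "integrable M (\<lambda>\<omega>. (D n \<omega>)\<^sup>2)" for n using D2 by (simp add: D_def)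
  have dlim: "d \<longlonglongrightarrow> 0" using lim by (simp add: d_def[abs_def] D_def)
  have d0: "0 \<le> d n" for n unfolding d_def by (intro Bochner_Integration.integral_nonneg) auto
  have Fi: "integrable M F" by (rule square_integrable_imp_integrable[OF _ F2]) simp
  have Di: "integrable M (D n)" for n by (rule square_integrable_imp_integrable[OF _ D2i]) simp
  have FDi: "integrable M (\<lambda>\<omega>. F \<omega> * D n \<omega>)" for n by (rule product_integrable_of_squares[OF _ _ F2 D2i]) auto
  have Fneq: "Fn n = (\<lambda>\<omega>. F \<omega> + D n \<omega>)" for n by (simp add: D_def fun_eq_iff)
  have Fni: "integrable M (Fn n)" for n unfolding Fneq using Fi Di by simp
  have absD: "expectation (\<lambda>\<omega>. \<bar>D n \<omega>\<bar>) \<le> sqrt (d n)" for n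
    unfolding d_def by (rule abs_expectation_le_sqrt(2)[OF D2i]) simp
  have sd: "(\<lambda>n. sqrt (d n)) \<longlonglongrightarrow> 0" using tendsto_real_sqrt[OF dlim] by simp
  have ED: "(\<lambda>n. expectation (D n)) \<longlonglongrightarrow> 0"
    by (rule Lim_null_comparison[OF _ sd]) (use order_trans[OF integral_abs_bound absD] in \<open>auto intro!: always_eventually\<close>)
  have EFD: "(\<lambda>n. expectation (\<lambda>\<omega>. F \<omega> * D n \<omega>)) \<longlonglongrightarrow> 0"
  proof (rule Lim_null_comparison)
    \<comment> \<open>Positive even if \<open>d n = 0\<close>, with \<open>d n / t n \<le> t n\<close>; it balances \<open>|F D| \<le> t F\<^sup>2 + D\<^sup>2/t\<close>.\<close>
    define t where "t n = sqrt (d n) + 1 / real (Suc n)" for n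
    have t: "0 < t n" for n unfolding t_def using d0 by (intro add_nonneg_pos) auto
    show "\<forall>\<^sub>F n in sequentially. norm (expectation (\<lambda>\<omega>. F \<omega> * D n \<omega>)) \<le> t n * (expectation (\<lambda>\<omega>. (F \<omega>)\<^sup>2) + 1)"
    proof (intro always_eventually allI)
      fix n
      have "\<bar>expectation (\<lambda>\<omega>. F \<omega> * D n \<omega>)\<bar> \<le> expectation (\<lambda>\<omega>. \<bar>F \<omega> * D n \<omega>\<bar>)" by (rule integral_abs_bound)
      also have "\<dots> \<le> expectation (\<lambda>\<omega>. t n * (F \<omega>)\<^sup>2 + (1 / t n) * (D n \<omega>)\<^sup>2)"
      proof (rule integral_mono)
        fix \<omega>
        have q: "\<bar>a * b\<bar> \<le> t n * a\<^sup>2 + (1 / t n) * b\<^sup>2" for a b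
        proof -
          define r where "r = sqrt (t n)"
          have r: "0 < r" "t n = r\<^sup>2" using t[of n] by (auto simp: r_def)
          have "2 * \<bar>r * a\<bar> * \<bar>b / r\<bar> \<le> \<bar>r * a\<bar>\<^sup>2 + \<bar>b / r\<bar>\<^sup>2" by (rule sum_squares_bound)
          moreover have "\<bar>r * a\<bar> * \<bar>b / r\<bar> = \<bar>a * b\<bar>" using r(1) by (simp add: abs_mult)
          moreover have "\<bar>r * a\<bar>\<^sup>2 + \<bar>b / r\<bar>\<^sup>2 = t n * a\<^sup>2 + (1 / t n) * b\<^sup>2" by (simp add: r(2) power_mult_distrib power_divide)
          moreover have "0 \<le> \<bar>a * b\<bar>" by simp
          ultimately show ?thesis unfolding mult.assoc by linarith
        qed
        show "\<bar>F \<omega> * D n \<omega>\<bar> \<le> t n * (F \<omega>)\<^sup>2 + (1 / t n) * (D n \<omega>)\<^sup>2" by (rule q)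
      qed (use FDi F2 D2i in auto)
      also have "\<dots> = t n * expectation (\<lambda>\<omega>. (F \<omega>)\<^sup>2) + (1 / t n) * d n" using F2 D2i by (simp add: d_def)
      also have "\<dots> \<le> t n * expectation (\<lambda>\<omega>. (F \<omega>)\<^sup>2) + t n"
      proof -
        have "d n = sqrt (d n) * sqrt (d n)" using d0 by simp
        also have "\<dots> \<le> t n * t n" unfolding t_def using d0 by (intro mult_mono) auto
        finally show ?thesis using t[of n] by (simp add: field_simps)
      qed
      finally show "norm (expectation (\<lambda>\<omega>. F \<omega> * D n \<omega>)) \<le> t n * (expectation (\<lambda>\<omega>. (F \<omega>)\<^sup>2) + 1)" by (simp add: distrib_left)
    qed
    have "t \<longlonglongrightarrow> 0 + 0" unfolding t_def[abs_def]
      using lim_inverse_n'[THEN LIMSEQ_Suc] by (intro tendsto_add sd) (simp add: inverse_eq_divide)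
    then show "(\<lambda>n. t n * (expectation (\<lambda>\<omega>. (F \<omega>)\<^sup>2) + 1)) \<longlonglongrightarrow> 0" by (simp add: tendsto_mult_left_zero)
  qed
  have var: "variance (Fn n) = variance F + 2 * expectation (\<lambda>\<omega>. F \<omega> * D n \<omega>) + d n
     - 2 * expectation F * expectation (D n) - (expectation (D n))\<^sup>2" for n
  proof -
    have sq: "(F \<omega> + D n \<omega>)\<^sup>2 = (F \<omega>)\<^sup>2 + 2 * (F \<omega> * D n \<omega>) + (D n \<omega>)\<^sup>2" for \<omega> by (simp add: power2_sum)
    have i2: "integrable M (\<lambda>\<omega>. (F \<omega> + D n \<omega>)\<^sup>2)" unfolding sq using F2 D2i FDi by simp
    have "variance (Fn n) = expectation (\<lambda>\<omega>. (F \<omega> + D n \<omega>)\<^sup>2) - (expectation F + expectation (D n))\<^sup>2"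
      using variance_eq[of "Fn n"] Fni[of n] i2 Fi Di unfolding Fneq by simp
    also have "expectation (\<lambda>\<omega>. (F \<omega> + D n \<omega>)\<^sup>2) = expectation (\<lambda>\<omega>. (F \<omega>)\<^sup>2) + 2 * expectation (\<lambda>\<omega>. F \<omega> * D n \<omega>) + d n"
      unfolding sq d_def using F2 D2i FDi by simp
    also have "expectation (\<lambda>\<omega>. (F \<omega>)\<^sup>2) = variance F + (expectation F)\<^sup>2" using variance_eq[OF Fi F2] by simp
    finally show ?thesis by (simp add: power2_sum)
  qed
  have "(\<lambda>n. variance F + 2 * expectation (\<lambda>\<omega>. F \<omega> * D n \<omega>) + d n - 2 * expectation F * expectation (D n) - (expectation (D n))\<^sup>2)
     \<longlonglongrightarrow> variance F + 2 * 0 + 0 - 2 * expectation F * 0 - 0\<^sup>2"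
    by (intro tendsto_intros EFD dlim ED)
  then show "(\<lambda>n. variance (Fn n)) \<longlonglongrightarrow> variance F" unfolding var[abs_def] by simp
  assume h: "L-lipschitz_on UNIV h" "\<And>x. \<bar>h x\<bar> \<le> 1" and s: "0 < s"
  have hm[measurable]: "h \<in> borel_measurable borel"
    by (intro borel_measurable_continuous_onI lipschitz_on_continuous_on[OF h(1)])
  have L0: "0 \<le> L" using h(1) by (rule lipschitz_on_nonneg)
  have hi: "integrable M (\<lambda>\<omega>. h ((X \<omega> - c) / s))" if [measurable]: "X \<in> borel_measurable M" for X c
    using h(2) by (intro integrable_const_bound[where B = 1]) auto
  have "(\<lambda>n. expectation (\<lambda>\<omega>. h ((Fn n \<omega> - expectation (Fn n)) / s)) - expectation (\<lambda>\<omega>. h ((F \<omega> - expectation F) / s))) \<longlonglongrightarrow> 0"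
  proof (rule Lim_null_comparison)
    show "\<forall>\<^sub>F n in sequentially. norm (expectation (\<lambda>\<omega>. h ((Fn n \<omega> - expectation (Fn n)) / s)) - expectation (\<lambda>\<omega>. h ((F \<omega> - expectation F) / s)))
      \<le> L / s * (sqrt (d n) + \<bar>expectation (D n)\<bar>)"
    proof (intro always_eventually allI)
      fix n
      have "expectation (\<lambda>\<omega>. h ((Fn n \<omega> - expectation (Fn n)) / s)) - expectation (\<lambda>\<omega>. h ((F \<omega> - expectation F) / s))
        = expectation (\<lambda>\<omega>. h ((Fn n \<omega> - expectation (Fn n)) / s) - h ((F \<omega> - expectation F) / s))"
        by (intro Bochner_Integration.integral_diff[symmetric] hi) auto
      also have "\<bar>\<dots>\<bar> \<le> expectation (\<lambda>\<omega>. \<bar>h ((Fn n \<omega> - expectation (Fn n)) / s) - h ((F \<omega> - expectation F) / s)\<bar>)"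
        by (rule integral_abs_bound)
      also have "\<dots> \<le> expectation (\<lambda>\<omega>. L / s * (\<bar>D n \<omega>\<bar> + \<bar>expectation (D n)\<bar>))"
      proof (rule integral_mono)
        fix \<omega>
        have "\<bar>h ((Fn n \<omega> - expectation (Fn n)) / s) - h ((F \<omega> - expectation F) / s)\<bar> \<le> L * \<bar>(Fn n \<omega> - expectation (Fn n)) / s - (F \<omega> - expectation F) / s\<bar>"
          using lipschitz_onD[OF h(1)] by (simp add: dist_real_def)
        also have "(Fn n \<omega> - expectation (Fn n)) / s - (F \<omega> - expectation F) / s = (D n \<omega> - expectation (D n)) / s"
          using Fi Di unfolding Fneq by (simp add: diff_divide_distrib add_divide_distrib)
        also have "L * \<bar>(D n \<omega> - expectation (D n)) / s\<bar> = L / s * \<bar>D n \<omega> - expectation (D n)\<bar>" using s by simp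
        also have "\<dots> \<le> L / s * (\<bar>D n \<omega>\<bar> + \<bar>expectation (D n)\<bar>)" using L0 s by (intro mult_left_mono abs_triangle_ineq4) auto
        finally show "\<bar>h ((Fn n \<omega> - expectation (Fn n)) / s) - h ((F \<omega> - expectation F) / s)\<bar> \<le> L / s * (\<bar>D n \<omega>\<bar> + \<bar>expectation (D n)\<bar>)" .
      qed (use hi Di in auto)
      also have "\<dots> = L / s * (expectation (\<lambda>\<omega>. \<bar>D n \<omega>\<bar>) + \<bar>expectation (D n)\<bar>)" using Di[of n] by (simp add: prob_space)
      also have "\<dots> \<le> L / s * (sqrt (d n) + \<bar>expectation (D n)\<bar>)" using L0 s absD by (intro mult_left_mono add_right_mono) auto
      finally show "norm (expectation (\<lambda>\<omega>. h ((Fn n \<omega> - expectation (Fn n)) / s)) - expectation (\<lambda>\<omega>. h ((F \<omega> - expectation F) / s))) \<le> L / s * (sqrt (d n) + \<bar>expectation (D n)\<bar>)"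
        by simp
    qed
    have "(\<lambda>n. L / s * (sqrt (d n) + \<bar>expectation (D n)\<bar>)) \<longlonglongrightarrow> L / s * (0 + \<bar>0\<bar>)"
      by (intro tendsto_intros sd ED)
    then show "(\<lambda>n. L / s * (sqrt (d n) + \<bar>expectation (D n)\<bar>)) \<longlonglongrightarrow> 0" by simp
  qed
  then show "(\<lambda>n. expectation (\<lambda>\<omega>. h ((Fn n \<omega> - expectation (Fn n)) / s))) \<longlonglongrightarrow> expectation (\<lambda>\<omega>. h ((F \<omega> - expectation F) / s))"
    by (rule LIM_zero_cancel)
qed

section \<open>Discretisation of the medium\<close>

text \<open>The difference of the ratios splits so that only \<open>B' / D'\<close> and \<open>C / D\<close> occur as factors: the
  functional is Lipschitz in the four integrals, with a constant that does not degenerate as \<open>D\<close> tends to \<open>0\<close>.\<close>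
lemma ratio_perturbation:
  fixes L :: real
  assumes p: "0 < D" "0 < D'" and B': "\<bar>B'\<bar> \<le> L * D'" and C: "\<bar>C\<bar> \<le> L * D" and L: "0 \<le> L"
    and d: "\<bar>A' - A\<bar> \<le> L\<^sup>2 * t" "\<bar>B' - B\<bar> \<le> L * t" "\<bar>C' - C\<bar> \<le> L * t" "\<bar>D' - D\<bar> \<le> 1 * t"
  shows "\<bar>(A' - B' * C' / D') - (A - B * C / D)\<bar> \<le> 4 * L\<^sup>2 * t"
proof -
  have q: "\<bar>B' / D'\<bar> \<le> L" "\<bar>C / D\<bar> \<le> L" using p B' C by (simp_all add: abs_divide pos_divide_le_eq)
  have t: "0 \<le> t" using d(4) by simp
  have e: "B' * C' / D' - B * C / D = (B' / D') * (C' - C) + (C / D) * (B' - B) + ((C / D) * (B' / D')) * (D - D')"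
    using p by (simp add: field_simps)
  have "\<bar>(B' / D') * (C' - C)\<bar> \<le> L * (L * t)"
    unfolding abs_mult[of "B' / D'"] by (intro mult_mono q d L abs_ge_zero)
  moreover have "\<bar>(C / D) * (B' - B)\<bar> \<le> L * (L * t)"
    unfolding abs_mult[of "C / D"] by (intro mult_mono q d L abs_ge_zero)
  moreover have "\<bar>(C / D) * (B' / D')\<bar> \<le> L * L"
    unfolding abs_mult[of "C / D"] by (intro mult_mono q L abs_ge_zero)
  then have "\<bar>((C / D) * (B' / D')) * (D - D')\<bar> \<le> (L * L) * t"
    unfolding abs_mult[of "(C / D) * (B' / D')"] using d(4) L
    by (intro mult_mono) (auto simp: abs_minus_commute simp del: abs_mult abs_divide)
  moreover have tri: "\<bar>x + y + z\<bar> \<le> 3 * a" if "\<bar>x\<bar> \<le> a" "\<bar>y\<bar> \<le> a" "\<bar>z\<bar> \<le> a" for x y z a :: real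
    using that by linarith
  ultimately have "\<bar>B' * C' / D' - B * C / D\<bar> \<le> 3 * (L\<^sup>2 * t)"
    unfolding e by (intro tri) (simp_all only: power2_eq_square mult.assoc)
  then show ?thesis using d(1) by linarith
qed

text \<open>The medium at a fixed scale \<open>\<epsilon>\<close>, with a field whose realisations are all continuous. The data \<open>f\<close>, \<open>g\<close>
  are defined and bounded on the whole line, which makes them measurable without restriction.\<close>
locale log_gaussian_medium = prob_space P for P :: "'w measure" +
  fixes Y :: "real \<Rightarrow> 'w \<Rightarrow> real" and C f g :: "real \<Rightarrow> real" and \<epsilon> L :: real
  assumes gY: "gauss_fam P Y (\<lambda>x y. C (x - y))"
    and cont: "\<And>\<omega>. \<omega> \<in> space P \<Longrightarrow> continuous_on UNIV (\<lambda>x. Y x \<omega>)"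
    and \<epsilon>: "0 < \<epsilon>"
    and fc: "continuous_on UNIV f" "\<And>x. \<bar>f x\<bar> \<le> L" and gc: "continuous_on UNIV g" "\<And>x. \<bar>g x\<bar> \<le> L"
    and C0: "isCont C 0"
begin

text \<open>\<open>r n\<close> rounds down to the grid of mesh \<open>1 / n\<close>; \<open>en\<close>, \<open>Sn\<close>, \<open>Fn\<close> are \<open>e\<close>, \<open>S\<close>, \<open>F\<close> for the field that is
  constant on the cells of the grid, and \<open>\<Delta>\<close> controls the error.\<close>
definition U :: "real measure" where "U = restrict_space lborel {0..1}"
definition r :: "nat \<Rightarrow> real \<Rightarrow> real" where "r n x = real_of_int \<lfloor>real n * x\<rfloor> / real n"
definition e :: "'w \<Rightarrow> real \<Rightarrow> real" where "e \<omega> x = exp (- Y (x / \<epsilon>) \<omega>)"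
definition en :: "nat \<Rightarrow> 'w \<Rightarrow> real \<Rightarrow> real" where "en n \<omega> x = exp (- Y (r n x / \<epsilon>) \<omega>)"
definition S :: "(real \<Rightarrow> real) \<Rightarrow> 'w \<Rightarrow> real" where "S \<phi> \<omega> = (LINT x|U. \<phi> x * e \<omega> x)"
definition Sn :: "nat \<Rightarrow> (real \<Rightarrow> real) \<Rightarrow> 'w \<Rightarrow> real" where "Sn n \<phi> \<omega> = (LINT x|U. \<phi> x * en n \<omega> x)"
definition F :: "'w \<Rightarrow> real" where "F \<omega> = S (\<lambda>x. f x * g x) \<omega> - S f \<omega> * S g \<omega> / S (\<lambda>_. 1) \<omega>"
definition Fn :: "nat \<Rightarrow> 'w \<Rightarrow> real" where "Fn n \<omega> = Sn n (\<lambda>x. f x * g x) \<omega> - Sn n f \<omega> * Sn n g \<omega> / Sn n (\<lambda>_. 1) \<omega>"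
definition \<Delta> :: "nat \<Rightarrow> 'w \<Rightarrow> real" where "\<Delta> n \<omega> = (LINT x|U. \<bar>en n \<omega> x - e \<omega> x\<bar>)"

lemma space_U: "space U = {0..1}" by (simp add: U_def space_restrict_space)

lemma prob_U: "prob_space U"
proof
  show "emeasure U (space U) = 1" unfolding space_U unfolding U_def by (subst emeasure_restrict_space) auto
qed

sublocale UU: prob_space U by (rule prob_U)
sublocale UP: pair_prob_space U P ..
sublocale PU: pair_prob_space P U ..

lemma integral_U:
  fixes h :: "real \<Rightarrow> real"
  shows "(LINT x|U. h x) = (LINT x:{0..1}|lborel. h x)"
  unfolding U_def set_lebesgue_integral_def by (subst integral_restrict_space) auto

lemma measurable_U_borel: "(\<lambda>x. x) \<in> borel_measurable U"
  unfolding U_def by (rule measurable_restrict_space1) simp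

lemma borel_measurable_U: "\<phi> \<in> borel_measurable borel \<Longrightarrow> \<phi> \<in> borel_measurable U"
  by (rule measurable_compose[OF measurable_U_borel])

lemma AE_U: "(\<And>x. x \<in> {0..1} \<Longrightarrow> Q x) \<Longrightarrow> AE x in U. Q x"
  by (rule AE_I2) (simp add: space_U)

lemma Ym: "Y x \<in> borel_measurable P" by (rule gauss_famD(2)[OF gY])

lemma L0: "0 \<le> L" using fc(2)[of 0] by (rule order_trans[OF abs_ge_zero])

lemma r_close: "0 < n \<Longrightarrow> \<bar>r n x - x\<bar> \<le> 1 / n"
proof -
  assume n: "0 < n"
  have "real n * x - 1 \<le> real_of_int \<lfloor>real n * x\<rfloor>" "real_of_int \<lfloor>real n * x\<rfloor> \<le> real n * x" by linarith+
  then have "\<bar>real_of_int \<lfloor>real n * x\<rfloor> - real n * x\<bar> \<le> 1" by linarith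
  then have "\<bar>real_of_int \<lfloor>real n * x\<rfloor> - real n * x\<bar> / n \<le> 1 / n" by (intro divide_right_mono) auto
  moreover have "r n x - x = (real_of_int \<lfloor>real n * x\<rfloor> - real n * x) / n" using n by (simp add: r_def field_simps)
  ultimately show ?thesis using n by simp
qed

lemma r_unit: "0 < n \<Longrightarrow> x \<in> {0..1} \<Longrightarrow> r n x \<in> {0..1}"
proof -
  assume n: "0 < n" and x: "x \<in> {0..1}"
  have "0 \<le> \<lfloor>real n * x\<rfloor>" using x by simp
  then have 1: "0 \<le> real_of_int \<lfloor>real n * x\<rfloor>" by simp
  have "real n * x \<le> real n" using x by (simp add: mult_left_le)
  then have 2: "real_of_int \<lfloor>real n * x\<rfloor> \<le> real n" by linarith
  show ?thesis using 1 2 n by (simp add: r_def)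
qed

lemma Y_step_measurable: "(\<lambda>p. Y (r n (snd p) / \<epsilon>) (fst p)) \<in> borel_measurable (P \<Otimes>\<^sub>M borel)"
proof -
  have "(\<lambda>p. \<lfloor>real n * snd p\<rfloor>) \<in> measurable (P \<Otimes>\<^sub>M borel) (count_space UNIV)" by measurable
  moreover have "(\<lambda>p. Y (real_of_int k / real n / \<epsilon>) (fst p)) \<in> borel_measurable (P \<Otimes>\<^sub>M borel)" for k
    by (rule measurable_compose[OF measurable_fst Ym])
  ultimately have "(\<lambda>p. Y (real_of_int \<lfloor>real n * snd p\<rfloor> / real n / \<epsilon>) (fst p)) \<in> borel_measurable (P \<Otimes>\<^sub>M borel)"
    using measurable_compose_countable[where f = "\<lambda>k p. Y (real_of_int k / real n / \<epsilon>) (fst p)" and g = "\<lambda>p. \<lfloor>real n * snd p\<rfloor>"] by blast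
  then show ?thesis unfolding r_def .
qed

lemma r_limit: "(\<lambda>n. r (Suc n) x) \<longlonglongrightarrow> x"
proof -
  have "(\<lambda>n. r (Suc n) x - x) \<longlonglongrightarrow> 0"
  proof (rule Lim_null_comparison)
    show "\<forall>\<^sub>F n in sequentially. norm (r (Suc n) x - x) \<le> 1 / real (Suc n)"
      using r_close[of "Suc n" x for n] by (intro always_eventually allI) simp
    show "(\<lambda>n. 1 / real (Suc n)) \<longlonglongrightarrow> 0"
      using lim_inverse_n'[THEN LIMSEQ_Suc] by (simp add: inverse_eq_divide)
  qed
  then show ?thesis by (rule LIM_zero_cancel)
qed

text \<open>Continuous in one variable and measurable in the other one: a limit of functions that take
  countably many positions into account.\<close>
lemma Y_joint_measurable: "(\<lambda>p. Y (snd p / \<epsilon>) (fst p)) \<in> borel_measurable (P \<Otimes>\<^sub>M borel)"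
proof (rule borel_measurable_LIMSEQ_real)
  show "(\<lambda>p. Y (r (Suc n) (snd p) / \<epsilon>) (fst p)) \<in> borel_measurable (P \<Otimes>\<^sub>M borel)" for n by (rule Y_step_measurable)
  fix p assume "p \<in> space (P \<Otimes>\<^sub>M (borel :: real measure))"
  then have "fst p \<in> space P" by (auto simp: space_pair_measure)
  then have c: "isCont (\<lambda>x. Y x (fst p)) (snd p / \<epsilon>)" using cont continuous_on_eq_continuous_at by blast
  have "(\<lambda>n. r (Suc n) (snd p) / \<epsilon>) \<longlonglongrightarrow> snd p / \<epsilon>" by (intro tendsto_intros r_limit) (use \<epsilon> in auto)
  then show "(\<lambda>n. Y (r (Suc n) (snd p) / \<epsilon>) (fst p)) \<longlonglongrightarrow> Y (snd p / \<epsilon>) (fst p)"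
    using isCont_tendsto_compose[OF c] by blast
qed

lemma PU_to_borel: "(\<lambda>p. p) \<in> measurable (P \<Otimes>\<^sub>M U) (P \<Otimes>\<^sub>M borel)"
proof -
  note measurable_U_borel[measurable]
  have "(\<lambda>p. (fst p, snd p)) \<in> measurable (P \<Otimes>\<^sub>M U) (P \<Otimes>\<^sub>M borel)" by measurable
  then show ?thesis by simp
qed

lemma e_joint: "(\<lambda>p. e (fst p) (snd p)) \<in> borel_measurable (P \<Otimes>\<^sub>M U)"
  "(\<lambda>p. en n (fst p) (snd p)) \<in> borel_measurable (P \<Otimes>\<^sub>M U)"
proof -
  have y: "(\<lambda>p. Y (snd p / \<epsilon>) (fst p)) \<in> borel_measurable (P \<Otimes>\<^sub>M U)"
    by (rule measurable_compose[OF PU_to_borel Y_joint_measurable])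
  have yn: "(\<lambda>p. Y (r n (snd p) / \<epsilon>) (fst p)) \<in> borel_measurable (P \<Otimes>\<^sub>M U)"
    by (rule measurable_compose[OF PU_to_borel Y_step_measurable])
  show "(\<lambda>p. e (fst p) (snd p)) \<in> borel_measurable (P \<Otimes>\<^sub>M U)"
    "(\<lambda>p. en n (fst p) (snd p)) \<in> borel_measurable (P \<Otimes>\<^sub>M U)"
    unfolding e_def en_def
    by (rule measurable_compose[OF borel_measurable_uminus[OF y] borel_measurable_exp],
        rule measurable_compose[OF borel_measurable_uminus[OF yn] borel_measurable_exp])
qed

lemma e_section:
  assumes "\<omega> \<in> space P"
  shows "e \<omega> \<in> borel_measurable U" "en n \<omega> \<in> borel_measurable U"
  using measurable_compose[OF measurable_Pair1'[OF assms] e_joint(1)] measurable_compose[OF measurable_Pair1'[OF assms] e_joint(2)[of n]]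
  unfolding fst_conv snd_conv .

lemma e_bounded:
  assumes w: "\<omega> \<in> space P"
  obtains B where "\<And>x. x \<in> {0..1} \<Longrightarrow> \<bar>e \<omega> x\<bar> \<le> B" "\<And>n x. 0 < n \<Longrightarrow> x \<in> {0..1} \<Longrightarrow> \<bar>en n \<omega> x\<bar> \<le> B"
proof -
  have "continuous_on {0..1} (e \<omega>)"
    unfolding e_def using \<epsilon> by (intro continuous_intros continuous_on_compose2[OF cont[OF w]]) auto
  then obtain B where B: "\<And>x. x \<in> {0..1} \<Longrightarrow> \<bar>e \<omega> x\<bar> \<le> B"
    by (rule continuous_on_unit_bounded) (rule that)
  have "\<bar>en n \<omega> x\<bar> \<le> B" if "0 < n" "x \<in> {0..1}" for n x
    using B[OF r_unit[OF that]] by (simp add: e_def en_def)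
  with B show ?thesis by (rule that)
qed

lemma section_integrable:
  assumes w: "\<omega> \<in> space P" and \<phi>: "\<phi> \<in> borel_measurable U" "\<And>x. \<bar>\<phi> x\<bar> \<le> K"
  shows "integrable U (\<lambda>x. \<phi> x * e \<omega> x)" "0 < n \<Longrightarrow> integrable U (\<lambda>x. \<phi> x * en n \<omega> x)"
proof -
  obtain B where B: "\<And>x. x \<in> {0..1} \<Longrightarrow> \<bar>e \<omega> x\<bar> \<le> B" "\<And>n x. 0 < n \<Longrightarrow> x \<in> {0..1} \<Longrightarrow> \<bar>en n \<omega> x\<bar> \<le> B"
    by (rule e_bounded[OF w]) (rule that)
  have K: "0 \<le> K" using \<phi>(2)[of 0] by (rule order_trans[OF abs_ge_zero])
  show "integrable U (\<lambda>x. \<phi> x * e \<omega> x)"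
  proof (rule UU.integrable_const_bound[where B = "K * B"])
    show "AE x in U. norm (\<phi> x * e \<omega> x) \<le> K * B"
      unfolding real_norm_def abs_mult by (intro AE_U mult_mono \<phi>(2) B(1) K abs_ge_zero)
  qed (intro borel_measurable_times \<phi>(1) e_section w)
  assume n: "0 < n"
  show "integrable U (\<lambda>x. \<phi> x * en n \<omega> x)"
  proof (rule UU.integrable_const_bound[where B = "K * B"])
    show "AE x in U. norm (\<phi> x * en n \<omega> x) \<le> K * B"
      unfolding real_norm_def abs_mult by (intro AE_U mult_mono \<phi>(2) B(2) n K abs_ge_zero)
  qed (intro borel_measurable_times \<phi>(1) e_section w)
qed

lemma fgm: "f \<in> borel_measurable borel" "g \<in> borel_measurable borel"
  by (rule borel_measurable_continuous_onI[OF fc(1)], rule borel_measurable_continuous_onI[OF gc(1)])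

lemma test_bounds: "f \<in> borel_measurable U" "g \<in> borel_measurable U" "(\<lambda>x. f x * g x) \<in> borel_measurable U" "(\<lambda>x. 1::real) \<in> borel_measurable U"
  "\<And>x. \<bar>f x * g x\<bar> \<le> L\<^sup>2" "\<And>x::real. \<bar>1::real\<bar> \<le> 1"
proof -
  show "\<bar>f x * g x\<bar> \<le> L\<^sup>2" for x unfolding abs_mult power2_eq_square using fc(2) gc(2) L0 by (intro mult_mono) auto
  show "f \<in> borel_measurable U" "g \<in> borel_measurable U" "(\<lambda>x. f x * g x) \<in> borel_measurable U"
    by (intro borel_measurable_U borel_measurable_times fgm)+
qed simp_all

lemma S_perturbation:
  assumes w: "\<omega> \<in> space P" and \<phi>: "\<phi> \<in> borel_measurable U" "\<And>x. \<bar>\<phi> x\<bar> \<le> K" and n: "0 < n"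
  shows "\<bar>Sn n \<phi> \<omega> - S \<phi> \<omega>\<bar> \<le> K * \<Delta> n \<omega>"
proof -
  note i = section_integrable[OF w \<phi>]
  have i1: "integrable U (\<lambda>x. 1 * e \<omega> x)" "integrable U (\<lambda>x. 1 * en n \<omega> x)"
    using section_integrable[OF w test_bounds(4,6)] n by blast+
  have "Sn n \<phi> \<omega> - S \<phi> \<omega> = (LINT x|U. \<phi> x * en n \<omega> x - \<phi> x * e \<omega> x)"
    unfolding Sn_def S_def using i n by simp
  also have "\<bar>\<dots>\<bar> \<le> (LINT x|U. \<bar>\<phi> x * en n \<omega> x - \<phi> x * e \<omega> x\<bar>)" by (rule integral_abs_bound)
  also have "\<dots> \<le> (LINT x|U. K * \<bar>en n \<omega> x - e \<omega> x\<bar>)"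
  proof (rule integral_mono)
    show "integrable U (\<lambda>x. \<bar>\<phi> x * en n \<omega> x - \<phi> x * e \<omega> x\<bar>)" using i n by simp
    show "integrable U (\<lambda>x. K * \<bar>en n \<omega> x - e \<omega> x\<bar>)" using i1 by simp
    show "\<bar>\<phi> x * en n \<omega> x - \<phi> x * e \<omega> x\<bar> \<le> K * \<bar>en n \<omega> x - e \<omega> x\<bar>" for x
      unfolding right_diff_distrib[symmetric] abs_mult by (intro mult_right_mono \<phi>(2)) simp
  qed
  finally show ?thesis by (simp add: \<Delta>_def)
qed

lemma S_positive:
  assumes w: "\<omega> \<in> space P"
  shows "0 < S (\<lambda>_. 1) \<omega>" "0 < n \<Longrightarrow> 0 < Sn n (\<lambda>_. 1) \<omega>"
proof -
  note i = section_integrable[OF w test_bounds(4,6)]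
  have pos: "0 < (LINT x|U. h x)" if "integrable U h" "\<And>x. 0 < h x" for h :: "real \<Rightarrow> real"
  proof -
    have "(LINT x|U. h x) \<noteq> 0"
    proof
      assume "(LINT x|U. h x) = 0"
      then have "AE x in U. h x = 0"
        using integral_nonneg_eq_0_iff_AE[OF that(1)] that(2) by (auto simp: less_imp_le)
      then have "AE x in U. False" by eventually_elim (metis that(2) less_irrefl)
      then show False using UU.AE_False by blast
    qed
    moreover have "0 \<le> (LINT x|U. h x)" by (intro integral_nonneg_AE AE_I2) (simp add: that(2) less_imp_le)
    ultimately show ?thesis by simp
  qed
  show "0 < S (\<lambda>_. 1) \<omega>" unfolding S_def using i by (intro pos) (auto simp: e_def)
  show "0 < n \<Longrightarrow> 0 < Sn n (\<lambda>_. 1) \<omega>" unfolding Sn_def using i by (intro pos) (auto simp: en_def)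
qed

lemma S_average_bound:
  assumes w: "\<omega> \<in> space P" and \<phi>: "\<phi> \<in> borel_measurable U" "\<And>x. \<bar>\<phi> x\<bar> \<le> K"
  shows "\<bar>S \<phi> \<omega>\<bar> \<le> K * S (\<lambda>_. 1) \<omega>" "0 < n \<Longrightarrow> \<bar>Sn n \<phi> \<omega>\<bar> \<le> K * Sn n (\<lambda>_. 1) \<omega>"
proof -
  note i = section_integrable[OF w \<phi>] and i1 = section_integrable[OF w test_bounds(4,6)]
  have b: "\<bar>LINT x|U. \<phi> x * h x\<bar> \<le> K * (LINT x|U. 1 * h x)"
    if "integrable U (\<lambda>x. \<phi> x * h x)" "integrable U (\<lambda>x. 1 * h x)" "\<And>x. 0 < h x" for h :: "real \<Rightarrow> real"
  proof -
    have "\<bar>LINT x|U. \<phi> x * h x\<bar> \<le> (LINT x|U. \<bar>\<phi> x * h x\<bar>)" by (rule integral_abs_bound)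
    also have "\<dots> \<le> (LINT x|U. K * (1 * h x))"
    proof (rule integral_mono)
      show "\<bar>\<phi> x * h x\<bar> \<le> K * (1 * h x)" for x
        unfolding abs_mult using \<phi>(2)[of x] that(3)[of x] by (simp add: mult_right_mono)
    qed (use that in auto)
    also have "\<dots> = K * (LINT x|U. 1 * h x)" by (rule integral_mult_right_zero)
    finally show ?thesis .
  qed
  show "\<bar>S \<phi> \<omega>\<bar> \<le> K * S (\<lambda>_. 1) \<omega>" unfolding S_def by (rule b[OF i(1) i1(1)]) (simp add: e_def)
  show "\<bar>Sn n \<phi> \<omega>\<bar> \<le> K * Sn n (\<lambda>_. 1) \<omega>" if "0 < n" unfolding Sn_def by (rule b[OF i(2) i1(2)]) (use that in \<open>simp_all add: en_def\<close>)
qed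

lemma F_perturbation:
  assumes w: "\<omega> \<in> space P" and n: "0 < n"
  shows "\<bar>Fn n \<omega> - F \<omega>\<bar> \<le> 4 * L\<^sup>2 * \<Delta> n \<omega>"
  unfolding Fn_def F_def
  by (rule ratio_perturbation[OF S_positive(1)[OF w] S_positive(2)[OF w n] S_average_bound(2)[OF w test_bounds(1) fc(2) n] S_average_bound(1)[OF w test_bounds(2) gc(2)] L0
      S_perturbation[OF w test_bounds(3,5) n] S_perturbation[OF w test_bounds(1) fc(2) n] S_perturbation[OF w test_bounds(2) gc(2) n] S_perturbation[OF w test_bounds(4,6) n]])

lemma S_measurable[measurable]:
  assumes [measurable]: "\<phi> \<in> borel_measurable U"
  shows "S \<phi> \<in> borel_measurable P" "Sn n \<phi> \<in> borel_measurable P"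
proof -
  have "(\<lambda>p. \<phi> (snd p) * e (fst p) (snd p)) \<in> borel_measurable (P \<Otimes>\<^sub>M U)"
    "(\<lambda>p. \<phi> (snd p) * en n (fst p) (snd p)) \<in> borel_measurable (P \<Otimes>\<^sub>M U)"
    by (intro borel_measurable_times measurable_compose[OF measurable_snd assms] e_joint)+
  then show "S \<phi> \<in> borel_measurable P" "Sn n \<phi> \<in> borel_measurable P"
    unfolding S_def[abs_def] Sn_def[abs_def]
    by (intro UU.borel_measurable_lebesgue_integral; simp only: case_prod_beta')+
qed

lemma F_measurable[measurable]: "F \<in> borel_measurable P" "Fn n \<in> borel_measurable P"
proof -
  note S_measurable[OF test_bounds(1), measurable] S_measurable[OF test_bounds(2), measurable]
    S_measurable[OF test_bounds(3), measurable] S_measurable[OF test_bounds(4), measurable]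
  show "F \<in> borel_measurable P" "Fn n \<in> borel_measurable P"
    unfolding F_def[abs_def] Fn_def[abs_def] by measurable
qed

lemma \<Delta>_measurable[measurable]: "\<Delta> n \<in> borel_measurable P"
proof -
  have "(\<lambda>p. \<bar>en n (fst p) (snd p) - e (fst p) (snd p)\<bar>) \<in> borel_measurable (P \<Otimes>\<^sub>M U)"
    by (intro borel_measurable_abs borel_measurable_diff e_joint)
  then show ?thesis unfolding \<Delta>_def[abs_def]
    by (intro UU.borel_measurable_lebesgue_integral; simp only: case_prod_beta')+
qed

text \<open>By Jensen's inequality and Fubini, the second moment of \<open>\<Delta>\<close> is at most the mean over \<open>x\<close> of the
  second moments of the increments.\<close>
lemma \<Delta>_second_moment:
  assumes n: "0 < n" and h: "\<And>x. x \<in> {0..1} \<Longrightarrow> 2 * exp (2 * C 0) * \<bar>C 0 - C (r n x / \<epsilon> - x / \<epsilon>)\<bar> \<le> \<eta>"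
  shows "integrable P (\<lambda>\<omega>. (\<Delta> n \<omega>)\<^sup>2)" "expectation (\<lambda>\<omega>. (\<Delta> n \<omega>)\<^sup>2) \<le> \<eta>"
proof -
  let ?q = "\<lambda>x \<omega>. (en n \<omega> x - e \<omega> x)\<^sup>2"
  have qP: "expectation (?q x) \<le> \<eta>" if "x \<in> {0..1}" for x
    using exp_increment_second_moment[OF gY, of "r n x / \<epsilon>" "x / \<epsilon>"] h[OF that] by (simp add: e_def en_def)
  have q0: "0 \<le> expectation (?q x)" for x by (intro Bochner_Integration.integral_nonneg) simp
  have \<eta>0: "0 \<le> \<eta>" by (rule order_trans[OF q0 qP[of 0]]) simp
  have qm[measurable]: "(\<lambda>p. ?q (fst p) (snd p)) \<in> borel_measurable (U \<Otimes>\<^sub>M P)"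
  proof -
    have "(\<lambda>p. ?q (snd p) (fst p)) \<in> borel_measurable (P \<Otimes>\<^sub>M U)"
      by (intro borel_measurable_power borel_measurable_diff e_joint)
    from measurable_compose[OF measurable_pair_swap' this] show ?thesis by (simp add: case_prod_beta')
  qed
  have int: "integrable (U \<Otimes>\<^sub>M P) (\<lambda>p. ?q (fst p) (snd p))"
  proof (rule UP.Fubini_integrable[OF qm])
    show "AE x in U. integrable P (\<lambda>\<omega>. ?q (fst (x, \<omega>)) (snd (x, \<omega>)))"
    proof (rule AE_I2)
      fix x
      have "exp_growth (\<lambda>z. (exp ((-1) * z (r n x / \<epsilon>)) - exp ((-1) * z (x / \<epsilon>))) ^ 2)"
        by (intro exp_growth_power exp_growth_diff exp_growth_exp)
      from gauss_fam_integrable[OF gY this]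
      show "integrable P (\<lambda>\<omega>. ?q (fst (x, \<omega>)) (snd (x, \<omega>)))" by (simp add: e_def en_def)
    qed
    have mm: "(\<lambda>x. LINT \<omega>|P. norm (?q (fst (x, \<omega>)) (snd (x, \<omega>)))) \<in> borel_measurable U"
      using qm by (intro borel_measurable_lebesgue_integral) (simp add: case_prod_beta')
    show "integrable U (\<lambda>x. LINT \<omega>|P. norm (?q (fst (x, \<omega>)) (snd (x, \<omega>))))"
      by (rule UU.integrable_const_bound[where B = \<eta>, OF AE_U mm]) (use qP q0 in simp)
  qed
  have int': "integrable (U \<Otimes>\<^sub>M P) (case_prod ?q)" using int by (simp add: case_prod_beta')
  have ie: "integrable P (\<lambda>\<omega>. LINT x|U. ?q x \<omega>)" by (rule UP.integrable_snd[OF int'])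
  have le: "AE \<omega> in P. (\<Delta> n \<omega>)\<^sup>2 \<le> (LINT x|U. ?q x \<omega>)"
    using UP.AE_integrable_snd[OF int'] AE_space
  proof eventually_elim
    fix \<omega> assume i: "integrable U (\<lambda>x. ?q x \<omega>)" and w: "\<omega> \<in> space P"
    have [measurable]: "e \<omega> \<in> borel_measurable U" "en n \<omega> \<in> borel_measurable U" by (rule e_section[OF w])+
    have "\<Delta> n \<omega> \<le> sqrt (LINT x|U. ?q x \<omega>)"
      unfolding \<Delta>_def by (rule UU.abs_expectation_le_sqrt(2)[OF i]) simp
    moreover have "0 \<le> \<Delta> n \<omega>" unfolding \<Delta>_def by (intro Bochner_Integration.integral_nonneg) simp
    moreover have "0 \<le> (LINT x|U. ?q x \<omega>)" by (intro Bochner_Integration.integral_nonneg) simp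
    ultimately show "(\<Delta> n \<omega>)\<^sup>2 \<le> (LINT x|U. ?q x \<omega>)" by (metis power_mono real_sqrt_pow2)
  qed
  show I: "integrable P (\<lambda>\<omega>. (\<Delta> n \<omega>)\<^sup>2)"
    by (rule Bochner_Integration.integrable_bound[OF ie])
       (use le in \<open>auto elim!: eventually_mono intro: order_trans[OF _ abs_ge_self]\<close>)
  have "expectation (\<lambda>\<omega>. (\<Delta> n \<omega>)\<^sup>2) \<le> expectation (\<lambda>\<omega>. LINT x|U. ?q x \<omega>)"
    by (rule integral_mono_AE[OF I ie le])
  also have "\<dots> = (LINT x|U. expectation (?q x))"
    using UP.integral_snd[OF int'] UP.integral_fst[OF int'] by simp
  also have "\<dots> \<le> (LINT x|U. \<eta>)"
    using UP.integrable_fst[OF int'] qP by (intro integral_mono) (auto simp: space_U)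
  finally show "expectation (\<lambda>\<omega>. (\<Delta> n \<omega>)\<^sup>2) \<le> \<eta>" using UU.prob_space by simp
qed

lemma \<Delta>_small:
  assumes \<eta>: "0 < \<eta>"
  obtains N where "0 < N" "\<And>n. n \<ge> N \<Longrightarrow> integrable P (\<lambda>\<omega>. (\<Delta> n \<omega>)\<^sup>2)" "\<And>n. n \<ge> N \<Longrightarrow> expectation (\<lambda>\<omega>. (\<Delta> n \<omega>)\<^sup>2) \<le> \<eta>"
proof -
  define k where "k = 2 * exp (2 * C 0)"
  have k: "0 < k" by (simp add: k_def)
  obtain \<delta> where \<delta>: "0 < \<delta>" "\<And>h. \<bar>h\<bar> < \<delta> \<Longrightarrow> \<bar>C h - C 0\<bar> < \<eta> / k"
  proof -
    have "\<exists>\<delta>>0. \<forall>h. dist h 0 < \<delta> \<longrightarrow> dist (C h) (C 0) < \<eta> / k"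
      using C0 \<eta> k unfolding continuous_at_eps_delta by simp
    then show ?thesis using that by (auto simp: dist_real_def)
  qed
  obtain N :: nat where N: "1 / (\<delta> * \<epsilon>) < real N" using reals_Archimedean2 by blast
  have N0: "0 < N" using N \<delta>(1) \<epsilon> by (metis divide_pos_pos mult_pos_pos of_nat_0_less_iff order_less_trans zero_less_one)
  have bd: "2 * exp (2 * C 0) * \<bar>C 0 - C (r n x / \<epsilon> - x / \<epsilon>)\<bar> \<le> \<eta>" if n: "n \<ge> N" for n x
  proof -
    have n0: "0 < n" using n N0 by simp
    have "\<bar>r n x / \<epsilon> - x / \<epsilon>\<bar> = \<bar>r n x - x\<bar> / \<epsilon>" using \<epsilon> by (simp add: diff_divide_distrib[symmetric])
    also have "\<dots> \<le> (1 / n) / \<epsilon>" using \<epsilon> r_close[OF n0, of x] by (intro divide_right_mono) auto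
    also have "\<dots> < \<delta>"
    proof -
      have "1 / (\<delta> * \<epsilon>) < real n" using N n by linarith
      then have "1 < real n * (\<delta> * \<epsilon>)" using \<delta>(1) \<epsilon> by (simp add: pos_divide_less_eq)
      then show ?thesis using n0 \<epsilon> by (simp add: divide_less_eq mult_ac)
    qed
    finally have "\<bar>C (r n x / \<epsilon> - x / \<epsilon>) - C 0\<bar> < \<eta> / k" by (rule \<delta>(2))
    then show ?thesis using k unfolding k_def[symmetric] by (simp add: field_simps abs_minus_commute)
  qed
  show ?thesis
  proof (rule that[OF N0])
    fix n assume n: "n \<ge> N"
    show "integrable P (\<lambda>\<omega>. (\<Delta> n \<omega>)\<^sup>2)" "expectation (\<lambda>\<omega>. (\<Delta> n \<omega>)\<^sup>2) \<le> \<eta>"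
      using \<Delta>_second_moment[OF _ bd[OF n]] n N0 by auto
  qed
qed

definition cell :: "nat \<Rightarrow> (real \<Rightarrow> real) \<Rightarrow> nat \<Rightarrow> real" where
  "cell n \<phi> i = (LINT x|U. \<phi> x * indicator {real i / n..<real (Suc i) / n} x)"

lemma cell_bound:
  assumes \<phi>[measurable]: "\<phi> \<in> borel_measurable U" and K: "\<And>x. \<bar>\<phi> x\<bar> \<le> K" and n: "0 < n" and i: "i < n"
  shows "\<bar>cell n \<phi> i\<bar> \<le> K * (1 / n)" "cell n (\<lambda>_. 1) i = 1 / n"
proof -
  let ?I = "{real i / n..<real (Suc i) / n}"
  have ij: "real i / n \<le> real (Suc i) / n" "real (Suc i) / n \<le> 1" "0 \<le> real i / n" using i n by (auto simp: divide_right_mono)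
  have m: "(LINT x|U. indicator ?I x) = 1 / n"
  proof -
    have "(LINT x|U. indicator ?I x) = (LINT x|lborel. (indicator ?I x :: real))"
    proof -
      have "indicator {0..1} x *\<^sub>R indicator ?I x = (indicator ?I x :: real)" for x
      proof (cases "x \<in> ?I")
        case True
        then have "real i / n \<le> x" "x < real (Suc i) / n" by simp_all
        then have "0 \<le> x" "x \<le> 1" using ij by linarith+
        then show ?thesis by simp
      qed simp
      then show ?thesis unfolding integral_U set_lebesgue_integral_def by (simp only:)
    qed
    also have "\<dots> = measure lborel ?I" by simp
    also have "\<dots> = 1 / n" using ij n by (simp add: diff_divide_distrib[symmetric])
    finally show ?thesis .
  qed
  have Im[measurable]: "(indicator ?I :: real \<Rightarrow> real) \<in> borel_measurable U" by (rule borel_measurable_U) simp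
  have ii: "integrable U (indicator ?I :: real \<Rightarrow> real)"
    by (rule UU.integrable_const_bound[where B = 1, OF _ Im], rule AE_I2) (simp add: indicator_def)
  have K0: "0 \<le> K" using K[of 0] by (rule order_trans[OF abs_ge_zero])
  have "\<bar>cell n \<phi> i\<bar> \<le> (LINT x|U. \<bar>\<phi> x * indicator ?I x\<bar>)" unfolding cell_def by (rule integral_abs_bound)
  also have "\<dots> \<le> (LINT x|U. K * indicator ?I x)"
  proof (rule integral_mono)
    have "integrable U (\<lambda>x. \<phi> x * indicator ?I x)"
      by (rule UU.integrable_const_bound[where B = K, OF _ borel_measurable_times[OF \<phi> Im]], rule AE_I2)
         (use K K0 in \<open>simp add: indicator_def\<close>)
    then show "integrable U (\<lambda>x. \<bar>\<phi> x * indicator ?I x\<bar>)" by (rule integrable_abs)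
    show "integrable U (\<lambda>x. K * indicator ?I x)" using ii by simp
    show "\<bar>\<phi> x * indicator ?I x\<bar> \<le> K * indicator ?I x" for x using K by (simp add: indicator_def)
  qed
  also have "\<dots> = K * (1 / n)" using m by simp
  finally show "\<bar>cell n \<phi> i\<bar> \<le> K * (1 / n)" .
  show "cell n (\<lambda>_. 1) i = 1 / n" unfolding cell_def using m by simp
qed

text \<open>The step function is constant on the cells; the end point \<open>1\<close>, which lies in none of them, is a null set.\<close>
lemma Sn_sum:
  assumes \<phi>[measurable]: "\<phi> \<in> borel_measurable U" and K: "\<And>x. \<bar>\<phi> x\<bar> \<le> K" and n: "0 < n"
  shows "Sn n \<phi> \<omega> = (\<Sum>i<n. cell n \<phi> i * exp ((-1) * Y (real i / n / \<epsilon>) \<omega>))"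
proof -
  let ?I = "\<lambda>i. {real i / n..<real (Suc i) / n}"
  have Im[measurable]: "(indicator (?I i) :: real \<Rightarrow> real) \<in> borel_measurable U" for i by (rule borel_measurable_U) simp
  have K0: "0 \<le> K" using K[of 0] by (rule order_trans[OF abs_ge_zero])
  have int: "integrable U (\<lambda>x. \<phi> x * indicator (?I i) x)" for i
    by (rule UU.integrable_const_bound[where B = K, OF _ borel_measurable_times[OF \<phi> Im]], rule AE_I2)
       (use K K0 in \<open>simp add: indicator_def\<close>)
  have rm[measurable]: "(\<lambda>x. en n \<omega> x) \<in> borel_measurable U"
  proof -
    have "(\<lambda>x. \<lfloor>real n * x\<rfloor>) \<in> measurable borel (count_space UNIV)" by measurable
    then have "(\<lambda>x. Y (real_of_int \<lfloor>real n * x\<rfloor> / real n / \<epsilon>) \<omega>) \<in> borel_measurable borel"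
      by (rule measurable_compose) simp
    then have "(\<lambda>x. Y (r n x / \<epsilon>) \<omega>) \<in> borel_measurable borel" unfolding r_def .
    then show ?thesis unfolding en_def
      by (intro borel_measurable_U measurable_compose[OF borel_measurable_uminus borel_measurable_exp])
  qed
  have ae1: "AE x in U. x \<noteq> 1"
    unfolding U_def using AE_lborel_singleton[of "1::real"] by (subst AE_restrict_space_iff) auto
  have "Sn n \<phi> \<omega> = (LINT x|U. (\<Sum>i<n. (\<phi> x * indicator (?I i) x) * exp ((-1) * Y (real i / n / \<epsilon>) \<omega>)))"
    unfolding Sn_def
  proof (rule integral_cong_AE)
    show "AE x in U. \<phi> x * en n \<omega> x = (\<Sum>i<n. (\<phi> x * indicator (?I i) x) * exp ((-1) * Y (real i / n / \<epsilon>) \<omega>))"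
      using ae1 AE_space
    proof eventually_elim
      fix x assume "x \<noteq> 1" "x \<in> space U"
      then have x: "0 \<le> x" "x < 1" by (auto simp: space_U)
      define j where "j = nat \<lfloor>real n * x\<rfloor>"
      have f0: "0 \<le> \<lfloor>real n * x\<rfloor>" using x by simp
      have rj: "real j = real_of_int \<lfloor>real n * x\<rfloor>" using f0 by (simp add: j_def)
      have jb: "real j \<le> real n * x" "real n * x < real (Suc j)" unfolding rj of_nat_Suc by linarith+
      have "real n * x < real n" using x n by simp
      then have jn: "j < n" using jb(1) by (metis of_nat_less_iff order_le_less_trans)
      have mem: "x \<in> ?I i \<longleftrightarrow> i = j" for i
      proof -
        have "x \<in> ?I i \<longleftrightarrow> real i \<le> real n * x \<and> real n * x < real (Suc i)"
          using n by (simp add: pos_divide_le_eq pos_less_divide_eq mult.commute)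
        also have "\<dots> \<longleftrightarrow> i = j"
        proof
          assume a: "real i \<le> real n * x \<and> real n * x < real (Suc i)"
          have "real i < real (Suc j)" "real j < real (Suc i)" using a jb by linarith+
          then show "i = j" by simp
        qed (use jb in simp)
        finally show ?thesis .
      qed
      have ind: "(indicator (?I i) x :: real) = (if i = j then 1 else 0)" for i
        unfolding indicator_def mem by simp
      have "(\<Sum>i<n. (\<phi> x * indicator (?I i) x) * exp ((-1) * Y (real i / n / \<epsilon>) \<omega>)) = (\<Sum>i<n. if i = j then \<phi> x * exp ((-1) * Y (real j / n / \<epsilon>) \<omega>) else 0)"
        unfolding ind by (intro sum.cong refl) simp
      also have "\<dots> = \<phi> x * exp ((-1) * Y (real j / n / \<epsilon>) \<omega>)" using jn by simp
      also have "\<dots> = \<phi> x * en n \<omega> x" by (simp add: en_def r_def rj)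
      finally show "\<phi> x * en n \<omega> x = (\<Sum>i<n. (\<phi> x * indicator (?I i) x) * exp ((-1) * Y (real i / n / \<epsilon>) \<omega>))" by simp
    qed
  qed (intro borel_measurable_sum borel_measurable_times borel_measurable_const \<phi> rm Im)+
  also have "\<dots> = (\<Sum>i<n. LINT x|U. (\<phi> x * indicator (?I i) x) * exp ((-1) * Y (real i / n / \<epsilon>) \<omega>))"
    by (intro Bochner_Integration.integral_sum integrable_mult_left int)
  also have "\<dots> = (\<Sum>i<n. cell n \<phi> i * exp ((-1) * Y (real i / n / \<epsilon>) \<omega>))"
    by (simp add: cell_def)
  finally show ?thesis .
qed

lemma quadrature_cells: "0 < n \<Longrightarrow> quadrature n (cell n (\<lambda>x. f x * g x)) (cell n f) (cell n g) L"
  by unfold_locales (use L0 cell_bound(1)[OF test_bounds(3,5)] cell_bound(1)[OF test_bounds(1) fc(2)] cell_bound(1)[OF test_bounds(2) gc(2)] in auto)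

lemma Fn_eq:
  assumes n: "0 < n"
  shows "Fn n \<omega> = quadrature.\<Phi> n (cell n (\<lambda>x. f x * g x)) (cell n f) (cell n g) (\<lambda>i. Y (real i / n / \<epsilon>) \<omega>)"
proof -
  interpret Q: quadrature n "cell n (\<lambda>x. f x * g x)" "cell n f" "cell n g" L by (rule quadrature_cells[OF n])
  let ?x = "\<lambda>i. Y (real i / n / \<epsilon>) \<omega>"
  have D: "Sn n (\<lambda>_. 1) \<omega> = Q.D ?x"
    unfolding Sn_sum[OF test_bounds(4,6) n] Q.D_def Q.w_def Q.e_def
    using cell_bound(2)[OF test_bounds(4,6) n] by (intro sum.cong refl) simp
  show ?thesis
    unfolding Fn_def Q.\<Phi>_def Q.P_def Q.Q_def D Sn_sum[OF test_bounds(3,5) n] Sn_sum[OF test_bounds(1) fc(2) n] Sn_sum[OF test_bounds(2) gc(2) n] Q.e_def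
    using Q.D_pos[of ?x] by simp
qed

text \<open>\<open>stein_bound\<close> and \<open>variance_kernel_le\<close> hold for the field on every grid; the limit of fine grids removes
  the term \<open>1 / n\<close> and the discrepancy between the two variances.\<close>
theorem lipschitz_test_bound:
  assumes \<kappa>: "\<And>n i. 0 < n \<Longrightarrow> i < n \<Longrightarrow> (\<Sum>j<n. \<bar>C (real i / n / \<epsilon> - real j / n / \<epsilon>)\<bar> * (1 / n)) \<le> \<kappa>1 * (1 / n + \<kappa>2)"
    and s: "s = sqrt (variance F)" "0 < s"
    and h: "Lh-lipschitz_on UNIV h" "\<And>x. 0 \<le> h x" "\<And>x. h x \<le> 1"
  shows "\<bar>expectation (\<lambda>\<omega>. h ((F \<omega> - expectation F) / s)) - (LINT z|std_normal_distribution. h z)\<bar>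
    \<le> 2 * sqrt (32 * (16 * exp (128 * C 0)) * (8 * L\<^sup>2)^4 * (\<kappa>1 * \<kappa>2)^3) / s\<^sup>2"
    and "integrable P (\<lambda>\<omega>. (F \<omega>)\<^sup>2)"
proof -
  \<comment> \<open>From this index on all approximations are square integrable; the sequence is shifted accordingly.\<close>
  obtain N where N: "0 < N" "\<And>n. n \<ge> N \<Longrightarrow> integrable P (\<lambda>\<omega>. (\<Delta> n \<omega>)\<^sup>2)"
    by (rule \<Delta>_small[of 1]) auto
  define A where "A n = Fn (n + N)" for n
  have pos: "0 < n + N" for n using N(1) by simp
  have Am[measurable]: "A n \<in> borel_measurable P" for n unfolding A_def by simp
  let ?c = "(4 * L\<^sup>2)\<^sup>2"
  have AF: "AE \<omega> in P. (A n \<omega> - F \<omega>)\<^sup>2 \<le> ?c * (\<Delta> (n + N) \<omega>)\<^sup>2" for n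
    using AE_space
  proof eventually_elim
    fix \<omega> assume w: "\<omega> \<in> space P"
    have "\<bar>A n \<omega> - F \<omega>\<bar>\<^sup>2 \<le> (4 * L\<^sup>2 * \<Delta> (n + N) \<omega>)\<^sup>2"
      unfolding A_def by (intro power_mono F_perturbation[OF w pos]) simp
    then show "(A n \<omega> - F \<omega>)\<^sup>2 \<le> ?c * (\<Delta> (n + N) \<omega>)\<^sup>2" unfolding power2_abs power_mult_distrib[of "4 * L\<^sup>2"] .
  qed
  have ci: "integrable P (\<lambda>\<omega>. ?c * (\<Delta> (n + N) \<omega>)\<^sup>2)" for n by (intro integrable_mult_right N) simp
  have D2: "integrable P (\<lambda>\<omega>. (A n \<omega> - F \<omega>)\<^sup>2)" for n
    by (rule Bochner_Integration.integrable_bound[OF ci[of n]])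
       (use AF[of n] in \<open>auto elim!: eventually_mono intro: order_trans[OF _ abs_ge_self]\<close>)
  have lim: "(\<lambda>n. expectation (\<lambda>\<omega>. (A n \<omega> - F \<omega>)\<^sup>2)) \<longlonglongrightarrow> 0"
  proof (rule LIMSEQ_I)
    fix \<eta> :: real assume \<eta>: "0 < \<eta>"
    define \<eta>' where "\<eta>' = \<eta> / (?c + 1)"
    have c1: "0 < ?c + 1" by (simp add: add_nonneg_pos)
    have \<eta>': "0 < \<eta>'" unfolding \<eta>'_def using \<eta> c1 by simp
    obtain N1 where N1: "0 < N1" "\<And>n. n \<ge> N1 \<Longrightarrow> integrable P (\<lambda>\<omega>. (\<Delta> n \<omega>)\<^sup>2)" "\<And>n. n \<ge> N1 \<Longrightarrow> expectation (\<lambda>\<omega>. (\<Delta> n \<omega>)\<^sup>2) \<le> \<eta>'"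
      by (rule \<Delta>_small[OF \<eta>']) (rule that)
    have "norm (expectation (\<lambda>\<omega>. (A n \<omega> - F \<omega>)\<^sup>2) - 0) < \<eta>" if n: "n \<ge> N1" for n
    proof -
      have "expectation (\<lambda>\<omega>. (A n \<omega> - F \<omega>)\<^sup>2) \<le> expectation (\<lambda>\<omega>. ?c * (\<Delta> (n + N) \<omega>)\<^sup>2)"
        by (rule integral_mono_AE[OF D2 ci AF])
      also have "\<dots> = ?c * expectation (\<lambda>\<omega>. (\<Delta> (n + N) \<omega>)\<^sup>2)" by (rule integral_mult_right_zero)
      also have "\<dots> \<le> ?c * \<eta>'" using n by (intro mult_left_mono N1) auto
      also have "\<dots> < (?c + 1) * \<eta>'" using \<eta>' by (simp add: distrib_right)
      also have "\<dots> = \<eta>" using c1 by (simp add: \<eta>'_def)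
      finally have "expectation (\<lambda>\<omega>. (A n \<omega> - F \<omega>)\<^sup>2) < \<eta>" .
      moreover have "0 \<le> expectation (\<lambda>\<omega>. (A n \<omega> - F \<omega>)\<^sup>2)" by (intro Bochner_Integration.integral_nonneg) simp
      ultimately show ?thesis by simp
    qed
    then show "\<exists>no. \<forall>n\<ge>no. norm (expectation (\<lambda>\<omega>. (A n \<omega> - F \<omega>)\<^sup>2) - 0) < \<eta>" by blast
  qed
  have gX: "gauss_fam P (\<lambda>i. Y (real i / n / \<epsilon>)) (\<lambda>i j. C (real i / n / \<epsilon> - real j / n / \<epsilon>))" if "0 < n" for n :: nat
    using gauss_fam_reindex[OF gY, of "\<lambda>i::nat. real i / n / \<epsilon>"] that \<epsilon> by (simp add: inj_on_def)
  have A2: "integrable P (\<lambda>\<omega>. (A n \<omega>)\<^sup>2)" for n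
  proof -
    interpret Q: quadrature "n + N" "cell (n + N) (\<lambda>x. f x * g x)" "cell (n + N) f" "cell (n + N) g" L by (rule quadrature_cells[OF pos])
    show ?thesis unfolding A_def Fn_eq[OF pos]
      by (rule gauss_fam_integrable[OF gX[OF pos] exp_growth_power[OF Q.growth_\<Phi>]])
  qed
  show F2: "integrable P (\<lambda>\<omega>. (F \<omega>)\<^sup>2)"
  proof (rule Bochner_Integration.integrable_bound)
    show "integrable P (\<lambda>\<omega>. 2 * (A 0 \<omega>)\<^sup>2 + 2 * (A 0 \<omega> - F \<omega>)\<^sup>2)" using A2 D2 by simp
    have "(F \<omega>)\<^sup>2 \<le> 2 * (A 0 \<omega>)\<^sup>2 + 2 * (A 0 \<omega> - F \<omega>)\<^sup>2" for \<omega>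
      using zero_le_power2[of "2 * A 0 \<omega> - F \<omega>"] by (simp add: power2_eq_square algebra_simps)
    then show "AE \<omega> in P. norm ((F \<omega>)\<^sup>2) \<le> norm (2 * (A 0 \<omega>)\<^sup>2 + 2 * (A 0 \<omega> - F \<omega>)\<^sup>2)"
      by (auto intro!: AE_I2 order_trans[OF _ abs_ge_self])
  qed simp
  have habs: "\<bar>h x\<bar> \<le> 1" for x using h(2,3)[of x] by simp
  note msl = mean_square_limit[OF F_measurable(1) Am F2 D2 lim]
  define V where "V n = 32 * (16 * exp (128 * C 0)) * (8 * L\<^sup>2)^4 * (\<kappa>1 * (1 / real (n + N) + \<kappa>2))^3" for n
  have bound: "\<bar>expectation (\<lambda>\<omega>. h ((A n \<omega> - expectation (A n)) / s)) - (LINT z|std_normal_distribution. h z)\<bar>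
    \<le> (2 * \<bar>s\<^sup>2 - variance (A n)\<bar> + 2 * sqrt (V n)) / s\<^sup>2" for n
  proof -
    interpret Q: quadrature "n + N" "cell (n + N) (\<lambda>x. f x * g x)" "cell (n + N) f" "cell (n + N) g" L by (rule quadrature_cells[OF pos])
    let ?X = "\<lambda>i. Y (real i / real (n + N) / \<epsilon>)" and ?\<Gamma> = "\<lambda>i j. C (real i / real (n + N) / \<epsilon> - real j / real (n + N) / \<epsilon>)"
    have C00: "0 \<le> C 0" using gauss_fam_exp_moment(2)[OF gY, of 0] by simp
    have V: "prob_space.variance (P \<Otimes>\<^sub>M P) (\<lambda>\<omega>. stein_kernel ?\<Gamma> {..<n + N} Q.\<Phi>1 \<theta> (pair_path ?X \<omega>)) \<le> V n" for \<theta>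
      unfolding V_def
      by (rule Q.variance_kernel_le[OF _ C00 gX[OF pos]]) (use \<kappa>[OF pos] in \<open>auto simp: Q.w_def\<close>)
    have "\<bar>expectation (\<lambda>\<omega>. h ((Q.\<Phi> (\<lambda>i. ?X i \<omega>) - expectation (\<lambda>\<omega>. Q.\<Phi> (\<lambda>i. ?X i \<omega>))) / s)) - (LINT z|std_normal_distribution. h z)\<bar>
      \<le> (2 * \<bar>s\<^sup>2 - variance (\<lambda>\<omega>. Q.\<Phi> (\<lambda>i. ?X i \<omega>))\<bar> + 2 * sqrt (V n)) / s\<^sup>2"
      by (rule stein_bound[OF gX[OF pos] finite_lessThan Q.growth_\<Phi> Q.growth_\<Phi>1 Q.has_grad_\<Phi> lipschitz_on_continuous_on[OF h(1)] h(2,3) s(2) V])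
    moreover have "A n = (\<lambda>\<omega>. Q.\<Phi> (\<lambda>i. ?X i \<omega>))" unfolding A_def using Fn_eq[OF pos] by (simp add: fun_eq_iff)
    ultimately show ?thesis by simp
  qed
  have inv: "(\<lambda>n. 1 / real (n + N)) \<longlonglongrightarrow> 0"
    using LIMSEQ_ignore_initial_segment[OF lim_inverse_n', of N] by (simp add: inverse_eq_divide)
  have s2: "s\<^sup>2 = variance F" using s variance_positive[of F] by simp
  have "(\<lambda>n. (2 * \<bar>s\<^sup>2 - variance (A n)\<bar> + 2 * sqrt (V n)) / s\<^sup>2) \<longlonglongrightarrow>
     (2 * \<bar>s\<^sup>2 - variance F\<bar> + 2 * sqrt (32 * (16 * exp (128 * C 0)) * (8 * L\<^sup>2)^4 * (\<kappa>1 * (0 + \<kappa>2))^3)) / s\<^sup>2"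
    unfolding V_def using s(2) by (intro tendsto_intros msl(1) inv) simp
  then have R: "(\<lambda>n. (2 * \<bar>s\<^sup>2 - variance (A n)\<bar> + 2 * sqrt (V n)) / s\<^sup>2) \<longlonglongrightarrow>
     2 * sqrt (32 * (16 * exp (128 * C 0)) * (8 * L\<^sup>2)^4 * (\<kappa>1 * \<kappa>2)^3) / s\<^sup>2"
    by (simp add: s2)
  have Lf: "(\<lambda>n. \<bar>expectation (\<lambda>\<omega>. h ((A n \<omega> - expectation (A n)) / s)) - (LINT z|std_normal_distribution. h z)\<bar>) \<longlonglongrightarrow>
    \<bar>expectation (\<lambda>\<omega>. h ((F \<omega> - expectation F) / s)) - (LINT z|std_normal_distribution. h z)\<bar>"
    by (intro tendsto_intros msl(2)[OF h(1) habs s(2)])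
  show "\<bar>expectation (\<lambda>\<omega>. h ((F \<omega> - expectation F) / s)) - (LINT z|std_normal_distribution. h z)\<bar>
    \<le> 2 * sqrt (32 * (16 * exp (128 * C 0)) * (8 * L\<^sup>2)^4 * (\<kappa>1 * \<kappa>2)^3) / s\<^sup>2"
    by (rule LIMSEQ_le[OF Lf R]) (use bound in auto)
qed

lemma bvp_formula:
  assumes w: "\<omega> \<in> space P" and \<phi>: "continuous_on UNIV \<phi>"
  shows "integral {0..1} (\<lambda>x. \<phi> x / exp (Y (x / \<epsilon>) \<omega>)) = S \<phi> \<omega>"
proof -
  have c: "continuous_on {0..1} (\<lambda>x. \<phi> x * e \<omega> x)"
    unfolding e_def using \<epsilon> by (intro continuous_intros continuous_on_compose2[OF cont[OF w]] continuous_on_subset[OF \<phi>]) auto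
  have "integral {0..1} (\<lambda>x. \<phi> x / exp (Y (x / \<epsilon>) \<omega>)) = integral {0..1} (\<lambda>x. \<phi> x * e \<omega> x)"
    by (simp add: e_def exp_minus divide_inverse)
  also have "\<dots> = (LINT x:{0..1}|lborel. \<phi> x * e \<omega> x)"
    by (rule set_borel_integral_eq_integral(2)[OF borel_integrable_atLeastAtMost'[OF c], symmetric])
  finally show ?thesis unfolding S_def integral_U .
qed

end

section \<open>The normal approximation\<close>

lemma holder_continuous_at_zero_isCont:
  assumes "holder_continuous_at_zero C"
  shows "isCont C 0"
proof -
  obtain \<alpha> L r where *: "0 < \<alpha>" "0 < r" "\<And>x. \<bar>x\<bar> \<le> r \<Longrightarrow> \<bar>C x - C 0\<bar> \<le> L * \<bar>x\<bar> powr \<alpha>"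
    using assms unfolding holder_continuous_at_zero_def by blast
  have "((\<lambda>x. L * \<bar>x\<bar> powr \<alpha>) \<longlongrightarrow> L * 0) (at 0)"
  proof (rule tendsto_mult_left)
    have "((\<lambda>x::real. \<bar>x\<bar> powr \<alpha>) \<longlongrightarrow> \<bar>0\<bar> powr \<alpha>) (at 0)"
      using *(1) by (intro tendsto_powr2 tendsto_intros) auto
    then show "((\<lambda>x::real. \<bar>x\<bar> powr \<alpha>) \<longlongrightarrow> 0) (at 0)" using *(1) by simp
  qed
  then have z: "((\<lambda>x. L * \<bar>x\<bar> powr \<alpha>) \<longlongrightarrow> 0) (at 0)" by simp
  have "((\<lambda>x. C x - C 0) \<longlongrightarrow> 0) (at 0)"
  proof (rule Lim_null_comparison[OF _ z])
    have "eventually (\<lambda>x. x \<in> {-r<..<r}) (at (0::real))"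
      using *(2) by (intro eventually_at_in_open') auto
    then show "\<forall>\<^sub>F x in at 0. norm (C x - C 0) \<le> L * \<bar>x\<bar> powr \<alpha>"
      by eventually_elim (auto intro!: *(3))
  qed
  then show ?thesis unfolding isCont_def by (rule LIM_zero_cancel)
qed

text \<open>Extends a function from the unit interval continuously to the line, so that
  only its values there matter.\<close>
definition clamp01 :: "(real \<Rightarrow> real) \<Rightarrow> real \<Rightarrow> real" where
  "clamp01 h x = h (max 0 (min 1 x))"

lemma clamp01:
  assumes "continuous_on {0..1} h" "\<And>x. x \<in> {0..1} \<Longrightarrow> \<bar>h x\<bar> \<le> B"
  shows "continuous_on UNIV (clamp01 h)" "\<bar>clamp01 h x\<bar> \<le> B"
proof -
  show "continuous_on UNIV (clamp01 h)"
    unfolding clamp01_def by (rule continuous_on_compose2[OF assms(1)]) (auto intro!: continuous_intros)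
  show "\<bar>clamp01 h x\<bar> \<le> B" unfolding clamp01_def by (rule assms(2)) auto
qed

text \<open>The field is set to zero on a measurable null set that contains all discontinuous realisations.\<close>
lemma continuous_modification:
  assumes P: "prob_space P" and g: "gauss_fam P G \<Gamma>"
    and c: "AE \<omega> in P. continuous_on UNIV (\<lambda>x. G x \<omega>)"
  obtains Y where "gauss_fam P Y \<Gamma>" "\<And>\<omega>. \<omega> \<in> space P \<Longrightarrow> continuous_on UNIV (\<lambda>x. Y x \<omega>)"
    "AE \<omega> in P. \<forall>x. Y x \<omega> = G x \<omega>"
proof -
  obtain N where N: "{\<omega> \<in> space P. \<not> continuous_on UNIV (\<lambda>x. G x \<omega>)} \<subseteq> N" "N \<in> sets P" "emeasure P N = 0"
    using AE_E[OF c] by metis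
  define Y where "Y x \<omega> = (if \<omega> \<in> N then 0 else G x \<omega>)" for x \<omega>
  have [measurable]: "G x \<in> borel_measurable P" for x by (rule gauss_famD(2)[OF g])
  have [measurable]: "N \<in> sets P" by fact
  have Ym: "Y x \<in> borel_measurable P" for x unfolding Y_def by measurable
  have "AE \<omega> in P. \<omega> \<notin> N" using N by (intro AE_not_in) (auto intro: null_setsI)
  then have ae: "AE \<omega> in P. \<forall>x. Y x \<omega> = G x \<omega>" by eventually_elim (simp add: Y_def)
  show ?thesis
  proof (rule that[of Y])
    show "gauss_fam P Y \<Gamma>"
      by (rule gauss_fam_cong_AE[OF g Ym]) (use ae in \<open>auto elim!: eventually_mono\<close>)
    show "continuous_on UNIV (\<lambda>x. Y x \<omega>)" if "\<omega> \<in> space P" for \<omega>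
      using N(1) that by (cases "\<omega> \<in> N") (auto simp: Y_def)
  qed fact
qed

theorem proposition5p9:
  fixes P :: "'w measure"
    and G :: "real \<Rightarrow> 'w \<Rightarrow> real"
    and C C0 :: "real \<Rightarrow> real"
    and \<beta> K :: real
    and f g :: "real \<Rightarrow> real"
    and u v :: "real \<Rightarrow> 'w \<Rightarrow> real \<Rightarrow> real"
    and I :: "real \<Rightarrow> 'w \<Rightarrow> real"
    and \<sigma> :: "real \<Rightarrow> real"
  assumes "prob_space P"
    and "0 < \<beta>" "\<beta> \<le> 1"
    and "stationary_centered_gaussian_field P G C"
    and "AE \<omega> in P. continuous_on UNIV (\<lambda>x. G x \<omega>)"
    and "holder_continuous_at_zero C"
    and "\<And>x. \<bar>C x\<bar> \<le> K * (1 + \<bar>x\<bar>) powr (- \<beta>)"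
    and "C0 \<in> borel_measurable lebesgue"
    and "\<And>x. C x = convolve C0 C0 x"
    and "\<And>x y. y \<in> ball x 1 \<Longrightarrow> \<bar>C0 y\<bar> \<le> K * (1 + \<bar>x\<bar>) powr (- ((1 + \<beta>) / 2)) * ell \<beta> x"
    and "C1_unit f" "C1_unit g"
    and "\<And>\<epsilon>. \<epsilon> \<in> {0<..1/2} \<Longrightarrow>
           random_bvp_solution P (\<lambda>\<omega> x. exp (G (x / \<epsilon>) \<omega>)) f (u \<epsilon>)"
    and "\<And>\<epsilon>. \<epsilon> \<in> {0<..1/2} \<Longrightarrow>
           random_bvp_solution P (\<lambda>\<omega> x. exp (G (x / \<epsilon>) \<omega>)) g (v \<epsilon>)"
    and I_def: "\<And>\<epsilon> \<omega>. I \<epsilon> \<omega> = gradient_functional (u \<epsilon> \<omega>) g"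
    and sigma_def: "\<And>\<epsilon>. \<sigma> \<epsilon> = sigma_scaled P \<beta> \<epsilon> (I \<epsilon>)"
  shows "(\<forall>\<epsilon>\<in>{0<..1/2}. AE \<omega> in P. I \<epsilon> \<omega> = gradient_functional (v \<epsilon> \<omega>) f) \<and>
         (\<exists>M::real. \<forall>\<epsilon>\<in>{0<..1/2}. \<sigma> \<epsilon> \<noteq> 0 \<longrightarrow>
            d_TV (distr P borel (\<lambda>\<omega>. (I \<epsilon> \<omega> - prob_space.expectation P (I \<epsilon>)) /
                                     (pi_scale \<beta> \<epsilon> * \<sigma> \<epsilon>)))
                 std_normal_distribution
            \<le> M / (\<sigma> \<epsilon>)\<^sup>2 * pi_scale \<beta> \<epsilon>)"
proof -
  interpret prob_space P by fact
  note \<beta> = assms(2,3) and C_decay = assms(7)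
  have gG: "gauss_fam P G (\<lambda>x y. C (x - y))" by (rule stationary_field_gauss_fam[OF assms(1,4)])
  obtain Y where Y: "gauss_fam P Y (\<lambda>x y. C (x - y))" "\<And>\<omega>. \<omega> \<in> space P \<Longrightarrow> continuous_on UNIV (\<lambda>x. Y x \<omega>)"
    "AE \<omega> in P. \<forall>x. Y x \<omega> = G x \<omega>"
    by (rule continuous_modification[OF assms(1) gG assms(5)]) (rule that)
  have fg: "continuous_on {0..1} f" "continuous_on {0..1} g" using assms(11,12) C1_unit_continuous by auto
  obtain Bf where Bf: "\<And>x. x \<in> {0..1} \<Longrightarrow> \<bar>f x\<bar> \<le> Bf" by (rule continuous_on_unit_bounded[OF fg(1)]) (rule that)
  obtain Bg where Bg: "\<And>x. x \<in> {0..1} \<Longrightarrow> \<bar>g x\<bar> \<le> Bg" by (rule continuous_on_unit_bounded[OF fg(2)]) (rule that)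
  define L where "L = max Bf Bg"
  have fL: "\<And>x. x \<in> {0..1} \<Longrightarrow> \<bar>f x\<bar> \<le> L" and gL: "\<And>x. x \<in> {0..1} \<Longrightarrow> \<bar>g x\<bar> \<le> L"
    using Bf Bg by (force simp: L_def)+
  let ?f = "clamp01 f" and ?g = "clamp01 g"
  have cf: "continuous_on UNIV ?f" "\<And>x. \<bar>?f x\<bar> \<le> L" "\<And>x. x \<in> {0..1} \<Longrightarrow> ?f x = f x"
    by (rule clamp01(1)[OF fg(1) fL], assumption, rule clamp01(2)[OF fg(1) fL], assumption) (simp add: clamp01_def)
  have cg: "continuous_on UNIV ?g" "\<And>x. \<bar>?g x\<bar> \<le> L" "\<And>x. x \<in> {0..1} \<Longrightarrow> ?g x = g x"
    by (rule clamp01(1)[OF fg(2) gL], assumption, rule clamp01(2)[OF fg(2) gL], assumption) (simp add: clamp01_def)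
  have med: "log_gaussian_medium P Y C ?f ?g \<epsilon> L" if "\<epsilon> \<in> {0<..1/2}" for \<epsilon>
    using that Y cf cg holder_continuous_at_zero_isCont[OF assms(6)]
    by (intro log_gaussian_medium.intro log_gaussian_medium_axioms.intro) (auto intro: prob_space_axioms)
  have repr: "AE \<omega> in P. I \<epsilon> \<omega> = log_gaussian_medium.F Y ?f ?g \<epsilon> \<omega> \<and> gradient_functional (v \<epsilon> \<omega>) f = log_gaussian_medium.F Y ?f ?g \<epsilon> \<omega>"
    if \<epsilon>: "\<epsilon> \<in> {0<..1/2}" for \<epsilon>
  proof -
    interpret R: log_gaussian_medium P Y C ?f ?g \<epsilon> L by (rule med[OF \<epsilon>])
    have su: "AE \<omega> in P. bvp_solution (\<lambda>x. exp (G (x / \<epsilon>) \<omega>)) f (u \<epsilon> \<omega>)"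
      and sv: "AE \<omega> in P. bvp_solution (\<lambda>x. exp (G (x / \<epsilon>) \<omega>)) g (v \<epsilon> \<omega>)"
      using assms(13,14)[OF \<epsilon>] unfolding random_bvp_solution_def by auto
    from su sv Y(3) AE_space show ?thesis
    proof eventually_elim
      fix \<omega>
      assume u: "bvp_solution (\<lambda>x. exp (G (x / \<epsilon>) \<omega>)) f (u \<epsilon> \<omega>)" and v: "bvp_solution (\<lambda>x. exp (G (x / \<epsilon>) \<omega>)) g (v \<epsilon> \<omega>)"
        and YG: "\<forall>x. Y x \<omega> = G x \<omega>" and w: "\<omega> \<in> space P"
      let ?A = "\<lambda>x. exp (Y (x / \<epsilon>) \<omega>)"
      have A: "continuous_on {0..1} ?A" "\<And>x. 0 < ?A x"
        using \<epsilon> by (auto intro!: continuous_intros continuous_on_compose2[OF Y(2)[OF w]])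
      have S: "integral {0..1} (\<lambda>x. \<phi> x / ?A x) = R.S \<psi> \<omega>" if "continuous_on UNIV \<psi>" "\<And>x. x \<in> {0..1} \<Longrightarrow> \<phi> x = \<psi> x" for \<phi> \<psi>
      proof -
        have "integral {0..1} (\<lambda>x. \<phi> x / ?A x) = integral {0..1} (\<lambda>x. \<psi> x / ?A x)"
          by (rule Henstock_Kurzweil_Integration.integral_cong) (simp add: that(2))
        then show ?thesis using R.bvp_formula[OF w that(1)] by simp
      qed
      have Sf: "integral {0..1} (\<lambda>x. f x / ?A x) = R.S ?f \<omega>" by (rule S[OF cf(1)]) (simp add: cf(3))
      have Sg: "integral {0..1} (\<lambda>x. g x / ?A x) = R.S ?g \<omega>" by (rule S[OF cg(1)]) (simp add: cg(3))
      have Sfg: "integral {0..1} (\<lambda>x. f x * g x / ?A x) = R.S (\<lambda>x. ?f x * ?g x) \<omega>"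
      proof (rule S)
        show "continuous_on UNIV (\<lambda>x. ?f x * ?g x)" by (intro continuous_on_mult cf(1) cg(1))
        show "f x * g x = ?f x * ?g x" if "x \<in> {0..1}" for x
          unfolding cf(3)[OF that] cg(3)[OF that] ..
      qed
      have Sgf: "integral {0..1} (\<lambda>x. g x * f x / ?A x) = R.S (\<lambda>x. ?f x * ?g x) \<omega>"
        using Sfg by (simp add: mult.commute)
      have S1: "integral {0..1} (\<lambda>x. 1 / ?A x) = R.S (\<lambda>_. 1) \<omega>" by (rule S) auto
      have u': "bvp_solution ?A f (u \<epsilon> \<omega>)" and v': "bvp_solution ?A g (v \<epsilon> \<omega>)" using u v YG by auto
      have "I \<epsilon> \<omega> = R.F \<omega>"
        unfolding I_def bvp_gradient_formula[OF A assms(11) fg(2) u'] Sf Sg Sfg S1 R.F_def ..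
      moreover have "gradient_functional (v \<epsilon> \<omega>) f = R.F \<omega>"
        unfolding bvp_gradient_formula[OF A assms(12) fg(1) v'] Sf Sg Sgf S1 R.F_def by simp
      ultimately show "I \<epsilon> \<omega> = R.F \<omega> \<and> gradient_functional (v \<epsilon> \<omega>) f = R.F \<omega>" by simp
    qed
  qed
  define \<kappa> where "\<kappa> = 2 * K * decay_const \<beta>"
  define M where "M = 2 * sqrt (32 * (16 * exp (128 * C 0)) * (8 * L\<^sup>2)^4 * \<kappa>^3)"
  have main: "d_TV (distr P borel (\<lambda>\<omega>. (I \<epsilon> \<omega> - expectation (I \<epsilon>)) / (pi_scale \<beta> \<epsilon> * \<sigma> \<epsilon>))) std_normal_distribution
      \<le> M / (\<sigma> \<epsilon>)\<^sup>2 * pi_scale \<beta> \<epsilon>"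
    if \<epsilon>: "\<epsilon> \<in> {0<..1/2}" and \<sigma>0: "\<sigma> \<epsilon> \<noteq> 0" for \<epsilon>
  proof -
    interpret R: log_gaussian_medium P Y C ?f ?g \<epsilon> L by (rule med[OF \<epsilon>])
    have IF: "AE \<omega> in P. I \<epsilon> \<omega> = R.F \<omega>" using repr[OF \<epsilon>] by (auto elim: eventually_mono)
    have Im[measurable]: "I \<epsilon> \<in> borel_measurable P"
      unfolding I_def[abs_def] by (rule gradient_functional_measurable[OF assms(13)[OF \<epsilon>] assms(12)])
    have EI: "expectation (I \<epsilon>) = expectation R.F" using IF by (intro integral_cong_AE) auto
    have VI: "variance (I \<epsilon>) = variance R.F" unfolding EI using IF by (intro integral_cong_AE) (auto elim: eventually_mono)
    define s where "s = sqrt (variance R.F)"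
    let ?p = "pi_scale \<beta> \<epsilon>"
    have p: "0 < ?p" by (rule pi_scale_pos[OF \<epsilon>])
    have \<sigma>: "\<sigma> \<epsilon> = s / ?p" unfolding sigma_def sigma_scaled_def VI s_def ..
    have s: "0 < s"
    proof -
      have "0 \<le> s" unfolding s_def by simp
      moreover have "s \<noteq> 0" using \<sigma>0 unfolding \<sigma> by auto
      ultimately show ?thesis by simp
    qed
    have ps: "?p * \<sigma> \<epsilon> = s" using p by (simp add: \<sigma>)
    let ?W = "\<lambda>\<omega>. (I \<epsilon> \<omega> - expectation (I \<epsilon>)) / s"
    have bound: "M / (\<sigma> \<epsilon>)\<^sup>2 * ?p = 2 * sqrt (32 * (16 * exp (128 * C 0)) * (8 * L\<^sup>2)^4 * (\<kappa> * ?p\<^sup>2)^3) / s\<^sup>2"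
    proof -
      have "32 * (16 * exp (128 * C 0)) * (8 * L\<^sup>2)^4 * (\<kappa> * ?p\<^sup>2)^3 = (32 * (16 * exp (128 * C 0)) * (8 * L\<^sup>2)^4 * \<kappa>^3) * (?p ^ 3)\<^sup>2"
        by (simp add: power_mult_distrib mult.assoc flip: power_mult)
      then have "2 * sqrt (32 * (16 * exp (128 * C 0)) * (8 * L\<^sup>2)^4 * (\<kappa> * ?p\<^sup>2)^3) = M * ?p ^ 3"
        using p unfolding M_def by (simp only: real_sqrt_mult real_sqrt_abs) simp
      then show ?thesis using p s by (simp add: \<sigma> power2_eq_square power3_eq_cube field_simps)
    qed
    have "d_TV (distr P borel ?W) std_normal_distribution \<le> M / (\<sigma> \<epsilon>)\<^sup>2 * ?p"
    proof (rule d_TV_le_Lipschitz)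
      show "prob_space (distr P borel ?W)" by (rule prob_space_distr) measurable
      show "prob_space std_normal_distribution" by (rule real_std_normal_prob)
      fix h :: "real \<Rightarrow> real" and Lh assume h: "Lh-lipschitz_on UNIV h" "\<And>x. 0 \<le> h x" "\<And>x. h x \<le> 1"
      have hm[measurable]: "h \<in> borel_measurable borel"
        by (intro borel_measurable_continuous_onI lipschitz_on_continuous_on[OF h(1)])
      have "(LINT x|distr P borel ?W. h x) = expectation (\<lambda>\<omega>. h (?W \<omega>))" by (rule integral_distr) measurable
      also have "\<dots> = expectation (\<lambda>\<omega>. h ((R.F \<omega> - expectation R.F) / s))"
        unfolding EI using IF by (intro integral_cong_AE) (auto elim: eventually_mono)
      finally show "\<bar>(LINT x|distr P borel ?W. h x) - (LINT x|std_normal_distribution. h x)\<bar> \<le> M / (\<sigma> \<epsilon>)\<^sup>2 * ?p"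
        unfolding bound
        using R.lipschitz_test_bound(1)[OF _ s_def s h, of \<kappa> "?p\<^sup>2"] decay_row_sum[OF C_decay \<epsilon> \<beta>]
        by (simp add: \<kappa>_def)
    qed auto
    then show ?thesis unfolding ps .
  qed
  show ?thesis
  proof (intro conjI ballI exI impI)
    show "AE \<omega> in P. I \<epsilon> \<omega> = gradient_functional (v \<epsilon> \<omega>) f" if "\<epsilon> \<in> {0<..1/2}" for \<epsilon>
      using repr[OF that] by eventually_elim simp
  qed (rule main)
qed

end
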